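(* Let $\mathsf Z>0$. As a function of $E=\sigma^2>0$ and $x=1/r>0$, the Whittaker W-function $\operatorname{WhittW}_{\kappa,1/2}$ satisfies $$\operatorname{WhittW}_{-i\mathsf Z/2\sigma,1/2}(2i\sigma r)\in\sigma\,\Gamma\Big(\frac{i\mathsf Z}{2\sigma}\Big)^{-1}\Big(\sigma^2+\frac{\mathsf Z}{r}\Big)^{-1/4}\exp\Big(-ir\sqrt{\sigma^2+\frac{\mathsf Z}{r}}-\frac{i\mathsf Z}{\sigma}\log\Big(\frac{\sigma r^{1/2}}{\mathsf Z^{1/2}}+\Big(1+\frac{\sigma^2r}{\mathsf Z}\Big)^{1/2}\Big)\Big)\mathcal A^{(0,0),\mathcal E,(0,0)}_{\mathrm{loc}}(X^{\mathrm{sp}}_{\mathrm{res}}).$$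
   Context: $\operatorname{WhittW}_{\kappa,\mu}(z)$ is Whittaker's W-function, the solution of $W''+(-\frac14+\frac{\kappa}{z}+\frac{1/4-\mu^2}{z^2})W=0$ with $W\sim e^{-z/2}z^\kappa$ as $z\to\infty$ (principal branch). Here $X=[0,\infty)_x$ with $x=1/r$. $X^{\mathrm{sp}}_{\mathrm{res}}$ is the manifold-with-corners obtained from the blow-up $[[0,\infty)_E\times[0,\infty)_x;\{(0,0)\}]$ by changing the smooth structure at the front face so that $(E+\mathsf Zx)^{1/2}$ is a boundary defining function of it. Faces: $\mathrm{bf}$ (lift of $\{x=0\}$), $\mathrm{tf}$ (front face), $\mathrm{zf}$ (lift of $\{E=0\}$). Coordinates near $\mathrm{tf}\cap\mathrm{zf}$: $\hat E=E/x$, $\rho=x^{1/2}$; near $\mathrm{tf}\cap\mathrm{bf}$: $\sigma=E^{1/2}$, $\varrho=x/E$. $\mathcal E=\{(k,\kappa)\in\mathbb N\times\mathbb N:\kappa\le\lfloor k/2\rfloor\}$. $\mathcal A^{(0,0),\mathcal E,(0,0)}_{\mathrm{loc}}(X^{\mathrm{sp}}_{\mathrm{res}})$ is the space of functions on the interior that extend smoothly up to $\mathrm{bf}$ and $\mathrm{zf}$ away from $\mathrm{tf}$, and are polyhomogeneous at $\mathrm{tf}$ with index set $\mathcal E$: near $\mathrm{tf}\cap\mathrm{zf}$ they have expansions $\sum_{(k,\kappa)\in\mathcal E}a_{k,\kappa}(\hat E)\rho^k\log^\kappa\rho$ as $\rho\to0^+$ with $a_{k,\kappa}$ smooth up to $\hat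 E=0$; near $\mathrm{tf}\cap\mathrm{bf}$ expansions $\sum_{(k,\kappa)\in\mathcal E}b_{k,\kappa}(\varrho)\sigma^k\log^\kappa\sigma$ as $\sigma\to0^+$ with $b_{k,\kappa}$ smooth up to $\varrho=0$; in both cases together with all derivatives in $\hat E,\rho\partial_\rho$ (resp. $\varrho,\sigma\partial_\sigma$), locally uniformly. "loc" means only local control on compact subsets of $X^{\mathrm{sp}}_{\mathrm{res}}$. *)

theory Defs
  imports "HOL-Analysis.Analysis" "HOL-Library.Landau_Symbols"
begin

section \<open>Whittaker's W-function\<close>

text \<open>
  The principal branch of the W-function lives on the plane cut along the nonpositive real axis;
  \<open>z powr \<kappa>\<close> is the principal power. The limit is taken over the whole cut plane.
\<close>

definition is_WhittW :: "complex \<Rightarrow> complex \<Rightarrow> (complex \<Rightarrow> complex) \<Rightarrow> bool" where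
  "is_WhittW \<kappa> \<mu> W \<longleftrightarrow>
     W holomorphic_on (- \<real>\<^sub>\<le>\<^sub>0) \<and>
     (\<forall>z\<in>- \<real>\<^sub>\<le>\<^sub>0. deriv (deriv W) z + (- 1/4 + \<kappa> / z + (1/4 - \<mu>\<^sup>2) / z\<^sup>2) * W z = 0) \<and>
     W \<sim>[inf at_infinity (principal (- \<real>\<^sub>\<le>\<^sub>0))] (\<lambda>z. exp (- z / 2) * z powr \<kappa>)"

text \<open>
  The conditions determine \<open>W\<close> on the cut plane (there is no second solution decaying along the
  positive real axis), so the choice only affects the irrelevant values on the cut.
\<close>

definition WhittW :: "complex \<Rightarrow> complex \<Rightarrow> complex \<Rightarrow> complex" where
  "WhittW \<kappa> \<mu> = (SOME W. is_WhittW \<kappa> \<mu> W)"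


section \<open>Smoothness up to the boundary\<close>

text \<open>
  \<open>D [v\<^sub>1, \<dots>, v\<^sub>n]\<close> is the iterated directional derivative along \<open>v\<^sub>1, \<dots>, v\<^sub>n\<close>. Derivatives are
  taken within \<open>S\<close>, hence one-sided at boundary points: all derivatives of \<open>f\<close> in the
  interior extend continuously to \<open>S\<close>. Meant for sets such as intervals or quadrants, where
  derivatives within \<open>S\<close> are unique.
\<close>

definition smooth_on ::
  "'a::real_normed_vector set \<Rightarrow> ('a \<Rightarrow> 'b::real_normed_vector) \<Rightarrow> bool" where
  "smooth_on S f \<longleftrightarrow>
     (\<exists>D :: 'a list \<Rightarrow> 'a \<Rightarrow> 'b.
        (\<forall>x\<in>S. D [] x = f x) \<and>
        (\<forall>vs. \<forall>x\<in>S. (D vs has_derivative (\<lambda>v. D (v # vs) x)) (at x within S)))"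


section \<open>Polyhomogeneous expansions\<close>

text \<open>
  Below, \<open>f s t\<close> is a function of two real variables, where \<open>t\<close> is the boundary defining function
  and \<open>s \<ge> 0\<close> is the coordinate along the boundary hypersurface.
  The two operators are \<open>\<partial>\<^sub>s\<close> and \<open>t \<partial>\<^sub>t\<close>.
\<close>

definition d_fst :: "(real \<Rightarrow> real \<Rightarrow> complex) \<Rightarrow> real \<Rightarrow> real \<Rightarrow> complex" where
  "d_fst f = (\<lambda>s t. vector_derivative (\<lambda>s'. f s' t) (at s))"

definition b_snd :: "(real \<Rightarrow> real \<Rightarrow> complex) \<Rightarrow> real \<Rightarrow> real \<Rightarrow> complex" where
  "b_snd f = (\<lambda>s t. t *\<^sub>R vector_derivative (\<lambda>t'. f s t') (at t))"

text \<open>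
  The index set must have finitely many elements \<open>(k, l)\<close> for each \<open>k\<close>. Estimates are uniform for
  \<open>s\<close> in bounded subsets of \<open>(0, \<infinity>)\<close>, i.e. up to \<open>s = 0\<close>. The terms with \<open>k = N + 1\<close> that are left in the
  remainder are \<open>O(t ^ N)\<close> despite their logarithmic factors; since \<open>N\<close> is arbitrary, nothing
  is lost by this bound.
\<close>

definition polyhomogeneous :: "(nat \<times> nat) set \<Rightarrow> (real \<Rightarrow> real \<Rightarrow> complex) \<Rightarrow> bool" where
  "polyhomogeneous I f \<longleftrightarrow>
     (\<exists>c :: nat \<Rightarrow> nat \<Rightarrow> real \<Rightarrow> complex.
        (\<forall>(k, l)\<in>I. smooth_on {0..} (c k l)) \<and>
        (\<forall>N i j A. \<exists>C. \<exists>\<delta>>0. \<forall>s\<in>{0<..A}. \<forall>t\<in>{0<..<\<delta>}.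
           norm ((d_fst ^^ i) ((b_snd ^^ j)
             (\<lambda>s t. f s t - (\<Sum>(k, l)\<in>{(k, l)\<in>I. k \<le> N}. c k l s * of_real (t ^ k * ln t ^ l)))) s t)
             \<le> C * t ^ N))"

definition index_E :: "(nat \<times> nat) set" where
  "index_E = {(k, l). l \<le> k div 2}"

lemma finite_index_E: "finite {(k, l)\<in>index_E. k \<le> N}"
proof (rule finite_subset)
  show "{(k, l)\<in>index_E. k \<le> N} \<subseteq> {..N} \<times> {..N}"
    by (auto simp: index_E_def)
qed simp


section \<open>The function space on the resolved space\<close>

text \<open>
  An element \<open>u E x\<close> is a function on the interior \<open>E > 0\<close>, \<open>x > 0\<close>; other values are
  irrelevant. The resolved space is covered by three charts:

  \<^item> the complement of the front face, which is the closed quadrant without its corner, with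
    coordinates \<open>(E, x)\<close>;
  \<^item> the complement of the lift of \<open>x = 0\<close> near the front face, with coordinates \<open>(E / x, \<rho>)\<close>, \<open>\<rho> = x\<^sup>1\<^sup>/\<^sup>2\<close>,
    so that \<open>E = (E / x) \<rho>\<^sup>2\<close> and \<open>x = \<rho>\<^sup>2\<close>;
  \<^item> the complement of the lift of \<open>E = 0\<close> near the front face, with coordinates \<open>(x / E, \<sigma>)\<close>, \<open>\<sigma> = E\<^sup>1\<^sup>/\<^sup>2\<close>,
    so that \<open>E = \<sigma>\<^sup>2\<close> and \<open>x = (x / E) \<sigma>\<^sup>2\<close>.

  The boundary defining function \<open>(E + Z x)\<^sup>1\<^sup>/\<^sup>2\<close> of the front face is \<open>\<rho>\<close>, respectively \<open>\<sigma>\<close>, times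
  a smooth positive function, so \<open>Z > 0\<close> does not enter.
\<close>

definition A_loc :: "(nat \<times> nat) set \<Rightarrow> (real \<Rightarrow> real \<Rightarrow> complex) set" where
  "A_loc I = {u.
     (\<exists>g :: real \<times> real \<Rightarrow> complex.
        smooth_on {(E, x). 0 \<le> E \<and> 0 \<le> x \<and> (E, x) \<noteq> (0, 0)} g \<and>
        (\<forall>E>0. \<forall>x>0. g (E, x) = u E x)) \<and>
     polyhomogeneous I (\<lambda>Eh \<rho>. u (Eh * \<rho>\<^sup>2) (\<rho>\<^sup>2)) \<and>
     polyhomogeneous I (\<lambda>xh \<sigma>. u (\<sigma>\<^sup>2) (xh * \<sigma>\<^sup>2))}"

end

theory Submission
 imports Defs "HOL-Complex_Analysis.Complex_Analysis" "HOL-Real_Asymp.Real_Asymp"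
begin

text \<open>
Put \<open>l = (E + Z x)\<^sup>1\<^sup>/\<^sup>2\<close> and \<open>m = E / (E + Z x)\<close>. The front face is \<open>l = 0\<close>, and \<open>m \<in> [0, 1]\<close> runs along it
from \<open>E = 0\<close> to \<open>x = 0\<close>. The idea is that, after division by the explicit prefactor, the W-function depends on
\<open>(l, m)\<close> only and is an oscillatory integral with large parameter \<open>Z / l\<close>,
\<open>a = 2 l\<^sup>-\<^sup>1\<^sup>/\<^sup>2 \<integral> exp (- (\<i> Z / l) F Q) dQ\<close>, \<open>F Q = Q\<^sup>2 ht Q (1 - m)\<close>, whose critical point \<open>Q = 0\<close> is
nondegenerate, uniformly in \<open>m\<close>.

This comes from the Laplace integral of the W-function for \<open>\<mu> = 1/2\<close>,
\<open>\<Gamma>(1 - \<kappa>) e\<^sup>z\<^sup>/\<^sup>2 W z = \<integral> e\<^sup>-\<^sup>s (1 + z / s)\<^sup>\<kappa> ds\<close> over \<open>s > 0\<close> (\<open>WhittW_eq\<close>). For \<open>z = 2 \<i> \<sigma> / x\<close> and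
\<open>\<kappa> = - \<i> Z / (2 \<sigma>)\<close> the integrand has a critical point \<open>s0\<close>, and the affine substitution \<open>s = s0 + (\<i> Z / l) Q\<close>
moves it to the origin; the value of the integrand there is the exponential of the prefactor. The contour is then
deformed (\<open>contour_shift\<close>) to one of steepest descent type: a straight line through \<open>Q = 0\<close> in the direction
\<open>\<omega> = e\<^sup>-\<^sup>i\<^sup>\<pi>\<^sup>/\<^sup>4\<close>, which is followed to infinity, and at its other end a short segment to a curve that spirals into
the singular point \<open>Q = - 1 / (1 + m\<^sup>1\<^sup>/\<^sup>2)\<close>, that is, \<open>s = 0\<close>. The spiral leaves the principal sheet of the
logarithm; all of this takes place in the variable \<open>v = ln (1 + z / s) / 2\<close>, where the integrand is holomorphic on
the half plane \<open>Re v > 0\<close>.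

On the deformed contour the phase decays, so everything away from \<open>Q = 0\<close> is \<open>O(l\<^sup>N)\<close> for all \<open>N\<close>
(\<open>left_kernel\<close>, \<open>right_kernel\<close>, \<open>connect_kernel\<close>), and near \<open>Q = 0\<close> Taylor expansion against a Gaussian gives an
expansion in powers \<open>l\<^sup>k\<close> with coefficients analytic in \<open>m \<in> [0, 1]\<close> and without logarithms; the half-integer powers
have odd integrands (\<open>gaussian_sum\<close>, \<open>gauss_rem_kernel\<close>).

Differentiability is the delicate point, since the integrands are not controlled in a fixed complex neighbourhood of
\<open>E = 0\<close> or \<open>x = 0\<close>. Every remainder is an integral over a real variable \<open>y\<close> of a function that is holomorphic in \<open>l\<close> in a sector and in \<open>m\<close> in a
neighbourhood of \<open>[0, 1]\<close> whose width shrinks like \<open>(1 + |y|)\<^sup>-\<^sup>2\<close>, and that decays exponentially in \<open>y\<close>. By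
Cauchy's estimate derivatives cost only powers of \<open>1 + |y|\<close>, so this class of integrals is stable under \<open>\<partial>\<^sub>s\<close> and
\<open>t \<partial>\<^sub>t\<close> in each chart of the resolved space. That yields all estimates at the front face and smoothness up to the two
other faces at once (\<open>A_loc_of_expansion\<close>).
\<close>

section \<open>Integrals depending on a parameter\<close>

lemma has_derivative_integral_param:
 fixes f :: "'p => 'a::real_normed_vector => 'b::{banach,second_countable_topology}"
  and f' :: "'p => 'a => 'c::{banach,second_countable_topology}"
 assumes bil: "bounded_bilinear m" and S: "convex S" "x \<in> S"
  and der: "\<And>s y. y \<in> S ==> (f s has_derivative (\<lambda>h. m h (f' s y))) (at y within S)"
  and meas: "\<And>y. y \<in> S ==> (\<lambda>s. f s y) \<in> borel_measurable M"
  and meas': "(\<lambda>s. f' s x) \<in> borel_measurable M"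
  and bound: "\<And>s y. y \<in> S ==> norm (f' s y) \<le> B s" and B: "integrable M B"
  and int: "integrable M (\<lambda>s. f s x)"
 shows "((\<lambda>y. \<integral>s. f s y \<partial>M) has_derivative (\<lambda>h. m h (\<integral>s. f' s x \<partial>M))) (at x within S)"
proof -
 interpret m: bounded_bilinear m by fact
 obtain K where K: "K \<ge> 0" "\<And>a b. norm (m a b) \<le> norm a * norm b * K"
  using m.nonneg_bounded by blast
 have lip: "norm (f s y - f s x) \<le> (B s * K) * norm (y - x)" if "y \<in> S" for s y
 proof (rule differentiable_bound[OF S(1) der _ that S(2)])
  fix y assume y: "y \<in> S"
  show "onorm (\<lambda>h. m h (f' s y)) \<le> B s * K"
  proof (rule onorm_bound)
   show "0 \<le> B s * K" using order_trans[OF norm_ge_zero bound[OF y]] K by simp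
   fix h
   have "norm (m h (f' s y)) \<le> norm h * norm (f' s y) * K" by (rule K)
   also have "\<dots> \<le> norm h * B s * K"
    by (intro mult_right_mono mult_left_mono bound y K) auto
   finally show "norm (m h (f' s y)) \<le> B s * K * norm h" by (simp add: mult_ac)
  qed
 qed
 have int_f': "integrable M (\<lambda>s. f' s x)"
  by (rule Bochner_Integration.integrable_bound[OF B meas'])
   (use bound[OF S(2)] in \<open>auto intro!: AE_I2 order_trans[OF _ abs_ge_self]\<close>)
 have int_y: "integrable M (\<lambda>s. f s y)" if "y \<in> S" for y
 proof -
  have "integrable M (\<lambda>s. f s y - f s x)"
  proof (rule Bochner_Integration.integrable_bound)
   show "integrable M (\<lambda>s. B s * K * norm (y - x))" using B by simp
   show "(\<lambda>s. f s y - f s x) \<in> borel_measurable M"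
    by (intro borel_measurable_diff meas that S)
  qed (use lip[OF that] in \<open>auto intro!: AE_I2 order_trans[OF _ abs_ge_self]\<close>)
  from Bochner_Integration.integrable_add[OF this int] show ?thesis by simp
 qed
 have int_m: "integrable M (\<lambda>s. m h (f' s x))" and int_m_eq: "(\<integral>s. m h (f' s x) \<partial>M) = m h (\<integral>s. f' s x \<partial>M)" for h
  using integrable_bounded_linear[OF m.bounded_linear_right int_f', of h]
   integral_bounded_linear[OF m.bounded_linear_right int_f', of h] by auto
 show ?thesis unfolding has_derivative_within
 proof
  show "bounded_linear (\<lambda>h. m h (\<integral>s. f' s x \<partial>M))" by (rule m.bounded_linear_left)
  show "((\<lambda>y. (1 / norm (y - x)) *\<^sub>R ((\<integral>s. f s y \<partial>M) - ((\<integral>s. f s x \<partial>M) + m (y - x) (\<integral>s. f' s x \<partial>M)))) \<longlongrightarrow> 0) (at x within S)"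
   unfolding tendsto_at_iff_sequentially
  proof (intro allI impI)
   fix X :: "nat => 'a" assume X: "\<forall>i. X i \<in> S - {x}" and lim: "X \<longlonglongrightarrow> x"
   define q where "q i s = (1 / norm (X i - x)) *\<^sub>R (f s (X i) - (f s x + m (X i - x) (f' s x)))" for i s
   have "(\<lambda>i. \<integral>s. q i s \<partial>M) \<longlonglongrightarrow> (\<integral>s. 0 \<partial>M)"
   proof (rule integral_dominated_convergence[where w = "\<lambda>s. 2 * K * B s"])
    show "q i \<in> borel_measurable M" for i
     unfolding q_def using X by (intro borel_measurable_scaleR borel_measurable_diff borel_measurable_add meas S
       borel_measurable_const borel_measurable_integrable[OF int_m]) auto
    show "integrable M (\<lambda>s. 2 * K * B s)" using B by simp
    show "AE s in M. (\<lambda>i. q i s) \<longlonglongrightarrow> 0"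
    proof (rule AE_I2)
     fix s
     from der[OF S(2), of s] have "((\<lambda>y. (1 / norm (y - x)) *\<^sub>R (f s y - (f s x + m (y - x) (f' s x)))) \<longlongrightarrow> 0) (at x within S)"
      by (simp add: has_derivative_within)
     thus "(\<lambda>i. q i s) \<longlonglongrightarrow> 0" unfolding tendsto_at_iff_sequentially
      using X lim by (auto simp: q_def o_def)
    qed
    show "AE s in M. norm (q i s) \<le> 2 * K * B s" for i
    proof (rule AE_I2)
     fix s
     have n: "norm (X i - x) > 0" using X by auto
     have "norm (f s (X i) - (f s x + m (X i - x) (f' s x))) \<le> norm (f s (X i) - f s x) + norm (m (X i - x) (f' s x))"
      by (metis diff_diff_eq norm_triangle_ineq4)
     also have "\<dots> \<le> (B s * K) * norm (X i - x) + norm (X i - x) * B s * K"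
     proof (intro add_mono lip)
      show "X i \<in> S" using X by auto
      have "norm (m (X i - x) (f' s x)) \<le> norm (X i - x) * norm (f' s x) * K" by (rule K)
      also have "\<dots> \<le> norm (X i - x) * B s * K"
       by (intro mult_right_mono mult_left_mono bound S K) auto
      finally show "norm (m (X i - x) (f' s x)) \<le> norm (X i - x) * B s * K" .
     qed
     finally have "norm (f s (X i) - (f s x + m (X i - x) (f' s x))) \<le> (2 * K * B s) * norm (X i - x)"
      by (simp add: algebra_simps)
     hence "norm (f s (X i) - (f s x + m (X i - x) (f' s x))) / norm (X i - x) \<le> 2 * K * B s"
      by (subst pos_divide_le_eq[OF n])
     thus "norm (q i s) \<le> 2 * K * B s" unfolding q_def norm_scaleR by simp
    qed
   qed auto
   moreover have "(\<integral>s. q i s \<partial>M) = (1 / norm (X i - x)) *\<^sub>R ((\<integral>s. f s (X i) \<partial>M) - ((\<integral>s. f s x \<partial>M) + m (X i - x) (\<integral>s. f' s x \<partial>M)))" for i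
   proof -
    have "X i \<in> S" using X by auto
    thus ?thesis unfolding q_def
     by (simp add: int_y int_m int S Bochner_Integration.integral_diff Bochner_Integration.integral_add int_m_eq)
   qed
   ultimately show "((\<lambda>y. (1 / norm (y - x)) *\<^sub>R ((\<integral>s. f s y \<partial>M) - ((\<integral>s. f s x \<partial>M) + m (y - x) (\<integral>s. f' s x \<partial>M)))) \<circ> X) \<longlonglongrightarrow> 0"
    by (simp add: o_def)
  qed
 qed
qed

lemma has_field_derivative_flip:
 fixes f :: "'a::real_normed_field => 'a"
 shows "(f has_field_derivative D) F \<longleftrightarrow> (f has_derivative (\<lambda>h. h * D)) F"
proof -
 have "(*) D = (\<lambda>h. h * D)" by (rule ext) (rule mult.commute)
 thus ?thesis unfolding has_field_derivative_def by (rule arg_cong)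
qed

text \<open>
Cauchy's estimate, with the circle of radius \<open>r / 4\<close> around \<open>w\<close>.
\<close>
lemma deriv_bound_ball:
 assumes "f holomorphic_on ball z r" "0 < r" "\<And>w. w \<in> ball z r ==> norm (f w) \<le> B"
  and "norm (w - z) \<le> r / 2"
 shows "norm (deriv f w) \<le> 4 * B / r"
proof -
 have sub: "cball w (r/4) \<subseteq> ball z r"
 proof
  fix u assume "u \<in> cball w (r/4)"
  hence "dist w u \<le> r/4" by simp
  moreover have "dist z w \<le> r/2" using assms(4) by (simp add: dist_norm norm_minus_commute)
  moreover have "dist z u \<le> dist z w + dist w u" by (rule dist_triangle)
  ultimately show "u \<in> ball z r" using assms(2) by simp
 qed
 have "norm ((deriv ^^ 1) f w) \<le> fact 1 * B / (r/4) ^ 1"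
 proof (rule Cauchy_inequality)
  show "f holomorphic_on ball w (r/4)"
   by (rule holomorphic_on_subset[OF assms(1)]) (use sub in auto)
  show "continuous_on (cball w (r/4)) f"
   by (rule continuous_on_subset[OF holomorphic_on_imp_continuous_on[OF assms(1)] sub])
  show "0 < r/4" using assms(2) by simp
  fix x assume "norm (w - x) = r/4"
  hence "x \<in> cball w (r/4)" by (simp add: dist_norm)
  thus "norm (f x) \<le> B" using assms(3) sub by blast
 qed
 thus ?thesis by (simp add: field_simps)
qed

text \<open>
No bound on the derivative is assumed: Cauchy's estimate turns the bound on the integrand into one.
\<close>
lemma integral_holomorphic_param:
 fixes f :: "'p => complex => complex"
 assumes S: "open S"
  and hol: "\<And>s. (\<lambda>z. f s z) holomorphic_on S"
  and meas: "\<And>z. z \<in> S ==> (\<lambda>s. f s z) \<in> borel_measurable M"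
  and bound: "\<And>z. z \<in> S ==> \<exists>r>0. \<exists>B. integrable M B \<and> (\<forall>s. \<forall>w\<in>ball z r \<inter> S. norm (f s w) \<le> B s)"
 shows "(\<lambda>z. \<integral>s. f s z \<partial>M) holomorphic_on S"
 unfolding holomorphic_on_open[OF S]
proof
 fix z assume z: "z \<in> S"
 obtain r1 B where r1: "r1 > 0" "integrable M B" "\<And>s w. w \<in> ball z r1 \<inter> S ==> norm (f s w) \<le> B s"
  using bound[OF z] by blast
 obtain r2 where r2: "r2 > 0" "ball z r2 \<subseteq> S" using S z openE by blast
 define r where "r = min r1 r2"
 have r: "r > 0" "ball z r \<subseteq> S" "ball z r \<subseteq> ball z r1 \<inter> S" using r1 r2 by (auto simp: r_def)
 have Bb: "\<And>s w. w \<in> ball z r ==> norm (f s w) \<le> B s" using r1(3) r(3) by blast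
 have holr: "f s holomorphic_on ball z r" for s using hol holomorphic_on_subset r(2) by blast
 have sub: "ball z (r/2) \<subseteq> ball z r" using r by auto
 have diff: "(f s has_field_derivative deriv (f s) w) (at w)" if "w \<in> ball z r" for s w
  using holr that holomorphic_derivI by blast
 have "((\<lambda>w. \<integral>s. f s w \<partial>M) has_derivative (\<lambda>h. h * (\<integral>s. deriv (f s) z \<partial>M))) (at z within ball z (r/2))"
 proof (rule has_derivative_integral_param[where f' = "\<lambda>s. deriv (f s)" and B = "\<lambda>s. 4 * B s / r"])
  show "bounded_bilinear ((*) :: complex => complex => complex)" by (rule bounded_bilinear_mult)
  show "(f s has_derivative (\<lambda>h. h * deriv (f s) y)) (at y within ball z (r / 2))" if "y \<in> ball z (r/2)" for s y
  proof -
   have "(f s has_field_derivative deriv (f s) y) (at y within ball z (r/2))"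
    by (rule has_field_derivative_at_within[OF diff[OF subsetD[OF sub that]]])
   thus ?thesis unfolding has_field_derivative_flip .
  qed
  show "(\<lambda>s. f s y) \<in> borel_measurable M" if "y \<in> ball z (r/2)" for y
   using that sub r(2) by (intro meas) blast
  show "norm (deriv (f s) y) \<le> 4 * B s / r" if "y \<in> ball z (r/2)" for s y
   by (rule deriv_bound_ball[OF holr r(1) Bb]) (use that in \<open>auto simp: dist_norm norm_minus_commute\<close>)
  show "integrable M (\<lambda>s. 4 * B s / r)" using r1 by simp
  show "integrable M (\<lambda>s. f s z)"
   by (rule Bochner_Integration.integrable_bound[OF r1(2) meas[OF z]])
    (use Bb[of z] r in \<open>auto intro!: AE_I2 order_trans[OF _ abs_ge_self]\<close>)
  show "(\<lambda>s. deriv (f s) z) \<in> borel_measurable M"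
  proof (rule borel_measurable_LIMSEQ_metric)
   define h where "h n = (of_real (r/2 / real (n+1)) :: complex)" for n
   have hn: "norm (h n) < r" for n
   proof -
    have "r/2 / real (n+1) \<le> r/2/1" using r by (intro divide_left_mono) auto
    moreover have "norm (h n) = r/2 / real (n+1)" unfolding h_def norm_of_real using r by simp
    ultimately show ?thesis using r by linarith
   qed
   have h0: "h n \<noteq> 0" for n using r by (auto simp: h_def simp del: of_nat_Suc)
   have hlim: "h \<longlonglongrightarrow> 0"
   proof -
    have "(\<lambda>n. r/2 / real (n+1)) \<longlonglongrightarrow> 0"
     using LIMSEQ_Suc[OF lim_const_over_n[of "r/2"]] by simp
    hence "(\<lambda>n. (of_real (r/2 / real (n+1)) :: complex)) \<longlonglongrightarrow> of_real 0" by (rule tendsto_of_real)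
    thus ?thesis by (simp add: h_def[abs_def])
   qed
   show "(\<lambda>s. (f s (z + h n) - f s z) / h n) \<in> borel_measurable M" for n
    using hn[of n] r(2) z by (intro borel_measurable_divide borel_measurable_diff meas borel_measurable_const)
     (auto simp: subset_eq dist_norm)
   fix s
   have "(f s has_field_derivative deriv (f s) z) (at z)" using diff[of z s] r by auto
   hence "((\<lambda>h. (f s (z + h) - f s z) / h) \<longlongrightarrow> deriv (f s) z) (at 0)" by (simp add: DERIV_def)
   thus "(\<lambda>n. (f s (z + h n) - f s z) / h n) \<longlonglongrightarrow> deriv (f s) z"
    unfolding tendsto_at_iff_sequentially using h0 hlim by (auto simp: o_def)
  qed
 qed (use r in auto)
 hence "((\<lambda>w. \<integral>s. f s w \<partial>M) has_field_derivative (\<integral>s. deriv (f s) z \<partial>M)) (at z within ball z (r/2))"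
  unfolding has_field_derivative_flip .
 thus "\<exists>f'. ((\<lambda>w. \<integral>s. f s w \<partial>M) has_field_derivative f') (at z)"
  using r by (metis at_within_open centre_in_ball half_gt_zero open_ball)
qed

lemma integrable_exp_minus_abs:
 assumes d: "(d::real) > 0"
 shows "integrable lborel (\<lambda>y. exp (- d * \<bar>y\<bar>))"
proof -
 have "(\<lambda>y. exp (- d * y)) absolutely_integrable_on {0..}"
  by (intro nonnegative_absolutely_integrable_1 integrable_on_exp_minus_to_infinity d) auto
 hence "set_integrable lebesgue {0..} (\<lambda>y. exp (- d * y))" .
 hence 1: "integrable lborel (\<lambda>y. indicator {0..} y *\<^sub>R exp (- d * y))"
  unfolding set_integrable_def by (rule integrable_completion[THEN iffD1, rotated]) measurable
 have 2: "integrable lborel (\<lambda>y. indicator {0..} (- y) *\<^sub>R exp (- d * (- y)))"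
  using lborel_integrable_real_affine[OF 1, of "-1" 0] by simp
 show ?thesis
 proof (rule Bochner_Integration.integrable_bound[OF Bochner_Integration.integrable_add[OF 1 2]])
  show "AE y in lborel. norm (exp (- d * \<bar>y\<bar>))
    \<le> norm (indicator {0..} y *\<^sub>R exp (- d * y) + indicator {0..} (- y) *\<^sub>R exp (- d * (- y)))"
   by (intro AE_I2) (auto simp: indicator_def)
 qed measurable
qed

section \<open>Integrals of kernels holomorphic near the real quadrant\<close>

text \<open>
Absorbs the factor that Cauchy's estimate costs on a disc of radius comparable to \<open>(1 + |y|)\<^sup>-\<^sup>2\<close>.
\<close>
lemma square_exp_absorb:
 assumes "(d::real) > 0"
 obtains K where "K > 0" "\<And>y. (1 + \<bar>y\<bar>)\<^sup>2 * exp (- d * \<bar>y\<bar>) \<le> K * exp (- (d/2) * \<bar>y\<bar>)"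
proof
 define k where "k = min 1 (d/4)"
 have k: "k > 0" "k \<le> 1" "k \<le> d/4" using assms by (auto simp: k_def)
 show "1 / k\<^sup>2 > 0" using k by simp
 fix y :: real
 have "k * (1 + \<bar>y\<bar>) \<le> 1 + d/4 * \<bar>y\<bar>"
  using k mult_right_mono[OF k(3), of "\<bar>y\<bar>"] by (simp add: algebra_simps)
 also have "\<dots> \<le> exp (d/4 * \<bar>y\<bar>)" by (rule exp_ge_add_one_self)
 finally have "(k * (1 + \<bar>y\<bar>))\<^sup>2 \<le> (exp (d/4 * \<bar>y\<bar>))\<^sup>2" using k by (intro power_mono) auto
 also have "\<dots> = exp (d/2 * \<bar>y\<bar>)" by (simp add: exp_double[symmetric])
 finally have "k\<^sup>2 * (1 + \<bar>y\<bar>)\<^sup>2 \<le> exp (d/2 * \<bar>y\<bar>)" by (simp only: power_mult_distrib)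
 hence "(1 + \<bar>y\<bar>)\<^sup>2 \<le> exp (d/2 * \<bar>y\<bar>) / k\<^sup>2"
  using k by (subst pos_le_divide_eq) (simp_all add: mult.commute)
 hence "(1 + \<bar>y\<bar>)\<^sup>2 \<le> 1 / k\<^sup>2 * exp (d/2 * \<bar>y\<bar>)" by simp
 hence "(1 + \<bar>y\<bar>)\<^sup>2 * exp (- d * \<bar>y\<bar>) \<le> 1 / k\<^sup>2 * exp (d/2 * \<bar>y\<bar>) * exp (- d * \<bar>y\<bar>)"
  by (intro mult_right_mono) auto
 also have "\<dots> = 1 / k\<^sup>2 * exp (- (d/2) * \<bar>y\<bar>)"
  by (simp add: mult.assoc flip: exp_add)
 finally show "(1 + \<bar>y\<bar>)\<^sup>2 * exp (- d * \<bar>y\<bar>) \<le> 1 / k\<^sup>2 * exp (- (d/2) * \<bar>y\<bar>)" .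
qed

definition sep_holomorphic :: "(complex => complex => complex) => complex set => complex set => bool" where
 "sep_holomorphic f S T \<longleftrightarrow>
   (\<forall>t\<in>T. (\<lambda>s. f s t) holomorphic_on S) \<and> (\<forall>s\<in>S. (\<lambda>t. f s t) holomorphic_on T)"

lemma sep_holomorphic_flip: "sep_holomorphic (\<lambda>t s. f s t) T S \<longleftrightarrow> sep_holomorphic f S T"
 by (auto simp: sep_holomorphic_def)

lemma sep_holomorphic_subset:
 "sep_holomorphic f S T ==> S' \<subseteq> S ==> T' \<subseteq> T ==> sep_holomorphic f S' T'"
 unfolding sep_holomorphic_def by (blast intro: holomorphic_on_subset)

lemma sep_holomorphic_deriv1:
 assumes S: "open S" and T: "open T" and f: "sep_holomorphic f S T"
  and B: "\<And>s t. s \<in> S ==> t \<in> T ==> norm (f s t) \<le> B"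
 shows "sep_holomorphic (\<lambda>s t. deriv (\<lambda>s. f s t) s) S T"
 unfolding sep_holomorphic_def
proof (intro conjI ballI)
 fix t assume "t \<in> T"
 thus "(\<lambda>s. deriv (\<lambda>s. f s t) s) holomorphic_on S"
  using f S by (auto simp: sep_holomorphic_def intro: holomorphic_deriv)
next
 fix s assume s: "s \<in> S"
 obtain r where r: "r > 0" "ball s r \<subseteq> S" using S s openE by blast
 have hol: "(\<lambda>s. f s t) holomorphic_on ball s r" if "t \<in> T" for t
  using f that r by (auto simp: sep_holomorphic_def intro: holomorphic_on_subset)
 define h where "h n = (of_real (r/8 / real (n+1)) :: complex)" for n
 have hn: "norm (h n) \<le> r/8" "norm (h n) = r/8 / real (n+1)" for n
 proof -
  show *: "norm (h n) = r/8 / real (n+1)" unfolding h_def norm_of_real using r by simp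
  have "r/8 / real (n+1) \<le> r/8/1" using r by (intro divide_left_mono) auto
  thus "norm (h n) \<le> r/8" using * by simp
 qed
 have h0: "h n \<noteq> 0" for n using r by (auto simp: h_def simp del: of_nat_Suc)
 have hlim: "(\<lambda>n. 32 * B / r\<^sup>2 * norm (h n)) \<longlonglongrightarrow> 0"
 proof -
  have "(\<lambda>n. r/8 / real (n+1)) \<longlonglongrightarrow> 0"
   using LIMSEQ_Suc[OF lim_const_over_n[of "r/8"]] by simp
  from tendsto_mult_right_zero[OF this, of "32 * B / r\<^sup>2"] show ?thesis by (simp add: hn(2))
 qed
 have est: "norm ((f (s + h n) t - f s t) / h n - deriv (\<lambda>s. f s t) s) \<le> 32 * B / r\<^sup>2 * norm (h n)" if t: "t \<in> T" for n t
 proof -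
  let ?g = "\<lambda>s. f s t"
  have Bt: "norm (?g w) \<le> B" if "w \<in> ball s r" for w using B[OF _ t] that r by blast
  have d1: "norm (deriv ?g w) \<le> 4 * B / r" if "w \<in> ball s (r/2)" for w
   by (rule deriv_bound_ball[OF hol[OF t] r(1) Bt]) (use that in \<open>auto simp: dist_norm norm_minus_commute\<close>)
  have hd: "deriv ?g holomorphic_on ball s r" by (rule holomorphic_deriv[OF hol[OF t]]) auto
  have d2: "norm (deriv (deriv ?g) w) \<le> 32 * B / r\<^sup>2" if "w \<in> ball s (r/4)" for w
  proof -
   have "norm (deriv (deriv ?g) w) \<le> 4 * (4 * B / r) / (r/2)"
    by (rule deriv_bound_ball[OF holomorphic_on_subset[OF hd] _ d1]) (use that r in \<open>auto simp: dist_norm norm_minus_commute\<close>)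
   thus ?thesis by (simp add: power2_eq_square)
  qed
  have "cmod (((deriv ^^ 0) ?g) (s + h n) - (\<Sum>i\<le>1. (deriv ^^ i) ?g s * (s + h n - s) ^ i / fact i))
    \<le> 32 * B / r\<^sup>2 * cmod (s + h n - s) ^ Suc 1 / fact 1"
  proof (rule complex_Taylor[where S = "ball s (r/4)"])
   fix i x assume x: "x \<in> ball s (r/4)" and i: "i \<le> (1::nat)"
   have x': "x \<in> ball s r" using x r by auto
   have "((deriv ^^ i) ?g has_field_derivative (deriv ^^ Suc i) ?g x) (at x)"
    using has_field_derivative_higher_deriv[OF hol[OF t] open_ball x', of i] by simp
   thus "((deriv ^^ i) ?g has_field_derivative (deriv ^^ Suc i) ?g x) (at x within ball s (r/4))"
    by (rule has_field_derivative_at_within)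
  next
   fix x assume x: "x \<in> ball s (r/4)"
   show "norm ((deriv ^^ Suc 1) ?g x) \<le> 32 * B / r\<^sup>2" using d2[OF x] by (simp add: eval_nat_numeral)
  next
   show "s + h n \<in> ball s (r/4)" using hn(1)[of n] r by (auto simp: dist_norm)
  qed (use r in auto)
  hence "norm (?g (s + h n) - ?g s - deriv ?g s * h n) \<le> 32 * B / r\<^sup>2 * norm (h n) * norm (h n)"
   by (simp add: diff_diff_eq power2_eq_square algebra_simps)
  moreover have "(?g (s + h n) - ?g s) / h n - deriv ?g s = (?g (s + h n) - ?g s - deriv ?g s * h n) / h n"
   using h0[of n] by (simp add: field_simps)
  ultimately show ?thesis using h0[of n] by (simp add: norm_divide divide_le_eq)
 qed
 show "(\<lambda>t. deriv (\<lambda>s. f s t) s) holomorphic_on T"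
 proof (rule holomorphic_uniform_sequence[OF T])
  show "(\<lambda>t. (f (s + h n) t - f s t) / h n) holomorphic_on T" for n
  proof -
   have "norm (h n) < r" using hn(1)[of n] r by linarith
   hence "s + h n \<in> S" using r(2) by (auto simp: subset_eq dist_norm)
   thus ?thesis using f s h0[of n] by (auto simp: sep_holomorphic_def intro!: holomorphic_intros)
  qed
  fix x assume "x \<in> T"
  then obtain d where d: "d > 0" "cball x d \<subseteq> T" using T open_contains_cball by blast
  have "uniform_limit (cball x d) (\<lambda>n t. (f (s + h n) t - f s t) / h n) (\<lambda>t. deriv (\<lambda>s. f s t) s) sequentially"
  proof (rule uniform_limitI)
   fix e :: real assume "e > 0"
   from order_tendstoD(2)[OF hlim this]
   show "\<forall>\<^sub>F n in sequentially. \<forall>t\<in>cball x d. dist ((f (s + h n) t - f s t) / h n) (deriv (\<lambda>s. f s t) s) < e"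
   proof eventually_elim
    case (elim n)
    thus ?case using est[of _ n] d by (auto simp: dist_norm intro: le_less_trans)
   qed
  qed
  thus "\<exists>d>0. cball x d \<subseteq> T \<and> uniform_limit (cball x d) (\<lambda>n t. (f (s + h n) t - f s t) / h n) (\<lambda>t. deriv (\<lambda>s. f s t) s) sequentially"
   using d by blast
 qed
qed

lemma sep_holomorphic_deriv2:
 assumes "open S" "open T" "sep_holomorphic f S T" "\<And>s t. s \<in> S ==> t \<in> T ==> norm (f s t) \<le> B"
 shows "sep_holomorphic (\<lambda>s t. deriv (f s) t) S T"
proof -
 have "sep_holomorphic (\<lambda>t s. deriv (\<lambda>t. f s t) t) T S"
  by (rule sep_holomorphic_deriv1[OF assms(2,1) iffD2[OF sep_holomorphic_flip assms(3)]]) (rule assms(4))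
 thus ?thesis by (rule iffD1[OF sep_holomorphic_flip])
qed

text \<open>
Far out on the contour the integrands are controlled only for parameters this close to real ones.
\<close>
definition rad :: "real => real => real" where "rad r y = r / (1 + \<bar>y\<bar>)\<^sup>2"

lemma rad_pos: "r > 0 ==> rad r y > 0" by (auto simp: rad_def intro!: divide_pos_pos zero_less_power)
lemma rad_le: "r > 0 ==> rad r y \<le> r"
 by (auto simp: rad_def divide_le_eq one_le_power)
lemma rad_half: "rad (r/2) y = rad r y / 2" by (simp add: rad_def)
lemma rad_mono: "r \<le> r' ==> rad r y \<le> rad r' y" by (simp add: rad_def divide_right_mono)

text \<open>
Each \<open>(a, A) \<in> J\<close> stands for the range \<open>0 \<le> s < A\<close>, \<open>a < t < A\<close> on which constants are uniform. The discs in \<open>t\<close> have radius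
proportional to \<open>t\<close>, so that Cauchy's estimate bounds \<open>t \<partial>\<^sub>t\<close> rather than \<open>\<partial>\<^sub>t\<close>, and discs in \<open>s\<close> extend across \<open>s = 0\<close>.
\<close>
definition bikernel :: "(real \<times> real) set => nat => (real => complex => complex => complex) => bool" where
 "bikernel J N \<Psi> \<longleftrightarrow> (\<forall>(a, A)\<in>J. \<exists>r C d. 0 < r \<and> r \<le> 1/2 \<and> 0 < d \<and>
   (\<forall>y. \<forall>s0\<in>{0..<A}. \<forall>t0\<in>{a<..<A}.
    (\<lambda>y. \<Psi> y (of_real s0) (of_real t0)) \<in> borel_measurable borel \<and>
    sep_holomorphic (\<Psi> y) (ball (of_real s0) (rad r y)) (ball (of_real t0) (rad r y * t0)) \<and>
    (\<forall>s\<in>ball (of_real s0) (rad r y). \<forall>t\<in>ball (of_real t0) (rad r y * t0).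
      norm (\<Psi> y s t) \<le> C * t0 ^ N * exp (- d * \<bar>y\<bar>))))"

definition covers :: "(real \<times> real) set => bool" where
 "covers J \<longleftrightarrow> (\<forall>(a, A)\<in>J. 0 \<le> a) \<and> (\<forall>s\<ge>0. \<forall>t>0. \<exists>(a, A)\<in>J. s < A \<and> a < t \<and> t < A)"

lemma covers_nonneg: "covers J ==> (a, A) \<in> J ==> 0 \<le> a" by (auto simp: covers_def)

lemma bikernelE:
 assumes "bikernel J N \<Psi>" "(a, A) \<in> J"
 obtains r d C where "0 < r" "r \<le> 1/2" "0 < d"
  "\<And>s0 t0. s0 \<in> {0..<A} ==> t0 \<in> {a<..<A} ==> (\<lambda>y. \<Psi> y (of_real s0) (of_real t0)) \<in> borel_measurable borel"
  "\<And>y s0 t0. s0 \<in> {0..<A} ==> t0 \<in> {a<..<A} ==>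
   sep_holomorphic (\<Psi> y) (ball (of_real s0) (rad r y)) (ball (of_real t0) (rad r y * t0))"
  "\<And>y s0 t0 s t. s0 \<in> {0..<A} ==> t0 \<in> {a<..<A} ==> s \<in> ball (of_real s0) (rad r y) ==>
    t \<in> ball (of_real t0) (rad r y * t0) ==> norm (\<Psi> y s t) \<le> C * t0 ^ N * exp (- d * \<bar>y\<bar>)"
 using assms unfolding bikernel_def by fast

lemma bikernelI:
 assumes "\<And>a A. (a, A) \<in> J ==> \<exists>r C d. 0 < r \<and> r \<le> 1/2 \<and> 0 < d \<and>
   (\<forall>y. \<forall>s0\<in>{0..<A}. \<forall>t0\<in>{a<..<A}.
    (\<lambda>y. \<Psi> y (of_real s0) (of_real t0)) \<in> borel_measurable borel \<and>
    sep_holomorphic (\<Psi> y) (ball (of_real s0) (rad r y)) (ball (of_real t0) (rad r y * t0)) \<and>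
    (\<forall>s\<in>ball (of_real s0) (rad r y). \<forall>t\<in>ball (of_real t0) (rad r y * t0).
      norm (\<Psi> y s t) \<le> C * t0 ^ N * exp (- d * \<bar>y\<bar>)))"
 shows "bikernel J N \<Psi>"
 using assms unfolding bikernel_def by fast

text \<open>
Difference quotients along a sequence suffice, as a derivative is the pointwise limit of them.
\<close>
lemma deriv_measurable_seq:
 fixes h :: "nat => complex" and f :: "real => complex => complex"
 assumes "h \<longlonglongrightarrow> 0" "\<And>n. h n \<noteq> 0" "\<And>n. (\<lambda>y. f y (z + h n)) \<in> borel_measurable borel"
  "(\<lambda>y. f y z) \<in> borel_measurable borel" "\<And>y. f y field_differentiable at z"
 shows "(\<lambda>y. deriv (f y) z) \<in> borel_measurable borel"
proof (rule borel_measurable_LIMSEQ_metric)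
 show "(\<lambda>y. (f y (z + h n) - f y z) / h n) \<in> borel_measurable borel" for n
  by (intro borel_measurable_divide borel_measurable_diff assms borel_measurable_const)
 fix y
 have "((\<lambda>h. (f y (z + h) - f y z) / h) \<longlongrightarrow> deriv (f y) z) (at 0)"
  using assms(5) by (simp add: DERIV_def flip: DERIV_deriv_iff_field_differentiable)
 thus "(\<lambda>n. (f y (z + h n) - f y z) / h n) \<longlonglongrightarrow> deriv (f y) z"
  unfolding tendsto_at_iff_sequentially using assms(1,2) by (auto simp: o_def)
qed

text \<open>
Measurability in \<open>y\<close> is known at real parameters in \<open>[0, A)\<close> only; approaching from the right stays in that range even for \<open>s = 0\<close>.
\<close>
lemma right_approach:
 assumes "(s::real) < A"
 obtains e where "e > 0" "(\<lambda>n. complex_of_real (e / real (n+1))) \<longlonglongrightarrow> 0"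
  "\<And>n. complex_of_real (e / real (n+1)) \<noteq> 0" "\<And>n. s + e / real (n+1) < A" "\<And>n. s + e / real (n+1) > s"
proof
 define e where "e = (A - s) / 2"
 show e: "e > 0" using assms by (simp add: e_def)
 have "(\<lambda>n. e / real (n+1)) \<longlonglongrightarrow> 0" using LIMSEQ_Suc[OF lim_const_over_n[of e]] by simp
 from tendsto_of_real[OF this, where 'a = complex] show "(\<lambda>n. complex_of_real (e / real (n+1))) \<longlonglongrightarrow> 0" by simp
 fix n
 show "complex_of_real (e / real (n+1)) \<noteq> 0" using e by (simp del: of_nat_Suc)
 have "e / real (n+1) \<le> e/1" using e by (intro divide_left_mono) auto
 moreover have "s + e < A" using assms by (simp add: e_def field_simps)
 ultimately show "s + e / real (n+1) < A" by linarith
 show "s + e / real (n+1) > s" using e by simp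
qed

text \<open>
Cauchy's estimate on half of each disc; the factor \<open>(1 + |y|)\<^sup>2\<close> is absorbed by halving the rate of decay.
\<close>
lemma bikernel_deriv1:
 assumes J: "covers J" and \<Psi>: "bikernel J N \<Psi>"
 shows "bikernel J N (\<lambda>y s t. deriv (\<lambda>s. \<Psi> y s t) s)"
proof (rule bikernelI)
 fix a A assume aA: "(a, A) \<in> J"
 have a: "a \<ge> 0" using covers_nonneg[OF J aA] .
 obtain r d C where r: "0 < r" "r \<le> 1/2" "0 < d"
  and m: "\<And>s0 t0. s0 \<in> {0..<A} ==> t0 \<in> {a<..<A} ==> (\<lambda>y. \<Psi> y (of_real s0) (of_real t0)) \<in> borel_measurable borel"
  and h: "\<And>y s0 t0. s0 \<in> {0..<A} ==> t0 \<in> {a<..<A} ==>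
   sep_holomorphic (\<Psi> y) (ball (of_real s0) (rad r y)) (ball (of_real t0) (rad r y * t0))"
  and b: "\<And>y s0 t0 s t. s0 \<in> {0..<A} ==> t0 \<in> {a<..<A} ==> s \<in> ball (of_real s0) (rad r y) ==>
    t \<in> ball (of_real t0) (rad r y * t0) ==> norm (\<Psi> y s t) \<le> C * t0 ^ N * exp (- d * \<bar>y\<bar>)"
  using bikernelE[OF \<Psi> aA] by blast
 obtain K where K: "K > 0" "\<And>y. (1 + \<bar>y\<bar>)\<^sup>2 * exp (- d * \<bar>y\<bar>) \<le> K * exp (- (d/2) * \<bar>y\<bar>)"
  using square_exp_absorb[OF r(3)] by blast
 show "\<exists>r C d. 0 < r \<and> r \<le> 1/2 \<and> 0 < d \<and>
   (\<forall>y. \<forall>s0\<in>{0..<A}. \<forall>t0\<in>{a<..<A}.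
    (\<lambda>y. deriv (\<lambda>s. \<Psi> y s (of_real t0)) (of_real s0)) \<in> borel_measurable borel \<and>
    sep_holomorphic (\<lambda>s t. deriv (\<lambda>s. \<Psi> y s t) s) (ball (of_real s0) (rad r y)) (ball (of_real t0) (rad r y * t0)) \<and>
    (\<forall>s\<in>ball (of_real s0) (rad r y). \<forall>t\<in>ball (of_real t0) (rad r y * t0).
      norm (deriv (\<lambda>s. \<Psi> y s t) s) \<le> C * t0 ^ N * exp (- d * \<bar>y\<bar>)))"
 proof (rule exI[of _ "r/2"], rule exI[of _ "4 * \<bar>C\<bar> * K / r"], rule exI[of _ "d/2"], intro conjI allI ballI)
  fix y s0 t0 assume s0: "s0 \<in> {0..<A}" and t0: "t0 \<in> {a<..<A}"
  have t0p: "t0 > 0" using a t0 by auto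
  have R: "rad r y > 0" by (rule rad_pos[OF r(1)])
  have sub1: "ball (complex_of_real s0) (rad (r/2) y) \<subseteq> ball (of_real s0) (rad r y)"
   using R by (intro subset_ball) (simp add: rad_half)
  have sub2: "ball (complex_of_real t0) (rad (r/2) y * t0) \<subseteq> ball (of_real t0) (rad r y * t0)"
   using R t0p by (intro subset_ball) (simp add: rad_half)
  show "sep_holomorphic (\<lambda>s t. deriv (\<lambda>s. \<Psi> y s t) s) (ball (of_real s0) (rad (r/2) y)) (ball (of_real t0) (rad (r/2) y * t0))"
   by (rule sep_holomorphic_subset[OF sep_holomorphic_deriv1[OF open_ball open_ball h[OF s0 t0] b[OF s0 t0]] sub1 sub2])
  { fix s t assume s: "s \<in> ball (complex_of_real s0) (rad (r/2) y)" and t: "t \<in> ball (complex_of_real t0) (rad (r/2) y * t0)"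
   have "norm (deriv (\<lambda>s. \<Psi> y s t) s) \<le> 4 * (C * t0 ^ N * exp (- d * \<bar>y\<bar>)) / rad r y"
   proof (rule deriv_bound_ball)
    show "(\<lambda>s. \<Psi> y s t) holomorphic_on ball (of_real s0) (rad r y)"
     using h[OF s0 t0, of y] t sub2 by (auto simp: sep_holomorphic_def)
    show "norm (s - of_real s0) \<le> rad r y / 2" using s by (auto simp: rad_half dist_norm norm_minus_commute)
    show "norm (\<Psi> y w t) \<le> C * t0 ^ N * exp (- d * \<bar>y\<bar>)" if "w \<in> ball (of_real s0) (rad r y)" for w
     using b[OF s0 t0 that] t sub2 by blast
   qed (use R in auto)
   also have "\<dots> = 4 * C * t0 ^ N / r * ((1 + \<bar>y\<bar>)\<^sup>2 * exp (- d * \<bar>y\<bar>))"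
    by (simp add: rad_def field_simps)
   also have "\<dots> \<le> 4 * \<bar>C\<bar> * t0 ^ N / r * ((1 + \<bar>y\<bar>)\<^sup>2 * exp (- d * \<bar>y\<bar>))"
    using t0p r by (intro mult_right_mono divide_right_mono mult_left_mono mult_nonneg_nonneg) auto
   also have "\<dots> \<le> 4 * \<bar>C\<bar> * t0 ^ N / r * (K * exp (- (d/2) * \<bar>y\<bar>))"
    using t0p r by (intro mult_left_mono K(2)) auto
   finally show "norm (deriv (\<lambda>s. \<Psi> y s t) s) \<le> 4 * \<bar>C\<bar> * K / r * t0 ^ N * exp (- (d/2) * \<bar>y\<bar>)"
    by (simp add: mult_ac) }
  obtain e where e: "e > 0" "(\<lambda>n. complex_of_real (e / real (n+1))) \<longlonglongrightarrow> 0"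
   "\<And>n. complex_of_real (e / real (n+1)) \<noteq> 0" "\<And>n. s0 + e / real (n+1) < A" "\<And>n. s0 + e / real (n+1) > s0"
   using right_approach[of s0 A] s0 by auto
  show "(\<lambda>y. deriv (\<lambda>s. \<Psi> y s (of_real t0)) (of_real s0)) \<in> borel_measurable borel"
  proof (rule deriv_measurable_seq[OF e(2,3)])
   fix n
   have "s0 + e / real (n+1) \<in> {0..<A}" using e(4,5)[of n] s0 by auto
   from m[OF this t0] show "(\<lambda>y. \<Psi> y (of_real s0 + of_real (e / real (n+1))) (of_real t0)) \<in> borel_measurable borel"
    by simp
  next
   fix y
   have "(\<lambda>s. \<Psi> y s (of_real t0)) holomorphic_on ball (of_real s0) (rad r y)"
    using h[OF s0 t0, of y] rad_pos[OF r(1)] t0p by (auto simp: sep_holomorphic_def)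
   thus "(\<lambda>s. \<Psi> y s (of_real t0)) field_differentiable at (of_real s0)"
    by (rule holomorphic_on_imp_differentiable_at) (use rad_pos[OF r(1)] in auto)
  qed (rule m[OF s0 t0])
 qed (use r in auto)
qed

text \<open>
As for the first variable; the factor \<open>t\<close> cancels the radius of the discs in \<open>t\<close>.
\<close>
lemma bikernel_deriv2:
 assumes J: "covers J" and \<Psi>: "bikernel J N \<Psi>"
 shows "bikernel J N (\<lambda>y s t. t * deriv (\<Psi> y s) t)"
proof (rule bikernelI)
 fix a A assume aA: "(a, A) \<in> J"
 have a: "a \<ge> 0" using covers_nonneg[OF J aA] .
 obtain r d C where r: "0 < r" "r \<le> 1/2" "0 < d"
  and m: "\<And>s0 t0. s0 \<in> {0..<A} ==> t0 \<in> {a<..<A} ==> (\<lambda>y. \<Psi> y (of_real s0) (of_real t0)) \<in> borel_measurable borel"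
  and h: "\<And>y s0 t0. s0 \<in> {0..<A} ==> t0 \<in> {a<..<A} ==>
   sep_holomorphic (\<Psi> y) (ball (of_real s0) (rad r y)) (ball (of_real t0) (rad r y * t0))"
  and b: "\<And>y s0 t0 s t. s0 \<in> {0..<A} ==> t0 \<in> {a<..<A} ==> s \<in> ball (of_real s0) (rad r y) ==>
    t \<in> ball (of_real t0) (rad r y * t0) ==> norm (\<Psi> y s t) \<le> C * t0 ^ N * exp (- d * \<bar>y\<bar>)"
  using bikernelE[OF \<Psi> aA] by blast
 obtain K where K: "K > 0" "\<And>y. (1 + \<bar>y\<bar>)\<^sup>2 * exp (- d * \<bar>y\<bar>) \<le> K * exp (- (d/2) * \<bar>y\<bar>)"
  using square_exp_absorb[OF r(3)] by blast
 show "\<exists>r C d. 0 < r \<and> r \<le> 1/2 \<and> 0 < d \<and>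
   (\<forall>y. \<forall>s0\<in>{0..<A}. \<forall>t0\<in>{a<..<A}.
    (\<lambda>y. of_real t0 * deriv (\<Psi> y (of_real s0)) (of_real t0)) \<in> borel_measurable borel \<and>
    sep_holomorphic (\<lambda>s t. t * deriv (\<Psi> y s) t) (ball (of_real s0) (rad r y)) (ball (of_real t0) (rad r y * t0)) \<and>
    (\<forall>s\<in>ball (of_real s0) (rad r y). \<forall>t\<in>ball (of_real t0) (rad r y * t0).
      norm (t * deriv (\<Psi> y s) t) \<le> C * t0 ^ N * exp (- d * \<bar>y\<bar>)))"
 proof (rule exI[of _ "r/2"], rule exI[of _ "8 * \<bar>C\<bar> * K / r"], rule exI[of _ "d/2"], intro conjI allI ballI)
  fix y s0 t0 assume s0: "s0 \<in> {0..<A}" and t0: "t0 \<in> {a<..<A}"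
  have t0p: "t0 > 0" using a t0 by auto
  have R: "rad r y > 0" by (rule rad_pos[OF r(1)])
  have R1: "rad r y \<le> 1" using rad_le[OF r(1), of y] r by simp
  have sub1: "ball (complex_of_real s0) (rad (r/2) y) \<subseteq> ball (of_real s0) (rad r y)"
   using R by (intro subset_ball) (simp add: rad_half)
  have sub2: "ball (complex_of_real t0) (rad (r/2) y * t0) \<subseteq> ball (of_real t0) (rad r y * t0)"
   using R t0p by (intro subset_ball) (simp add: rad_half)
  have "sep_holomorphic (\<lambda>s t. deriv (\<Psi> y s) t) (ball (of_real s0) (rad (r/2) y)) (ball (of_real t0) (rad (r/2) y * t0))"
   by (rule sep_holomorphic_subset[OF sep_holomorphic_deriv2[OF open_ball open_ball h[OF s0 t0] b[OF s0 t0]] sub1 sub2])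
  thus "sep_holomorphic (\<lambda>s t. t * deriv (\<Psi> y s) t) (ball (of_real s0) (rad (r/2) y)) (ball (of_real t0) (rad (r/2) y * t0))"
   unfolding sep_holomorphic_def by (auto intro!: holomorphic_on_mult)
  { fix s t assume s: "s \<in> ball (complex_of_real s0) (rad (r/2) y)" and t: "t \<in> ball (complex_of_real t0) (rad (r/2) y * t0)"
   have dt: "norm (deriv (\<Psi> y s) t) \<le> 4 * (C * t0 ^ N * exp (- d * \<bar>y\<bar>)) / (rad r y * t0)"
   proof (rule deriv_bound_ball)
    show "\<Psi> y s holomorphic_on ball (of_real t0) (rad r y * t0)"
     using h[OF s0 t0, of y] s sub1 by (auto simp: sep_holomorphic_def)
    show "norm (t - of_real t0) \<le> rad r y * t0 / 2" using t by (auto simp: rad_half dist_norm norm_minus_commute)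
    show "norm (\<Psi> y s w) \<le> C * t0 ^ N * exp (- d * \<bar>y\<bar>)" if "w \<in> ball (of_real t0) (rad r y * t0)" for w
     using b[OF s0 t0 _ that] s sub1 by blast
   qed (use R t0p in auto)
   have "norm t \<le> norm (of_real t0 :: complex) + norm (t - of_real t0)" by (rule norm_triangle_sub)
   also have "\<dots> \<le> t0 + rad r y * t0 / 2" using t t0p by (auto simp: rad_half dist_norm norm_minus_commute)
   also have "\<dots> \<le> t0 + 1 * t0 / 2" using R1 t0p by (intro add_left_mono divide_right_mono mult_right_mono) auto
   finally have nt: "norm t \<le> 2 * t0" using t0p by simp
   have "norm (t * deriv (\<Psi> y s) t) \<le> 2 * t0 * (4 * (C * t0 ^ N * exp (- d * \<bar>y\<bar>)) / (rad r y * t0))"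
    unfolding norm_mult using t0p by (intro mult_mono nt dt) auto
   also have "\<dots> = 8 * C * t0 ^ N / r * ((1 + \<bar>y\<bar>)\<^sup>2 * exp (- d * \<bar>y\<bar>))"
    using t0p by (simp add: rad_def field_simps)
   also have "\<dots> \<le> 8 * \<bar>C\<bar> * t0 ^ N / r * ((1 + \<bar>y\<bar>)\<^sup>2 * exp (- d * \<bar>y\<bar>))"
    using t0p r by (intro mult_right_mono divide_right_mono mult_left_mono mult_nonneg_nonneg) auto
   also have "\<dots> \<le> 8 * \<bar>C\<bar> * t0 ^ N / r * (K * exp (- (d/2) * \<bar>y\<bar>))"
    using t0p r by (intro mult_left_mono K(2)) auto
   finally show "norm (t * deriv (\<Psi> y s) t) \<le> 8 * \<bar>C\<bar> * K / r * t0 ^ N * exp (- (d/2) * \<bar>y\<bar>)"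
    by (simp add: mult_ac) }
  obtain e where e: "e > 0" "(\<lambda>n. complex_of_real (e / real (n+1))) \<longlonglongrightarrow> 0"
   "\<And>n. complex_of_real (e / real (n+1)) \<noteq> 0" "\<And>n. t0 + e / real (n+1) < A" "\<And>n. t0 + e / real (n+1) > t0"
   using right_approach[of t0 A] t0 by auto
  have "(\<lambda>y. deriv (\<Psi> y (of_real s0)) (of_real t0)) \<in> borel_measurable borel"
  proof (rule deriv_measurable_seq[OF e(2,3)])
   fix n
   have "t0 + e / real (n+1) \<in> {a<..<A}" using e(4,5)[of n] t0 by auto
   from m[OF s0 this] show "(\<lambda>y. \<Psi> y (of_real s0) (of_real t0 + of_real (e / real (n+1)))) \<in> borel_measurable borel"
    by simp
  next
   fix y
   have "\<Psi> y (of_real s0) holomorphic_on ball (of_real t0) (rad r y * t0)"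
    using h[OF s0 t0, of y] rad_pos[OF r(1)] t0p by (auto simp: sep_holomorphic_def)
   thus "\<Psi> y (of_real s0) field_differentiable at (of_real t0)"
    by (rule holomorphic_on_imp_differentiable_at) (use rad_pos[OF r(1)] t0p in auto)
  qed (rule m[OF s0 t0])
  thus "(\<lambda>y. of_real t0 * deriv (\<Psi> y (of_real s0)) (of_real t0)) \<in> borel_measurable borel"
   by (intro borel_measurable_times borel_measurable_const)
 qed (use r in auto)
qed

definition bint :: "(real => complex => complex => complex) => real => real => complex" where
 "bint \<Psi> s t = (\<integral>y. \<Psi> y (of_real s) (of_real t) \<partial>lborel)"

lemma bikernel_real:
 assumes J: "covers J" and \<Psi>: "bikernel J N \<Psi>" and aA: "(a, A) \<in> J"
 obtains C d where "C \<ge> 0" "d > 0"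
  "\<And>y s t. s \<in> {0..<A} ==> t \<in> {a<..<A} ==> norm (\<Psi> y (of_real s) (of_real t)) \<le> C * t ^ N * exp (- d * \<bar>y\<bar>)"
  "\<And>s t. s \<in> {0..<A} ==> t \<in> {a<..<A} ==> (\<lambda>y. \<Psi> y (of_real s) (of_real t)) \<in> borel_measurable borel"
  "\<And>s t. s \<in> {0..<A} ==> t \<in> {a<..<A} ==> integrable lborel (\<lambda>y. \<Psi> y (of_real s) (of_real t))"
proof -
 have a: "a \<ge> 0" using covers_nonneg[OF J aA] .
 obtain r d C where r: "0 < r" "r \<le> 1/2" "0 < d"
  and m: "\<And>s0 t0. s0 \<in> {0..<A} ==> t0 \<in> {a<..<A} ==> (\<lambda>y. \<Psi> y (of_real s0) (of_real t0)) \<in> borel_measurable borel"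
  and h: "\<And>y s0 t0. s0 \<in> {0..<A} ==> t0 \<in> {a<..<A} ==>
   sep_holomorphic (\<Psi> y) (ball (of_real s0) (rad r y)) (ball (of_real t0) (rad r y * t0))"
  and b: "\<And>y s0 t0 s t. s0 \<in> {0..<A} ==> t0 \<in> {a<..<A} ==> s \<in> ball (of_real s0) (rad r y) ==>
    t \<in> ball (of_real t0) (rad r y * t0) ==> norm (\<Psi> y s t) \<le> C * t0 ^ N * exp (- d * \<bar>y\<bar>)"
  using bikernelE[OF \<Psi> aA] by blast
 have b': "norm (\<Psi> y (of_real s) (of_real t)) \<le> \<bar>C\<bar> * t ^ N * exp (- d * \<bar>y\<bar>)" if "s \<in> {0..<A}" "t \<in> {a<..<A}" for y s t
 proof -
  have t: "t > 0" using that a by auto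
  have "norm (\<Psi> y (of_real s) (of_real t)) \<le> C * t ^ N * exp (- d * \<bar>y\<bar>)"
   by (rule b[OF that]) (use rad_pos[OF r(1)] t in auto)
  also have "\<dots> \<le> \<bar>C\<bar> * t ^ N * exp (- d * \<bar>y\<bar>)" using t by (intro mult_right_mono) auto
  finally show ?thesis .
 qed
 have i: "integrable lborel (\<lambda>y. \<Psi> y (of_real s) (of_real t))" if "s \<in> {0..<A}" "t \<in> {a<..<A}" for s t
 proof (rule Bochner_Integration.integrable_bound)
  show "integrable lborel (\<lambda>y. \<bar>C\<bar> * t ^ N * exp (- d * \<bar>y\<bar>))"
   by (intro integrable_mult_right integrable_exp_minus_abs r)
  show "(\<lambda>y. \<Psi> y (of_real s) (of_real t)) \<in> borel_measurable lborel" using m[OF that] by simp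
  show "AE y in lborel. norm (\<Psi> y (of_real s) (of_real t)) \<le> norm (\<bar>C\<bar> * t ^ N * exp (- d * \<bar>y\<bar>))"
   using b'[OF that] by (intro AE_I2) (metis abs_ge_self order_trans real_norm_def)
 qed
 show thesis by (rule that[OF _ r(3) b' m i]) auto
qed

lemma bint_bound:
 assumes J: "covers J" and \<Psi>: "bikernel J N \<Psi>" and aA: "(a, A) \<in> J"
 obtains C where "C \<ge> 0" "\<And>s t. s \<in> {0..<A} ==> t \<in> {a<..<A} ==> norm (bint \<Psi> s t) \<le> C * t ^ N"
proof -
 obtain C d where C: "C \<ge> 0" "d > 0"
  "\<And>y s t. s \<in> {0..<A} ==> t \<in> {a<..<A} ==> norm (\<Psi> y (of_real s) (of_real t)) \<le> C * t ^ N * exp (- d * \<bar>y\<bar>)"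
  "\<And>s t. s \<in> {0..<A} ==> t \<in> {a<..<A} ==> (\<lambda>y. \<Psi> y (of_real s) (of_real t)) \<in> borel_measurable borel"
  "\<And>s t. s \<in> {0..<A} ==> t \<in> {a<..<A} ==> integrable lborel (\<lambda>y. \<Psi> y (of_real s) (of_real t))"
  using bikernel_real[OF assms] by blast
 define I where "I = (\<integral>y. exp (- d * \<bar>y\<bar>) \<partial>lborel)"
 have I: "I \<ge> 0" unfolding I_def by (intro integral_nonneg_AE AE_I2) auto
 show thesis
 proof (rule that[of "C * I"])
  fix s t assume st: "s \<in> {0..<A}" "t \<in> {a<..<A}"
  have "norm (bint \<Psi> s t) \<le> (\<integral>y. norm (\<Psi> y (of_real s) (of_real t)) \<partial>lborel)"
   unfolding bint_def by (rule integral_norm_bound)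
  also have "\<dots> \<le> (\<integral>y. C * t ^ N * exp (- d * \<bar>y\<bar>) \<partial>lborel)"
   by (intro integral_mono integrable_norm C st integrable_mult_right integrable_exp_minus_abs)
  also have "\<dots> = C * I * t ^ N" by (simp add: I_def)
  finally show "norm (bint \<Psi> s t) \<le> C * I * t ^ N" .
 qed (use C I in auto)
qed

lemma bint_deriv1:
 assumes J: "covers J" and \<Psi>: "bikernel J N \<Psi>" and s: "s \<ge> 0" and t: "t > 0"
 shows "((\<lambda>s. bint \<Psi> s t) has_vector_derivative bint (\<lambda>y s t. deriv (\<lambda>s. \<Psi> y s t) s) s t) (at s within {0..})"
proof -
 obtain a A where aA: "(a, A) \<in> J" "s < A" "a < t" "t < A" using J s t unfolding covers_def by blast
 have a: "a \<ge> 0" using covers_nonneg[OF J aA(1)] .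
 have st: "s \<in> {0..<A}" "t \<in> {a<..<A}" using aA s by auto
 obtain C d where C: "C \<ge> 0" "d > 0"
  "\<And>y s t. s \<in> {0..<A} ==> t \<in> {a<..<A} ==> norm (deriv (\<lambda>s. \<Psi> y s (of_real t)) (of_real s)) \<le> C * t ^ N * exp (- d * \<bar>y\<bar>)"
  "\<And>s t. s \<in> {0..<A} ==> t \<in> {a<..<A} ==> (\<lambda>y. deriv (\<lambda>s. \<Psi> y s (of_real t)) (of_real s)) \<in> borel_measurable borel"
  "\<And>s t. s \<in> {0..<A} ==> t \<in> {a<..<A} ==> integrable lborel (\<lambda>y. deriv (\<lambda>s. \<Psi> y s (of_real t)) (of_real s))"
  using bikernel_real[OF J bikernel_deriv1[OF J \<Psi>] aA(1)] by blast
 obtain C' d' where "C' \<ge> 0" "d' > 0"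
  "\<And>y s t. s \<in> {0..<A} ==> t \<in> {a<..<A} ==> norm (\<Psi> y (of_real s) (of_real t)) \<le> C' * t ^ N * exp (- d' * \<bar>y\<bar>)"
  and m: "\<And>s t. s \<in> {0..<A} ==> t \<in> {a<..<A} ==> (\<lambda>y. \<Psi> y (of_real s) (of_real t)) \<in> borel_measurable borel"
  and i: "\<And>s t. s \<in> {0..<A} ==> t \<in> {a<..<A} ==> integrable lborel (\<lambda>y. \<Psi> y (of_real s) (of_real t))"
  using bikernel_real[OF J \<Psi> aA(1)] by blast
 obtain r d'' C'' where r: "0 < r" and "r \<le> 1/2" "0 < d''"
  and "\<And>s0 t0. s0 \<in> {0..<A} ==> t0 \<in> {a<..<A} ==> (\<lambda>y. \<Psi> y (of_real s0) (of_real t0)) \<in> borel_measurable borel"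
  and h: "\<And>y s0 t0. s0 \<in> {0..<A} ==> t0 \<in> {a<..<A} ==>
   sep_holomorphic (\<Psi> y) (ball (of_real s0) (rad r y)) (ball (of_real t0) (rad r y * t0))"
  and "\<And>y s0 t0 s t. s0 \<in> {0..<A} ==> t0 \<in> {a<..<A} ==> s \<in> ball (of_real s0) (rad r y) ==>
    t \<in> ball (of_real t0) (rad r y * t0) ==> norm (\<Psi> y s t) \<le> C'' * t0 ^ N * exp (- d'' * \<bar>y\<bar>)"
  using bikernelE[OF \<Psi> aA(1)] by blast
 have der: "((\<lambda>s. \<Psi> y (of_real s) (of_real t)) has_vector_derivative deriv (\<lambda>s. \<Psi> y s (of_real t)) (of_real x)) (at x within S)"
  if "x \<in> {0..<A}" for x y S
 proof (rule has_vector_derivative_real_field)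
  have "(\<lambda>s. \<Psi> y s (of_real t)) holomorphic_on ball (of_real x) (rad r y)"
   using h[OF that st(2), of y] rad_pos[OF r] t by (auto simp: sep_holomorphic_def)
  thus "((\<lambda>s. \<Psi> y s (of_real t)) has_field_derivative deriv (\<lambda>s. \<Psi> y s (of_real t)) (of_real x)) (at (of_real x))"
   by (rule holomorphic_derivI) (use rad_pos[OF r] in auto)
 qed
 have "((\<lambda>s. \<integral>y. \<Psi> y (of_real s) (of_real t) \<partial>lborel) has_derivative (\<lambda>h. h *\<^sub>R (\<integral>y. deriv (\<lambda>s. \<Psi> y s (of_real t)) (of_real s) \<partial>lborel))) (at s within {0..<A})"
 proof (rule has_derivative_integral_param[where f' = "\<lambda>y s. deriv (\<lambda>s. \<Psi> y s (of_real t)) (of_real s)"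
    and B = "\<lambda>y. C * t ^ N * exp (- d * \<bar>y\<bar>)"])
  show "integrable lborel (\<lambda>y. C * t ^ N * exp (- d * \<bar>y\<bar>))"
   by (intro integrable_mult_right integrable_exp_minus_abs C)
  show "((\<lambda>s. \<Psi> y (of_real s) (of_real t)) has_derivative (\<lambda>h. h *\<^sub>R deriv (\<lambda>s. \<Psi> y s (of_real t)) (of_real x))) (at x within {0..<A})"
   if "x \<in> {0..<A}" for x y using der[OF that] by (simp add: has_vector_derivative_def)
 qed (use C(3,4) m i st bounded_bilinear_scaleR in auto)
 hence "((\<lambda>s. bint \<Psi> s t) has_vector_derivative bint (\<lambda>y s t. deriv (\<lambda>s. \<Psi> y s t) s) s t) (at s within {0..<A})"
  unfolding has_vector_derivative_def bint_def .
 moreover have "at s within {0..<A} = at s within {0..}"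
  by (rule at_within_nhd[of s "{..<A}"]) (use st in auto)
 ultimately show ?thesis by simp
qed

lemma bint_deriv2:
 assumes J: "covers J" and \<Psi>: "bikernel J N \<Psi>" and s: "s \<ge> 0" and t: "t > 0"
 shows "((\<lambda>t. bint \<Psi> s t) has_vector_derivative (1 / t) *\<^sub>R bint (\<lambda>y s t. t * deriv (\<Psi> y s) t) s t) (at t)"
proof -
 obtain a A where aA: "(a, A) \<in> J" "s < A" "a < t" "t < A" using J s t unfolding covers_def by blast
 have a: "a \<ge> 0" using covers_nonneg[OF J aA(1)] .
 have st: "s \<in> {0..<A}" "t \<in> {a<..<A}" using aA s by auto
 obtain C d where C: "C \<ge> 0" "d > 0"
  "\<And>y s t. s \<in> {0..<A} ==> t \<in> {a<..<A} ==> norm (of_real t * deriv (\<Psi> y (of_real s)) (of_real t)) \<le> C * t ^ N * exp (- d * \<bar>y\<bar>)"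
  "\<And>s t. s \<in> {0..<A} ==> t \<in> {a<..<A} ==> (\<lambda>y. of_real t * deriv (\<Psi> y (of_real s)) (of_real t)) \<in> borel_measurable borel"
  "\<And>s t. s \<in> {0..<A} ==> t \<in> {a<..<A} ==> integrable lborel (\<lambda>y. of_real t * deriv (\<Psi> y (of_real s)) (of_real t))"
  using bikernel_real[OF J bikernel_deriv2[OF J \<Psi>] aA(1)] by blast
 obtain C' d' where "C' \<ge> 0" "d' > 0"
  "\<And>y s t. s \<in> {0..<A} ==> t \<in> {a<..<A} ==> norm (\<Psi> y (of_real s) (of_real t)) \<le> C' * t ^ N * exp (- d' * \<bar>y\<bar>)"
  and m: "\<And>s t. s \<in> {0..<A} ==> t \<in> {a<..<A} ==> (\<lambda>y. \<Psi> y (of_real s) (of_real t)) \<in> borel_measurable borel"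
  and i: "\<And>s t. s \<in> {0..<A} ==> t \<in> {a<..<A} ==> integrable lborel (\<lambda>y. \<Psi> y (of_real s) (of_real t))"
  using bikernel_real[OF J \<Psi> aA(1)] by blast
 obtain r d'' C'' where r: "0 < r" and "r \<le> 1/2" "0 < d''"
  and "\<And>s0 t0. s0 \<in> {0..<A} ==> t0 \<in> {a<..<A} ==> (\<lambda>y. \<Psi> y (of_real s0) (of_real t0)) \<in> borel_measurable borel"
  and h: "\<And>y s0 t0. s0 \<in> {0..<A} ==> t0 \<in> {a<..<A} ==>
   sep_holomorphic (\<Psi> y) (ball (of_real s0) (rad r y)) (ball (of_real t0) (rad r y * t0))"
  and "\<And>y s0 t0 s t. s0 \<in> {0..<A} ==> t0 \<in> {a<..<A} ==> s \<in> ball (of_real s0) (rad r y) ==>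
    t \<in> ball (of_real t0) (rad r y * t0) ==> norm (\<Psi> y s t) \<le> C'' * t0 ^ N * exp (- d'' * \<bar>y\<bar>)"
  using bikernelE[OF \<Psi> aA(1)] by blast
 define b where "b = max a (t/2)"
 have b: "b > 0" "b \<ge> a" "b \<ge> t/2" "b < t" using t a aA by (auto simp: b_def)
 have sub: "x \<in> {a<..<A}" "x > 0" if "x \<in> {b<..<A}" for x using that b a by auto
 have der: "((\<lambda>t. \<Psi> y (of_real s) (of_real t)) has_vector_derivative deriv (\<Psi> y (of_real s)) (of_real x)) (at x within S)"
  if x: "x \<in> {b<..<A}" for x y S
 proof (rule has_vector_derivative_real_field)
  have "\<Psi> y (of_real s) holomorphic_on ball (of_real x) (rad r y * x)"
   using h[OF st(1) sub(1)[OF x], of y] rad_pos[OF r] by (auto simp: sep_holomorphic_def)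
  thus "(\<Psi> y (of_real s) has_field_derivative deriv (\<Psi> y (of_real s)) (of_real x)) (at (of_real x))"
   by (rule holomorphic_derivI) (use rad_pos[OF r] sub(2)[OF x] in auto)
 qed
 have bnd: "norm (deriv (\<Psi> y (of_real s)) (of_real x)) \<le> C * A ^ N / b * exp (- d * \<bar>y\<bar>)" if x: "x \<in> {b<..<A}" for x y
 proof -
  have "norm (deriv (\<Psi> y (of_real s)) (of_real x)) = norm (of_real x * deriv (\<Psi> y (of_real s)) (of_real x)) / x"
   using sub(2)[OF x] by (simp add: norm_mult)
  also have "\<dots> \<le> (C * x ^ N * exp (- d * \<bar>y\<bar>)) / x"
   using C(3)[OF st(1) sub(1)[OF x]] sub(2)[OF x] by (intro divide_right_mono) auto
  also have "\<dots> \<le> (C * A ^ N * exp (- d * \<bar>y\<bar>)) / b"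
   using sub(2)[OF x] b x C by (intro frac_le mult_right_mono mult_left_mono power_mono) auto
  finally show ?thesis by simp
 qed
 have "((\<lambda>t. \<integral>y. \<Psi> y (of_real s) (of_real t) \<partial>lborel) has_derivative (\<lambda>h. h *\<^sub>R (\<integral>y. deriv (\<Psi> y (of_real s)) (of_real t) \<partial>lborel))) (at t within {b<..<A})"
 proof (rule has_derivative_integral_param[where f' = "\<lambda>y t. deriv (\<Psi> y (of_real s)) (of_real t)"
    and B = "\<lambda>y. C * A ^ N / b * exp (- d * \<bar>y\<bar>)"])
  show "integrable lborel (\<lambda>y. C * A ^ N / b * exp (- d * \<bar>y\<bar>))"
   by (intro integrable_mult_right integrable_exp_minus_abs C)
  show "((\<lambda>t. \<Psi> y (of_real s) (of_real t)) has_derivative (\<lambda>h. h *\<^sub>R deriv (\<Psi> y (of_real s)) (of_real x))) (at x within {b<..<A})"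
   if "x \<in> {b<..<A}" for x y using der[OF that] by (simp add: has_vector_derivative_def)
  have "(\<lambda>y. of_real (1/t) * (of_real t * deriv (\<Psi> y (of_real s)) (of_real t))) \<in> borel_measurable borel"
   by (intro borel_measurable_times borel_measurable_const C(4) st)
  thus "(\<lambda>y. deriv (\<Psi> y (of_real s)) (of_real t)) \<in> borel_measurable lborel" using t by simp
  show "(\<lambda>y. \<Psi> y (of_real s) (of_real x)) \<in> borel_measurable lborel" if "x \<in> {b<..<A}" for x
   using m[OF st(1) sub(1)[OF that]] by simp
 qed (use bnd b i[OF st] st bounded_bilinear_scaleR in auto)
 moreover have "at t within {b<..<A} = at t" by (rule at_within_open) (use b st in auto)
 moreover have "(1 / t) *\<^sub>R bint (\<lambda>y s t. t * deriv (\<Psi> y s) t) s t = (\<integral>y. deriv (\<Psi> y (of_real s)) (of_real t) \<partial>lborel)"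
  unfolding bint_def using t by (simp add: scaleR_conv_of_real)
 ultimately show ?thesis unfolding has_vector_derivative_def bint_def by simp
qed

section \<open>Polyhomogeneity and smoothness of kernel integrals\<close>

text \<open>
The ranges for estimates that are uniform down to \<open>t = 0\<close>.
\<close>
definition tube :: "(real \<times> real) set" where "tube = {(0, A) | A. A > 0}"

lemma covers_tube: "covers tube"
proof -
 have "\<exists>A>0. s < A \<and> t < A" if "t > 0" for s t :: real
  by (rule exI[of _ "max s t + 1"]) (use that in auto)
 thus ?thesis by (force simp: covers_def tube_def)
qed

definition bfun :: "nat => (real => real => complex) set" where
 "bfun N = {F. \<exists>\<Psi>. bikernel tube N \<Psi> \<and> (\<forall>s>0. \<forall>t>0. F s t = bint \<Psi> s t)}"

lemma bfun_d_fst: assumes "F \<in> bfun N" shows "d_fst F \<in> bfun N"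
proof -
 obtain \<Psi> where \<Psi>: "bikernel tube N \<Psi>" "\<And>s t. s > 0 ==> t > 0 ==> F s t = bint \<Psi> s t"
  using assms unfolding bfun_def by blast
 have "d_fst F s t = bint (\<lambda>y s t. deriv (\<lambda>s. \<Psi> y s t) s) s t" if "s > 0" "t > 0" for s t
  unfolding d_fst_def
 proof (rule vector_derivative_at, rule has_vector_derivative_transform_within_open)
  have "((\<lambda>s. bint \<Psi> s t) has_vector_derivative bint (\<lambda>y s t. deriv (\<lambda>s. \<Psi> y s t) s) s t) (at s within {0..})"
   by (rule bint_deriv1[OF covers_tube \<Psi>(1)]) (use that in auto)
  moreover have "at s within {0..} = at s" by (rule at_within_interior) (use that in auto)
  ultimately show "((\<lambda>s. bint \<Psi> s t) has_vector_derivative bint (\<lambda>y s t. deriv (\<lambda>s. \<Psi> y s t) s) s t) (at s)" by simp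
  show "open {0::real<..}" by simp
 qed (use that \<Psi>(2) in auto)
 thus ?thesis unfolding bfun_def using bikernel_deriv1[OF covers_tube \<Psi>(1)] by blast
qed

lemma bfun_b_snd: assumes "F \<in> bfun N" shows "b_snd F \<in> bfun N"
proof -
 obtain \<Psi> where \<Psi>: "bikernel tube N \<Psi>" "\<And>s t. s > 0 ==> t > 0 ==> F s t = bint \<Psi> s t"
  using assms unfolding bfun_def by blast
 have "b_snd F s t = bint (\<lambda>y s t. t * deriv (\<Psi> y s) t) s t" if st: "s > 0" "t > 0" for s t
 proof -
  have "(F s has_vector_derivative (1 / t) *\<^sub>R bint (\<lambda>y s t. t * deriv (\<Psi> y s) t) s t) (at t)"
  proof (rule has_vector_derivative_transform_within_open)
   show "(bint \<Psi> s has_vector_derivative (1 / t) *\<^sub>R bint (\<lambda>y s t. t * deriv (\<Psi> y s) t) s t) (at t)"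
    by (rule bint_deriv2[OF covers_tube \<Psi>(1)]) (use st in auto)
   show "open {0::real<..}" by simp
  qed (use st \<Psi>(2) in auto)
  from vector_derivative_at[OF this] show ?thesis using st by (simp add: b_snd_def)
 qed
 thus ?thesis unfolding bfun_def using bikernel_deriv2[OF covers_tube \<Psi>(1)] by blast
qed

lemma bfun_bound:
 assumes "F \<in> bfun N" shows "\<exists>C. \<exists>\<delta>>0. \<forall>s\<in>{0<..A}. \<forall>t\<in>{0<..<\<delta>}. norm (F s t) \<le> C * t ^ N"
proof -
 obtain \<Psi> where \<Psi>: "bikernel tube N \<Psi>" "\<And>s t. s > 0 ==> t > 0 ==> F s t = bint \<Psi> s t"
  using assms unfolding bfun_def by blast
 have "(0, \<bar>A\<bar> + 1) \<in> tube" by (auto simp: tube_def)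
 from bint_bound[OF covers_tube \<Psi>(1) this] obtain C where C: "C \<ge> 0"
  "\<And>s t. s \<in> {0..<\<bar>A\<bar>+1} ==> t \<in> {0<..<\<bar>A\<bar>+1} ==> norm (bint \<Psi> s t) \<le> C * t ^ N" by blast
 show ?thesis
  by (rule exI[of _ C], rule exI[of _ "\<bar>A\<bar> + 1"]) (use C(2) \<Psi>(2) in auto)
qed

text \<open>
The coefficients with \<open>l > 0\<close> are taken to be zero. The \<open>N\<close>-th remainder in the sense of the definition is bounded
with all its derivatives because the integrals of kernels of order \<open>N\<close> form a class closed under both operators.
\<close>
lemma polyhomogeneousI_no_logs:
 fixes f :: "real => real => complex"
 assumes c: "\<And>k. smooth_on {0..} (c k)"
  and f: "\<And>N. \<exists>\<Psi>. bikernel tube N \<Psi> \<and> (\<forall>s>0. \<forall>t>0. f s t - (\<Sum>k\<le>N. c k s * of_real t ^ k) = bint \<Psi> s t)"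
 shows "polyhomogeneous index_E f"
proof -
 define c' :: "nat => nat => real => complex" where "c' k l = (if l = 0 then c k else (\<lambda>_. 0))" for k l
 have z: "smooth_on {0..} (\<lambda>_::real. 0 :: complex)"
  unfolding smooth_on_def by (rule exI[of _ "\<lambda>_ _. 0"]) auto
 have sum: "(\<Sum>(k, l)\<in>{(k, l)\<in>index_E. k \<le> N}. c' k l s * of_real (t ^ k * ln t ^ l)) = (\<Sum>k\<le>N. c k s * of_real t ^ k)" for N s t
 proof -
  have "(\<Sum>(k, l)\<in>{(k, l)\<in>index_E. k \<le> N}. c' k l s * of_real (t ^ k * ln t ^ l)) =
    (\<Sum>(k, l)\<in>(\<lambda>k. (k, 0)) ` {..N}. c' k l s * of_real (t ^ k * ln t ^ l))"
   by (rule sum.mono_neutral_right[OF finite_index_E]) (auto simp: index_E_def c'_def)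
  also have "\<dots> = (\<Sum>k\<le>N. c k s * of_real t ^ k)"
   by (subst sum.reindex) (auto simp: inj_on_def c'_def)
  finally show ?thesis .
 qed
 have "\<forall>(k, l)\<in>index_E. smooth_on {0..} (c' k l)" using c z by (auto simp: c'_def)
 moreover have "\<exists>C. \<exists>\<delta>>0. \<forall>s\<in>{0<..A}. \<forall>t\<in>{0<..<\<delta>}.
      norm ((d_fst ^^ i) ((b_snd ^^ j)
       (\<lambda>s t. f s t - (\<Sum>(k, l)\<in>{(k, l)\<in>index_E. k \<le> N}. c' k l s * of_real (t ^ k * ln t ^ l)))) s t)
       \<le> C * t ^ N" for N i j A
 proof (rule bfun_bound)
  have 0: "(\<lambda>s t. f s t - (\<Sum>k\<le>N. c k s * of_real t ^ k)) \<in> bfun N"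
   using f[of N] unfolding bfun_def by blast
  have 1: "(b_snd ^^ j) (\<lambda>s t. f s t - (\<Sum>k\<le>N. c k s * of_real t ^ k)) \<in> bfun N" for j
   by (induction j) (auto intro: 0 bfun_b_snd)
  have "(d_fst ^^ i) ((b_snd ^^ j) (\<lambda>s t. f s t - (\<Sum>k\<le>N. c k s * of_real t ^ k))) \<in> bfun N" for i
   by (induction i) (auto intro: 1 bfun_d_fst)
  thus "(d_fst ^^ i) ((b_snd ^^ j)
       (\<lambda>s t. f s t - (\<Sum>(k, l)\<in>{(k, l)\<in>index_E. k \<le> N}. c' k l s * of_real (t ^ k * ln t ^ l)))) \<in> bfun N"
   unfolding sum .
 qed
 ultimately show ?thesis unfolding polyhomogeneous_def by (intro exI[of _ c']) blast
qed

text \<open>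
A linear class of functions closed under partial derivatives consists of smooth functions: an iterated directional
derivative is again a member, chosen along the list of directions.
\<close>
lemma smooth_onI_partials:
 fixes F :: "real \<times> real => complex"
 assumes part: "\<And>F. F \<in> X ==> \<exists>F1\<in>X. \<exists>F2\<in>X. \<forall>p\<in>S. (F has_derivative (\<lambda>v. fst v *\<^sub>R F1 p + snd v *\<^sub>R F2 p)) (at p within S)"
  and lin: "\<And>F G a b. F \<in> X ==> G \<in> X ==> (\<lambda>p. (a::real) *\<^sub>R F p + (b::real) *\<^sub>R G p) \<in> X"
  and F: "F \<in> X"
 shows "smooth_on S F"
proof -
 have "\<forall>F\<in>X. \<exists>q. fst q \<in> X \<and> snd q \<in> X \<and> (\<forall>p\<in>S. (F has_derivative (\<lambda>v. fst v *\<^sub>R fst q p + snd v *\<^sub>R snd q p)) (at p within S))"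
 proof
  fix F assume "F \<in> X"
  from part[OF this] obtain F1 F2 where "F1 \<in> X" "F2 \<in> X"
   "\<forall>p\<in>S. (F has_derivative (\<lambda>v. fst v *\<^sub>R F1 p + snd v *\<^sub>R F2 p)) (at p within S)" by blast
  thus "\<exists>q. fst q \<in> X \<and> snd q \<in> X \<and> (\<forall>p\<in>S. (F has_derivative (\<lambda>v. fst v *\<^sub>R fst q p + snd v *\<^sub>R snd q p)) (at p within S))"
   by (intro exI[of _ "(F1, F2)"]) simp
 qed
 from bchoice[OF this] obtain q where q: "\<And>F. F \<in> X ==> fst (q F) \<in> X" "\<And>F. F \<in> X ==> snd (q F) \<in> X"
  "\<And>F p. F \<in> X ==> p \<in> S ==> (F has_derivative (\<lambda>v. fst v *\<^sub>R fst (q F) p + snd v *\<^sub>R snd (q F) p)) (at p within S)"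
  by blast
 define D where "D = rec_list F (\<lambda>(v::real\<times>real) vs G. (\<lambda>p. fst v *\<^sub>R fst (q G) p + snd v *\<^sub>R snd (q G) p))"
 have D0: "D [] = F" by (simp add: D_def)
 have DS: "D (v # vs) = (\<lambda>p. fst v *\<^sub>R fst (q (D vs)) p + snd v *\<^sub>R snd (q (D vs)) p)" for v vs
  by (simp add: D_def)
 have X: "D vs \<in> X" for vs
  by (induction vs) (auto simp: D0 DS intro!: F lin q)
 show ?thesis unfolding smooth_on_def
 proof (intro exI[of _ D] conjI ballI allI)
  fix vs p assume "p \<in> S"
  from q(3)[OF X[of vs] this] show "(D vs has_derivative (\<lambda>v. D (v # vs) p)) (at p within S)"
   unfolding DS .
 qed (simp add: D0)
qed

text \<open>
The two families of derivatives agree in the open quadrant, where derivatives are unique, and each of the two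
pieces is relatively open in the union.
\<close>
lemma smooth_on_union_quadrant:
 fixes g :: "real \<times> real => complex"
 assumes "smooth_on ({0..} \<times> {0<..}) g" "smooth_on ({0<..} \<times> {0..}) g"
 shows "smooth_on ({0..} \<times> {0<..} \<union> {0<..} \<times> {0..}) g"
proof -
 define S1 S2 Q where "S1 = {0::real..} \<times> {0::real<..}" and "S2 = {0::real<..} \<times> {0::real..}"
  and "Q = {0::real<..} \<times> {0::real<..}"
 obtain D1 where D1: "\<And>x. x \<in> S1 ==> D1 [] x = g x"
  "\<And>vs x. x \<in> S1 ==> (D1 vs has_derivative (\<lambda>v. D1 (v # vs) x)) (at x within S1)"
  using assms(1) unfolding smooth_on_def S1_def by blast
 obtain D2 where D2: "\<And>x. x \<in> S2 ==> D2 [] x = g x"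
  "\<And>vs x. x \<in> S2 ==> (D2 vs has_derivative (\<lambda>v. D2 (v # vs) x)) (at x within S2)"
  using assms(2) unfolding smooth_on_def S2_def by blast
 have Q: "open Q" "Q \<subseteq> S1" "Q \<subseteq> S2" "Q = S1 \<inter> S2" by (auto simp: Q_def S1_def S2_def intro!: open_Times)
 have eq: "D1 vs p = D2 vs p" if "p \<in> Q" for vs p
  using that
 proof (induction vs arbitrary: p)
  case Nil thus ?case using D1(1) D2(1) Q by auto
 next
  case (Cons v vs)
  have "(D1 vs has_derivative (\<lambda>v. D1 (v # vs) p)) (at p within Q)"
   using D1(2)[of p vs] Q Cons.prems by (auto intro: has_derivative_subset)
  hence 1: "(D1 vs has_derivative (\<lambda>v. D1 (v # vs) p)) (at p)" unfolding at_within_open[OF Cons.prems Q(1)] .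
  have "(D2 vs has_derivative (\<lambda>v. D2 (v # vs) p)) (at p within Q)"
   using D2(2)[of p vs] Q Cons.prems by (auto intro: has_derivative_subset)
  hence "(D2 vs has_derivative (\<lambda>v. D2 (v # vs) p)) (at p)" unfolding at_within_open[OF Cons.prems Q(1)] .
  hence "(D1 vs has_derivative (\<lambda>v. D2 (v # vs) p)) (at p)"
   by (rule has_derivative_transform_within_open[OF _ Q(1) Cons.prems]) (simp add: Cons.IH)
  from has_derivative_unique[OF 1 this] show ?case by (rule fun_cong)
 qed
 define D where "D vs p = (if snd p > 0 then D1 vs p else D2 vs p)" for vs p
 have D_S1: "D vs p = D1 vs p" if "p \<in> S1" for vs p using that by (auto simp: D_def S1_def)
 have D_S2: "D vs p = D2 vs p" if "p \<in> S2" for vs p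
  using that eq[of p vs] by (auto simp: D_def S2_def Q_def)
 have "smooth_on (S1 \<union> S2) g" unfolding smooth_on_def
 proof (intro exI[of _ D] conjI ballI allI)
  fix p assume "p \<in> S1 \<union> S2"
  thus "D [] p = g p" by (elim UnE) (simp_all add: D_S1 D_S2 D1(1) D2(1))
 next
  fix vs p assume p: "p \<in> S1 \<union> S2"
  show "(D vs has_derivative (\<lambda>v. D (v # vs) p)) (at p within S1 \<union> S2)"
  proof (cases "p \<in> S1")
   case True
   have "(D vs has_derivative (\<lambda>v. D1 (v # vs) p)) (at p within S1)"
    by (rule has_derivative_transform[OF True _ D1(2)[OF True]]) (simp add: D_S1)
   moreover have "at p within S1 = at p within (S1 \<union> S2)"
    by (rule at_within_nhd[of p "UNIV \<times> {0<..}"]) (use True in \<open>auto simp: S1_def S2_def intro!: open_Times\<close>)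
   ultimately show ?thesis using D_S1[OF True] by simp
  next
   case False
   hence p2: "p \<in> S2" using p by auto
   have "(D vs has_derivative (\<lambda>v. D2 (v # vs) p)) (at p within S2)"
    by (rule has_derivative_transform[OF p2 _ D2(2)[OF p2]]) (simp add: D_S2)
   moreover have "at p within S2 = at p within (S1 \<union> S2)"
    by (rule at_within_nhd[of p "{0<..} \<times> UNIV"]) (use p2 in \<open>auto simp: S1_def S2_def intro!: open_Times\<close>)
   ultimately show ?thesis using D_S2[OF p2] by simp
  qed
 qed
 thus ?thesis by (simp add: S1_def S2_def)
qed

lemma smooth_on_swap:
 fixes g :: "real \<times> real => complex"
 assumes "smooth_on (A \<times> B) g"
 shows "smooth_on (B \<times> A) (\<lambda>p. g (prod.swap p))"
proof -
 obtain D where D: "\<And>x. x \<in> A \<times> B ==> D [] x = g x"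
  "\<And>vs x. x \<in> A \<times> B ==> (D vs has_derivative (\<lambda>v. D (v # vs) x)) (at x within A \<times> B)"
  using assms unfolding smooth_on_def by blast
 have bl: "bounded_linear (prod.swap :: real \<times> real => real \<times> real)"
  unfolding prod.swap_def by (intro bounded_linear_Pair bounded_linear_fst bounded_linear_snd)
 show ?thesis unfolding smooth_on_def
 proof (intro exI[of _ "\<lambda>vs p. D (map prod.swap vs) (prod.swap p)"] conjI ballI allI)
  fix vs and p :: "real \<times> real" assume p: "p \<in> B \<times> A"
  hence p': "prod.swap p \<in> A \<times> B" by auto
  have im: "prod.swap ` (B \<times> A) = A \<times> B" by auto
  have "((D (map prod.swap vs)) \<circ> prod.swap has_derivative (\<lambda>v. D (v # map prod.swap vs) (prod.swap p)) \<circ> prod.swap) (at p within B \<times> A)"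
   by (rule diff_chain_within[OF bounded_linear_imp_has_derivative[OF bl]]) (use D(2)[OF p'] in \<open>simp only: im\<close>)
  thus "((\<lambda>p. D (map prod.swap vs) (prod.swap p)) has_derivative (\<lambda>v. D (map prod.swap (v # vs)) (prod.swap p))) (at p within B \<times> A)"
   by (simp add: o_def)
 qed (use D(1) in auto)
qed

lemma smooth_on_analytic:
 assumes "g analytic_on (of_real ` {0::real..})"
 shows "smooth_on {0..} (\<lambda>s::real. g (of_real s) :: complex)"
proof -
 obtain T where T: "open T" "of_real ` {0::real..} \<subseteq> T" "g holomorphic_on T"
  using assms unfolding analytic_on_holomorphic by blast
 show ?thesis unfolding smooth_on_def
 proof (intro exI[of _ "\<lambda>vs s. prod_list vs *\<^sub>R (deriv ^^ length vs) g (of_real s)"] conjI ballI allI)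
  fix vs :: "real list" and s :: real assume s: "s \<in> {0..}"
  have "((\<lambda>s. (deriv ^^ length vs) g (of_real s)) has_vector_derivative (deriv ^^ Suc (length vs)) g (of_real s)) (at s within {0..})"
   by (rule has_vector_derivative_real_field[OF has_field_derivative_higher_deriv[OF T(3,1)]]) (use T(2) s in auto)
  hence "((\<lambda>s. prod_list vs *\<^sub>R (deriv ^^ length vs) g (of_real s)) has_derivative
    (\<lambda>v. prod_list vs *\<^sub>R (v *\<^sub>R (deriv ^^ Suc (length vs)) g (of_real s)))) (at s within {0..})"
   unfolding has_vector_derivative_def by (rule has_derivative_scaleR_right)
  moreover have "(\<lambda>v. prod_list vs *\<^sub>R (v *\<^sub>R (deriv ^^ Suc (length vs)) g (of_real s))) =
    (\<lambda>v. prod_list (v # vs) *\<^sub>R (deriv ^^ length (v # vs)) g (of_real s))"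
   by (rule ext) (simp add: mult.commute)
  ultimately show "((\<lambda>s. prod_list vs *\<^sub>R (deriv ^^ length vs) g (of_real s)) has_derivative
    (\<lambda>v. prod_list (v # vs) *\<^sub>R (deriv ^^ length (v # vs)) g (of_real s))) (at s within {0..})" by simp
 qed simp
qed

text \<open>
The ranges for smoothness away from \<open>t = 0\<close>, where powers of \<open>t\<close> do not matter.
\<close>
definition slots :: "(real \<times> real) set" where "slots = {(a, A). 0 < a}"

lemma covers_slots: "covers slots"
proof -
 have "\<exists>a A. a > 0 \<and> s < A \<and> a < t \<and> t < A" if "t > 0" for s t :: real
  by (rule exI[of _ "t/2"], rule exI[of _ "max s t + 1"]) (use that in auto)
 thus ?thesis by (force simp: covers_def slots_def)
qed

lemma onorm_scaleR_le:
 assumes "norm c \<le> L" shows "onorm (\<lambda>h::real. h *\<^sub>R c) \<le> L"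
proof (rule onorm_bound)
 show "0 \<le> L" using assms norm_ge_zero order_trans by blast
 show "norm (h *\<^sub>R c) \<le> L * norm h" for h
  using mult_right_mono[OF assms, of "\<bar>h\<bar>"] by (simp add: mult.commute)
qed

lemma bint_continuous:
 assumes J: "covers J" and \<Psi>: "bikernel J N \<Psi>" and s: "s \<ge> 0" and t: "t > 0"
 shows "continuous (at (s, t) within {0..} \<times> {0<..}) (\<lambda>(s, t). bint \<Psi> s t)"
proof -
 obtain a A where aA: "(a, A) \<in> J" "s < A" "a < t" "t < A" using J s t unfolding covers_def by blast
 have a: "a \<ge> 0" using covers_nonneg[OF J aA(1)] .
 define b where "b = max a (t/2)"
 have b: "b > 0" "b \<ge> a" "b < t" using t a aA by (auto simp: b_def)
 have A: "A > 0" using aA t by simp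
 obtain C1 where C1: "C1 \<ge> 0" "\<And>s t. s \<in> {0..<A} ==> t \<in> {a<..<A} ==> norm (bint (\<lambda>y s t. deriv (\<lambda>s. \<Psi> y s t) s) s t) \<le> C1 * t ^ N"
  using bint_bound[OF J bikernel_deriv1[OF J \<Psi>] aA(1)] by blast
 obtain C2 where C2: "C2 \<ge> 0" "\<And>s t. s \<in> {0..<A} ==> t \<in> {a<..<A} ==> norm (bint (\<lambda>y s t. t * deriv (\<Psi> y s) t) s t) \<le> C2 * t ^ N"
  using bint_bound[OF J bikernel_deriv2[OF J \<Psi>] aA(1)] by blast
 define L1 L2 where "L1 = C1 * A ^ N" and "L2 = C2 * A ^ N / b"
 have L1: "norm (bint \<Psi> s' t' - bint \<Psi> s t') \<le> L1 * norm (s' - s)" if "s' \<in> {0..<A}" "t' \<in> {b<..<A}" for s' t'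
 proof (rule differentiable_bound[where S = "{0..<A}" and f = "\<lambda>s. bint \<Psi> s t'"])
  fix x assume x: "x \<in> {0..<A}"
  show "((\<lambda>s. bint \<Psi> s t') has_derivative (\<lambda>h. h *\<^sub>R bint (\<lambda>y s t. deriv (\<lambda>s. \<Psi> y s t) s) x t')) (at x within {0..<A})"
   using bint_deriv1[OF J \<Psi>, of x t'] x that b unfolding has_vector_derivative_def
   by (auto elim: has_derivative_subset)
  have "norm (bint (\<lambda>y s t. deriv (\<lambda>s. \<Psi> y s t) s) x t') \<le> C1 * t' ^ N" using C1(2)[OF x, of t'] that b by auto
  also have "\<dots> \<le> L1" unfolding L1_def using C1 that b by (intro mult_left_mono power_mono) auto
  finally show "onorm (\<lambda>h. h *\<^sub>R bint (\<lambda>y s t. deriv (\<lambda>s. \<Psi> y s t) s) x t') \<le> L1"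
   by (rule onorm_scaleR_le)
 qed (use that aA s in auto)
 have L2: "norm (bint \<Psi> s t' - bint \<Psi> s t) \<le> L2 * norm (t' - t)" if "t' \<in> {b<..<A}" for t'
 proof (rule differentiable_bound[where S = "{b<..<A}" and f = "\<lambda>t. bint \<Psi> s t"])
  fix x assume x: "x \<in> {b<..<A}"
  show "(bint \<Psi> s has_derivative (\<lambda>h. h *\<^sub>R ((1/x) *\<^sub>R bint (\<lambda>y s t. t * deriv (\<Psi> y s) t) s x))) (at x within {b<..<A})"
   using bint_deriv2[OF J \<Psi> s, of x] x b unfolding has_vector_derivative_def
   by (auto intro: has_derivative_at_withinI)
  have "norm ((1/x) *\<^sub>R bint (\<lambda>y s t. t * deriv (\<Psi> y s) t) s x) = norm (bint (\<lambda>y s t. t * deriv (\<Psi> y s) t) s x) / x"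
   using x b by simp
  also have "\<dots> \<le> (C2 * x ^ N) / x" using C2(2)[of s x] x b s aA by (intro divide_right_mono) auto
  also have "\<dots> \<le> (C2 * A ^ N) / b" using x b C2 A by (intro frac_le mult_left_mono power_mono) auto
  finally show "onorm (\<lambda>h. h *\<^sub>R ((1/x) *\<^sub>R bint (\<lambda>y s t. t * deriv (\<Psi> y s) t) s x)) \<le> L2" unfolding L2_def
   by (rule onorm_scaleR_le)
 qed (use that b aA in auto)
 have "((\<lambda>p. bint \<Psi> (fst p) (snd p) - bint \<Psi> s t) \<longlongrightarrow> 0) (at (s, t) within {0..} \<times> {0<..})"
 proof (rule Lim_null_comparison)
  have "((\<lambda>p. L1 * norm (fst p - s) + L2 * norm (snd p - t)) \<longlongrightarrow> L1 * norm (fst (s, t) - s) + L2 * norm (snd (s, t) - t)) (at (s, t) within {0..} \<times> {0<..})"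
   by (intro tendsto_intros)
  thus "((\<lambda>p. L1 * norm (fst p - s) + L2 * norm (snd p - t)) \<longlongrightarrow> 0) (at (s, t) within {0..} \<times> {0<..})" by simp
  have "\<forall>\<^sub>F p in at (s, t) within {0..} \<times> {0<..}. p \<in> ({..<A} \<times> {b<..<A}) \<inter> ({0..} \<times> {0<..})"
   unfolding eventually_at_topological
   by (rule exI[of _ "{..<A} \<times> {b<..<A}"]) (use aA b in \<open>auto intro!: open_Times\<close>)
  thus "\<forall>\<^sub>F p in at (s, t) within {0..} \<times> {0<..}. norm (bint \<Psi> (fst p) (snd p) - bint \<Psi> s t) \<le> L1 * norm (fst p - s) + L2 * norm (snd p - t)"
  proof eventually_elim
   case (elim p)
   have "bint \<Psi> (fst p) (snd p) - bint \<Psi> s t = (bint \<Psi> (fst p) (snd p) - bint \<Psi> s (snd p)) + (bint \<Psi> s (snd p) - bint \<Psi> s t)"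
    by simp
   thus ?case using norm_triangle_le[OF add_mono[OF L1[of "fst p" "snd p"] L2[of "snd p"]]] elim by auto
  qed
 qed
 from Lim_null[THEN iffD2, OF this] show ?thesis
  by (simp add: continuous_within case_prod_unfold)
qed

lemma bikernel_linear:
 assumes J: "covers J" and \<Psi>: "bikernel J N \<Psi>" and \<Phi>: "bikernel J N \<Phi>"
 shows "bikernel J N (\<lambda>y s t. a * \<Psi> y s t + b * \<Phi> y s t)"
proof (rule bikernelI)
 fix a' A assume aA: "(a', A) \<in> J"
 have a': "a' \<ge> 0" using covers_nonneg[OF J aA] .
 obtain r d C where r: "0 < r" "r \<le> 1/2" "0 < d"
  and m: "\<And>s0 t0. s0 \<in> {0..<A} ==> t0 \<in> {a'<..<A} ==> (\<lambda>y. \<Psi> y (of_real s0) (of_real t0)) \<in> borel_measurable borel"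
  and h: "\<And>y s0 t0. s0 \<in> {0..<A} ==> t0 \<in> {a'<..<A} ==>
   sep_holomorphic (\<Psi> y) (ball (of_real s0) (rad r y)) (ball (of_real t0) (rad r y * t0))"
  and b: "\<And>y s0 t0 s t. s0 \<in> {0..<A} ==> t0 \<in> {a'<..<A} ==> s \<in> ball (of_real s0) (rad r y) ==>
    t \<in> ball (of_real t0) (rad r y * t0) ==> norm (\<Psi> y s t) \<le> C * t0 ^ N * exp (- d * \<bar>y\<bar>)"
  using bikernelE[OF \<Psi> aA] by blast
 obtain r' d' C' where r': "0 < r'" "r' \<le> 1/2" "0 < d'"
  and m': "\<And>s0 t0. s0 \<in> {0..<A} ==> t0 \<in> {a'<..<A} ==> (\<lambda>y. \<Phi> y (of_real s0) (of_real t0)) \<in> borel_measurable borel"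
  and h': "\<And>y s0 t0. s0 \<in> {0..<A} ==> t0 \<in> {a'<..<A} ==>
   sep_holomorphic (\<Phi> y) (ball (of_real s0) (rad r' y)) (ball (of_real t0) (rad r' y * t0))"
  and b': "\<And>y s0 t0 s t. s0 \<in> {0..<A} ==> t0 \<in> {a'<..<A} ==> s \<in> ball (of_real s0) (rad r' y) ==>
    t \<in> ball (of_real t0) (rad r' y * t0) ==> norm (\<Phi> y s t) \<le> C' * t0 ^ N * exp (- d' * \<bar>y\<bar>)"
  using bikernelE[OF \<Phi> aA] by blast
 define R where "R = min r r'"
 have R: "rad R y \<le> rad r y" "rad R y \<le> rad r' y" for y by (auto intro!: rad_mono simp: R_def)
 define e where "e = min d d'"
 show "\<exists>r C d. 0 < r \<and> r \<le> 1/2 \<and> 0 < d \<and>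
   (\<forall>y. \<forall>s0\<in>{0..<A}. \<forall>t0\<in>{a'<..<A}.
    (\<lambda>y. a * \<Psi> y (of_real s0) (of_real t0) + b * \<Phi> y (of_real s0) (of_real t0)) \<in> borel_measurable borel \<and>
    sep_holomorphic (\<lambda>s t. a * \<Psi> y s t + b * \<Phi> y s t) (ball (of_real s0) (rad r y)) (ball (of_real t0) (rad r y * t0)) \<and>
    (\<forall>s\<in>ball (of_real s0) (rad r y). \<forall>t\<in>ball (of_real t0) (rad r y * t0).
      norm (a * \<Psi> y s t + b * \<Phi> y s t) \<le> C * t0 ^ N * exp (- d * \<bar>y\<bar>)))"
 proof (rule exI[of _ R], rule exI[of _ "norm a * \<bar>C\<bar> + norm b * \<bar>C'\<bar>"], rule exI[of _ e], intro conjI allI ballI)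
  fix y s0 t0 assume s0: "s0 \<in> {0..<A}" and t0: "t0 \<in> {a'<..<A}"
  have t0p: "t0 > 0" using a' t0 by auto
  show "(\<lambda>y. a * \<Psi> y (of_real s0) (of_real t0) + b * \<Phi> y (of_real s0) (of_real t0)) \<in> borel_measurable borel"
   by (intro borel_measurable_add borel_measurable_times borel_measurable_const m m' s0 t0)
  have sub: "ball (complex_of_real s0) (rad R y) \<subseteq> ball (of_real s0) (rad r y)"
   "ball (complex_of_real t0) (rad R y * t0) \<subseteq> ball (of_real t0) (rad r y * t0)"
   "ball (complex_of_real s0) (rad R y) \<subseteq> ball (of_real s0) (rad r' y)"
   "ball (complex_of_real t0) (rad R y * t0) \<subseteq> ball (of_real t0) (rad r' y * t0)"
   using R t0p by (auto intro!: subset_ball mult_right_mono)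
  have H: "sep_holomorphic (\<Psi> y) (ball (of_real s0) (rad R y)) (ball (of_real t0) (rad R y * t0))"
   "sep_holomorphic (\<Phi> y) (ball (of_real s0) (rad R y)) (ball (of_real t0) (rad R y * t0))"
   using sep_holomorphic_subset[OF h[OF s0 t0] sub(1,2)] sep_holomorphic_subset[OF h'[OF s0 t0] sub(3,4)] by auto
  show "sep_holomorphic (\<lambda>s t. a * \<Psi> y s t + b * \<Phi> y s t) (ball (of_real s0) (rad R y)) (ball (of_real t0) (rad R y * t0))"
   using H unfolding sep_holomorphic_def by (auto intro!: holomorphic_on_add holomorphic_on_mult)
  fix s t assume s: "s \<in> ball (complex_of_real s0) (rad R y)" and t: "t \<in> ball (complex_of_real t0) (rad R y * t0)"
  have 1: "norm (\<Psi> y s t) \<le> C * t0 ^ N * exp (- d * \<bar>y\<bar>)" using b[OF s0 t0] s t sub by blast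
  have 2: "norm (\<Phi> y s t) \<le> C' * t0 ^ N * exp (- d' * \<bar>y\<bar>)" using b'[OF s0 t0] s t sub by blast
  have "C * t0 ^ N * exp (- d * \<bar>y\<bar>) \<le> \<bar>C\<bar> * t0 ^ N * exp (- e * \<bar>y\<bar>)"
   using t0p by (intro mult_mono mult_nonneg_nonneg) (auto simp: e_def intro: mult_right_mono)
  note 1 = order_trans[OF 1 this]
  have "C' * t0 ^ N * exp (- d' * \<bar>y\<bar>) \<le> \<bar>C'\<bar> * t0 ^ N * exp (- e * \<bar>y\<bar>)"
   using t0p by (intro mult_mono mult_nonneg_nonneg) (auto simp: e_def intro: mult_right_mono)
  note 2 = order_trans[OF 2 this]
  have "norm (a * \<Psi> y s t + b * \<Phi> y s t) \<le> norm a * norm (\<Psi> y s t) + norm b * norm (\<Phi> y s t)"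
   by (metis norm_mult norm_triangle_ineq)
  also have "\<dots> \<le> norm a * (\<bar>C\<bar> * t0 ^ N * exp (- e * \<bar>y\<bar>)) + norm b * (\<bar>C'\<bar> * t0 ^ N * exp (- e * \<bar>y\<bar>))"
   by (intro add_mono mult_left_mono 1 2) auto
  finally show "norm (a * \<Psi> y s t + b * \<Phi> y s t) \<le> (norm a * \<bar>C\<bar> + norm b * \<bar>C'\<bar>) * t0 ^ N * exp (- e * \<bar>y\<bar>)"
   by (simp add: algebra_simps)
 qed (use r r' in \<open>auto simp: R_def e_def\<close>)
qed

text \<open>
Turns \<open>t \<partial>\<^sub>t\<close> into \<open>\<partial>\<^sub>t\<close>.
\<close>
lemma bikernel_divide:
 assumes \<Psi>: "bikernel slots 0 \<Psi>"
 shows "bikernel slots 0 (\<lambda>y s t. \<Psi> y s t / t)"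
proof (rule bikernelI)
 fix a A assume aA: "(a, A) \<in> slots"
 have a: "a > 0" using aA by (auto simp: slots_def)
 obtain r d C where r: "0 < r" "r \<le> 1/2" "0 < d"
  and m: "\<And>s0 t0. s0 \<in> {0..<A} ==> t0 \<in> {a<..<A} ==> (\<lambda>y. \<Psi> y (of_real s0) (of_real t0)) \<in> borel_measurable borel"
  and h: "\<And>y s0 t0. s0 \<in> {0..<A} ==> t0 \<in> {a<..<A} ==>
   sep_holomorphic (\<Psi> y) (ball (of_real s0) (rad r y)) (ball (of_real t0) (rad r y * t0))"
  and b: "\<And>y s0 t0 s t. s0 \<in> {0..<A} ==> t0 \<in> {a<..<A} ==> s \<in> ball (of_real s0) (rad r y) ==>
    t \<in> ball (of_real t0) (rad r y * t0) ==> norm (\<Psi> y s t) \<le> C * t0 ^ 0 * exp (- d * \<bar>y\<bar>)"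
  using bikernelE[OF \<Psi> aA] by blast
 show "\<exists>r C d. 0 < r \<and> r \<le> 1/2 \<and> 0 < d \<and>
   (\<forall>y. \<forall>s0\<in>{0..<A}. \<forall>t0\<in>{a<..<A}.
    (\<lambda>y. \<Psi> y (of_real s0) (of_real t0) / of_real t0) \<in> borel_measurable borel \<and>
    sep_holomorphic (\<lambda>s t. \<Psi> y s t / t) (ball (of_real s0) (rad r y)) (ball (of_real t0) (rad r y * t0)) \<and>
    (\<forall>s\<in>ball (of_real s0) (rad r y). \<forall>t\<in>ball (of_real t0) (rad r y * t0).
      norm (\<Psi> y s t / t) \<le> C * t0 ^ 0 * exp (- d * \<bar>y\<bar>)))"
 proof (rule exI[of _ r], rule exI[of _ "\<bar>C\<bar> / (a / 2)"], rule exI[of _ d], intro conjI allI ballI)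
  fix y s0 t0 assume s0: "s0 \<in> {0..<A}" and t0: "t0 \<in> {a<..<A}"
  have nt: "norm t \<ge> a / 2" if "t \<in> ball (complex_of_real t0) (rad r y * t0)" for t
  proof -
   have "norm (of_real t0 :: complex) \<le> norm t + norm (of_real t0 - t)" by (rule norm_triangle_sub)
   also have "\<dots> \<le> norm t + rad r y * t0" using that by (simp add: dist_norm)
   also have "\<dots> \<le> norm t + 1/2 * t0" using rad_le[OF r(1), of y] r t0 a by (intro add_left_mono mult_right_mono) auto
   finally show ?thesis using t0 a by simp
  qed
  have nz: "t \<noteq> 0" if "t \<in> ball (complex_of_real t0) (rad r y * t0)" for t using nt[OF that] a by auto
  show "(\<lambda>y. \<Psi> y (of_real s0) (of_real t0) / of_real t0) \<in> borel_measurable borel"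
   by (intro borel_measurable_divide borel_measurable_const m s0 t0)
  show "sep_holomorphic (\<lambda>s t. \<Psi> y s t / t) (ball (of_real s0) (rad r y)) (ball (of_real t0) (rad r y * t0))"
   unfolding sep_holomorphic_def
  proof (intro conjI ballI)
   fix t assume t: "t \<in> ball (complex_of_real t0) (rad r y * t0)"
   show "(\<lambda>s. \<Psi> y s t / t) holomorphic_on ball (of_real s0) (rad r y)"
    using h[OF s0 t0, of y] nz[OF t] t unfolding sep_holomorphic_def
    by (intro holomorphic_on_divide holomorphic_on_const) blast+
  next
   fix s assume s: "s \<in> ball (complex_of_real s0) (rad r y)"
   show "(\<lambda>t. \<Psi> y s t / t) holomorphic_on ball (of_real t0) (rad r y * t0)"
    using h[OF s0 t0, of y] nz s unfolding sep_holomorphic_def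
    by (intro holomorphic_on_divide holomorphic_on_ident) blast+
  qed
  fix s t assume s: "s \<in> ball (complex_of_real s0) (rad r y)" and t: "t \<in> ball (complex_of_real t0) (rad r y * t0)"
  have "norm (\<Psi> y s t) \<le> \<bar>C\<bar> * exp (- d * \<bar>y\<bar>)"
   using b[OF s0 t0 s t] by (rule order_trans) (auto intro!: mult_right_mono)
  hence "norm (\<Psi> y s t / t) \<le> (\<bar>C\<bar> * exp (- d * \<bar>y\<bar>)) / (a/2)"
   unfolding norm_divide using nt[OF t] a by (intro frac_le) auto
  thus "norm (\<Psi> y s t / t) \<le> \<bar>C\<bar> / (a/2) * t0 ^ 0 * exp (- d * \<bar>y\<bar>)" by (simp add: mult_ac)
 qed (use r in auto)
qed

lemma bint_smooth:
 assumes \<Psi>: "bikernel slots 0 \<Psi>"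
 shows "smooth_on ({0..} \<times> {0<..}) (\<lambda>(s, t). bint \<Psi> s t)"
proof (rule smooth_onI_partials[where X = "{F. \<exists>\<Psi>. bikernel slots 0 \<Psi> \<and> (\<forall>s\<ge>0. \<forall>t>0. F (s, t) = bint \<Psi> s t)}"])
 show "(\<lambda>(s, t). bint \<Psi> s t) \<in> {F. \<exists>\<Psi>. bikernel slots 0 \<Psi> \<and> (\<forall>s\<ge>0. \<forall>t>0. F (s, t) = bint \<Psi> s t)}"
  using \<Psi> by auto
next
 fix F G :: "real \<times> real => complex" and a b :: real
 assume "F \<in> {F. \<exists>\<Psi>. bikernel slots 0 \<Psi> \<and> (\<forall>s\<ge>0. \<forall>t>0. F (s, t) = bint \<Psi> s t)}"
  "G \<in> {F. \<exists>\<Psi>. bikernel slots 0 \<Psi> \<and> (\<forall>s\<ge>0. \<forall>t>0. F (s, t) = bint \<Psi> s t)}"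
 then obtain \<Phi> \<Xi> where \<Phi>: "bikernel slots 0 \<Phi>" "\<And>s t. s \<ge> 0 ==> t > 0 ==> F (s, t) = bint \<Phi> s t"
  and \<Xi>: "bikernel slots 0 \<Xi>" "\<And>s t. s \<ge> 0 ==> t > 0 ==> G (s, t) = bint \<Xi> s t" by blast
 have "a *\<^sub>R F (s, t) + b *\<^sub>R G (s, t) = bint (\<lambda>y s t. of_real a * \<Phi> y s t + of_real b * \<Xi> y s t) s t" if st: "s \<ge> 0" "t > 0" for s t
 proof -
  obtain a' A where aA: "(a', A) \<in> slots" "s < A" "a' < t" "t < A" using covers_slots st unfolding covers_def by blast
  have "integrable lborel (\<lambda>y. \<Phi> y (of_real s) (of_real t))"
   by (rule bikernel_real[OF covers_slots \<Phi>(1) aA(1)]) (use aA st in auto)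
  moreover have "integrable lborel (\<lambda>y. \<Xi> y (of_real s) (of_real t))"
   by (rule bikernel_real[OF covers_slots \<Xi>(1) aA(1)]) (use aA st in auto)
  ultimately show ?thesis using \<Phi>(2)[OF st] \<Xi>(2)[OF st] unfolding bint_def
   by (simp add: Bochner_Integration.integral_add scaleR_conv_of_real)
 qed
 thus "(\<lambda>p. a *\<^sub>R F p + b *\<^sub>R G p) \<in> {F. \<exists>\<Psi>. bikernel slots 0 \<Psi> \<and> (\<forall>s\<ge>0. \<forall>t>0. F (s, t) = bint \<Psi> s t)}"
  using bikernel_linear[OF covers_slots \<Phi>(1) \<Xi>(1)] by blast
next
 fix F :: "real \<times> real => complex"
 assume "F \<in> {F. \<exists>\<Psi>. bikernel slots 0 \<Psi> \<and> (\<forall>s\<ge>0. \<forall>t>0. F (s, t) = bint \<Psi> s t)}"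
 then obtain \<Phi> where \<Phi>: "bikernel slots 0 \<Phi>" "\<And>s t. s \<ge> 0 ==> t > 0 ==> F (s, t) = bint \<Phi> s t" by blast
 define \<Phi>1 where "\<Phi>1 = (\<lambda>y s t. deriv (\<lambda>s. \<Phi> y s t) s)"
 define \<Phi>2 where "\<Phi>2 = (\<lambda>y s t. (t * deriv (\<Phi> y s) t) / t)"
 have 1: "bikernel slots 0 \<Phi>1" unfolding \<Phi>1_def by (rule bikernel_deriv1[OF covers_slots \<Phi>(1)])
 have 2: "bikernel slots 0 \<Phi>2" unfolding \<Phi>2_def by (rule bikernel_divide[OF bikernel_deriv2[OF covers_slots \<Phi>(1)]])
 have \<Phi>2: "bint \<Phi>2 s t = (1 / t) *\<^sub>R bint (\<lambda>y s t. t * deriv (\<Phi> y s) t) s t" if "t > 0" for s t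
  using that by (simp add: bint_def \<Phi>2_def scaleR_conv_of_real)
 have der: "(F has_derivative (\<lambda>v. fst v *\<^sub>R bint \<Phi>1 (fst p) (snd p) + snd v *\<^sub>R bint \<Phi>2 (fst p) (snd p))) (at p within {0..} \<times> {0<..})"
  if p: "p \<in> {0..} \<times> {0<..}" for p
 proof -
  obtain s t where st: "p = (s, t)" "s \<ge> 0" "t > 0" using p by auto
  have "((\<lambda>(s, t). bint \<Phi> s t) has_derivative (\<lambda>(tx, ty). tx *\<^sub>R bint \<Phi>1 s t + blinfun_apply (blinfun_scaleR_left (bint \<Phi>2 s t)) ty)) (at (s, t) within {0..} \<times> {0<..})"
  proof (rule has_derivative_partialsI)
   show "((\<lambda>s. bint \<Phi> s t) has_derivative (\<lambda>h. h *\<^sub>R bint \<Phi>1 s t)) (at s within {0..})"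
    using bint_deriv1[OF covers_slots \<Phi>(1) st(2,3)] by (simp add: has_vector_derivative_def \<Phi>1_def)
   show "(bint \<Phi> x has_derivative blinfun_apply (blinfun_scaleR_left (bint \<Phi>2 x y))) (at y within {0<..})"
    if "x \<in> {0..}" "y \<in> {0<..}" for x y
    using bint_deriv2[OF covers_slots \<Phi>(1), of x y] that
    by (auto simp: has_vector_derivative_def \<Phi>2 intro: has_derivative_at_withinI)
   have "continuous (at (s, t) within {0..} \<times> {0<..}) (\<lambda>p. blinfun_scaleR_left ((\<lambda>(s, t). bint \<Phi>2 s t) p))"
    by (rule bounded_linear.continuous[OF bounded_linear_blinfun_scaleR_left bint_continuous[OF covers_slots 2 st(2,3)]])
   thus "continuous (at (s, t) within {0..} \<times> {0<..}) (\<lambda>(x, y). blinfun_scaleR_left (bint \<Phi>2 x y))"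
    by (simp add: case_prod_unfold)
  qed (use st in auto)
  hence "((\<lambda>(s, t). bint \<Phi> s t) has_derivative (\<lambda>v. fst v *\<^sub>R bint \<Phi>1 (fst p) (snd p) + snd v *\<^sub>R bint \<Phi>2 (fst p) (snd p))) (at p within {0..} \<times> {0<..})"
   by (simp add: st case_prod_unfold)
  thus ?thesis by (rule has_derivative_transform[OF p, rotated]) (use \<Phi>(2) in auto)
 qed
 show "\<exists>F1\<in>{F. \<exists>\<Psi>. bikernel slots 0 \<Psi> \<and> (\<forall>s\<ge>0. \<forall>t>0. F (s, t) = bint \<Psi> s t)}.
    \<exists>F2\<in>{F. \<exists>\<Psi>. bikernel slots 0 \<Psi> \<and> (\<forall>s\<ge>0. \<forall>t>0. F (s, t) = bint \<Psi> s t)}.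
    \<forall>p\<in>{0..} \<times> {0<..}. (F has_derivative (\<lambda>v. fst v *\<^sub>R F1 p + snd v *\<^sub>R F2 p)) (at p within {0..} \<times> {0<..})"
  by (rule bexI[of _ "\<lambda>p. bint \<Phi>1 (fst p) (snd p)"], rule bexI[of _ "\<lambda>p. bint \<Phi>2 (fst p) (snd p)"])
   (use der 1 2 in auto)
qed

section \<open>Kernels on the front face and the charts of the resolved space\<close>

definition sector :: "real => complex set" where "sector k = {z. \<bar>Im z\<bar> < k * Re z}"

definition nbh :: "real => real => complex set" where
 "nbh c y = {m. \<exists>m0\<in>{0..1::real}. norm (m - of_real m0) < rad c y}"

lemma sector_mono: "k \<le> k' ==> 0 < k ==> sector k \<subseteq> sector k'"
proof
 fix z assume k: "k \<le> k'" "0 < k" and z: "z \<in> sector k"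
 have "k * Re z > 0" using z abs_ge_zero[of "Im z"] by (auto simp: sector_def)
 hence "Re z > 0" using k by (simp add: zero_less_mult_iff)
 hence "k * Re z \<le> k' * Re z" using k by simp
 thus "z \<in> sector k'" using z by (auto simp: sector_def)
qed

lemma sector_Re_pos: assumes "z \<in> sector k" "0 < k" shows "0 < Re z"
proof -
 have "0 < k * Re z" using assms(1) abs_ge_zero[of "Im z"] by (simp add: sector_def)
 thus ?thesis using assms(2) by (simp add: zero_less_mult_iff)
qed

lemma nbh_mono: "c \<le> c' ==> nbh c y \<subseteq> nbh c' y"
 unfolding nbh_def using rad_mono[of c c' y] by force

lemma of_real_in_sector: "0 < l ==> 0 < k ==> of_real l \<in> sector k" by (auto simp: sector_def)

lemma of_real_in_nbh: "m \<in> {0..1} ==> 0 < c ==> of_real m \<in> nbh c y"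
 using rad_pos[of c y] by (force simp: nbh_def)

text \<open>
Holomorphy is required along holomorphic curves \<open>(f, g)\<close> in the parameter domain. This is what the substitution of a
chart needs, and it is easier to verify than joint holomorphy in two variables.
\<close>
definition kernel :: "nat => (real => complex => complex => complex) => bool" where
 "kernel N \<Psi> \<longleftrightarrow> (\<exists>c>0. \<exists>k>0.
   (\<forall>y U f g. open U --> f holomorphic_on U --> g holomorphic_on U --> f ` U \<subseteq> sector k --> g ` U \<subseteq> nbh c y -->
    (\<lambda>z. \<Psi> y (f z) (g z)) holomorphic_on U) \<and>
   (\<forall>l>0. \<forall>m\<in>{0..1}. (\<lambda>y. \<Psi> y (of_real l) (of_real m)) \<in> borel_measurable borel) \<and>
   (\<forall>B>0. \<exists>C. \<exists>d>0. \<forall>y. \<forall>l\<in>sector k. \<forall>m\<in>nbh c y. norm l \<le> B -->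
    norm (\<Psi> y l m) \<le> C * norm l ^ N * exp (- d * \<bar>y\<bar>)))"

lemma kernelI:
 assumes "0 < c" "0 < k"
  "\<And>y U f g. open U ==> f holomorphic_on U ==> g holomorphic_on U ==> f ` U \<subseteq> sector k ==> g ` U \<subseteq> nbh c y ==>
    (\<lambda>z. \<Psi> y (f z) (g z)) holomorphic_on U"
  "\<And>l m. l > 0 ==> m \<in> {0..1} ==> (\<lambda>y. \<Psi> y (of_real l) (of_real m)) \<in> borel_measurable borel"
  "\<And>B. B > 0 ==> \<exists>C. \<exists>d>0. \<forall>y. \<forall>l\<in>sector k. \<forall>m\<in>nbh c y. norm l \<le> B -->
    norm (\<Psi> y l m) \<le> C * norm l ^ N * exp (- d * \<bar>y\<bar>)"
 shows "kernel N \<Psi>"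
 using assms unfolding kernel_def by (intro exI[of _ c] conjI exI[of _ k]) auto

lemma kernelE:
 assumes "kernel N \<Psi>"
 obtains c k where "0 < c" "0 < k"
  "\<And>y U f g. open U ==> f holomorphic_on U ==> g holomorphic_on U ==> f ` U \<subseteq> sector k ==> g ` U \<subseteq> nbh c y ==>
    (\<lambda>z. \<Psi> y (f z) (g z)) holomorphic_on U"
  "\<And>l m. l > 0 ==> m \<in> {0..1} ==> (\<lambda>y. \<Psi> y (of_real l) (of_real m)) \<in> borel_measurable borel"
  "\<And>B. B > 0 ==> \<exists>C. \<exists>d>0. \<forall>y. \<forall>l\<in>sector k. \<forall>m\<in>nbh c y. norm l \<le> B -->
    norm (\<Psi> y l m) \<le> C * norm l ^ N * exp (- d * \<bar>y\<bar>)"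
 using assms unfolding kernel_def by (elim exE conjE) blast

lemma kernel_add:
 assumes "kernel N \<Psi>" "kernel N \<Phi>"
 shows "kernel N (\<lambda>y l m. \<Psi> y l m + \<Phi> y l m)"
proof -
 obtain c k where c: "0 < c" "0 < k"
  and h: "\<And>y U f g. open U ==> f holomorphic_on U ==> g holomorphic_on U ==> f ` U \<subseteq> sector k ==> g ` U \<subseteq> nbh c y ==>
    (\<lambda>z. \<Psi> y (f z) (g z)) holomorphic_on U"
  and m: "\<And>l m. l > 0 ==> m \<in> {0..1} ==> (\<lambda>y. \<Psi> y (of_real l) (of_real m)) \<in> borel_measurable borel"
  and b: "\<And>B. B > 0 ==> \<exists>C. \<exists>d>0. \<forall>y. \<forall>l\<in>sector k. \<forall>m\<in>nbh c y. norm l \<le> B -->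
    norm (\<Psi> y l m) \<le> C * norm l ^ N * exp (- d * \<bar>y\<bar>)"
  using kernelE[OF assms(1)] by blast
 obtain c' k' where c': "0 < c'" "0 < k'"
  and h': "\<And>y U f g. open U ==> f holomorphic_on U ==> g holomorphic_on U ==> f ` U \<subseteq> sector k' ==> g ` U \<subseteq> nbh c' y ==>
    (\<lambda>z. \<Phi> y (f z) (g z)) holomorphic_on U"
  and m': "\<And>l m. l > 0 ==> m \<in> {0..1} ==> (\<lambda>y. \<Phi> y (of_real l) (of_real m)) \<in> borel_measurable borel"
  and b': "\<And>B. B > 0 ==> \<exists>C. \<exists>d>0. \<forall>y. \<forall>l\<in>sector k'. \<forall>m\<in>nbh c' y. norm l \<le> B -->
    norm (\<Phi> y l m) \<le> C * norm l ^ N * exp (- d * \<bar>y\<bar>)"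
  using kernelE[OF assms(2)] by blast
 have sub: "sector (min k k') \<subseteq> sector k" "sector (min k k') \<subseteq> sector k'"
  "nbh (min c c') y \<subseteq> nbh c y" "nbh (min c c') y \<subseteq> nbh c' y" for y
  by (rule sector_mono nbh_mono; use c c' in simp)+
 show ?thesis
 proof (rule kernelI[of "min c c'" "min k k'"])
  fix y U f g assume "open U" "f holomorphic_on U" "g holomorphic_on U" "f ` U \<subseteq> sector (min k k')" "g ` U \<subseteq> nbh (min c c') y"
  thus "(\<lambda>z. \<Psi> y (f z) (g z) + \<Phi> y (f z) (g z)) holomorphic_on U"
   using sub(1,2) sub(3,4)[of y] by (intro holomorphic_on_add h h') auto
 next
  fix B :: real assume B: "B > 0"
  obtain C d where C: "d > 0" "\<And>y l m. l \<in> sector k ==> m \<in> nbh c y ==> norm l \<le> B ==>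
    norm (\<Psi> y l m) \<le> C * norm l ^ N * exp (- d * \<bar>y\<bar>)" using b[OF B] by blast
  obtain C' d' where C': "d' > 0" "\<And>y l m. l \<in> sector k' ==> m \<in> nbh c' y ==> norm l \<le> B ==>
    norm (\<Phi> y l m) \<le> C' * norm l ^ N * exp (- d' * \<bar>y\<bar>)" using b'[OF B] by blast
  define e where "e = min d d'"
  show "\<exists>C. \<exists>d>0. \<forall>y. \<forall>l\<in>sector (min k k'). \<forall>m\<in>nbh (min c c') y. norm l \<le> B -->
    norm (\<Psi> y l m + \<Phi> y l m) \<le> C * norm l ^ N * exp (- d * \<bar>y\<bar>)"
  proof (rule exI[of _ "\<bar>C\<bar> + \<bar>C'\<bar>"], rule exI[of _ e], intro conjI allI ballI impI)
   show "e > 0" using C(1) C'(1) by (simp add: e_def)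
   fix y l m assume l: "l \<in> sector (min k k')" and m: "m \<in> nbh (min c c') y" and lB: "norm l \<le> B"
   have "norm (\<Psi> y l m) \<le> C * norm l ^ N * exp (- d * \<bar>y\<bar>)" using C(2) l m lB sub by blast
   also have "\<dots> \<le> \<bar>C\<bar> * norm l ^ N * exp (- e * \<bar>y\<bar>)"
    by (intro mult_mono mult_nonneg_nonneg) (auto simp: e_def intro: mult_right_mono)
   finally have 1: "norm (\<Psi> y l m) \<le> \<bar>C\<bar> * norm l ^ N * exp (- e * \<bar>y\<bar>)" .
   have "norm (\<Phi> y l m) \<le> C' * norm l ^ N * exp (- d' * \<bar>y\<bar>)" using C'(2) l m lB sub by blast
   also have "\<dots> \<le> \<bar>C'\<bar> * norm l ^ N * exp (- e * \<bar>y\<bar>)"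
    by (intro mult_mono mult_nonneg_nonneg) (auto simp: e_def intro: mult_right_mono)
   finally have 2: "norm (\<Phi> y l m) \<le> \<bar>C'\<bar> * norm l ^ N * exp (- e * \<bar>y\<bar>)" .
   show "norm (\<Psi> y l m + \<Phi> y l m) \<le> (\<bar>C\<bar> + \<bar>C'\<bar>) * norm l ^ N * exp (- e * \<bar>y\<bar>)"
    using norm_triangle_le[OF add_mono[OF 1 2]] by (simp add: algebra_simps)
  qed
 qed (use c c' m m' in \<open>auto intro: borel_measurable_add\<close>)
qed

lemma kernel_integrable:
 assumes "kernel N \<Psi>" and l: "l > 0" and m: "m \<in> {0..1}"
 shows "integrable lborel (\<lambda>y. \<Psi> y (of_real l) (of_real m))"
proof -
 obtain c k where c: "0 < c" "0 < k"
  and h: "\<And>y U f g. open U ==> f holomorphic_on U ==> g holomorphic_on U ==> f ` U \<subseteq> sector k ==> g ` U \<subseteq> nbh c y ==>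
    (\<lambda>z. \<Psi> y (f z) (g z)) holomorphic_on U"
  and ms: "\<And>l m. l > 0 ==> m \<in> {0..1} ==> (\<lambda>y. \<Psi> y (of_real l) (of_real m)) \<in> borel_measurable borel"
  and b: "\<And>B. B > 0 ==> \<exists>C. \<exists>d>0. \<forall>y. \<forall>l\<in>sector k. \<forall>m\<in>nbh c y. norm l \<le> B -->
    norm (\<Psi> y l m) \<le> C * norm l ^ N * exp (- d * \<bar>y\<bar>)"
  using kernelE[OF assms(1)] by blast
 obtain C d where C: "d > 0" "\<And>y l' m. l' \<in> sector k ==> m \<in> nbh c y ==> norm l' \<le> l ==>
    norm (\<Psi> y l' m) \<le> C * norm l' ^ N * exp (- d * \<bar>y\<bar>)" using b[OF l] by blast
 have bd: "norm (\<Psi> y (of_real l) (of_real m)) \<le> C * l ^ N * exp (- d * \<bar>y\<bar>)" for y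
  using C(2)[OF of_real_in_sector[OF l c(2)] of_real_in_nbh[OF m c(1)], of y] l by simp
 show ?thesis
 proof (rule Bochner_Integration.integrable_bound)
  show "integrable lborel (\<lambda>y. C * l ^ N * exp (- d * \<bar>y\<bar>))"
   by (intro integrable_mult_right integrable_exp_minus_abs C)
  show "AE y in lborel. norm (\<Psi> y (of_real l) (of_real m)) \<le> norm (C * l ^ N * exp (- d * \<bar>y\<bar>))"
   by (intro AE_I2 order_trans[OF bd]) (simp only: real_norm_def abs_ge_self)
 qed (use ms[OF l m] in simp)
qed

lemma kernel_const:
 assumes h: "h analytic_on (of_real ` {0..1::real})"
 shows "kernel 0 (\<lambda>y l m. indicator {0..1} y * h m)"
proof -
 obtain T where T: "open T" "of_real ` {0..1::real} \<subseteq> T" "h holomorphic_on T"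
  using h unfolding analytic_on_holomorphic by blast
 have cpt: "compact (complex_of_real ` {0..1})" by (intro compact_continuous_image continuous_intros compact_Icc)
 obtain e where e: "e > 0" "(\<Union>x\<in>complex_of_real ` {0..1}. cball x e) \<subseteq> T"
  using compact_subset_open_imp_cball_epsilon_subset[OF cpt T(1,2)] by blast
 define K where "K = {x + y | x y. x \<in> complex_of_real ` {0..1} \<and> y \<in> cball 0 e}"
 have K: "compact K" unfolding K_def by (intro compact_sums cpt compact_cball)
 have KT: "K \<subseteq> T" using e(2) by (fastforce simp: K_def dist_norm)
 have nK: "nbh e y \<subseteq> K" for y
 proof
  fix m assume "m \<in> nbh e y"
  then obtain m0 where m0: "m0 \<in> {0..1}" "norm (m - of_real m0) < rad e y" by (auto simp: nbh_def)
  hence "norm (m - of_real m0) \<le> e" using rad_le[OF e(1), of y] by simp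
  thus "m \<in> K" unfolding K_def using m0(1)
   by (intro CollectI exI[of _ "of_real m0"] exI[of _ "m - of_real m0"]) auto
 qed
 have "bounded (h ` K)"
  by (intro compact_imp_bounded compact_continuous_image K continuous_on_subset[OF holomorphic_on_imp_continuous_on[OF T(3)] KT])
 then obtain M where M: "\<And>m. m \<in> K ==> norm (h m) \<le> M" by (auto simp: bounded_iff)
 have "M \<ge> 0" using M[of 0] order_trans[OF norm_ge_zero] nK[of 0] of_real_in_nbh[OF _ e(1), of 0 0] by fastforce
 show ?thesis
 proof (rule kernelI[OF e(1) zero_less_one])
  fix y U f g assume U: "open U" "g holomorphic_on U" "g ` U \<subseteq> nbh e y"
  have "(h \<circ> g) holomorphic_on U"
   by (rule holomorphic_on_compose_gen[OF U(2) T(3)]) (use U(3) nK KT in blast)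
  thus "(\<lambda>z. indicator {0..1} y * h (g z)) holomorphic_on U"
   by (intro holomorphic_on_mult holomorphic_on_const) (simp add: o_def)
 next
  fix B :: real
  show "\<exists>C. \<exists>d>0. \<forall>y. \<forall>l\<in>sector 1. \<forall>m\<in>nbh e y. norm l \<le> B -->
    norm (indicator {0..1} y * h m) \<le> C * norm l ^ 0 * exp (- d * \<bar>y\<bar>)"
  proof (rule exI[of _ "M * exp 1"], rule exI[of _ 1], intro conjI allI ballI impI)
   fix y l m assume "m \<in> nbh e y"
   hence "norm (h m) \<le> M" using M nK by blast
   have "norm (indicator {0..1} y * h m) \<le> M * (exp 1 * exp (- \<bar>y\<bar>))"
   proof (cases "y \<in> {0..1}")
    case True
    have "norm (h m) \<le> M * 1" using \<open>norm (h m) \<le> M\<close> by simp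
    also have "\<dots> \<le> M * (exp 1 * exp (- \<bar>y\<bar>))"
     using True \<open>M \<ge> 0\<close> by (intro mult_left_mono) (auto simp flip: exp_add)
    finally show ?thesis using True by simp
   qed (use \<open>M \<ge> 0\<close> in auto)
   thus "norm (indicator {0..1} y * h m) \<le> M * exp 1 * norm l ^ 0 * exp (- 1 * \<bar>y\<bar>)" by simp
  qed simp
 qed measurable
qed

text \<open>
\<open>p\<close> and \<open>q\<close> express \<open>l\<close> and \<open>m\<close> in coordinates \<open>(s, t)\<close>. On discs of radius proportional to \<open>t\<close> in the second variable \<open>p\<close> keeps
to the sector and is \<open>O(t)\<close>, and \<open>q\<close> is Lipschitz, so that \<open>q\<close> stays in the shrinking neighbourhood of \<open>[0, 1]\<close> when the
discs are shrunk in the same way.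
\<close>
definition chart_on :: "real => real => real => (complex => complex => complex) => (complex => complex => complex) => bool" where
 "chart_on a A k p q \<longleftrightarrow> (\<exists>r>0. \<exists>L. \<forall>s0\<in>{0..<A}. \<forall>t0\<in>{a<..<A}.
   (\<exists>l>0. p (of_real s0) (of_real t0) = of_real l) \<and> (\<exists>m\<in>{0..1}. q (of_real s0) (of_real t0) = of_real m) \<and>
   sep_holomorphic p (ball (of_real s0) r) (ball (of_real t0) (r * t0)) \<and>
   sep_holomorphic q (ball (of_real s0) r) (ball (of_real t0) (r * t0)) \<and>
   (\<forall>s\<in>ball (of_real s0) r. \<forall>t\<in>ball (of_real t0) (r * t0).
    p s t \<in> sector k \<and> norm (p s t) \<le> L * t0 \<and>
    norm (q s t - q (of_real s0) (of_real t0)) \<le> L * (norm (s - of_real s0) + norm (t - of_real t0) / t0)))"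

definition chart :: "(real \<times> real) set => (complex => complex => complex) => (complex => complex => complex) => bool" where
 "chart J p q \<longleftrightarrow> (\<forall>(a, A)\<in>J. \<forall>k>0. chart_on a A k p q)"

lemma kernel_chart:
 assumes J: "covers J" and \<Psi>: "kernel N \<Psi>" and pq: "chart J p q"
 shows "bikernel J N (\<lambda>y s t. \<Psi> y (p s t) (q s t))"
proof (rule bikernelI)
 fix a A assume aA: "(a, A) \<in> J"
 have a: "a \<ge> 0" using covers_nonneg[OF J aA] .
 obtain c k where c: "0 < c" "0 < k"
  and h: "\<And>y U f g. open U ==> f holomorphic_on U ==> g holomorphic_on U ==> f ` U \<subseteq> sector k ==> g ` U \<subseteq> nbh c y ==>
    (\<lambda>z. \<Psi> y (f z) (g z)) holomorphic_on U"
  and ms: "\<And>l m. l > 0 ==> m \<in> {0..1} ==> (\<lambda>y. \<Psi> y (of_real l) (of_real m)) \<in> borel_measurable borel"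
  and b: "\<And>B. B > 0 ==> \<exists>C. \<exists>d>0. \<forall>y. \<forall>l\<in>sector k. \<forall>m\<in>nbh c y. norm l \<le> B -->
    norm (\<Psi> y l m) \<le> C * norm l ^ N * exp (- d * \<bar>y\<bar>)"
  using kernelE[OF \<Psi>] by blast
 obtain r0 L0 where r0: "r0 > 0" and ch: "\<forall>s0\<in>{0..<A}. \<forall>t0\<in>{a<..<A}.
   (\<exists>l>0. p (of_real s0) (of_real t0) = of_real l) \<and> (\<exists>m\<in>{0..1}. q (of_real s0) (of_real t0) = of_real m) \<and>
   sep_holomorphic p (ball (of_real s0) r0) (ball (of_real t0) (r0 * t0)) \<and>
   sep_holomorphic q (ball (of_real s0) r0) (ball (of_real t0) (r0 * t0)) \<and>
   (\<forall>s\<in>ball (of_real s0) r0. \<forall>t\<in>ball (of_real t0) (r0 * t0).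
    p s t \<in> sector k \<and> norm (p s t) \<le> L0 * t0 \<and>
    norm (q s t - q (of_real s0) (of_real t0)) \<le> L0 * (norm (s - of_real s0) + norm (t - of_real t0) / t0))"
 proof -
  have "chart_on a A k p q" using pq aA c(2) unfolding chart_def by blast
  thus thesis unfolding chart_on_def by (elim exE conjE) (rule that)
 qed
 define L where "L = max L0 1"
 have L: "L \<ge> L0" "L > 0" by (auto simp: L_def)
 define r where "r = min (min r0 (1/2)) (c / (2 * L))"
 have r: "r > 0" "r \<le> r0" "r \<le> 1/2" "r \<le> c / (2 * L)" using r0 c L by (auto simp: r_def)
 have B: "L * (\<bar>A\<bar> + 1) > 0" using L by simp
 obtain C d where C: "d > 0" "\<And>y l m. l \<in> sector k ==> m \<in> nbh c y ==> norm l \<le> L * (\<bar>A\<bar> + 1) ==>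
    norm (\<Psi> y l m) \<le> C * norm l ^ N * exp (- d * \<bar>y\<bar>)" using b[OF B] by blast
 show "\<exists>r C d. 0 < r \<and> r \<le> 1/2 \<and> 0 < d \<and>
   (\<forall>y. \<forall>s0\<in>{0..<A}. \<forall>t0\<in>{a<..<A}.
    (\<lambda>y. \<Psi> y (p (of_real s0) (of_real t0)) (q (of_real s0) (of_real t0))) \<in> borel_measurable borel \<and>
    sep_holomorphic (\<lambda>s t. \<Psi> y (p s t) (q s t)) (ball (of_real s0) (rad r y)) (ball (of_real t0) (rad r y * t0)) \<and>
    (\<forall>s\<in>ball (of_real s0) (rad r y). \<forall>t\<in>ball (of_real t0) (rad r y * t0).
      norm (\<Psi> y (p s t) (q s t)) \<le> C * t0 ^ N * exp (- d * \<bar>y\<bar>)))"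
 proof (rule exI[of _ r], rule exI[of _ "\<bar>C\<bar> * L ^ N"], rule exI[of _ d], intro conjI allI ballI)
  fix y s0 t0 assume s0: "s0 \<in> {0..<A}" and t0: "t0 \<in> {a<..<A}"
  have t0p: "t0 > 0" using a t0 by auto
  note ch0 = ch[rule_format, OF s0 t0]
  obtain l m where lm: "l > 0" "p (of_real s0) (of_real t0) = of_real l" "m \<in> {0..1}" "q (of_real s0) (of_real t0) = of_real m"
   using ch0 by blast
  show "(\<lambda>y. \<Psi> y (p (of_real s0) (of_real t0)) (q (of_real s0) (of_real t0))) \<in> borel_measurable borel"
   unfolding lm by (rule ms[OF lm(1,3)])
  define S T where "S = ball (complex_of_real s0) (rad r y)" and "T = ball (complex_of_real t0) (rad r y * t0)"
  have rr: "rad r y \<le> r0" using rad_le[OF r(1), of y] r by simp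
  have sub: "S \<subseteq> ball (of_real s0) r0" "T \<subseteq> ball (of_real t0) (r0 * t0)"
   unfolding S_def T_def using rr t0p by (auto intro!: subset_ball mult_right_mono)
  have hp: "sep_holomorphic p S T" and hq: "sep_holomorphic q S T"
   using ch0 sub sep_holomorphic_subset by blast+
  have pc: "p s t \<in> sector k" and pn: "norm (p s t) \<le> L * t0" if "s \<in> S" "t \<in> T" for s t
  proof -
   have "s \<in> ball (of_real s0) r0" "t \<in> ball (of_real t0) (r0 * t0)" using that sub by auto
   hence *: "p s t \<in> sector k \<and> norm (p s t) \<le> L0 * t0" using ch0 by blast
   thus "p s t \<in> sector k" by blast
   have "L0 * t0 \<le> L * t0" using L t0p by (intro mult_right_mono) auto
   thus "norm (p s t) \<le> L * t0" using * by linarith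
  qed
  have qn: "q s t \<in> nbh c y" if "s \<in> S" "t \<in> T" for s t
  proof -
   have n: "norm (s - of_real s0) < rad r y" "norm (t - of_real t0) / t0 < rad r y"
    using that t0p by (auto simp: S_def T_def dist_norm norm_minus_commute pos_divide_less_eq)
   have "s \<in> ball (of_real s0) r0" "t \<in> ball (of_real t0) (r0 * t0)" using that sub by auto
   hence "norm (q s t - of_real m) \<le> L0 * (norm (s - of_real s0) + norm (t - of_real t0) / t0)" using ch0 lm(4) by metis
   also have "\<dots> \<le> L * (norm (s - of_real s0) + norm (t - of_real t0) / t0)"
    using L t0p by (intro mult_right_mono add_nonneg_nonneg divide_nonneg_nonneg) auto
   also have "\<dots> < L * (rad r y + rad r y)" using n L by (intro mult_strict_left_mono add_strict_mono) auto
   also have "\<dots> \<le> rad c y"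
   proof -
    have "L * (rad r y + rad r y) = rad (2 * L * r) y" by (simp add: rad_def)
    also have "\<dots> \<le> rad c y" using r(4) L by (intro rad_mono) (simp add: pos_le_divide_eq mult.commute)
    finally show ?thesis .
   qed
   finally show ?thesis using lm(3) by (auto simp: nbh_def)
  qed
  show "sep_holomorphic (\<lambda>s t. \<Psi> y (p s t) (q s t)) (ball (of_real s0) (rad r y)) (ball (of_real t0) (rad r y * t0))"
   unfolding sep_holomorphic_def S_def[symmetric] T_def[symmetric]
  proof (intro conjI ballI)
   fix t assume t: "t \<in> T"
   show "(\<lambda>s. \<Psi> y (p s t) (q s t)) holomorphic_on S"
    by (rule h) (use hp hq t pc qn in \<open>auto simp: sep_holomorphic_def S_def\<close>)
  next
   fix s assume s: "s \<in> S"
   show "(\<lambda>t. \<Psi> y (p s t) (q s t)) holomorphic_on T"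
    by (rule h) (use hp hq s pc qn in \<open>auto simp: sep_holomorphic_def T_def\<close>)
  qed
  fix s t assume st: "s \<in> ball (complex_of_real s0) (rad r y)" "t \<in> ball (complex_of_real t0) (rad r y * t0)"
  hence st: "s \<in> S" "t \<in> T" by (auto simp: S_def T_def)
  have "L * t0 \<le> L * (\<bar>A\<bar> + 1)" using L t0 by (intro mult_left_mono) auto
  with pn[OF st] have "norm (p s t) \<le> L * (\<bar>A\<bar> + 1)" by linarith
  from C(2)[OF pc[OF st] qn[OF st] this]
  have "norm (\<Psi> y (p s t) (q s t)) \<le> C * norm (p s t) ^ N * exp (- d * \<bar>y\<bar>)" .
  also have "\<dots> \<le> \<bar>C\<bar> * (L * t0) ^ N * exp (- d * \<bar>y\<bar>)"
   by (intro mult_right_mono mult_mono power_mono pn[OF st]) auto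
  finally show "norm (\<Psi> y (p s t) (q s t)) \<le> \<bar>C\<bar> * L ^ N * t0 ^ N * exp (- d * \<bar>y\<bar>)"
   by (simp add: power_mult_distrib mult.assoc)
 qed (use r C in auto)
qed

lemma sector_near_real:
 assumes k: "0 < k" "k \<le> 1/2" and x: "x \<ge> a" "a > 0" and z: "norm (z - of_real x) < k * a / 2"
 shows "z \<in> sector k" "Re z > 0" "norm z \<ge> a / 2"
proof -
 have "\<bar>Re z - x\<bar> \<le> norm (z - of_real x)" using abs_Re_le_cmod[of "z - of_real x"] by simp
 moreover have "\<bar>Im z\<bar> \<le> norm (z - of_real x)" using abs_Im_le_cmod[of "z - of_real x"] by simp
 moreover have "k * a / 2 \<le> a / 4" using k x by simp
 ultimately have *: "Re z \<ge> 3/4 * a" "\<bar>Im z\<bar> < k * a / 2" using z x by linarith+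
 have "k * a / 2 \<le> k * (3/4 * a)" using k x by simp
 also have "\<dots> \<le> k * Re z" using * k by (intro mult_left_mono) auto
 finally show "z \<in> sector k" using * by (simp add: sector_def)
 show "Re z > 0" using * x by linarith
 show "norm z \<ge> a / 2" using * x complex_Re_le_cmod[of z] by linarith
qed

lemma sector_csqrt:
 assumes "z \<in> sector k" "0 < k" shows "csqrt z \<in> sector k"
proof -
 define w where "w = csqrt z"
 have z: "z = w\<^sup>2" by (simp add: w_def)
 have Rz: "Re z > 0" using sector_Re_pos[OF assms] .
 hence "w \<noteq> 0" "Re w \<noteq> 0" using z by (auto simp: power2_eq_square)
 hence Rw: "Re w > 0" using Re_csqrt[of z] by (simp add: w_def)
 have "\<bar>Im z\<bar> = 2 * Re w * \<bar>Im w\<bar>" using Rw by (simp add: z power2_eq_square abs_mult)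
 moreover have "Re z \<le> Re w * Re w" by (simp add: z power2_eq_square)
 hence "k * Re z \<le> k * (Re w * Re w)" using assms by simp
 moreover have "\<bar>Im z\<bar> < k * Re z" using assms by (simp add: sector_def)
 ultimately have "2 * Re w * \<bar>Im w\<bar> < k * (Re w * Re w)" by linarith
 hence "Re w * (2 * \<bar>Im w\<bar>) < Re w * (k * Re w)" by (simp add: mult_ac)
 hence "2 * \<bar>Im w\<bar> < k * Re w" using Rw by simp
 thus ?thesis by (simp add: sector_def w_def)
qed

lemma sector_mult:
 assumes z: "z \<in> sector k" and w: "w \<in> sector k" and k: "0 < k" "k \<le> 1/2"
 shows "z * w \<in> sector (4 * k)"
proof -
 have R: "Re z > 0" "Re w > 0" using sector_Re_pos z w k by auto
 have I: "\<bar>Im z\<bar> < k * Re z" "\<bar>Im w\<bar> < k * Re w" using z w by (auto simp: sector_def)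
 have "\<bar>Im z * Im w\<bar> \<le> (k * Re z) * (k * Re w)" unfolding abs_mult using I R k by (intro mult_mono) auto
 also have "\<dots> = (k * k) * (Re z * Re w)" by (simp add: mult_ac)
 also have "\<dots> \<le> (1/2 * (1/2)) * (Re z * Re w)" using k R by (intro mult_right_mono mult_mono) auto
 finally have 1: "Re (z * w) \<ge> 3/4 * (Re z * Re w)" using abs_ge_self[of "Im z * Im w"] by (simp add: mult.commute)
 have "\<bar>Im (z * w)\<bar> \<le> \<bar>Re z * Im w\<bar> + \<bar>Im z * Re w\<bar>" by simp
 also have "\<dots> \<le> Re z * (k * Re w) + (k * Re z) * Re w" unfolding abs_mult using I R by (intro add_mono mult_mono) auto
 also have "\<dots> = 2 * k * (Re z * Re w)" by (simp add: algebra_simps)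
 also have "\<dots> < 4 * k * (3/4 * (Re z * Re w))" using k R by simp
 also have "\<dots> \<le> 4 * k * Re (z * w)" using k 1 by (intro mult_left_mono) auto
 finally show ?thesis by (simp add: sector_def)
qed

lemma sector_not_nonpos: "z \<in> sector k ==> 0 < k ==> z \<notin> \<real>\<^sub>\<le>\<^sub>0"
 using sector_Re_pos[of z k] by (auto simp: complex_nonpos_Reals_iff)

lemma sqrt_le_one_plus: "(x::real) \<ge> 0 ==> sqrt x \<le> 1 + x"
 by (rule real_le_lsqrt) (auto simp: power2_eq_square algebra_simps)

text \<open>
Both charts at the front face are of this form: \<open>\<alpha> = Z\<close>, \<open>\<beta> = 1\<close>, \<open>\<gamma> = 0\<close>, \<open>\<delta> = 1\<close> for \<open>(E / x, x\<^sup>1\<^sup>/\<^sup>2)\<close>, and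
\<open>\<alpha> = 1\<close>, \<open>\<beta> = Z\<close>, \<open>\<gamma> = 1\<close>, \<open>\<delta> = 0\<close> for \<open>(x / E, E\<^sup>1\<^sup>/\<^sup>2)\<close>.
\<close>
lemma chart_tube:
 assumes \<alpha>: "\<alpha> > 0" and \<beta>: "\<beta> \<ge> 0" and \<gamma>: "0 \<le> \<gamma>" "\<gamma> \<le> \<alpha>" and \<delta>: "0 \<le> \<delta>" "\<delta> \<le> \<beta>"
 shows "chart tube (\<lambda>s t. t * csqrt (of_real \<alpha> + of_real \<beta> * s))
   (\<lambda>s t. (of_real \<gamma> + of_real \<delta> * s) / (of_real \<alpha> + of_real \<beta> * s))"
 unfolding chart_def
proof (clarify)
 fix a A k :: real assume "(a, A) \<in> tube" "k > 0"
 hence a: "a = 0" and A: "A > 0" and k: "k > 0" by (auto simp: tube_def)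
 define \<kappa> where "\<kappa> = min (k/4) (1/2)"
 have \<kappa>: "\<kappa> > 0" "\<kappa> \<le> 1/2" "4 * \<kappa> \<le> k" using k by (auto simp: \<kappa>_def)
 define r where "r = min (\<kappa>/2) (\<kappa> * \<alpha> / (2 * (\<beta> + 1)))"
 have "r > 0" using \<kappa> \<alpha> \<beta> by (simp add: r_def)
 moreover have "r \<le> \<kappa>/2" unfolding r_def by (rule min.cobounded1)
 ultimately have r: "r > 0" "r \<le> \<kappa>/2" by auto
 have "r \<le> \<kappa> * \<alpha> / (2 * (\<beta> + 1))" by (simp add: r_def)
 hence r3: "(\<beta> + 1) * r \<le> \<kappa> * \<alpha> / 2" using \<beta> by (simp add: field_simps)
 define M where "M = \<alpha> + \<beta> * (A + 1)"
 have M: "M > 0" using \<alpha> \<beta> A by (auto simp: M_def intro: add_pos_nonneg)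
 define L where "L = max (2 * (1 + M)) (2 * \<bar>\<delta> * \<alpha> - \<gamma> * \<beta>\<bar> / \<alpha>\<^sup>2)"
 define D where "D s = of_real \<alpha> + of_real \<beta> * s" for s :: complex
 show "chart_on a A k (\<lambda>s t. t * csqrt (of_real \<alpha> + of_real \<beta> * s))
   (\<lambda>s t. (of_real \<gamma> + of_real \<delta> * s) / (of_real \<alpha> + of_real \<beta> * s))"
  unfolding chart_on_def
 proof (rule exI[of _ r], rule conjI, rule r(1), rule exI[of _ L], intro ballI conjI)
  fix s0 t0 assume s0: "s0 \<in> {0..<A}" and t0: "t0 \<in> {a<..<A}"
  have t0p: "t0 > 0" using t0 a by simp
  have D0: "\<alpha> + \<beta> * s0 \<ge> \<alpha>" using \<beta> s0 by simp
  have D0r: "D (of_real s0) = of_real (\<alpha> + \<beta> * s0)" by (simp add: D_def)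
  show "\<exists>l>0. of_real t0 * csqrt (of_real \<alpha> + of_real \<beta> * of_real s0) = of_real l"
   using D0 \<alpha> t0p by (intro exI[of _ "t0 * sqrt (\<alpha> + \<beta> * s0)"]) (auto simp flip: of_real_mult of_real_add)
  have "\<gamma> + \<delta> * s0 \<le> \<alpha> + \<beta> * s0" using \<gamma> \<delta> s0 by (intro add_mono mult_right_mono) auto
  thus "\<exists>m\<in>{0..1}. (of_real \<gamma> + of_real \<delta> * of_real s0) / (of_real \<alpha> + of_real \<beta> * of_real s0) = complex_of_real m"
   using less_le_trans[OF \<alpha> D0] \<gamma> \<delta> s0 by (intro bexI[of _ "(\<gamma> + \<delta> * s0) / (\<alpha> + \<beta> * s0)"]) auto
  have near: "norm (D s - of_real (\<alpha> + \<beta> * s0)) < \<kappa> * \<alpha> / 2" if "s \<in> ball (of_real s0) r" for s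
  proof -
   have "D s - of_real (\<alpha> + \<beta> * s0) = of_real \<beta> * (s - of_real s0)" by (simp add: D_def algebra_simps)
   hence "norm (D s - of_real (\<alpha> + \<beta> * s0)) = \<beta> * norm (s - of_real s0)" using \<beta> by (simp add: norm_mult)
   also have "\<dots> \<le> \<beta> * r" using that \<beta> by (intro mult_left_mono) (auto simp: dist_norm norm_minus_commute)
   also have "\<dots> < (\<beta> + 1) * r" using r by simp
   finally show ?thesis using r3 by simp
  qed
  note Dc = sector_near_real[OF \<kappa>(1,2) D0 \<alpha> near]
  have Dnz: "D s \<noteq> 0" if "s \<in> ball (of_real s0) r" for s using Dc(2)[OF that] by auto
  have Dnn: "D s \<notin> \<real>\<^sub>\<le>\<^sub>0" if "s \<in> ball (of_real s0) r" for s using sector_not_nonpos[OF Dc(1)[OF that] \<kappa>(1)] .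
  have hD: "D holomorphic_on X" for X unfolding D_def[abs_def] by (intro holomorphic_intros)
  have tc: "t \<in> sector \<kappa>" and tn: "norm t \<le> 2 * t0" if "t \<in> ball (of_real t0) (r * t0)" for t
  proof -
   have n: "norm (t - of_real t0) < r * t0" using that by (simp add: dist_norm norm_minus_commute)
   also have "\<dots> \<le> \<kappa>/2 * t0" using r t0p by (intro mult_right_mono) auto
   finally show "t \<in> sector \<kappa>" using sector_near_real(1)[OF \<kappa>(1,2) order_refl t0p] by simp
   have "r * t0 \<le> 1 * t0" using r \<kappa> t0p by (intro mult_right_mono) auto
   moreover have "norm (of_real t0 :: complex) = t0" using t0p by simp
   ultimately show "norm t \<le> 2 * t0" using n norm_triangle_sub[of t "of_real t0"] by linarith
  qed
  show "sep_holomorphic (\<lambda>s t. t * csqrt (of_real \<alpha> + of_real \<beta> * s)) (ball (of_real s0) r) (ball (of_real t0) (r * t0))"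
   unfolding sep_holomorphic_def D_def[symmetric]
   using Dnn by (auto intro!: holomorphic_on_mult holomorphic_on_csqrt' hD holomorphic_on_const holomorphic_on_ident)
  have "(\<lambda>s. of_real \<gamma> + of_real \<delta> * s) holomorphic_on X" for X :: "complex set" by (intro holomorphic_intros)
  thus "sep_holomorphic (\<lambda>s t. (of_real \<gamma> + of_real \<delta> * s) / (of_real \<alpha> + of_real \<beta> * s)) (ball (of_real s0) r) (ball (of_real t0) (r * t0))"
   unfolding sep_holomorphic_def D_def[symmetric]
   using Dnz by (auto intro!: holomorphic_on_divide hD)
  fix s t assume s: "s \<in> ball (complex_of_real s0) r" and t: "t \<in> ball (complex_of_real t0) (r * t0)"
  have "t * csqrt (D s) \<in> sector (4 * \<kappa>)" by (rule sector_mult[OF tc[OF t] sector_csqrt[OF Dc(1)[OF s] \<kappa>(1)] \<kappa>(1,2)])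
  thus "t * csqrt (of_real \<alpha> + of_real \<beta> * s) \<in> sector k" using sector_mono[OF \<kappa>(3)] \<kappa>(1) by (auto simp: D_def)
  have "norm s \<le> A + 1" using s r \<kappa> s0 norm_triangle_sub[of s "of_real s0"] by (auto simp: dist_norm norm_minus_commute)
  hence "norm (D s) \<le> M" unfolding D_def M_def using \<alpha> \<beta>
   by (intro order_trans[OF norm_triangle_ineq] add_mono) (auto simp: norm_mult intro: mult_left_mono)
  hence "norm (csqrt (D s)) \<le> 1 + M" using sqrt_le_one_plus[of "norm (D s)"] by simp
  hence "norm (t * csqrt (D s)) \<le> 2 * t0 * (1 + M)" unfolding norm_mult using tn[OF t] M t0p by (intro mult_mono) auto
  also have "\<dots> \<le> L * t0" using t0p mult_right_mono[of "2 * (1 + M)" L t0] by (simp add: L_def mult_ac)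
  finally show "norm (t * csqrt (of_real \<alpha> + of_real \<beta> * s)) \<le> L * t0" by (simp add: D_def)
  have s00: "of_real s0 \<in> ball (complex_of_real s0) r" using r by simp
  have "(of_real \<gamma> + of_real \<delta> * s) / D s - (of_real \<gamma> + of_real \<delta> * of_real s0) / D (of_real s0)
    = of_real (\<delta> * \<alpha> - \<gamma> * \<beta>) * (s - of_real s0) / (D s * D (of_real s0))"
   using Dnz[OF s] Dnz[OF s00] by (simp add: diff_frac_eq) (simp add: D_def algebra_simps)
  also have "norm \<dots> = \<bar>\<delta> * \<alpha> - \<gamma> * \<beta>\<bar> * norm (s - of_real s0) / (norm (D s) * norm (D (of_real s0)))"
   by (simp only: norm_mult norm_divide norm_of_real real_norm_def)
  also have "\<dots> \<le> \<bar>\<delta> * \<alpha> - \<gamma> * \<beta>\<bar> * norm (s - of_real s0) / (\<alpha> / 2 * \<alpha>)"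
  proof (rule divide_left_mono)
   have n0: "norm (D (of_real s0)) \<ge> \<alpha>" unfolding D0r norm_of_real using D0 by linarith
   show le: "\<alpha> / 2 * \<alpha> \<le> norm (D s) * norm (D (of_real s0))"
    using Dc(3)[OF s] n0 \<alpha> by (intro mult_mono) auto
   have p: "0 < \<alpha> / 2 * \<alpha>" using \<alpha> by simp
   show "0 < norm (D s) * norm (D (of_real s0)) * (\<alpha> / 2 * \<alpha>)"
    by (rule mult_pos_pos[OF less_le_trans[OF p le] p])
  qed auto
  also have "\<dots> = 2 * \<bar>\<delta> * \<alpha> - \<gamma> * \<beta>\<bar> / \<alpha>\<^sup>2 * norm (s - of_real s0)" by (simp add: power2_eq_square)
  also have "\<dots> \<le> L * norm (s - of_real s0)" by (intro mult_right_mono) (auto simp: L_def)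
  also have "\<dots> \<le> L * (norm (s - of_real s0) + norm (t - of_real t0) / t0)"
   using t0p M by (intro mult_left_mono) (auto simp: L_def)
  finally show "norm ((of_real \<gamma> + of_real \<delta> * s) / (of_real \<alpha> + of_real \<beta> * s) -
    (of_real \<gamma> + of_real \<delta> * of_real s0) / (of_real \<alpha> + of_real \<beta> * of_real s0)) \<le> L * (norm (s - of_real s0) + norm (t - of_real t0) / t0)"
   by (simp add: D_def)
 qed
qed

text \<open>
Away from the front face: \<open>(s, t)\<close> is \<open>(E, x)\<close> near \<open>E = 0\<close> and \<open>(x, E)\<close> near \<open>x = 0\<close>.
\<close>
lemma chart_slots:
 assumes \<beta>: "\<beta> \<ge> 0" and \<zeta>: "\<zeta> > 0" and \<delta>: "0 \<le> \<delta>" "\<delta> \<le> \<beta>" and \<epsilon>: "0 \<le> \<epsilon>" "\<epsilon> \<le> \<zeta>"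
 shows "chart slots (\<lambda>s t. csqrt (of_real \<beta> * s + of_real \<zeta> * t))
   (\<lambda>s t. (of_real \<delta> * s + of_real \<epsilon> * t) / (of_real \<beta> * s + of_real \<zeta> * t))"
 unfolding chart_def
proof (clarify)
 fix a A k :: real assume "(a, A) \<in> slots" "k > 0"
 hence a: "a > 0" and k: "k > 0" by (auto simp: slots_def)
 define \<kappa> where "\<kappa> = min k (1/2)"
 have \<kappa>: "\<kappa> > 0" "\<kappa> \<le> 1/2" "\<kappa> \<le> k" using k by (auto simp: \<kappa>_def)
 define W where "W = \<beta> + \<zeta> * \<bar>A\<bar> + 1"
 have W: "W > 0" using \<beta> \<zeta> by (auto simp: W_def intro: add_nonneg_pos)
 define b where "b = \<zeta> * a"
 have b: "b > 0" using a \<zeta> by (simp add: b_def)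
 define r where "r = min 1 (\<kappa> * b / (2 * W))"
 have r: "r > 0" "r \<le> 1" using \<kappa> b W by (auto simp: r_def)
 have "r \<le> \<kappa> * b / (2 * W)" by (simp add: r_def)
 hence r3: "W * r \<le> \<kappa> * b / 2" using W by (simp add: field_simps)
 define M where "M = \<beta> * (\<bar>A\<bar> + 1) + \<zeta> * (2 * \<bar>A\<bar>)"
 have M: "M \<ge> 0" using \<beta> \<zeta> by (auto simp: M_def)
 define Q where "Q = \<bar>\<delta> * \<zeta> - \<epsilon> * \<beta>\<bar>"
 define L where "L = max ((1 + M) / a) (2 * Q * (\<bar>A\<bar> * (\<bar>A\<bar> + 1)) / b\<^sup>2)"
 have L0: "L \<ge> 0" using M a by (simp add: L_def le_max_iff_disj)
 define D where "D s t = of_real \<beta> * s + of_real \<zeta> * t" for s t :: complex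
 show "chart_on a A k (\<lambda>s t. csqrt (of_real \<beta> * s + of_real \<zeta> * t))
   (\<lambda>s t. (of_real \<delta> * s + of_real \<epsilon> * t) / (of_real \<beta> * s + of_real \<zeta> * t))"
  unfolding chart_on_def
 proof (rule exI[of _ r], rule conjI, rule r(1), rule exI[of _ L], intro ballI conjI)
  fix s0 t0 assume s0: "s0 \<in> {0..<A}" and t0: "t0 \<in> {a<..<A}"
  have t0p: "t0 > 0" using t0 a by simp
  have A: "A > 0" using t0 t0p by simp
  have D0: "\<beta> * s0 + \<zeta> * t0 \<ge> b" using \<beta> s0 \<zeta> t0 by (auto simp: b_def intro!: add_increasing)
  have D0r: "D (of_real s0) (of_real t0) = of_real (\<beta> * s0 + \<zeta> * t0)" by (simp add: D_def)
  have "csqrt (of_real (\<beta> * s0 + \<zeta> * t0)) = of_real (sqrt (\<beta> * s0 + \<zeta> * t0))" using D0 b by simp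
  thus "\<exists>l>0. csqrt (of_real \<beta> * of_real s0 + of_real \<zeta> * of_real t0) = of_real l"
   using D0 b by (intro exI[of _ "sqrt (\<beta> * s0 + \<zeta> * t0)"]) auto
  have "\<delta> * s0 + \<epsilon> * t0 \<le> \<beta> * s0 + \<zeta> * t0" using \<delta> \<epsilon> s0 t0p by (intro add_mono mult_right_mono) auto
  thus "\<exists>m\<in>{0..1}. (of_real \<delta> * of_real s0 + of_real \<epsilon> * of_real t0) / (of_real \<beta> * of_real s0 + of_real \<zeta> * of_real t0) = complex_of_real m"
   using less_le_trans[OF b D0] \<epsilon> \<delta> s0 t0p by (intro bexI[of _ "(\<delta> * s0 + \<epsilon> * t0) / (\<beta> * s0 + \<zeta> * t0)"]) auto
  have near: "norm (D s t - of_real (\<beta> * s0 + \<zeta> * t0)) < \<kappa> * b / 2"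
   if "s \<in> ball (of_real s0) r" "t \<in> ball (of_real t0) (r * t0)" for s t
  proof -
   have "D s t - of_real (\<beta> * s0 + \<zeta> * t0) = of_real \<beta> * (s - of_real s0) + of_real \<zeta> * (t - of_real t0)" by (simp add: D_def algebra_simps)
   hence "norm (D s t - of_real (\<beta> * s0 + \<zeta> * t0)) \<le> \<beta> * norm (s - of_real s0) + \<zeta> * norm (t - of_real t0)" using \<beta> \<zeta>
    by (metis abs_of_nonneg less_eq_real_def norm_mult norm_of_real norm_triangle_ineq)
   also have "\<dots> \<le> \<beta> * r + \<zeta> * (r * t0)" using that \<beta> \<zeta> by (intro add_mono mult_left_mono) (auto simp: dist_norm norm_minus_commute)
   also have "\<dots> \<le> \<beta> * r + \<zeta> * (r * \<bar>A\<bar>)" using \<zeta> r t0 by (intro add_left_mono mult_left_mono) auto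
   also have "\<dots> < W * r" using r by (simp add: W_def algebra_simps)
   finally show ?thesis using r3 by simp
  qed
  note Dc = sector_near_real[OF \<kappa>(1,2) D0 b near]
  have Dnz: "D s t \<noteq> 0" if "s \<in> ball (of_real s0) r" "t \<in> ball (of_real t0) (r * t0)" for s t using Dc(2)[OF that] by auto
  have Dnn: "D s t \<notin> \<real>\<^sub>\<le>\<^sub>0" if "s \<in> ball (of_real s0) r" "t \<in> ball (of_real t0) (r * t0)" for s t
   using sector_not_nonpos[OF Dc(1)[OF that] \<kappa>(1)] .
  have hD: "(\<lambda>s. D s t) holomorphic_on X" "D s holomorphic_on X" for X s t unfolding D_def[abs_def] by (intro holomorphic_intros)+
  show "sep_holomorphic (\<lambda>s t. csqrt (of_real \<beta> * s + of_real \<zeta> * t)) (ball (of_real s0) r) (ball (of_real t0) (r * t0))"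
   unfolding sep_holomorphic_def D_def[symmetric]
   using Dnn by (auto intro!: holomorphic_on_csqrt' hD)
  have "(\<lambda>s. of_real \<delta> * s + of_real \<epsilon> * t) holomorphic_on X" "(\<lambda>t. of_real \<delta> * s + of_real \<epsilon> * t) holomorphic_on X" for X :: "complex set" and s t by (intro holomorphic_intros)+
  thus "sep_holomorphic (\<lambda>s t. (of_real \<delta> * s + of_real \<epsilon> * t) / (of_real \<beta> * s + of_real \<zeta> * t)) (ball (of_real s0) r) (ball (of_real t0) (r * t0))"
   unfolding sep_holomorphic_def D_def[symmetric]
   using Dnz by (auto intro!: holomorphic_on_divide hD)
  fix s t assume s: "s \<in> ball (complex_of_real s0) r" and t: "t \<in> ball (complex_of_real t0) (r * t0)"
  have "csqrt (D s t) \<in> sector \<kappa>" by (rule sector_csqrt[OF Dc(1)[OF s t] \<kappa>(1)])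
  thus "csqrt (of_real \<beta> * s + of_real \<zeta> * t) \<in> sector k" using sector_mono[OF \<kappa>(3)] \<kappa>(1) by (auto simp: D_def)
  have ns: "norm s \<le> \<bar>A\<bar> + 1" using s r s0 norm_triangle_sub[of s "of_real s0"] by (auto simp: dist_norm norm_minus_commute)
  have "r * t0 \<le> 1 * t0" using r t0p by (intro mult_right_mono) auto
  moreover have "norm (of_real t0 :: complex) = t0" using t0p by simp
  moreover have "norm (t - of_real t0) < r * t0" using t by (simp add: dist_norm norm_minus_commute)
  moreover have "t0 \<le> \<bar>A\<bar>" using t0 A by simp
  ultimately have nt: "norm t \<le> 2 * \<bar>A\<bar>" using norm_triangle_sub[of t "of_real t0"] by linarith
  have "norm (D s t) \<le> \<beta> * norm s + \<zeta> * norm t" unfolding D_def using \<beta> \<zeta>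
   by (intro order_trans[OF norm_triangle_ineq]) (auto simp: norm_mult)
  also have "\<dots> \<le> M" unfolding M_def using ns nt \<beta> \<zeta> by (intro add_mono mult_left_mono) auto
  finally have "norm (csqrt (D s t)) \<le> 1 + M" using sqrt_le_one_plus[of "norm (D s t)"] by simp
  also have "\<dots> = (1 + M) / a * a" using a by simp
  also have "\<dots> \<le> L * t0" using t0 a M by (intro mult_mono) (auto simp: L_def le_max_iff_disj)
  finally show "norm (csqrt (of_real \<beta> * s + of_real \<zeta> * t)) \<le> L * t0" by (simp add: D_def)
  have s00: "of_real s0 \<in> ball (complex_of_real s0) r" "of_real t0 \<in> ball (complex_of_real t0) (r * t0)" using r t0p by auto
  define X where "X = norm (s - of_real s0) + norm (t - of_real t0) / t0"
  have "(of_real \<delta> * s + of_real \<epsilon> * t) / D s t - (of_real \<delta> * of_real s0 + of_real \<epsilon> * of_real t0) / D (of_real s0) (of_real t0)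
    = of_real (\<delta> * \<zeta> - \<epsilon> * \<beta>) * ((s - of_real s0) * of_real t0 - of_real s0 * (t - of_real t0)) / (D s t * D (of_real s0) (of_real t0))"
   using Dnz[OF s t] Dnz[OF s00] by (simp add: diff_frac_eq) (simp add: D_def algebra_simps)
  also have "norm \<dots> = Q * norm ((s - of_real s0) * of_real t0 - of_real s0 * (t - of_real t0)) / (norm (D s t) * norm (D (of_real s0) (of_real t0)))"
   unfolding Q_def by (simp only: norm_mult norm_divide norm_of_real real_norm_def)
  also have "\<dots> \<le> Q * ((\<bar>A\<bar> * (\<bar>A\<bar> + 1)) * X) / (b / 2 * b)"
  proof (intro frac_le mult_left_mono)
   have "norm ((s - of_real s0) * of_real t0 - of_real s0 * (t - of_real t0)) \<le> norm (s - of_real s0) * t0 + s0 * norm (t - of_real t0)"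
    using t0p s0 by (intro order_trans[OF norm_triangle_ineq4]) (auto simp: norm_mult)
   also have "\<dots> = t0 * norm (s - of_real s0) + s0 * t0 * (norm (t - of_real t0) / t0)" using t0p by simp
   also have "\<dots> \<le> (\<bar>A\<bar> * (\<bar>A\<bar> + 1)) * norm (s - of_real s0) + (\<bar>A\<bar> * (\<bar>A\<bar> + 1)) * (norm (t - of_real t0) / t0)"
   proof (intro add_mono mult_right_mono)
    have "0 < A * A" "\<bar>A\<bar> * (\<bar>A\<bar> + 1) = A * A + A" "t0 < A" using A t0 by (simp_all add: algebra_simps)
    thus "t0 \<le> \<bar>A\<bar> * (\<bar>A\<bar> + 1)" by linarith
    have "s0 * t0 \<le> A * A" using s0 t0 A t0p by (intro mult_mono) auto
    thus "s0 * t0 \<le> \<bar>A\<bar> * (\<bar>A\<bar> + 1)" using A by (simp add: algebra_simps)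
   qed (use t0p in auto)
   finally show "norm ((s - of_real s0) * of_real t0 - of_real s0 * (t - of_real t0)) \<le> (\<bar>A\<bar> * (\<bar>A\<bar> + 1)) * X"
    by (simp add: X_def distrib_left)
   show "0 \<le> Q * ((\<bar>A\<bar> * (\<bar>A\<bar> + 1)) * X)" using t0p by (auto simp: Q_def X_def intro!: mult_nonneg_nonneg add_nonneg_nonneg)
   have n0: "norm (D (of_real s0) (of_real t0)) \<ge> b" unfolding D0r norm_of_real using D0 by linarith
   show "b / 2 * b \<le> norm (D s t) * norm (D (of_real s0) (of_real t0))"
    using Dc(3)[OF s t] n0 b by (intro mult_mono) auto
   show "0 < b / 2 * b" using b by simp
  qed (simp add: Q_def)
  also have "\<dots> = 2 * Q * (\<bar>A\<bar> * (\<bar>A\<bar> + 1)) / b\<^sup>2 * X" by (simp add: power2_eq_square)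
  also have "\<dots> \<le> L * X" using t0p by (intro mult_right_mono) (auto simp: L_def X_def)
  finally show "norm ((of_real \<delta> * s + of_real \<epsilon> * t) / (of_real \<beta> * s + of_real \<zeta> * t) -
    (of_real \<delta> * of_real s0 + of_real \<epsilon> * of_real t0) / (of_real \<beta> * of_real s0 + of_real \<zeta> * of_real t0))
    \<le> L * (norm (s - of_real s0) + norm (t - of_real t0) / t0)"
   by (simp add: D_def X_def)
 qed
qed

lemma smooth_on_cong: "smooth_on S f ==> (\<And>x. x \<in> S ==> f x = g x) ==> smooth_on S g"
 unfolding smooth_on_def by metis

lemma polyhomogeneous_chart:
 fixes H :: "real => real => complex" and h :: "nat => complex => complex"
 assumes \<alpha>: "\<alpha> > 0" and \<beta>: "\<beta> \<ge> 0" and \<gamma>: "0 \<le> \<gamma>" "\<gamma> \<le> \<alpha>" and \<delta>: "0 \<le> \<delta>" "\<delta> \<le> \<beta>"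
  and h: "\<And>k. h k analytic_on of_real ` {0..1::real}"
  and exp: "\<And>N. \<exists>\<Psi>. kernel N \<Psi> \<and> (\<forall>l>0. \<forall>m\<in>{0..1}.
   H l m - (\<Sum>k\<le>N. h k (of_real m) * of_real l ^ k) = (\<integral>y. \<Psi> y (of_real l) (of_real m) \<partial>lborel))"
  and f: "\<And>s t. s > 0 ==> t > 0 ==> f s t = H (t * sqrt (\<alpha> + \<beta> * s)) ((\<gamma> + \<delta> * s) / (\<alpha> + \<beta> * s))"
 shows "polyhomogeneous index_E f"
proof (rule polyhomogeneousI_no_logs)
 define D where "D s = of_real \<alpha> + of_real \<beta> * s" for s :: complex
 define q where "q s = (of_real \<gamma> + of_real \<delta> * s) / D s" for s :: complex
 have D0: "\<alpha> + \<beta> * s > 0" if "s \<ge> 0" for s using \<alpha> \<beta> that by (auto intro: add_pos_nonneg)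
 have q_real: "q (of_real s) = of_real ((\<gamma> + \<delta> * s) / (\<alpha> + \<beta> * s))" for s by (simp add: q_def D_def)
 have q01: "(\<gamma> + \<delta> * s) / (\<alpha> + \<beta> * s) \<in> {0..1}" if "s \<ge> 0" for s
 proof -
  have "\<gamma> + \<delta> * s \<le> \<alpha> + \<beta> * s" using \<gamma> \<delta> that by (intro add_mono mult_right_mono) auto
  thus ?thesis using D0[OF that] \<gamma> \<delta> that by auto
 qed
 have Dr: "D (of_real s) = of_real (\<alpha> + \<beta> * s)" for s by (simp add: D_def)
 have aD: "D analytic_on S" for S unfolding D_def[abs_def] by (intro analytic_intros)
 have Dnz: "D z \<noteq> 0" "D z \<notin> \<real>\<^sub>\<le>\<^sub>0" if z: "z \<in> of_real ` {0::real..}" for z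
 proof -
  obtain s where s: "s \<ge> 0" "z = of_real s" using z by auto
  show "D z \<notin> \<real>\<^sub>\<le>\<^sub>0" using D0[OF s(1)] unfolding s(2) Dr by (simp add: complex_nonpos_Reals_iff del: of_real_add of_real_mult)
  thus "D z \<noteq> 0" by auto
 qed
 have aq: "q analytic_on (of_real ` {0::real..})" unfolding q_def[abs_def]
  by (intro analytic_on_divide aD analytic_intros Dnz)
 show "smooth_on {0..} (\<lambda>s. h k (q (of_real s)) * csqrt (D (of_real s)) ^ k)" for k
 proof (rule smooth_on_analytic[where g = "\<lambda>z. h k (q z) * csqrt (D z) ^ k"])
  have "h k \<circ> q analytic_on (of_real ` {0::real..})"
  proof (rule analytic_on_compose_gen[OF aq h])
   fix z assume "z \<in> complex_of_real ` {0..}"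
   then obtain s where s: "s \<ge> 0" "z = of_real s" by auto
   show "q z \<in> complex_of_real ` {0..1}" unfolding s(2) q_real by (intro imageI q01 s)
  qed
  moreover have "(\<lambda>z. csqrt (D z)) analytic_on (of_real ` {0::real..})"
   by (rule analytic_on_csqrt'[OF aD Dnz(2)])
  ultimately show "(\<lambda>z. h k (q z) * csqrt (D z) ^ k) analytic_on (of_real ` {0::real..})"
   by (intro analytic_on_mult analytic_on_power) (simp_all add: o_def)
 qed
 fix N
 obtain \<Psi> where \<Psi>: "kernel N \<Psi>" "\<And>l m. l > 0 ==> m \<in> {0..1} ==>
   H l m - (\<Sum>k\<le>N. h k (of_real m) * of_real l ^ k) = (\<integral>y. \<Psi> y (of_real l) (of_real m) \<partial>lborel)"
  using exp[of N] by blast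
 show "\<exists>\<Psi>. bikernel tube N \<Psi> \<and> (\<forall>s>0. \<forall>t>0. f s t - (\<Sum>k\<le>N. h k (q (of_real s)) * csqrt (D (of_real s)) ^ k * of_real t ^ k) = bint \<Psi> s t)"
 proof (intro exI conjI allI impI)
  show "bikernel tube N (\<lambda>y s t. \<Psi> y (t * csqrt (of_real \<alpha> + of_real \<beta> * s)) ((of_real \<gamma> + of_real \<delta> * s) / (of_real \<alpha> + of_real \<beta> * s)))"
   by (rule kernel_chart[OF covers_tube \<Psi>(1) chart_tube[OF \<alpha> \<beta> \<gamma> \<delta>]])
  fix s t :: real assume st: "s > 0" "t > 0"
  define l m where "l = t * sqrt (\<alpha> + \<beta> * s)" and "m = (\<gamma> + \<delta> * s) / (\<alpha> + \<beta> * s)"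
  have l: "l > 0" using st D0[of s] by (simp add: l_def)
  have m: "m \<in> {0..1}" using q01[of s] st by (simp add: m_def)
  have cs: "csqrt (D (of_real s)) = of_real (sqrt (\<alpha> + \<beta> * s))"
   unfolding Dr using D0[of s] st by simp
  have pl: "of_real t * csqrt (of_real \<alpha> + of_real \<beta> * of_real s) = complex_of_real l"
   using cs by (simp add: D_def l_def)
  have qm: "(of_real \<gamma> + of_real \<delta> * of_real s) / (of_real \<alpha> + of_real \<beta> * of_real s) = complex_of_real m"
   using q_real[of s] by (simp add: q_def D_def m_def)
  have "h k (q (of_real s)) * csqrt (D (of_real s)) ^ k * of_real t ^ k = h k (of_real m) * of_real l ^ k" for k
   unfolding cs q_real m_def[symmetric] by (simp add: l_def power_mult_distrib mult_ac)
  thus "f s t - (\<Sum>k\<le>N. h k (q (of_real s)) * csqrt (D (of_real s)) ^ k * of_real t ^ k) =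
    bint (\<lambda>y s t. \<Psi> y (t * csqrt (of_real \<alpha> + of_real \<beta> * s)) ((of_real \<gamma> + of_real \<delta> * s) / (of_real \<alpha> + of_real \<beta> * s))) s t"
   unfolding bint_def pl qm f[OF st] l_def[symmetric] m_def[symmetric] using \<Psi>(2)[OF l m] by simp
 qed
qed

text \<open>
The expansion coefficients \<open>h k m l\<^sup>k\<close> are smooth in each chart; the remainders become integrals of kernels in the
coordinates of the chart. Smoothness off the front face only uses the remainder of order 0.
\<close>
lemma A_loc_of_expansion:
 fixes H :: "real => real => complex" and h :: "nat => complex => complex"
 assumes Z: "Z > 0"
  and h: "\<And>k. h k analytic_on of_real ` {0..1::real}"
  and exp: "\<And>N. \<exists>\<Psi>. kernel N \<Psi> \<and> (\<forall>l>0. \<forall>m\<in>{0..1}.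
   H l m - (\<Sum>k\<le>N. h k (of_real m) * of_real l ^ k) = (\<integral>y. \<Psi> y (of_real l) (of_real m) \<partial>lborel))"
 shows "(\<lambda>E x. H (sqrt (E + Z * x)) (E / (E + Z * x))) \<in> A_loc index_E"
proof -
 define G where "G = (\<lambda>E x. H (sqrt (E + Z * x)) (E / (E + Z * x)))"
 obtain \<Psi>0 where \<Psi>0: "kernel 0 \<Psi>0" "\<And>l m. l > 0 ==> m \<in> {0..1} ==>
   H l m - (\<Sum>k\<le>0. h k (of_real m) * of_real l ^ k) = (\<integral>y. \<Psi>0 y (of_real l) (of_real m) \<partial>lborel)"
  using exp[of 0] by blast
 define \<Psi> where "\<Psi> = (\<lambda>y l m. \<Psi>0 y l m + indicator {0..1} y * h 0 m)"
 have k: "kernel 0 \<Psi>" unfolding \<Psi>_def by (rule kernel_add[OF \<Psi>0(1) kernel_const[OF h]])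
 have H: "H l m = (\<integral>y. \<Psi> y (of_real l) (of_real m) \<partial>lborel)" if lm: "l > 0" "m \<in> {0..1}" for l m
 proof -
  have "(\<integral>y. \<Psi> y (of_real l) (of_real m) \<partial>lborel) =
    (\<integral>y. \<Psi>0 y (of_real l) (of_real m) \<partial>lborel) + (\<integral>y. indicator {0..1::real} y * h 0 (of_real m) \<partial>lborel)"
   unfolding \<Psi>_def by (intro Bochner_Integration.integral_add kernel_integrable[OF \<Psi>0(1) lm] kernel_integrable[OF kernel_const[OF h] lm])
  also have "(\<lambda>y. indicator {0..1::real} y * h 0 (of_real m)) = (\<lambda>y. indicator {0..1::real} y *\<^sub>R h 0 (of_real m))"
   by (auto simp: indicator_def fun_eq_iff)
  also have "(\<integral>y. indicator {0..1::real} y *\<^sub>R h 0 (of_real m) \<partial>lborel) = h 0 (of_real m)"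
   by (subst integral_scaleR_left) auto
  finally have "(\<integral>y. \<Psi> y (of_real l) (of_real m) \<partial>lborel) =
    (\<integral>y. \<Psi>0 y (of_real l) (of_real m) \<partial>lborel) + h 0 (of_real m)" .
  moreover have "H l m = (\<integral>y. \<Psi>0 y (of_real l) (of_real m) \<partial>lborel) + h 0 (of_real m)"
   using \<Psi>0(2)[OF lm] by (simp add: diff_eq_eq)
  ultimately show ?thesis by simp
 qed
 have pos: "E + Z * x > 0" if "E \<ge> 0" "x \<ge> 0" "E > 0 \<or> x > 0" for E x
  using that Z by (auto intro: add_pos_nonneg add_nonneg_pos)
 have csq: "csqrt (of_real E + of_real Z * of_real x) = of_real (sqrt (E + Z * x))" if "E \<ge> 0" "x \<ge> 0" "E > 0 \<or> x > 0" for E x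
 proof -
  have "csqrt (of_real (E + Z * x)) = of_real (sqrt (E + Z * x))" using pos[OF that] by (intro of_real_sqrt[symmetric]) simp
  thus ?thesis by simp
 qed
 have GH: "G E x = (\<integral>y. \<Psi> y (of_real (sqrt (E + Z * x))) (of_real (E / (E + Z * x))) \<partial>lborel)"
  if "E \<ge> 0" "x \<ge> 0" "E > 0 \<or> x > 0" for E x
  unfolding G_def by (rule H) (use pos[OF that] that Z in auto)
 have S1: "smooth_on ({0..} \<times> {0<..}) (\<lambda>(E, x). G E x)"
 proof (rule smooth_on_cong[OF bint_smooth[OF kernel_chart[OF covers_slots k chart_slots[of 1 Z 1 0]]]])
  fix p :: "real \<times> real" assume "p \<in> {0..} \<times> {0<..}"
  then obtain E x where p: "p = (E, x)" "E \<ge> 0" "x > 0" by auto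
  show "(case p of (s, t) => bint (\<lambda>y s t. \<Psi> y (csqrt (of_real 1 * s + of_real Z * t)) ((of_real 1 * s + of_real 0 * t) / (of_real 1 * s + of_real Z * t))) s t) = (case p of (E, x) => G E x)"
   using csq[of E x] GH[of E x] p by (simp add: bint_def)
 qed (use Z in auto)
 have "smooth_on ({0..} \<times> {0<..}) (\<lambda>(x, E). G E x)"
 proof (rule smooth_on_cong[OF bint_smooth[OF kernel_chart[OF covers_slots k chart_slots[of Z 1 0 1]]]])
  fix p :: "real \<times> real" assume "p \<in> {0..} \<times> {0<..}"
  then obtain E x where p: "p = (x, E)" "E > 0" "x \<ge> 0" by auto
  show "(case p of (s, t) => bint (\<lambda>y s t. \<Psi> y (csqrt (of_real Z * s + of_real 1 * t)) ((of_real 0 * s + of_real 1 * t) / (of_real Z * s + of_real 1 * t))) s t) = (case p of (x, E) => G E x)"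
   using csq[of E x] GH[of E x] p by (simp add: bint_def add.commute)
 qed (use Z in auto)
 from smooth_on_swap[OF this] have S2: "smooth_on ({0<..} \<times> {0..}) (\<lambda>(E, x). G E x)"
  by (simp add: case_prod_unfold)
 have set: "{(E::real, x::real). 0 \<le> E \<and> 0 \<le> x \<and> (E, x) \<noteq> (0, 0)} = {0..} \<times> {0<..} \<union> {0<..} \<times> {0..}" by auto
 have smooth: "smooth_on {(E, x). 0 \<le> E \<and> 0 \<le> x \<and> (E, x) \<noteq> (0, 0)} (\<lambda>(E, x). G E x)"
  unfolding set by (rule smooth_on_union_quadrant[OF S1 S2])
 have P1: "polyhomogeneous index_E (\<lambda>s t. G (s * t\<^sup>2) (t\<^sup>2))"
 proof (rule polyhomogeneous_chart[OF _ _ _ _ _ _ h exp, of Z 1 0 1])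
  fix s t :: real assume st: "s > 0" "t > 0"
  have 1: "s * t\<^sup>2 + Z * t\<^sup>2 = t\<^sup>2 * (Z + 1 * s)" by (simp add: algebra_simps)
  have "sqrt (s * t\<^sup>2 + Z * t\<^sup>2) = t * sqrt (Z + 1 * s)" unfolding 1 real_sqrt_mult using st by simp
  moreover have "s * t\<^sup>2 / (s * t\<^sup>2 + Z * t\<^sup>2) = (0 + 1 * s) / (Z + 1 * s)" unfolding 1 using st by simp
  ultimately show "G (s * t\<^sup>2) (t\<^sup>2) = H (t * sqrt (Z + 1 * s)) ((0 + 1 * s) / (Z + 1 * s))" by (simp add: G_def)
 qed (use Z in auto)
 have P2: "polyhomogeneous index_E (\<lambda>s t. G (t\<^sup>2) (s * t\<^sup>2))"
 proof (rule polyhomogeneous_chart[OF _ _ _ _ _ _ h exp, of 1 Z 1 0])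
  fix s t :: real assume st: "s > 0" "t > 0"
  have 1: "t\<^sup>2 + Z * (s * t\<^sup>2) = t\<^sup>2 * (1 + Z * s)" by (simp add: algebra_simps)
  have "sqrt (t\<^sup>2 + Z * (s * t\<^sup>2)) = t * sqrt (1 + Z * s)" unfolding 1 real_sqrt_mult using st by simp
  moreover have "t\<^sup>2 / (t\<^sup>2 + Z * (s * t\<^sup>2)) = (1 + 0 * s) / (1 + Z * s)" unfolding 1 using st by simp
  ultimately show "G (t\<^sup>2) (s * t\<^sup>2) = H (t * sqrt (1 + Z * s)) ((1 + 0 * s) / (1 + Z * s))" by (simp add: G_def)
 qed (use Z in auto)
 have "G \<in> A_loc index_E" unfolding A_loc_def
  using smooth P1 P2 by (intro CollectI conjI exI[of _ "\<lambda>(E, x). G E x"]) auto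
 thus ?thesis by (simp add: G_def)
qed

section \<open>Kernels with decaying phase\<close>

lemma lebesgue_norm_le:
 fixes f :: "'a => 'b::{banach, second_countable_topology}"
 assumes "integrable M f" "integrable M g" "\<And>x. norm (f x) \<le> g x"
 shows "norm (\<integral>x. f x \<partial>M) \<le> (\<integral>x. g x \<partial>M)"
 by (rule order_trans[OF integral_norm_bound integral_mono]) (use assms in auto)

lemma power_le_exp: assumes "(x::real) \<ge> 0" "n > 0" shows "x ^ n \<le> real n ^ n * exp x"
proof -
 have "x / real n \<le> 1 + x / real n" by simp
 hence "(x / real n) ^ n \<le> (1 + x / real n) ^ n" using assms by (intro power_mono) auto
 also have "\<dots> \<le> exp x" by (rule exp_ge_one_plus_x_over_n_power_n) (use assms in auto)
 finally have "x ^ n / real n ^ n \<le> exp x" by (simp add: power_divide)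
 thus ?thesis using assms by (simp add: pos_divide_le_eq mult.commute)
qed

lemma sector_norm_le:
 assumes "l \<in> sector k" "0 < k" "k \<le> 1" shows "norm l \<le> 2 * Re l"
proof -
 have "\<bar>Im l\<bar> < k * Re l" using assms by (simp add: sector_def)
 also have "\<dots> \<le> 1 * Re l" using assms sector_Re_pos[of l k] by (intro mult_right_mono) auto
 finally have "\<bar>Im l\<bar> \<le> Re l" by simp
 thus ?thesis using cmod_le[of l] sector_Re_pos[OF assms(1,2)] by simp
qed

lemma Re_divide_sector:
 assumes l: "l \<in> sector k" "0 < k" "k \<le> 1" and X: "\<bar>Im X\<bar> \<le> M * Re X" "0 \<le> Re X" and M: "M * k \<le> 1/2"
 shows "Re (X / l) \<ge> Re X / (4 * norm l)"
proof -
 have R: "Re l > 0" using sector_Re_pos l by blast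
 hence n: "norm l > 0" by auto
 have I: "\<bar>Im l\<bar> \<le> k * Re l" using l by (simp add: sector_def)
 have "\<bar>Im X * Im l\<bar> \<le> (M * Re X) * (k * Re l)" unfolding abs_mult by (rule mult_mono[OF X(1) I]) (use X in auto)
 also have "\<dots> = (M * k) * (Re X * Re l)" by (simp add: mult_ac)
 also have "\<dots> \<le> 1/2 * (Re X * Re l)" using M X R by (intro mult_right_mono) auto
 finally have "Re X * Re l + Im X * Im l \<ge> 1/2 * (Re X * Re l)" by linarith
 moreover have "1/2 * (Re X * Re l) \<ge> 1/2 * (Re X * (norm l / 2))"
  using sector_norm_le[OF l] X by (intro mult_left_mono) auto
 ultimately have *: "Re X * Re l + Im X * Im l \<ge> Re X * norm l / 4" by simp
 have "Re (X / l) = (Re X * Re l + Im X * Im l) / (norm l)\<^sup>2"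
  by (simp add: Re_divide cmod_power2)
 also have "\<dots> \<ge> (Re X * norm l / 4) / (norm l)\<^sup>2" using * by (intro divide_right_mono) auto
 finally show ?thesis using n by (simp add: power2_eq_square)
qed

text \<open>
Part of the exponent beats every power of \<open>1 / l\<close>; what remains is exponential decay in \<open>y\<close>, uniformly for \<open>l \<le> B\<close>.
\<close>
lemma flat_bound:
 assumes u: "u > 0" and B: "B > 0"
 obtains C where "C \<ge> 0" "\<And>y l. 0 < l ==> l \<le> B ==> inverse (sqrt l) * exp (- (u * (1 + \<bar>y\<bar>)) / l) \<le> C * l ^ N * exp (- (u / B) * \<bar>y\<bar>)"
proof (rule that[of "real (N+1) ^ (N+1) / u ^ (N+1) * sqrt B"])
 fix y l :: real assume l: "0 < l" "l \<le> B"
 have "(u / l) ^ (N+1) \<le> real (N+1) ^ (N+1) * exp (u / l)" using u l by (intro power_le_exp) auto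
 hence "exp (- (u / l)) \<le> real (N+1) ^ (N+1) / (u / l) ^ (N+1)"
  using u l by (simp add: exp_minus field_simps)
 also have "\<dots> = real (N+1) ^ (N+1) / u ^ (N+1) * l ^ (N+1)" by (simp add: power_divide)
 finally have 1: "exp (- (u / l)) \<le> real (N+1) ^ (N+1) / u ^ (N+1) * l ^ (N+1)" .
 have "(u / B) * \<bar>y\<bar> \<le> (u / l) * \<bar>y\<bar>" using u l by (intro mult_right_mono divide_left_mono) auto
 hence 2: "exp (- (u / l) * \<bar>y\<bar>) \<le> exp (- (u / B) * \<bar>y\<bar>)" by simp
 have "inverse (sqrt l) * exp (- (u * (1 + \<bar>y\<bar>)) / l) = inverse (sqrt l) * (exp (- (u / l)) * exp (- (u / l) * \<bar>y\<bar>))"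
  using l by (simp add: field_simps flip: exp_add)
 also have "\<dots> \<le> inverse (sqrt l) * ((real (N+1) ^ (N+1) / u ^ (N+1) * l ^ (N+1)) * exp (- (u / B) * \<bar>y\<bar>))"
  using u l by (intro mult_left_mono mult_mono 1 2) auto
 also have "\<dots> = real (N+1) ^ (N+1) / u ^ (N+1) * (inverse (sqrt l) * l) * l ^ N * exp (- (u / B) * \<bar>y\<bar>)" by (simp add: mult_ac)
 also have "inverse (sqrt l) * l = sqrt l" using l by (simp add: field_simps)
 also have "real (N+1) ^ (N+1) / u ^ (N+1) * sqrt l * l ^ N * exp (- (u / B) * \<bar>y\<bar>) \<le>
    real (N+1) ^ (N+1) / u ^ (N+1) * sqrt B * l ^ N * exp (- (u / B) * \<bar>y\<bar>)"
  using u l by (intro mult_right_mono mult_left_mono) auto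
 finally show "inverse (sqrt l) * exp (- (u * (1 + \<bar>y\<bar>)) / l) \<le> real (N+1) ^ (N+1) / u ^ (N+1) * sqrt B * l ^ N * exp (- (u / B) * \<bar>y\<bar>)" .
qed (use u B in auto)

text \<open>
Pieces of the contour that stay away from the critical point contribute to no power of \<open>l\<close>. The cone condition on \<open>X\<close>
leaves room for \<open>l\<close> in a small sector.
\<close>
lemma tail_kernel:
 fixes X G :: "real => complex => complex"
 assumes Z: "Z > 0" and c: "c > 0" and a: "a > 0" and M: "M > 0"
  and hX: "\<And>y U g. y \<in> Y ==> open U ==> g holomorphic_on U ==> g ` U \<subseteq> nbh c y ==> (\<lambda>z. X y (g z)) holomorphic_on U"
  and hG: "\<And>y U g. y \<in> Y ==> open U ==> g holomorphic_on U ==> g ` U \<subseteq> nbh c y ==> (\<lambda>z. G y (g z)) holomorphic_on U"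
  and mX: "\<And>m. m \<in> {0..1} ==> (\<lambda>y. indicator Y y *\<^sub>R X y (of_real m)) \<in> borel_measurable borel"
  and mG: "\<And>m. m \<in> {0..1} ==> (\<lambda>y. indicator Y y *\<^sub>R G y (of_real m)) \<in> borel_measurable borel"
  and bX: "\<And>y m. y \<in> Y ==> m \<in> nbh c y ==> a * (1 + \<bar>y\<bar>) \<le> Re (X y m) \<and> \<bar>Im (X y m)\<bar> \<le> M * Re (X y m)"
  and bG: "\<And>y m. y \<in> Y ==> m \<in> nbh c y ==> norm (G y m) \<le> K"
  and K: "K \<ge> 0"
 shows "kernel N (\<lambda>y l m. indicator Y y *\<^sub>R (inverse (csqrt l) * exp (- (of_real Z / l) * X y m) * G y m))"
proof -
 \<comment> \<open>for \<open>l\<close> in this sector, rotating \<open>X\<close> by the argument of \<open>1 / l\<close> keeps half of its real part\<close>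
 define k where "k = min 1 (1 / (2 * M))"
 have k: "k > 0" "k \<le> 1" "M * k \<le> 1/2" using M by (auto simp: k_def min_def field_simps)
 have nz: "l \<noteq> 0" "l \<notin> \<real>\<^sub>\<le>\<^sub>0" if "l \<in> sector k" for l
  using sector_Re_pos[OF that k(1)] sector_not_nonpos[OF that k(1)] by auto
 show ?thesis
 proof (rule kernelI[OF c k(1)])
  fix y U f g assume U: "open U" "f holomorphic_on U" "g holomorphic_on U" "f ` U \<subseteq> sector k" "g ` U \<subseteq> nbh c y"
  have fz: "f z \<noteq> 0" "f z \<notin> \<real>\<^sub>\<le>\<^sub>0" "csqrt (f z) \<noteq> 0" if "z \<in> U" for z using nz[of "f z"] U(4) that by auto
  show "(\<lambda>z. indicator Y y *\<^sub>R (inverse (csqrt (f z)) * exp (- (of_real Z / f z) * X y (g z)) * G y (g z))) holomorphic_on U"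
  proof (cases "y \<in> Y")
   case True
   have "(\<lambda>z. inverse (csqrt (f z)) * exp (- (of_real Z / f z) * X y (g z)) * G y (g z)) holomorphic_on U"
    by (intro holomorphic_on_mult holomorphic_on_inverse holomorphic_on_csqrt' holomorphic_on_exp' holomorphic_on_minus
      holomorphic_on_divide holomorphic_on_const hX hG True U fz)
   thus ?thesis using True by simp
  qed simp
 next
  fix l m :: real assume l: "l > 0" and m: "m \<in> {0..1}"
  define A D where "A = (\<lambda>y. indicator Y y *\<^sub>R X y (of_real m))" and "D = (\<lambda>y. indicator Y y *\<^sub>R G y (of_real m))"
  have [measurable]: "A \<in> borel_measurable borel" "D \<in> borel_measurable borel"
   unfolding A_def D_def by (rule mX[OF m], rule mG[OF m])
  have "(\<lambda>y. inverse (csqrt (of_real l)) * exp (- (of_real Z / of_real l) * A y) * D y) \<in> borel_measurable borel"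
   by measurable
  moreover have "(\<lambda>y. inverse (csqrt (of_real l)) * exp (- (of_real Z / of_real l) * A y) * D y) =
   (\<lambda>y. indicator Y y *\<^sub>R (inverse (csqrt (of_real l)) * exp (- (of_real Z / of_real l) * X y (of_real m)) * G y (of_real m)))"
   by (auto simp: fun_eq_iff indicator_def A_def D_def)
  ultimately show "(\<lambda>y. indicator Y y *\<^sub>R (inverse (csqrt (of_real l)) * exp (- (of_real Z / of_real l) * X y (of_real m)) * G y (of_real m))) \<in> borel_measurable borel"
   by (simp only:)
 next
  fix B :: real assume B: "B > 0"
  define u where "u = Z * a / 4"
  have u: "u > 0" using Z a by (simp add: u_def)
  obtain C where C: "C \<ge> 0" "\<And>y l. 0 < l ==> l \<le> B ==> inverse (sqrt l) * exp (- (u * (1 + \<bar>y\<bar>)) / l) \<le> C * l ^ N * exp (- (u / B) * \<bar>y\<bar>)"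
   using flat_bound[OF u B] by blast
  show "\<exists>C. \<exists>d>0. \<forall>y. \<forall>l\<in>sector k. \<forall>m\<in>nbh c y. norm l \<le> B -->
    norm (indicator Y y *\<^sub>R (inverse (csqrt l) * exp (- (of_real Z / l) * X y m) * G y m)) \<le> C * norm l ^ N * exp (- d * \<bar>y\<bar>)"
  proof (rule exI[of _ "C * K"], rule exI[of _ "u / B"], intro conjI allI ballI impI)
   show "u / B > 0" using u B by simp
   fix y l m assume l: "l \<in> sector k" and m: "m \<in> nbh c y" and lB: "norm l \<le> B"
   have l0: "norm l > 0" using nz[OF l] by simp
   show "norm (indicator Y y *\<^sub>R (inverse (csqrt l) * exp (- (of_real Z / l) * X y m) * G y m)) \<le> C * K * norm l ^ N * exp (- (u / B) * \<bar>y\<bar>)"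
   proof (cases "y \<in> Y")
    case True
    note bx = bX[OF True m]
    have R0: "0 \<le> Re (X y m)" using bx a by (smt (verit) mult_nonneg_nonneg abs_ge_zero)
    have "Re (X y m / l) \<ge> Re (X y m) / (4 * norm l)"
     by (rule Re_divide_sector[OF l k(1,2) _ R0 k(3)]) (use bx in auto)
    moreover have "Re (X y m) / (4 * norm l) \<ge> a * (1 + \<bar>y\<bar>) / (4 * norm l)" using bx l0 by (intro divide_right_mono) auto
    ultimately have "Z * Re (X y m / l) \<ge> Z * (a * (1 + \<bar>y\<bar>) / (4 * norm l))" using Z by (intro mult_left_mono) auto
    moreover have "of_real Z / l * X y m = of_real Z * (X y m / l)" by simp
    hence "Re (of_real Z / l * X y m) = Z * Re (X y m / l)" by (simp only: Re_complex_of_real Im_complex_of_real times_complex.sel mult_zero_left diff_0_right)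
    ultimately have ex: "- Re (of_real Z / l * X y m) \<le> - (u * (1 + \<bar>y\<bar>)) / norm l"
     by (simp add: u_def)
    have "norm (exp (- (of_real Z / l) * X y m)) = exp (- Re (of_real Z / l * X y m))" by (simp add: norm_exp_eq_Re)
    also have "\<dots> \<le> exp (- (u * (1 + \<bar>y\<bar>)) / norm l)" using ex by simp
    finally have "norm (inverse (csqrt l) * exp (- (of_real Z / l) * X y m)) \<le> inverse (sqrt (norm l)) * exp (- (u * (1 + \<bar>y\<bar>)) / norm l)"
     unfolding norm_mult norm_inverse norm_csqrt by (intro mult_left_mono) auto
    also have "\<dots> \<le> C * norm l ^ N * exp (- (u / B) * \<bar>y\<bar>)" by (rule C(2)[OF l0 lB])
    finally have "norm (inverse (csqrt l) * exp (- (of_real Z / l) * X y m) * G y m) \<le> C * norm l ^ N * exp (- (u / B) * \<bar>y\<bar>) * K"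
     unfolding norm_mult[of _ "G y m"] using bG[OF True m] C(1) by (intro mult_mono mult_nonneg_nonneg) auto
    thus ?thesis using True by (simp add: mult_ac)
   qed (use C K in auto)
  qed
 qed
qed

section \<open>The phase\<close>

text \<open>
The phase \<open>F\<close> is normalised by \<open>F 0 = 0\<close> and \<open>F' Q = Q * kap Q n\<close>. Hence \<open>F Q = Q\<^sup>2 * ht Q n\<close> with \<open>ht\<close> the average below, so that
\<open>ht\<close> is regular at the critical point and equals 1 there.
\<close>
definition kap :: "complex => complex => complex" where
 "kap q n = (2 + n * q) / (1 + 2 * q + n * q\<^sup>2)"

definition ht :: "complex => complex => complex" where
 "ht q n = (\<integral>x. indicator {0..1} x *\<^sub>R (of_real x * kap (q * of_real x) n) \<partial>lborel)"

text \<open>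
The segment from 0 to \<open>q\<close> avoids the poles of \<open>kap\<close>.
\<close>
definition good :: "real => complex => complex => bool" where
 "good B q n \<longleftrightarrow> (\<forall>x\<in>{0..1}. 1 + 2 * (q * of_real x) + n * (q * of_real x)\<^sup>2 \<noteq> 0 \<and> norm (kap (q * of_real x) n) \<le> B)"

lemma kap_measurable: "(\<lambda>x. indicator {0..1} x *\<^sub>R (of_real x * kap (q * of_real x) n)) \<in> borel_measurable borel"
proof -
 have "(\<lambda>x::real. 2 + n * (q * of_real x)) \<in> borel_measurable borel"
  "(\<lambda>x::real. 1 + 2 * (q * of_real x) + n * (q * of_real x)\<^sup>2) \<in> borel_measurable borel"
  "(\<lambda>x::real. complex_of_real x) \<in> borel_measurable borel"
  by (intro borel_measurable_continuous_onI continuous_intros)+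
 thus ?thesis unfolding kap_def
  by (intro borel_measurable_scaleR borel_measurable_times borel_measurable_divide borel_measurable_indicator) auto
qed

lemma ht_measurable:
 fixes q :: "real => complex"
 assumes [measurable]: "q \<in> borel_measurable borel"
 shows "(\<lambda>y. ht (q y) n) \<in> borel_measurable borel"
proof -
 have [measurable]: "(\<lambda>x::real \<times> real. kap (q (fst x) * of_real (snd x)) n) \<in> borel_measurable (borel \<Otimes>\<^sub>M lborel)"
  unfolding kap_def by measurable
 show ?thesis unfolding ht_def
  by (rule lborel.borel_measurable_lebesgue_integral) (simp add: case_prod_unfold)
qed

lemma unit_interval_integrable:
 fixes f :: "real => complex"
 assumes "(\<lambda>x. indicator {0..1} x *\<^sub>R f x) \<in> borel_measurable borel" "\<And>x. x \<in> {0..1} ==> norm (f x) \<le> B"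
 shows "integrable lborel (\<lambda>x. indicator {0..1} x *\<^sub>R f x)"
  and "norm (\<integral>x. indicator {0..1} x *\<^sub>R f x \<partial>lborel) \<le> B"
proof -
 have iB: "integrable lborel (\<lambda>x. indicator {0..1::real} x *\<^sub>R B)" by (intro integrable_scaleR_left) simp
 have b: "norm (indicator {0..1} x *\<^sub>R f x) \<le> indicator {0..1} x *\<^sub>R B" for x
  using assms(2)[of x] by (cases "x \<in> {0..1}") auto
 show i: "integrable lborel (\<lambda>x. indicator {0..1} x *\<^sub>R f x)"
  by (rule Bochner_Integration.integrable_bound[OF iB])
   (use assms(1) b in \<open>auto intro!: AE_I2 order_trans[OF b] simp del: norm_scaleR\<close>)
 have "norm (\<integral>x. indicator {0..1} x *\<^sub>R f x \<partial>lborel) \<le> (\<integral>x. norm (indicator {0..1} x *\<^sub>R f x) \<partial>lborel)"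
  by (rule integral_norm_bound)
 also have "\<dots> \<le> (\<integral>x. indicator {0..1::real} x *\<^sub>R B \<partial>lborel)"
  by (intro integral_mono integrable_norm i iB b)
 also have "\<dots> = B" by (subst integral_scaleR_left) auto
 finally show "norm (\<integral>x. indicator {0..1} x *\<^sub>R f x \<partial>lborel) \<le> B" .
qed

lemma ht_integrable:
 assumes "good B q n"
 shows "integrable lborel (\<lambda>x. indicator {0..1} x *\<^sub>R (of_real x * kap (q * of_real x) n))"
proof (rule unit_interval_integrable(1)[OF kap_measurable, where B = B])
 fix x :: real assume x: "x \<in> {0..1}"
 have "norm (of_real x * kap (q * of_real x) n) \<le> 1 * B"
  unfolding norm_mult using x assms by (intro mult_mono) (auto simp: good_def)
 thus "norm (of_real x * kap (q * of_real x) n) \<le> B" by simp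
qed

lemma ht_holomorphic:
 assumes U: "open U" "f holomorphic_on U" "g holomorphic_on U" and good: "\<And>z. z \<in> U ==> good B (f z) (g z)"
 shows "(\<lambda>z. ht (f z) (g z)) holomorphic_on U"
 unfolding ht_def
proof (rule integral_holomorphic_param[OF U(1)])
 fix x :: real
 show "(\<lambda>z. indicator {0..1} x *\<^sub>R (of_real x * kap (f z * of_real x) (g z))) holomorphic_on U"
 proof (cases "x \<in> {0..1}")
  case True
  hence nz: "1 + 2 * (f z * of_real x) + g z * (f z * of_real x)\<^sup>2 \<noteq> 0" if "z \<in> U" for z
   using good[OF that] by (auto simp: good_def)
  have "(\<lambda>z. of_real x * kap (f z * of_real x) (g z)) holomorphic_on U"
   unfolding kap_def by (intro holomorphic_intros U nz)
  thus ?thesis using True by simp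
 qed simp
next
 fix z assume z: "z \<in> U"
 show "(\<lambda>x. indicator {0..1} x *\<^sub>R (of_real x * kap (f z * of_real x) (g z))) \<in> borel_measurable lborel"
  using kap_measurable[of "f z" "g z"] by simp
 show "\<exists>r>0. \<exists>Bf. integrable lborel Bf \<and> (\<forall>s. \<forall>w\<in>ball z r \<inter> U. norm (indicator {0..1} s *\<^sub>R (of_real s * kap (f w * of_real s) (g w))) \<le> Bf s)"
 proof (intro exI[of _ 1] conjI exI[of _ "\<lambda>x. indicator {0..1::real} x *\<^sub>R B"] allI ballI)
  show "integrable lborel (\<lambda>x. indicator {0..1::real} x *\<^sub>R B)" by (intro integrable_scaleR_left) simp
  fix s :: real and w assume w: "w \<in> ball z 1 \<inter> U"
  show "norm (indicator {0..1} s *\<^sub>R (of_real s * kap (f w * of_real s) (g w))) \<le> indicator {0..1} s *\<^sub>R B"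
  proof (cases "s \<in> {0..1}")
   case True
   have "norm (of_real s * kap (f w * of_real s) (g w)) \<le> 1 * B"
    unfolding norm_mult using True good[of w] w by (intro mult_mono) (auto simp: good_def)
   thus ?thesis using True by simp
  qed simp
 qed simp
qed

lemma kap_small:
 assumes q: "norm q \<le> 1/24" and n: "norm n \<le> 2"
 shows "1 + 2 * q + n * q\<^sup>2 \<noteq> 0" "norm (kap q n - 2) \<le> 1/2" "norm (kap q n) \<le> 3"
proof -
 have n2: "norm (n * q\<^sup>2) \<le> 2 * (1/24)\<^sup>2" unfolding norm_mult norm_power using q n by (intro mult_mono power_mono) auto
 have nq: "norm (n * q) \<le> 2 * (1/24)" unfolding norm_mult using q n by (intro mult_mono) auto
 have "norm (1::complex) \<le> norm (1 + 2 * q + n * q\<^sup>2) + norm (2 * q + n * q\<^sup>2)"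
  by (metis add.assoc add_diff_cancel_right' norm_triangle_ineq4)
 also have "norm (2 * q + n * q\<^sup>2) \<le> 2 * (1/24) + 2 * (1/24)\<^sup>2"
  using q n2 by (intro order_trans[OF norm_triangle_ineq] add_mono) (auto simp: norm_mult)
 finally have D: "norm (1 + 2 * q + n * q\<^sup>2) \<ge> 9/10" by (simp add: power2_eq_square)
 thus D0: "1 + 2 * q + n * q\<^sup>2 \<noteq> 0" by auto
 have "kap q n - 2 = (n * q - 4 * q - 2 * (n * q\<^sup>2)) / (1 + 2 * q + n * q\<^sup>2)"
  using D0 by (simp add: kap_def divide_diff_eq_iff algebra_simps)
 also have "norm \<dots> \<le> (2 * (1/24) + 4 * (1/24) + 2 * (2 * (1/24)\<^sup>2)) / (9/10)"
  unfolding norm_divide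
 proof (intro frac_le D)
  have "norm (n * q - 4 * q - 2 * (n * q\<^sup>2)) \<le> norm (n * q) + norm (4 * q) + norm (2 * (n * q\<^sup>2))"
   by (meson norm_triangle_ineq4 order_trans add_right_mono)
  also have "\<dots> \<le> 2 * (1/24) + 4 * (1/24) + 2 * (2 * (1/24)\<^sup>2)" using q nq n2 by (intro add_mono) (auto simp: norm_mult)
  finally show "norm (n * q - 4 * q - 2 * (n * q\<^sup>2)) \<le> 2 * (1/24) + 4 * (1/24) + 2 * (2 * (1/24)\<^sup>2)" .
 qed auto
 also have "\<dots> \<le> 1/2" by (simp add: power2_eq_square)
 finally show k2: "norm (kap q n - 2) \<le> 1/2" .
 thus "norm (kap q n) \<le> 3" using norm_triangle_sub[of "kap q n" 2] by simp
qed

lemma good_small: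
 assumes q: "norm q \<le> 1/24" and n: "norm n \<le> 2" shows "good 3 q n"
 unfolding good_def
proof
 fix x :: real assume x: "x \<in> {0..1}"
 have "norm (q * of_real x) \<le> 1/24 * 1" unfolding norm_mult using q x by (intro mult_mono) auto
 thus "1 + 2 * (q * of_real x) + n * (q * of_real x)\<^sup>2 \<noteq> 0 \<and> norm (kap (q * of_real x) n) \<le> 3"
  using kap_small[of "q * of_real x" n] n by simp
qed

lemma integral_unit_id: "(\<integral>x. indicator {0..1::real} x *\<^sub>R complex_of_real x \<partial>lborel) = 1/2"
 and integrable_unit_id: "integrable lborel (\<lambda>x. indicator {0..1::real} x *\<^sub>R complex_of_real x)"
proof -
 have "(\<integral>x. indicator {0..1::real} x *\<^sub>R complex_of_real x \<partial>lborel) = (of_real 1)\<^sup>2/2 - (of_real 0)\<^sup>2/2"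
 proof (rule integral_FTC_atLeastAtMost[where F = "\<lambda>x. (of_real x)\<^sup>2/2"])
  fix x :: real
  show "((\<lambda>x. (complex_of_real x)\<^sup>2/2) has_vector_derivative of_real x) (at x within {0..1})"
   by (rule has_vector_derivative_real_field) (auto intro!: derivative_eq_intros)
 qed (auto intro!: continuous_intros)
 thus "(\<integral>x. indicator {0..1::real} x *\<^sub>R complex_of_real x \<partial>lborel) = 1/2" by simp
 show "integrable lborel (\<lambda>x. indicator {0..1::real} x *\<^sub>R complex_of_real x)"
  using borel_integrable_atLeastAtMost'[of 0 1 complex_of_real] by (simp add: set_integrable_def continuous_on_of_real_id)
qed

lemma ht_small:
 assumes q: "norm q \<le> 1/24" and n: "norm n \<le> 2" shows "norm (ht q n - 1) \<le> 1/4"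
proof -
 have i2: "integrable lborel (\<lambda>x. indicator {0..1::real} x *\<^sub>R (2 * complex_of_real x))"
  using integrable_mult_right[OF integrable_unit_id, of 2] by (simp add: mult.commute)
 have e2: "(\<integral>x. indicator {0..1::real} x *\<^sub>R (2 * complex_of_real x) \<partial>lborel) = 1"
 proof -
  have eq: "(\<lambda>x. indicator {0..1::real} x *\<^sub>R (2 * complex_of_real x)) = (\<lambda>x. 2 * (indicator {0..1::real} x *\<^sub>R complex_of_real x))" by auto
  show ?thesis unfolding eq by (subst integral_mult_right_zero, subst integral_unit_id) simp
 qed
 have "ht q n - 1 = (\<integral>x. indicator {0..1} x *\<^sub>R (of_real x * kap (q * of_real x) n) - indicator {0..1} x *\<^sub>R (2 * complex_of_real x) \<partial>lborel)"
  unfolding ht_def using ht_integrable[OF good_small[OF q n]] i2 e2 by simp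
 also have "norm \<dots> \<le> (\<integral>x. indicator {0..1} x *\<^sub>R (x / 2) \<partial>lborel)"
 proof (rule lebesgue_norm_le)
  show "integrable lborel (\<lambda>x. indicator {0..1} x *\<^sub>R (of_real x * kap (q * of_real x) n) - indicator {0..1} x *\<^sub>R (2 * complex_of_real x))"
   using ht_integrable[OF good_small[OF q n]] i2 by simp
  show "integrable lborel (\<lambda>x. indicator {0..1} x *\<^sub>R (x / 2 :: real))"
   using borel_integrable_atLeastAtMost'[of 0 1 "\<lambda>x::real. x / 2"] by (simp add: set_integrable_def continuous_intros)
  fix x :: real
  show "norm (indicator {0..1} x *\<^sub>R (of_real x * kap (q * of_real x) n) - indicator {0..1} x *\<^sub>R (2 * complex_of_real x)) \<le> indicator {0..1} x *\<^sub>R (x / 2)"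
  proof (cases "x \<in> {0..1}")
   case True
   have "norm (q * of_real x) \<le> 1/24 * 1" unfolding norm_mult using q True by (intro mult_mono) auto
   hence "norm (kap (q * of_real x) n - 2) \<le> 1/2" using kap_small(2)[of "q * of_real x" n] n by simp
   hence "norm (of_real x * (kap (q * of_real x) n - 2)) \<le> x * (1/2)" unfolding norm_mult using True by (intro mult_mono) auto
   thus ?thesis using True by (simp add: algebra_simps)
  qed simp
 qed
 also have "(\<integral>x. indicator {0..1} x *\<^sub>R (x / 2) \<partial>lborel) = (1::real)\<^sup>2/4 - 0\<^sup>2/4"
  by (rule integral_FTC_atLeastAtMost)
   (auto intro!: derivative_eq_intros continuous_intros simp flip: has_real_derivative_iff_has_vector_derivative)
 finally show ?thesis by simp
qed

section \<open>The left tail\<close>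

text \<open>
The direction of steepest descent at the critical point: \<open>\<i> \<omega>\<^sup>2 = 1\<close>.
\<close>
definition \<omega> :: complex where "\<omega> = Complex (sqrt 2 / 2) (- (sqrt 2 / 2))"

lemma \<omega>: "Re \<omega> = sqrt 2 / 2" "Im \<omega> = - (sqrt 2 / 2)" "\<omega>\<^sup>2 = - \<i>" "norm \<omega> = 1" "\<omega> \<noteq> 0"
proof -
 show 1: "Re \<omega> = sqrt 2 / 2" "Im \<omega> = - (sqrt 2 / 2)" by (auto simp: \<omega>_def)
 show "\<omega>\<^sup>2 = - \<i>" by (simp add: complex_eq_iff 1 power2_eq_square)
 show "norm \<omega> = 1" by (simp add: cmod_def 1 power_divide)
 thus "\<omega> \<noteq> 0" by auto
qed

lemma i_\<omega>_sq: "\<i> * (\<omega> * of_real s)\<^sup>2 = of_real (s\<^sup>2)" "(\<omega> * of_real s)\<^sup>2 = - \<i> * of_real (s\<^sup>2)"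
 by (simp_all add: power_mult_distrib \<omega>(3) flip: mult.assoc)

lemma cone_norm: "\<bar>Im z\<bar> \<le> Re z ==> norm z \<le> 2 * Re z"
 using cmod_le[of z] by simp

text \<open>
\<open>kap q n = 1 / (q + 1 / (2 + n q))\<close>, and the cone \<open>|Im| \<le> Re\<close> is closed under sums and inverses and contains \<open>q\<close>. This settles
real \<open>n\<close>; complex \<open>n\<close> is a small perturbation.
\<close>
lemma left_kap:
 assumes s: "s \<ge> 0" and n0: "n0 \<in> {0..1}" and n: "norm (n - of_real n0) * s \<le> 1/4" "norm (n - of_real n0) \<le> 1/4"
 defines "q \<equiv> \<omega> * of_real s"
 shows "1 + 2 * q + n * q\<^sup>2 \<noteq> 0" "norm (kap q n) \<le> 8" "\<bar>Im (kap q n)\<bar> \<le> Re (kap q n)" "Re (kap q n) \<ge> 1 / (2 * (1 + s))"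
proof -
 define B where "B = 2 + n * q"
 define e where "e = (n - of_real n0) * q"
 have q: "Re q = sqrt 2 / 2 * s" "Im q = - (sqrt 2 / 2 * s)" "norm q = s" using s by (auto simp: q_def \<omega> norm_mult)
 have e: "norm e \<le> 1/4" using n by (simp add: e_def norm_mult q)
 have Be: "B = 2 + of_real n0 * q + e" by (simp add: B_def e_def algebra_simps)
 have R: "Re B = 2 + n0 * (sqrt 2 / 2 * s) + Re e" "Im B = - (n0 * (sqrt 2 / 2 * s)) + Im e" by (simp_all add: Be q)
 have ns: "0 \<le> n0 * (sqrt 2 / 2 * s)" using n0 s by simp
 have ee: "\<bar>Re e\<bar> \<le> 1/4" "\<bar>Im e\<bar> \<le> 1/4" using e abs_Re_le_cmod[of e] abs_Im_le_cmod[of e] by linarith+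
 have B1: "Re B \<ge> 7/4" "\<bar>Im B\<bar> \<le> Re B" using R ns ee by linarith+
 hence B0: "B \<noteq> 0" "norm B > 0" by auto
 have nB: "norm B \<le> 2 * Re B" by (rule cone_norm[OF B1(2)])
 have nB2: "norm B \<le> 9/4 + s"
 proof -
  have "norm B \<le> norm (2 :: complex) + norm (of_real n0 * q) + norm e" unfolding Be
   by (meson norm_triangle_ineq order_trans add_right_mono)
  moreover have "norm (of_real n0 * q) \<le> 1 * s" unfolding norm_mult q using n0 s by (intro mult_right_mono) auto
  ultimately show ?thesis using e by simp
 qed
 define D where "D = q + inverse B"
 have ReI: "Re (inverse B) = Re B / (norm B)\<^sup>2" "Im (inverse B) = - Im B / (norm B)\<^sup>2" by (simp_all add: cmod_power2)
 have cI: "\<bar>Im (inverse B)\<bar> \<le> Re (inverse B)" unfolding ReI using B1 by (simp add: divide_right_mono)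
 have "Re (inverse B) \<ge> 1 / (2 * norm B)"
  unfolding ReI using nB B0(2) by (simp add: power2_eq_square field_simps)
 moreover have "1 / (2 * norm B) \<ge> 1 / (2 * (9/4 + s))" using nB2 B0(2) s by (intro divide_left_mono) auto
 ultimately have RI: "Re (inverse B) \<ge> 1 / (2 * (9/4 + s))" by linarith
 have s2: "sqrt 2 / 2 \<ge> 1/2" by simp
 have RD: "Re D = sqrt 2 / 2 * s + Re (inverse B)" by (simp add: D_def q)
 have "sqrt 2 / 2 * s \<ge> 1/2 * s" using s s2 by (rule mult_right_mono[rotated])
 hence RD1: "Re D \<ge> s / 2 + 1 / (2 * (9/4 + s))" using RD RI by simp
 have RD8: "Re D \<ge> 1/8"
 proof (cases "s \<ge> 1/4")
  case True
  have "1 / (2 * (9/4 + s)) \<ge> 0" using s by simp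
  thus ?thesis using RD1 True by linarith
 next
  case False
  have "1 / (2 * (9/4 + s)) \<ge> 1 / (2 * (9/4 + 1/4))" using False s by (intro divide_left_mono) auto
  moreover have "1 / (2 * (9/4 + 1/4)) = (1/5 :: real)" by simp
  ultimately show ?thesis using RD1 s by linarith
 qed
 have cD: "\<bar>Im D\<bar> \<le> Re D"
 proof -
  have "Im D = - (sqrt 2 / 2 * s) + Im (inverse B)" by (simp only: D_def plus_complex.sel q)
  moreover have "sqrt 2 / 2 * s \<ge> 0" using s by simp
  ultimately have "\<bar>Im D\<bar> \<le> sqrt 2 / 2 * s + \<bar>Im (inverse B)\<bar>" by linarith
  thus ?thesis using cI RD by linarith
 qed
 have D0: "D \<noteq> 0" "norm D > 0" using RD8 by auto
 have c: "1 + 2 * q + n * q\<^sup>2 = B * D" using B0 by (simp add: D_def distrib_left) (simp add: B_def algebra_simps power2_eq_square)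
 thus "1 + 2 * q + n * q\<^sup>2 \<noteq> 0" using B0 D0 by simp
 have kap: "kap q n = inverse D" unfolding kap_def c B_def[symmetric] using B0 by (simp add: inverse_eq_divide)
 have "norm D \<ge> 1/8" using RD8 complex_Re_le_cmod[of D] by linarith
 thus "norm (kap q n) \<le> 8" unfolding kap norm_inverse using D0 by (simp add: inverse_eq_divide divide_le_eq)
 have RK: "Re (kap q n) = Re D / (norm D)\<^sup>2" "Im (kap q n) = - Im D / (norm D)\<^sup>2" unfolding kap by (simp_all add: cmod_power2)
 show "\<bar>Im (kap q n)\<bar> \<le> Re (kap q n)" unfolding RK using cD by (simp add: divide_right_mono)
 have nD: "norm D \<le> 2 * Re D" by (rule cone_norm[OF cD])
 have "norm D \<le> s + 1 / norm B" using norm_triangle_ineq[of q "inverse B"] by (simp add: D_def q norm_divide inverse_eq_divide)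
 also have "1 / norm B \<le> 1" using B1 complex_Re_le_cmod[of B] B0 by (simp add: divide_le_eq)
 finally have nD2: "norm D \<le> 1 + s" by simp
 have "1 / (2 * (1 + s)) \<le> 1 / (2 * norm D)" using nD2 D0 s by (intro divide_left_mono) auto
 also have "\<dots> \<le> Re (kap q n)" unfolding RK using nD D0 by (simp add: power2_eq_square field_simps)
 finally show "Re (kap q n) \<ge> 1 / (2 * (1 + s))" .
qed

lemma left_ht:
 assumes s: "s \<ge> 0" and n0: "n0 \<in> {0..1}" and n: "norm (n - of_real n0) * s \<le> 1/4" "norm (n - of_real n0) \<le> 1/4"
 shows "good 8 (\<omega> * of_real s) n" "\<bar>Im (ht (\<omega> * of_real s) n)\<bar> \<le> Re (ht (\<omega> * of_real s) n)"
  "Re (ht (\<omega> * of_real s) n) \<ge> 1 / (4 * (1 + s))"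
proof -
 define q where "q = \<omega> * of_real s"
 have qx: "q * of_real x = \<omega> * of_real (s * x)" for x by (simp add: q_def)
 have K: "1 + 2 * (q * of_real x) + n * (q * of_real x)\<^sup>2 \<noteq> 0" "norm (kap (q * of_real x) n) \<le> 8"
  "\<bar>Im (kap (q * of_real x) n)\<bar> \<le> Re (kap (q * of_real x) n)" "Re (kap (q * of_real x) n) \<ge> 1 / (2 * (1 + s))"
  if x: "x \<in> {0..1}" for x
 proof -
  have "s * x \<le> s * 1" using s x by (intro mult_left_mono) auto
  hence sx: "s * x \<ge> 0" "s * x \<le> s" using s x by auto
  have "norm (n - of_real n0) * (s * x) \<le> norm (n - of_real n0) * s" using sx by (intro mult_left_mono) auto
  hence n': "norm (n - of_real n0) * (s * x) \<le> 1/4" using n by simp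
  note L = left_kap[OF sx(1) n0 n' n(2)]
  show "1 + 2 * (q * of_real x) + n * (q * of_real x)\<^sup>2 \<noteq> 0" "norm (kap (q * of_real x) n) \<le> 8"
   "\<bar>Im (kap (q * of_real x) n)\<bar> \<le> Re (kap (q * of_real x) n)" unfolding qx using L by auto
  have "1 / (2 * (1 + s)) \<le> 1 / (2 * (1 + s * x))" using sx s by (intro divide_left_mono) auto
  thus "Re (kap (q * of_real x) n) \<ge> 1 / (2 * (1 + s))" unfolding qx using L(4) by linarith
 qed
 show g: "good 8 (\<omega> * of_real s) n" using K(1,2) unfolding good_def q_def by blast
 note i = ht_integrable[OF g, folded q_def]
 define kr where "kr x = indicator {0..1} x *\<^sub>R (of_real x * kap (q * of_real x) n)" for x
 have ikr: "integrable lborel kr" unfolding kr_def[abs_def] by (rule i)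
 have h: "ht q n = (\<integral>x. kr x \<partial>lborel)" by (simp add: ht_def kr_def)
 have Re: "Re (ht q n) = (\<integral>x. Re (kr x) \<partial>lborel)" unfolding h by (rule integral_Re[symmetric, OF ikr])
 have Im: "Im (ht q n) = (\<integral>x. Im (kr x) \<partial>lborel)" unfolding h by (rule integral_Im[symmetric, OF ikr])
 have "\<bar>Im (ht q n)\<bar> \<le> (\<integral>x. Re (kr x) \<partial>lborel)" unfolding Im real_norm_def[symmetric]
 proof (rule lebesgue_norm_le)
  fix x :: real
  show "norm (Im (kr x)) \<le> Re (kr x)"
  proof (cases "x \<in> {0..1}")
   case True thus ?thesis using K(3)[OF True] by (simp add: kr_def abs_mult mult_left_mono)
  qed (simp add: kr_def)
 qed (use integrable_Re[OF ikr] integrable_Im[OF ikr] in auto)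
 thus "\<bar>Im (ht (\<omega> * of_real s) n)\<bar> \<le> Re (ht (\<omega> * of_real s) n)" unfolding Re[symmetric] q_def .
 have "1 / (4 * (1 + s)) = (\<integral>x. indicator {0..1} x *\<^sub>R (x / (2 * (1 + s))) \<partial>lborel)"
 proof -
  have "(\<integral>x. indicator {0..1} x *\<^sub>R (x / (2 * (1 + s))) \<partial>lborel) = (1::real)\<^sup>2/(4 * (1 + s)) - 0\<^sup>2/(4 * (1 + s))"
  proof (rule integral_FTC_atLeastAtMost[where F = "\<lambda>x. x\<^sup>2 / (4 * (1 + s))"])
   fix x :: real
   have "((\<lambda>x. x\<^sup>2 / (4 * (1 + s))) has_real_derivative x / (2 * (1 + s))) (at x within {0..1})"
    using s by (auto intro!: derivative_eq_intros simp: divide_simps)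
   thus "((\<lambda>x. x\<^sup>2 / (4 * (1 + s))) has_vector_derivative x / (2 * (1 + s))) (at x within {0..1})"
    by (simp add: has_real_derivative_iff_has_vector_derivative)
  qed (use s in \<open>auto intro!: continuous_intros\<close>)
  thus ?thesis by simp
 qed
 also have "\<dots> \<le> (\<integral>x. Re (kr x) \<partial>lborel)"
 proof (rule integral_mono)
  show "integrable lborel (\<lambda>x. indicator {0..1} x *\<^sub>R (x / (2 * (1 + s)) :: real))"
   using borel_integrable_atLeastAtMost'[of 0 1 "\<lambda>x::real. x / (2 * (1 + s))"] s by (simp add: set_integrable_def continuous_intros)
  fix x :: real
  show "indicator {0..1} x *\<^sub>R (x / (2 * (1 + s))) \<le> Re (kr x)"
  proof (cases "x \<in> {0..1}")
   case True
   have "x * (1 / (2 * (1 + s))) \<le> x * Re (kap (q * of_real x) n)" using K(4)[OF True] True by (intro mult_left_mono) auto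
   thus ?thesis using True by (simp add: kr_def)
  qed (simp add: kr_def)
 qed (use integrable_Re[OF ikr] in auto)
 finally show "Re (ht (\<omega> * of_real s) n) \<ge> 1 / (4 * (1 + s))" unfolding Re[symmetric] q_def .
qed

lemma nbh_elim:
 assumes "m \<in> nbh c y" "0 < c" "c \<le> 1/4"
 obtains m0 where "m0 \<in> {0..1}" "norm (m - of_real m0) \<le> c" "norm (m - of_real m0) * \<bar>y\<bar> \<le> c" "norm (m - of_real m0) * (1 + \<bar>y\<bar>)\<^sup>2 \<le> c"
proof -
 obtain m0 where m0: "m0 \<in> {0..1}" "norm (m - of_real m0) < rad c y" using assms by (auto simp: nbh_def)
 have 1: "norm (m - of_real m0) * (1 + \<bar>y\<bar>)\<^sup>2 \<le> c"
  using m0(2) unfolding rad_def by (subst (asm) pos_less_divide_eq) (auto intro!: zero_less_power)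
 have y: "\<bar>y\<bar> \<le> (1 + \<bar>y\<bar>)\<^sup>2" by (simp add: power2_eq_square algebra_simps)
 have "norm (m - of_real m0) * \<bar>y\<bar> \<le> norm (m - of_real m0) * (1 + \<bar>y\<bar>)\<^sup>2" by (intro mult_left_mono y) auto
 moreover have "norm (m - of_real m0) \<le> c" using m0(2) rad_le[OF assms(2), of y] by simp
 ultimately show thesis using that m0(1) 1 by simp
qed

lemma left_kernel:
 assumes Z: "Z > 0" and e: "0 < \<epsilon>" "\<epsilon> \<le> 1"
 shows "kernel N (\<lambda>y l m. indicator {\<epsilon><..} y *\<^sub>R (inverse (csqrt l) * exp (- (of_real Z / l) * (of_real (y\<^sup>2) * ht (\<omega> * of_real y) (1 - m))) * (2 * \<omega>)))"
proof (rule tail_kernel[where c = "1/4" and a = "\<epsilon>\<^sup>2/16" and M = 1 and K = 2])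
 fix y m assume y: "y \<in> {\<epsilon><..}" and m: "m \<in> nbh (1/4) y"
 have y0: "y \<ge> 0" using y e by simp
 obtain m0 where m0: "m0 \<in> {0..1}" "norm (m - of_real m0) \<le> 1/4" "norm (m - of_real m0) * \<bar>y\<bar> \<le> 1/4"
  "norm (m - of_real m0) * (1 + \<bar>y\<bar>)\<^sup>2 \<le> 1/4"
  using nbh_elim[OF m] by auto
 have nn: "norm (1 - m - of_real (1 - m0)) = norm (m - of_real m0)" by (simp add: norm_minus_commute)
 have L: "\<bar>Im (ht (\<omega> * of_real y) (1 - m))\<bar> \<le> Re (ht (\<omega> * of_real y) (1 - m))"
  "Re (ht (\<omega> * of_real y) (1 - m)) \<ge> 1 / (4 * (1 + y))"
  using left_ht(2,3)[OF y0, of "1 - m0" "1 - m"] m0 y0 unfolding nn by auto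
 have "\<epsilon>\<^sup>2 * (1 + y)\<^sup>2 \<le> 4 * y\<^sup>2"
 proof -
  have "\<epsilon> * (1 + y) \<le> 2 * y" using y mult_right_mono[OF e(2) y0] by (simp add: algebra_simps)
  hence "(\<epsilon> * (1 + y))\<^sup>2 \<le> (2 * y)\<^sup>2" using e y0 by (intro power_mono) auto
  thus ?thesis by (simp add: power_mult_distrib)
 qed
 hence "\<epsilon>\<^sup>2/16 * (1 + y) \<le> y\<^sup>2 * (1 / (4 * (1 + y)))" using y0 by (simp add: field_simps power2_eq_square)
 also have "\<dots> \<le> y\<^sup>2 * Re (ht (\<omega> * of_real y) (1 - m))" using L by (intro mult_left_mono) auto
 finally show "\<epsilon>\<^sup>2/16 * (1 + \<bar>y\<bar>) \<le> Re (of_real (y\<^sup>2) * ht (\<omega> * of_real y) (1 - m)) \<and>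
   \<bar>Im (of_real (y\<^sup>2) * ht (\<omega> * of_real y) (1 - m))\<bar> \<le> 1 * Re (of_real (y\<^sup>2) * ht (\<omega> * of_real y) (1 - m))"
  using L(1) y0 by (simp add: abs_mult mult_left_mono)
next
 fix y U g assume y: "y \<in> {\<epsilon><..}" and U: "open U" "g holomorphic_on U" "g ` U \<subseteq> nbh (1/4) y"
 have y0: "y \<ge> 0" using y e by simp
 have "(\<lambda>z. ht (\<omega> * of_real y) (1 - g z)) holomorphic_on U"
 proof (rule ht_holomorphic[OF U(1), where B = 8])
  fix z assume "z \<in> U"
  hence m: "g z \<in> nbh (1/4) y" using U by auto
  obtain m0 where m0: "m0 \<in> {0..1}" "norm (g z - of_real m0) \<le> 1/4" "norm (g z - of_real m0) * \<bar>y\<bar> \<le> 1/4"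
   "norm (g z - of_real m0) * (1 + \<bar>y\<bar>)\<^sup>2 \<le> 1/4"
   using nbh_elim[OF m] by auto
  have nn: "norm (1 - g z - of_real (1 - m0)) = norm (g z - of_real m0)" by (simp add: norm_minus_commute)
  show "good 8 (\<omega> * of_real y) (1 - g z)"
   using left_ht(1)[OF y0, of "1 - m0" "1 - g z"] m0 y0 unfolding nn by auto
 qed (intro holomorphic_intros U)+
 thus "(\<lambda>z. of_real (y\<^sup>2) * ht (\<omega> * of_real y) (1 - g z)) holomorphic_on U" by (intro holomorphic_on_mult holomorphic_on_const)
next
 fix m :: real assume m: "m \<in> {0..1}"
 have [measurable]: "(\<lambda>y. ht (\<omega> * of_real y) (1 - of_real m)) \<in> borel_measurable borel" by (rule ht_measurable) measurable
 show "(\<lambda>y. indicator {\<epsilon><..} y *\<^sub>R (of_real (y\<^sup>2) * ht (\<omega> * of_real y) (1 - of_real m))) \<in> borel_measurable borel"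
  by measurable
 show "(\<lambda>y. indicator {\<epsilon><..} y *\<^sub>R (2 * \<omega>)) \<in> borel_measurable borel" by measurable
qed (use Z e in \<open>auto simp: norm_mult \<omega>\<close>)

section \<open>The neighbourhood of the critical point\<close>

definition circ :: "real => complex" where "circ x = 1/32 * exp (2 * of_real pi * \<i> * of_real x)"

lemma circ: "norm (circ x) = 1/32" "circ x \<noteq> 0"
proof -
 show "norm (circ x) = 1/32" by (simp add: circ_def norm_mult norm_exp_eq_Re)
 thus "circ x \<noteq> 0" by auto
qed

definition amp :: "complex => complex => complex => complex" where
 "amp w n Q = exp (- w * (ht Q n - 1))"

text \<open>
The Taylor coefficients of \<open>amp w n\<close> at the origin, written as averages over a circle to make their dependence on \<open>w\<close>
and \<open>n\<close> evidently holomorphic.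
\<close>
definition tay :: "nat => complex => complex => complex" where
 "tay j w n = (\<integral>x. indicator {0..1} x *\<^sub>R (amp w n (circ x) * inverse (circ x) ^ j) \<partial>lborel)"

lemma amp_bound: "norm Q \<le> 1/24 ==> norm n \<le> 2 ==> norm (amp w n Q) \<le> exp (norm w / 4)"
proof -
 assume "norm Q \<le> 1/24" "norm n \<le> 2"
 hence "norm w * norm (ht Q n - 1) \<le> norm w * (1/4)" by (intro mult_left_mono ht_small) auto
 hence "norm (- w * (ht Q n - 1)) \<le> norm w / 4" by (simp add: norm_mult)
 moreover have "Re (- w * (ht Q n - 1)) \<le> norm (- w * (ht Q n - 1))" by (rule complex_Re_le_cmod)
 ultimately show ?thesis by (simp only: amp_def norm_exp_eq_Re exp_le_cancel_iff)
qed

lemma amp_holomorphic: "norm n \<le> 2 ==> amp w n holomorphic_on ball 0 (1/24)"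
 unfolding amp_def[abs_def]
 by (intro holomorphic_intros ht_holomorphic[where B = 3] good_small) auto

lemma amp_holomorphic_param:
 assumes "open U" "f holomorphic_on U" "g holomorphic_on U" "\<And>z. z \<in> U ==> norm (g z) \<le> 2" "norm Q \<le> 1/24"
 shows "(\<lambda>z. amp (f z) (g z) Q) holomorphic_on U"
 unfolding amp_def by (intro holomorphic_intros assms ht_holomorphic[where B = 3] good_small)

lemma amp_circ_measurable: "(\<lambda>x. amp w n (circ x)) \<in> borel_measurable borel"
proof -
 have [measurable]: "circ \<in> borel_measurable borel" unfolding circ_def by measurable
 have [measurable]: "(\<lambda>x. ht (circ x) n) \<in> borel_measurable borel" by (rule ht_measurable) measurable
 show ?thesis unfolding amp_def by measurable
qed

lemma tay_meas: "(\<lambda>x. indicator {0..1} x *\<^sub>R (amp w n (circ x) * inverse (circ x) ^ j)) \<in> borel_measurable borel"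
proof -
 have [measurable]: "circ \<in> borel_measurable borel" unfolding circ_def by measurable
 note [measurable] = amp_circ_measurable[of w n]
 show ?thesis by measurable
qed

lemma circ_bound: "norm n \<le> 2 ==> norm (amp w n (circ x) * inverse (circ x) ^ j) \<le> exp (norm w / 4) * 32 ^ j"
 unfolding norm_mult norm_power norm_inverse circ(1) by (intro mult_mono amp_bound) (auto simp: circ)

lemma tay_bound: "norm n \<le> 2 ==> norm (tay j w n) \<le> exp (norm w / 4) * 32 ^ j"
 unfolding tay_def by (rule unit_interval_integrable(2)[OF tay_meas]) (rule circ_bound)

lemma tay_holomorphic:
 assumes U: "open U" "f holomorphic_on U" "g holomorphic_on U" and n: "\<And>z. z \<in> U ==> norm (g z) \<le> 2"
 shows "(\<lambda>z. tay j (f z) (g z)) holomorphic_on U"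
 unfolding tay_def
proof (rule integral_holomorphic_param[OF U(1)])
 fix x
 show "(\<lambda>z. indicator {0..1} x *\<^sub>R (amp (f z) (g z) (circ x) * inverse (circ x) ^ j)) holomorphic_on U"
  unfolding scaleR_conv_of_real
  by (intro holomorphic_on_mult holomorphic_on_const amp_holomorphic_param U n) (simp_all add: circ)
next
 fix z assume z: "z \<in> U"
 show "(\<lambda>x. indicator {0..1} x *\<^sub>R (amp (f z) (g z) (circ x) * inverse (circ x) ^ j)) \<in> borel_measurable lborel"
  using tay_meas by simp
 have "isCont f z" using U z holomorphic_on_imp_continuous_on continuous_on_eq_continuous_at by blast
 hence "\<forall>\<^sub>F w in nhds z. dist (f w) (f z) < 1"
  using tendstoD[of f "f z" "at z" 1] by (auto simp: isCont_def eventually_at_filter elim: eventually_mono)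
 then obtain r where r: "r > 0" "\<And>w. dist w z < r ==> dist (f w) (f z) < 1" unfolding eventually_nhds_metric by blast
 show "\<exists>r>0. \<exists>B. integrable lborel B \<and> (\<forall>s. \<forall>w\<in>ball z r \<inter> U. norm (indicator {0..1} s *\<^sub>R (amp (f w) (g w) (circ s) * inverse (circ s) ^ j)) \<le> B s)"
 proof (intro exI[of _ r] conjI r(1) exI[of _ "\<lambda>x. indicator {0..1::real} x *\<^sub>R (exp ((norm (f z) + 1) / 4) * 32 ^ j)"] allI ballI)
  show "integrable lborel (\<lambda>x. indicator {0..1::real} x *\<^sub>R (exp ((norm (f z) + 1) / 4) * 32 ^ j))" by (intro integrable_scaleR_left) simp
  fix s :: real and w assume w: "w \<in> ball z r \<inter> U"
  have "norm (f w) \<le> norm (f z) + 1" using r(2)[of w] w norm_triangle_sub[of "f w" "f z"] by (auto simp: dist_norm norm_minus_commute)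
  hence "exp (norm (f w) / 4) * 32 ^ j \<le> exp ((norm (f z) + 1) / 4) * 32 ^ j" by (intro mult_right_mono) auto
  moreover have "norm (amp (f w) (g w) (circ s) * inverse (circ s) ^ j) \<le> exp (norm (f w) / 4) * 32 ^ j" by (rule circ_bound) (use n w in auto)
  ultimately have "norm (amp (f w) (g w) (circ s) * inverse (circ s) ^ j) \<le> exp ((norm (f z) + 1) / 4) * 32 ^ j" by linarith
  thus "norm (indicator {0..1} s *\<^sub>R (amp (f w) (g w) (circ s) * inverse (circ s) ^ j)) \<le> indicator {0..1} s *\<^sub>R (exp ((norm (f z) + 1) / 4) * 32 ^ j)"
   by (cases "s \<in> {0..1}") simp_all
 qed
qed

lemma amp_Cauchy:
 assumes n: "norm n \<le> 2" and Q: "norm Q \<le> 1/64"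
 shows "integrable lborel (\<lambda>x. indicator {0..1} x *\<^sub>R (amp w n (circ x) * circ x / (circ x - Q)))"
  and "(\<integral>x. indicator {0..1} x *\<^sub>R (amp w n (circ x) * circ x / (circ x - Q)) \<partial>lborel) = amp w n Q"
proof -
 have cp: "circlepath 0 (1/32) = circ" by (auto simp: circlepath circ_def fun_eq_iff)
 have nz: "circ x - Q \<noteq> 0" for x
 proof
  assume "circ x - Q = 0" hence "norm Q = 1/32" using circ(1)[of x] by simp
  thus False using Q by simp
 qed
 have sub: "cball 0 (1/32) \<subseteq> ball (0::complex) (1/24)" by auto
 have "((\<lambda>u. amp w n u / (u - Q)) has_contour_integral (2 * of_real pi * \<i> * amp w n Q)) (circlepath 0 (1/32))"
  by (rule Cauchy_integral_circlepath_simple[OF holomorphic_on_subset[OF amp_holomorphic[OF n] sub]]) (use Q in simp)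
 hence "((\<lambda>x. amp w n (circ x) / (circ x - Q) * vector_derivative (circlepath 0 (1/32)) (at x within {0..1})) has_integral (2 * of_real pi * \<i> * amp w n Q)) {0..1}"
  by (simp add: has_contour_integral_def cp)
 hence "((\<lambda>x. 1 / (2 * of_real pi * \<i>) * (amp w n (circ x) / (circ x - Q) * vector_derivative (circlepath 0 (1/32)) (at x within {0..1}))) has_integral 1 / (2 * of_real pi * \<i>) * (2 * of_real pi * \<i> * amp w n Q)) {0..1}"
  by (rule has_integral_mult_right)
 hence hi: "((\<lambda>x. amp w n (circ x) * circ x / (circ x - Q)) has_integral amp w n Q) {0..1}"
  by (rule has_integral_eq_rhs[OF has_integral_eq[rotated]]) (simp_all add: vector_derivative_circlepath01 circ_def)
 have cont: "continuous_on {0..1} (\<lambda>x. amp w n (circ x) * circ x / (circ x - Q))"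
 proof -
  have cc: "continuous_on {0..1} circ" unfolding circ_def by (intro continuous_intros)
  have "continuous_on {0..1} (\<lambda>x. amp w n (circ x))"
   by (rule continuous_on_compose2[OF holomorphic_on_imp_continuous_on[OF amp_holomorphic[OF n]] cc]) (auto simp: circ)
  thus ?thesis using cc nz by (intro continuous_intros) auto
 qed
 from borel_integrable_atLeastAtMost'[OF cont] show i: "integrable lborel (\<lambda>x. indicator {0..1} x *\<^sub>R (amp w n (circ x) * circ x / (circ x - Q)))"
  by (simp add: set_integrable_def)
 have "set_integrable lborel {0..1} (\<lambda>x. amp w n (circ x) * circ x / (circ x - Q))" using i by (simp add: set_integrable_def)
 from set_borel_integral_eq_integral(2)[OF this] show "(\<integral>x. indicator {0..1} x *\<^sub>R (amp w n (circ x) * circ x / (circ x - Q)) \<partial>lborel) = amp w n Q"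
  using integral_unique[OF hi] by (simp add: set_lebesgue_integral_def)
qed

text \<open>
Geometric series under Cauchy's integral formula.
\<close>
lemma tay_remainder:
 assumes n: "norm n \<le> 2" and Q: "norm Q \<le> 1/64"
 shows "norm (amp w n Q - (\<Sum>j<M. tay j w n * Q ^ j)) \<le> 2 * exp (norm w / 4) * (32 * norm Q) ^ M"
proof -
 have ij: "integrable lborel (\<lambda>x. indicator {0..1} x *\<^sub>R (amp w n (circ x) * inverse (circ x) ^ j) * Q ^ j)" for j
  by (intro integrable_mult_left unit_interval_integrable(1)[OF tay_meas, where B = "exp (norm w / 4) * 32 ^ j"] circ_bound n)
 have T: "tay j w n * Q ^ j = (\<integral>x. indicator {0..1} x *\<^sub>R (amp w n (circ x) * inverse (circ x) ^ j) * Q ^ j \<partial>lborel)" for j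
  unfolding tay_def by (rule integral_mult_left_zero[symmetric])
 define q where "q x = Q * inverse (circ x)" for x
 have nq: "norm (q x) \<le> 1/2" "norm (q x) = 32 * norm Q" for x
  using Q by (simp_all add: q_def norm_mult norm_inverse circ)
 have q1: "q x \<noteq> 1" for x
 proof
  assume "q x = 1" thus False using nq(1)[of x] by simp
 qed
 have gs: "circ x / (circ x - Q) - (\<Sum>j<M. inverse (circ x) ^ j * Q ^ j) = q x ^ M / (1 - q x)" for x
 proof -
  have "circ x / (circ x - Q) = 1 / (1 - q x)" using circ(2)[of x] by (simp add: q_def field_simps)
  moreover have "(\<Sum>j<M. inverse (circ x) ^ j * Q ^ j) = (\<Sum>j<M. q x ^ j)" by (simp add: q_def power_mult_distrib mult.commute)
  moreover have "(\<Sum>j<M. q x ^ j) = (1 - q x ^ M) / (1 - q x)" using q1[of x] by (simp add: sum_gp_strict)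
  ultimately show ?thesis by (simp add: diff_divide_distrib)
 qed
 have "amp w n Q - (\<Sum>j<M. tay j w n * Q ^ j) =
   (\<integral>x. indicator {0..1} x *\<^sub>R (amp w n (circ x) * circ x / (circ x - Q)) - (\<Sum>j<M. indicator {0..1} x *\<^sub>R (amp w n (circ x) * inverse (circ x) ^ j) * Q ^ j) \<partial>lborel)"
  unfolding T amp_Cauchy(2)[OF n Q, symmetric, of w]
  by (subst Bochner_Integration.integral_diff[OF amp_Cauchy(1)[OF n Q] Bochner_Integration.integrable_sum[OF ij]], subst Bochner_Integration.integral_sum[OF ij]) simp_all
 also have "(\<lambda>x. indicator {0..1} x *\<^sub>R (amp w n (circ x) * circ x / (circ x - Q)) - (\<Sum>j<M. indicator {0..1} x *\<^sub>R (amp w n (circ x) * inverse (circ x) ^ j) * Q ^ j)) =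
   (\<lambda>x. indicator {0..1} x *\<^sub>R (amp w n (circ x) * (q x ^ M / (1 - q x))))"
  (is "?L = ?R")
 proof
  fix x
  have "?L x = indicator {0..1} x *\<^sub>R (amp w n (circ x) * (circ x / (circ x - Q) - (\<Sum>j<M. inverse (circ x) ^ j * Q ^ j)))"
   by (simp add: algebra_simps sum_distrib_left scaleR_sum_right)
  thus "?L x = ?R x" unfolding gs .
 qed
 also have "norm (\<integral>x. indicator {0..1} x *\<^sub>R (amp w n (circ x) * (q x ^ M / (1 - q x))) \<partial>lborel) \<le> 2 * exp (norm w / 4) * (32 * norm Q) ^ M"
 proof (rule unit_interval_integrable(2))
  have [measurable]: "circ \<in> borel_measurable borel" unfolding circ_def by measurable
  note [measurable] = amp_circ_measurable[of w n]
  show "(\<lambda>x. indicator {0..1} x *\<^sub>R (amp w n (circ x) * (q x ^ M / (1 - q x)))) \<in> borel_measurable borel"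
   unfolding q_def by measurable
  fix x :: real
  have "1 \<le> norm (1 - q x) + norm (q x)" using norm_triangle_ineq[of "1 - q x" "q x"] by simp
  hence "norm (1 - q x) \<ge> 1/2" using nq(1)[of x] by linarith
  hence "norm (q x ^ M / (1 - q x)) \<le> (32 * norm Q) ^ M / (1/2)"
   unfolding norm_divide norm_power nq(2) by (intro frac_le) auto
  hence "norm (amp w n (circ x) * (q x ^ M / (1 - q x))) \<le> exp (norm w / 4) * ((32 * norm Q) ^ M / (1/2))"
   unfolding norm_mult by (intro mult_mono amp_bound n) (auto simp: circ)
  thus "norm (amp w n (circ x) * (q x ^ M / (1 - q x))) \<le> 2 * exp (norm w / 4) * (32 * norm Q) ^ M" by (simp add: mult_ac)
 qed
 finally show ?thesis .
qed

text \<open>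
With \<open>w = Z s\<^sup>2 / l\<close> the integrand on the line \<open>Q = \<omega> s\<close> is \<open>e\<^sup>-\<^sup>w amp w n (\<omega> s)\<close>, and this is its Taylor term of degree \<open>j\<close>
with the Gaussian factor.
\<close>
definition gauss_term :: "real => nat => real => complex => complex => complex" where
 "gauss_term Z j s l n = exp (- (of_real (Z * s\<^sup>2) / l)) * tay j (of_real (Z * s\<^sup>2) / l) n * (\<omega> * of_real s) ^ j"

definition gauss_rem :: "real => real => nat => real => complex => complex => complex" where
 "gauss_rem Z \<epsilon> M s l n = indicator {-\<epsilon>..\<epsilon>} s *\<^sub>R exp (- (of_real Z / l) * (of_real (s\<^sup>2) * ht (\<omega> * of_real s) n)) - (\<Sum>j<M. gauss_term Z j s l n)"

lemma gauss_term_bound: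
 assumes l: "l \<in> sector k" "0 < k" "k \<le> 1/4" and n: "norm n \<le> 2" and Z: "Z > 0"
 shows "norm (exp (- (of_real (Z * s\<^sup>2) / l))) \<le> exp (- 3/4 * (Z * s\<^sup>2 / norm l))"
  and "norm (gauss_term Z j s l n) \<le> exp (- (Z * s\<^sup>2 / (2 * norm l))) * (32 * \<bar>s\<bar>) ^ j"
proof -
 define w where "w = of_real (Z * s\<^sup>2) / l"
 have R: "Re l > 0" using sector_Re_pos l by blast
 hence n0: "norm l > 0" by auto
 have "norm l \<le> Re l + \<bar>Im l\<bar>" using cmod_le[of l] R by simp
 also have "\<dots> \<le> Re l + 1/4 * Re l"
 proof -
  have "\<bar>Im l\<bar> < k * Re l" using l by (simp add: sector_def)
  also have "\<dots> \<le> 1/4 * Re l" using l R by (intro mult_right_mono) auto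
  finally show ?thesis by simp
 qed
 finally have "norm l \<le> 5/4 * Re l" by simp
 hence nl: "Re l \<ge> 3/4 * norm l" using n0 by linarith
 have nw: "norm w = Z * s\<^sup>2 / norm l" unfolding w_def norm_divide norm_of_real using Z by simp
 have "Re w = Z * s\<^sup>2 * Re l / (norm l)\<^sup>2" by (simp add: w_def Re_divide cmod_power2 del: of_real_mult)
 also have "\<dots> \<ge> Z * s\<^sup>2 * (3/4 * norm l) / (norm l)\<^sup>2" using nl Z by (intro divide_right_mono mult_left_mono) auto
 finally have Rw: "Re w \<ge> 3/4 * norm w" using n0 unfolding nw by (simp add: power2_eq_square)
 have "norm (exp (- w)) \<le> exp (- 3/4 * norm w)" using Rw by (simp add: norm_exp_eq_Re)
 thus 1: "norm (exp (- (of_real (Z * s\<^sup>2) / l))) \<le> exp (- 3/4 * (Z * s\<^sup>2 / norm l))" unfolding w_def[symmetric] nw .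
 have "norm (gauss_term Z j s l n) = norm (exp (- w)) * norm (tay j w n) * \<bar>s\<bar> ^ j"
  by (simp add: gauss_term_def w_def norm_mult norm_power \<omega>)
 also have "\<dots> \<le> exp (- 3/4 * norm w) * (exp (norm w / 4) * 32 ^ j) * \<bar>s\<bar> ^ j"
  using 1 unfolding w_def[symmetric] nw[symmetric] by (intro mult_right_mono mult_mono tay_bound n) auto
 also have "\<dots> = (exp (- 3/4 * norm w) * exp (norm w / 4)) * (32 * \<bar>s\<bar>) ^ j" by (simp add: power_mult_distrib mult_ac)
 also have "exp (- 3/4 * norm w) * exp (norm w / 4) = exp (- (norm w / 2))" by (simp flip: exp_add)
 also have "norm w / 2 = Z * s\<^sup>2 / (2 * norm l)" unfolding nw by simp
 finally show "norm (gauss_term Z j s l n) \<le> exp (- (Z * s\<^sup>2 / (2 * norm l))) * (32 * \<bar>s\<bar>) ^ j" .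
qed

text \<open>
The growth \<open>exp (|w| / 4)\<close> of the Taylor remainder is paid by a part of the Gaussian. Outside \<open>[- \<epsilon>, \<epsilon>]\<close> the Gaussian terms
themselves are small, since there \<open>1 \<le> |s| / \<epsilon>\<close>.
\<close>
lemma gauss_rem_bound:
 assumes l: "l \<in> sector k" "0 < k" "k \<le> 1/4" and n: "norm n \<le> 2" and Z: "Z > 0" and e: "0 < \<epsilon>" "\<epsilon> \<le> 1/64"
 shows "norm (gauss_rem Z \<epsilon> M s l n) \<le> real (M + 2) * (32 / \<epsilon>) ^ M * (\<bar>s\<bar> ^ M * exp (- (Z * s\<^sup>2 / (2 * norm l))))"
proof -
 define w where "w = of_real (Z * s\<^sup>2) / l"
 have nw: "norm w = Z * s\<^sup>2 / norm l" unfolding w_def norm_divide norm_of_real using Z by simp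
 define X where "X = exp (- (Z * s\<^sup>2 / (2 * norm l)))"
 have Xw: "X = exp (- 3/4 * norm w) * exp (norm w / 4)" unfolding X_def nw by (simp flip: exp_add)
 show ?thesis
 proof (cases "s \<in> {-\<epsilon>..\<epsilon>}")
  case True
  have Q: "norm (\<omega> * of_real s) = \<bar>s\<bar>" by (simp add: norm_mult \<omega>)
  have sQ: "\<bar>s\<bar> \<le> 1/64" using True e by auto
  have "gauss_rem Z \<epsilon> M s l n = exp (- w) * (amp w n (\<omega> * of_real s) - (\<Sum>j<M. tay j w n * (\<omega> * of_real s) ^ j))"
  proof -
   have "exp (- (of_real Z / l) * (of_real (s\<^sup>2) * ht (\<omega> * of_real s) n)) = exp (- w) * amp w n (\<omega> * of_real s)"
   proof -
    have gen: "- a * (b * h) = - (a * b) + - (a * b) * (h - 1)" for a b h :: complex by (simp add: algebra_simps)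
    have w': "w = of_real Z / l * of_real (s\<^sup>2)" by (simp add: w_def)
    show ?thesis unfolding amp_def exp_add[symmetric] w' gen ..
   qed
   thus ?thesis using True by (simp add: gauss_rem_def gauss_term_def w_def sum_distrib_left algebra_simps)
  qed
  hence "norm (gauss_rem Z \<epsilon> M s l n) \<le> exp (- 3/4 * norm w) * (2 * exp (norm w / 4) * (32 * \<bar>s\<bar>) ^ M)"
   using gauss_term_bound(1)[OF l n Z, of s] tay_remainder[OF n, of "\<omega> * of_real s" w M] sQ unfolding w_def[symmetric] nw[symmetric] Q
   by (simp add: norm_mult mult_mono)
  also have "\<dots> = 2 * 32 ^ M * (\<bar>s\<bar> ^ M * X)" by (simp add: Xw power_mult_distrib mult_ac)
  also have "\<dots> \<le> real (M + 2) * (32 / \<epsilon>) ^ M * (\<bar>s\<bar> ^ M * X)"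
  proof (intro mult_right_mono mult_mono power_mono)
   show "(32::real) \<le> 32 / \<epsilon>" using e by (simp add: le_divide_eq)
  qed (use e in \<open>auto simp: X_def\<close>)
  finally show ?thesis by (simp add: X_def)
 next
  case False
  hence s: "\<bar>s\<bar> \<ge> \<epsilon>" using e by auto
  have "norm (gauss_rem Z \<epsilon> M s l n) \<le> (\<Sum>j<M. norm (gauss_term Z j s l n))"
   using False by (simp add: gauss_rem_def norm_sum)
  also have "\<dots> \<le> (\<Sum>j<M. (32 / \<epsilon>) ^ M * (\<bar>s\<bar> ^ M * X))"
  proof (rule sum_mono)
   fix j assume j: "j \<in> {..<M}"
   have "norm (gauss_term Z j s l n) \<le> X * (32 * \<bar>s\<bar>) ^ j" using gauss_term_bound(2)[OF l n Z] by (simp add: X_def)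
   also have "(32 * \<bar>s\<bar>) ^ j \<le> (32 / \<epsilon> * \<bar>s\<bar>) ^ j"
    using e by (intro power_mono mult_right_mono) (auto simp: le_divide_eq)
   also have "\<dots> \<le> (32 / \<epsilon> * \<bar>s\<bar>) ^ M"
   proof (rule power_increasing)
    have "1 \<le> 32 / \<epsilon> * \<epsilon>" using e by simp
    also have "\<dots> \<le> 32 / \<epsilon> * \<bar>s\<bar>" using s e by (intro mult_left_mono) auto
    finally show "1 \<le> 32 / \<epsilon> * \<bar>s\<bar>" .
   qed (use j in auto)
   finally show "norm (gauss_term Z j s l n) \<le> (32 / \<epsilon>) ^ M * (\<bar>s\<bar> ^ M * X)" by (simp add: X_def power_mult_distrib power_divide mult_ac)
  qed
  also have "\<dots> \<le> real (M + 2) * (32 / \<epsilon>) ^ M * (\<bar>s\<bar> ^ M * X)"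
   using e by (simp add: X_def algebra_simps mult_right_mono)
  finally show ?thesis by (simp add: X_def)
 qed
qed

lemma nbh_norm: "m \<in> nbh (1/4) y ==> norm (1 - m) \<le> 2"
proof -
 assume m: "m \<in> nbh (1/4) y"
 obtain m0 where m0: "m0 \<in> {0..1}" "norm (m - of_real m0) \<le> 1/4" "norm (m - of_real m0) * \<bar>y\<bar> \<le> 1/4"
  "norm (m - of_real m0) * (1 + \<bar>y\<bar>)\<^sup>2 \<le> 1/4"
  using nbh_elim[OF m] by auto
 have "1 - m = of_real (1 - m0) - (m - of_real m0)" by simp
 hence "norm (1 - m) \<le> norm (of_real (1 - m0) :: complex) + norm (m - of_real m0)" by (metis norm_triangle_ineq4)
 thus "norm (1 - m) \<le> 2" using m0 by (simp del: of_real_diff)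
qed

lemma gauss_term_measurable:
 assumes "l > 0" "norm n \<le> 2"
 shows "(\<lambda>s. gauss_term Z j s (of_real l) n) \<in> borel_measurable borel"
proof -
 have "(\<lambda>w. tay j w n) holomorphic_on UNIV"
  using tay_holomorphic[OF open_UNIV holomorphic_on_ident holomorphic_on_const, of n j] assms by simp
 hence c: "continuous_on UNIV (\<lambda>w. tay j w n)" by (rule holomorphic_on_imp_continuous_on)
 have "continuous_on UNIV (\<lambda>s. tay j (of_real (Z * s\<^sup>2) / of_real l) n)"
  by (rule continuous_on_compose2[OF c]) (use assms in \<open>auto intro!: continuous_intros\<close>)
 hence [measurable]: "(\<lambda>s. tay j (of_real (Z * s\<^sup>2) / of_real l) n) \<in> borel_measurable borel"
  by (rule borel_measurable_continuous_onI)
 show ?thesis unfolding gauss_term_def by measurable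
qed

text \<open>
\<open>s\<^sup>2\<^sup>N\<^sup>+\<^sup>2\<close> against half of the Gaussian is worth \<open>l\<^sup>N\<^sup>+\<^sup>1\<close>; one power of \<open>l\<close> more than required pays for \<open>l\<^sup>-\<^sup>1\<^sup>/\<^sup>2\<close>.
\<close>
lemma gauss_absorb:
 assumes Z: "Z > 0" and B: "B > 0"
 obtains C d where "C \<ge> 0" "d > 0" "\<And>s l. 0 < l ==> l \<le> B ==>
   inverse (sqrt l) * (\<bar>s\<bar> ^ (2 * N + 2) * exp (- (Z * s\<^sup>2 / (2 * l)))) \<le> C * l ^ N * exp (- d * \<bar>s\<bar>)"
proof -
 define c where "c = Z / (4 * B)"
 have c: "c > 0" using Z B by (simp add: c_def)
 define K where "K = real (N+1) ^ (N+1) * (4 / Z) ^ (N+1)"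
 have K: "K \<ge> 0" using Z by (simp add: K_def)
 show thesis
 proof (rule that[of "K * sqrt B * exp c" c])
  fix s l :: real assume l: "0 < l" "l \<le> B"
  define v where "v = s\<^sup>2 / l"
  have v: "v \<ge> 0" using l by (simp add: v_def)
  have s2: "s\<^sup>2 = l * v" using l by (simp add: v_def)
  have "(Z / 4 * v) ^ (N+1) \<le> real (N+1) ^ (N+1) * exp (Z / 4 * v)" using Z v by (intro power_le_exp) auto
  hence "(4 / Z) ^ (N+1) * (Z / 4 * v) ^ (N+1) \<le> (4 / Z) ^ (N+1) * (real (N+1) ^ (N+1) * exp (Z / 4 * v))"
   using Z by (intro mult_left_mono) auto
  also have "(4 / Z) ^ (N+1) * (Z / 4 * v) ^ (N+1) = v ^ (N+1)" using Z by (subst power_mult_distrib[symmetric]) simp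
  finally have vN: "v ^ (N+1) \<le> K * exp (Z / 4 * v)" by (simp add: K_def mult_ac)
  have e2: "exp (- (Z * s\<^sup>2 / (2 * l))) = exp (- (Z / 4 * v)) * exp (- (Z / 4 * v))"
   unfolding v_def by (simp flip: exp_add add: field_simps)
  have es: "exp (- (Z / 4 * v)) \<le> exp c * exp (- c * \<bar>s\<bar>)"
  proof -
   have "Z / 4 * v = Z * s\<^sup>2 / (4 * l)" by (simp add: v_def)
   moreover have "\<dots> \<ge> Z * s\<^sup>2 / (4 * B)" using l Z by (intro divide_left_mono) auto
   moreover have "Z * s\<^sup>2 / (4 * B) = c * s\<^sup>2" by (simp add: c_def)
   moreover have "c * s\<^sup>2 \<ge> c * (\<bar>s\<bar> - 1)"
   proof (rule mult_left_mono)
    have "(\<bar>s\<bar> - 1/2)\<^sup>2 \<ge> 0" by simp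
    thus "\<bar>s\<bar> - 1 \<le> s\<^sup>2" unfolding power2_diff by (simp add: power_divide)
   qed (use c in simp)
   ultimately have "- (Z / 4 * v) \<le> c + - c * \<bar>s\<bar>" by (simp add: algebra_simps)
   thus ?thesis unfolding exp_add[symmetric] by simp
  qed
  have "\<bar>s\<bar> ^ (2 * N + 2) = \<bar>s\<bar> ^ (2 * (N + 1))" by simp
  also have "\<dots> = (s\<^sup>2) ^ (N+1)" unfolding power_mult power2_abs ..
  also have "\<dots> = l ^ (N+1) * v ^ (N+1)" unfolding s2 power_mult_distrib ..
  finally have pw: "\<bar>s\<bar> ^ (2 * N + 2) = l ^ (N+1) * v ^ (N+1)" .
  have "inverse (sqrt l) * (\<bar>s\<bar> ^ (2 * N + 2) * exp (- (Z * s\<^sup>2 / (2 * l)))) =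
    inverse (sqrt l) * l ^ (N+1) * (v ^ (N+1) * exp (- (Z / 4 * v)) * exp (- (Z / 4 * v)))"
   unfolding e2 pw by (simp only: mult_ac)
  also have "inverse (sqrt l) * l ^ (N+1) = sqrt l * l ^ N" using l by (simp add: field_simps)
  also have "v ^ (N+1) * exp (- (Z / 4 * v)) \<le> K" using vN by (simp add: exp_minus field_simps)
  hence "sqrt l * l ^ N * (v ^ (N+1) * exp (- (Z / 4 * v)) * exp (- (Z / 4 * v))) \<le> sqrt B * l ^ N * (K * (exp c * exp (- c * \<bar>s\<bar>)))"
   using l K v by (intro mult_mono es) auto
  finally show "inverse (sqrt l) * (\<bar>s\<bar> ^ (2 * N + 2) * exp (- (Z * s\<^sup>2 / (2 * l)))) \<le> K * sqrt B * exp c * l ^ N * exp (- c * \<bar>s\<bar>)"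
   by (simp add: mult_ac)
 qed (use c K B in auto)
qed

lemma gauss_rem_kernel:
 assumes Z: "Z > 0" and e: "0 < \<epsilon>" "\<epsilon> \<le> 1/64"
 shows "kernel N (\<lambda>y l m. 2 * \<omega> * (inverse (csqrt l) * gauss_rem Z \<epsilon> (2 * N + 2) y l (1 - m)))"
proof (rule kernelI[of "1/4" "1/4"])
 fix y U f g assume U: "open U" "f holomorphic_on U" "g holomorphic_on U" "f ` U \<subseteq> sector (1/4)" "g ` U \<subseteq> nbh (1/4) y"
 have fz: "f z \<noteq> 0" "f z \<notin> \<real>\<^sub>\<le>\<^sub>0" "csqrt (f z) \<noteq> 0" if "z \<in> U" for z
  using sector_Re_pos[of "f z" "1/4"] sector_not_nonpos[of "f z" "1/4"] U(4) that by auto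
 have gz: "norm (1 - g z) \<le> 2" if "z \<in> U" for z using nbh_norm[of "g z" y] U(5) that by auto
 have g1: "(\<lambda>z. 1 - g z) holomorphic_on U" by (intro holomorphic_intros U)
 have w: "(\<lambda>z. of_real (Z * y\<^sup>2) / f z) holomorphic_on U" by (intro holomorphic_intros U fz)
 have G: "(\<lambda>z. gauss_term Z j y (f z) (1 - g z)) holomorphic_on U" for j
  unfolding gauss_term_def by (intro holomorphic_on_mult holomorphic_on_const holomorphic_on_exp' holomorphic_on_minus w tay_holomorphic U(1) g1 gz)
 have "(\<lambda>z. indicator {-\<epsilon>..\<epsilon>} y *\<^sub>R exp (- (of_real Z / f z) * (of_real (y\<^sup>2) * ht (\<omega> * of_real y) (1 - g z)))) holomorphic_on U"
 proof (cases "y \<in> {-\<epsilon>..\<epsilon>}")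
  case True
  hence "norm (\<omega> * of_real y) \<le> 1/24" using e by (auto simp: norm_mult \<omega>)
  hence "(\<lambda>z. ht (\<omega> * of_real y) (1 - g z)) holomorphic_on U"
   by (intro ht_holomorphic[where B = 3] U(1) g1 holomorphic_on_const good_small gz)
  hence "(\<lambda>z. exp (- (of_real Z / f z) * (of_real (y\<^sup>2) * ht (\<omega> * of_real y) (1 - g z)))) holomorphic_on U"
   by (intro holomorphic_on_mult holomorphic_on_const holomorphic_on_exp' holomorphic_on_minus holomorphic_on_divide U fz)
  thus ?thesis using True by simp
 qed simp
 thus "(\<lambda>z. 2 * \<omega> * (inverse (csqrt (f z)) * gauss_rem Z \<epsilon> (2 * N + 2) y (f z) (1 - g z))) holomorphic_on U"
  unfolding gauss_rem_def
  by (intro holomorphic_on_mult holomorphic_on_const holomorphic_on_inverse holomorphic_on_csqrt' holomorphic_on_diff holomorphic_on_sum G U fz)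
next
 fix l m :: real assume l: "l > 0" and m: "m \<in> {0..1}"
 have gm: "(\<lambda>s. gauss_term Z j s (of_real l) (1 - of_real m)) \<in> borel_measurable borel" for j
 proof (rule gauss_term_measurable[OF l])
  have "(1::complex) - of_real m = of_real (1 - m)" by simp
  hence "norm ((1::complex) - of_real m) = \<bar>1 - m\<bar>" by (simp only: norm_of_real)
  thus "norm ((1::complex) - of_real m) \<le> 2" using m by simp
 qed
 have [measurable]: "(\<lambda>y. ht (\<omega> * of_real y) (1 - of_real m)) \<in> borel_measurable borel" by (rule ht_measurable) measurable
 show "(\<lambda>y. 2 * \<omega> * (inverse (csqrt (of_real l)) * gauss_rem Z \<epsilon> (2 * N + 2) y (of_real l) (1 - of_real m))) \<in> borel_measurable borel"
 proof -
  have A: "(\<lambda>y. indicator {-\<epsilon>..\<epsilon>} y *\<^sub>R exp (- (of_real Z / of_real l) * (of_real (y\<^sup>2) * ht (\<omega> * of_real y) (1 - of_real m)))) \<in> borel_measurable borel"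
   by measurable
  have S: "(\<lambda>y. \<Sum>j<2 * N + 2. gauss_term Z j y (of_real l) (1 - of_real m)) \<in> borel_measurable borel"
   by (rule borel_measurable_sum) (rule gm)
  show ?thesis unfolding gauss_rem_def
   by (rule borel_measurable_times[OF borel_measurable_const borel_measurable_times[OF borel_measurable_const borel_measurable_diff[OF A S]]])
 qed
next
 fix B :: real assume B: "B > 0"
 obtain C d where C: "C \<ge> 0" "d > 0" "\<And>s l. 0 < l ==> l \<le> B ==>
   inverse (sqrt l) * (\<bar>s\<bar> ^ (2 * N + 2) * exp (- (Z * s\<^sup>2 / (2 * l)))) \<le> C * l ^ N * exp (- d * \<bar>s\<bar>)"
  using gauss_absorb[OF Z B, of N] by blast
 define R where "R = real (2 * N + 2 + 2) * (32 / \<epsilon>) ^ (2 * N + 2)"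
 have R: "R \<ge> 0" using e by (simp add: R_def)
 show "\<exists>C. \<exists>d>0. \<forall>y. \<forall>l\<in>sector (1/4). \<forall>m\<in>nbh (1/4) y. norm l \<le> B -->
   norm (2 * \<omega> * (inverse (csqrt l) * gauss_rem Z \<epsilon> (2 * N + 2) y l (1 - m))) \<le> C * norm l ^ N * exp (- d * \<bar>y\<bar>)"
 proof (rule exI[of _ "2 * R * C"], rule exI[of _ d], intro conjI C(2) allI ballI impI)
  fix y l m assume l: "l \<in> sector (1/4)" and m: "m \<in> nbh (1/4) y" and lB: "norm l \<le> B"
  have l0: "norm l > 0" using sector_Re_pos[OF l] by auto
  have "norm (gauss_rem Z \<epsilon> (2 * N + 2) y l (1 - m)) \<le> R * (\<bar>y\<bar> ^ (2 * N + 2) * exp (- (Z * y\<^sup>2 / (2 * norm l))))"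
   unfolding R_def by (rule gauss_rem_bound[OF l _ _ nbh_norm[OF m] Z e]) auto
  hence "norm (2 * \<omega> * (inverse (csqrt l) * gauss_rem Z \<epsilon> (2 * N + 2) y l (1 - m))) \<le>
    2 * (inverse (sqrt (norm l)) * (R * (\<bar>y\<bar> ^ (2 * N + 2) * exp (- (Z * y\<^sup>2 / (2 * norm l))))))"
   unfolding norm_mult norm_inverse norm_csqrt by (auto simp: \<omega> intro!: mult_left_mono)
  also have "\<dots> = 2 * R * (inverse (sqrt (norm l)) * (\<bar>y\<bar> ^ (2 * N + 2) * exp (- (Z * y\<^sup>2 / (2 * norm l)))))" by (simp only: mult_ac)
  also have "\<dots> \<le> 2 * R * (C * norm l ^ N * exp (- d * \<bar>y\<bar>))" using R by (intro mult_left_mono C(3) l0 lB) auto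
  finally show "norm (2 * \<omega> * (inverse (csqrt l) * gauss_rem Z \<epsilon> (2 * N + 2) y l (1 - m))) \<le> 2 * R * C * norm l ^ N * exp (- d * \<bar>y\<bar>)"
   by (simp add: mult_ac)
 qed
qed auto

section \<open>The expansion coefficients\<close>

text \<open>
The rescaling \<open>s = l\<^sup>1\<^sup>/\<^sup>2 v\<close> reduces the Gaussian moments to those with \<open>l = 1\<close>.
\<close>
definition expansion_coeff :: "real => nat => complex => complex" where
 "expansion_coeff Z k m = 2 * \<omega> * (\<integral>v. gauss_term Z (2 * k) v 1 (1 - m) \<partial>lborel)"

lemma gauss_term_one_bound:
 assumes Z: "Z > 0"
 obtains C d where "C \<ge> 0" "d > 0" "\<And>v n. norm n \<le> 2 ==> norm (gauss_term Z j v 1 n) \<le> C * exp (- d * \<bar>v\<bar>)"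
proof -
 define c where "c = Z / 2"
 have c: "c > 0" using Z by (simp add: c_def)
 define K where "K = real (j + 1) ^ (j + 1) * (64 / c) ^ (j + 1)"
 show thesis
 proof (rule that[of "exp c * (1 + K)" "c/2"])
  show "0 \<le> exp c * (1 + K)" using c by (simp add: K_def)
  fix v :: real and n :: complex assume n: "norm n \<le> 2"
  have l: "(1::complex) \<in> sector (1/4)" by (simp add: sector_def)
  have "norm (gauss_term Z j v 1 n) \<le> exp (- (Z * v\<^sup>2 / (2 * norm (1::complex)))) * (32 * \<bar>v\<bar>) ^ j"
   by (rule gauss_term_bound(2)[OF l _ _ n Z]) auto
  also have "\<dots> = exp (- (c * v\<^sup>2)) * (32 * \<bar>v\<bar>) ^ j" by (simp add: c_def)
  also have "\<dots> \<le> (exp c * exp (- c * \<bar>v\<bar>)) * ((1 + K) * exp (c/2 * \<bar>v\<bar>))"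
  proof (rule mult_mono)
   have "(\<bar>v\<bar> - 1/2)\<^sup>2 \<ge> 0" by simp
   hence "\<bar>v\<bar> - 1 \<le> v\<^sup>2" unfolding power2_diff by (simp add: power_divide)
   hence "c * (\<bar>v\<bar> - 1) \<le> c * v\<^sup>2" using c by (intro mult_left_mono) auto
   thus "exp (- (c * v\<^sup>2)) \<le> exp c * exp (- c * \<bar>v\<bar>)" by (simp add: algebra_simps flip: exp_add)
   have "(32 * \<bar>v\<bar>) ^ j \<le> 1 + (32 * \<bar>v\<bar>) ^ (j + 1)"
   proof (cases "32 * \<bar>v\<bar> \<le> 1")
    case True
    hence "(32 * \<bar>v\<bar>) ^ j \<le> 1" by (intro power_le_one) auto
    thus ?thesis by (simp add: add_increasing2)
   next
    case False
    hence "(32 * \<bar>v\<bar>) ^ j \<le> (32 * \<bar>v\<bar>) ^ (j + 1)" by (intro power_increasing) auto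
    thus ?thesis by linarith
   qed
   also have "(32 * \<bar>v\<bar>) ^ (j + 1) = (64 / c) ^ (j + 1) * (c/2 * \<bar>v\<bar>) ^ (j + 1)"
    using c by (subst power_mult_distrib[symmetric]) simp
   also have "(c/2 * \<bar>v\<bar>) ^ (j + 1) \<le> real (j + 1) ^ (j + 1) * exp (c/2 * \<bar>v\<bar>)" using c by (intro power_le_exp) auto
   hence "1 + (64 / c) ^ (j + 1) * (c/2 * \<bar>v\<bar>) ^ (j + 1) \<le> exp (c/2 * \<bar>v\<bar>) + (64 / c) ^ (j + 1) * (real (j + 1) ^ (j + 1) * exp (c/2 * \<bar>v\<bar>))"
    using c by (intro add_mono mult_left_mono) auto
   also have "\<dots> = (1 + K) * exp (c/2 * \<bar>v\<bar>)" proof -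
    have "E + X * (Y * E) = (1 + Y * X) * E" for E X Y :: real by (simp add: algebra_simps)
    thus ?thesis unfolding K_def .
   qed
   finally show "(32 * \<bar>v\<bar>) ^ j \<le> (1 + K) * exp (c/2 * \<bar>v\<bar>)" .
  qed auto
  also have "\<dots> = exp c * (1 + K) * (exp (- c * \<bar>v\<bar>) * exp (c/2 * \<bar>v\<bar>))" by (simp add: mult_ac)
  also have "exp (- c * \<bar>v\<bar>) * exp (c/2 * \<bar>v\<bar>) = exp (- (c/2) * \<bar>v\<bar>)" by (simp flip: exp_add)
  finally show "norm (gauss_term Z j v 1 n) \<le> exp c * (1 + K) * exp (- (c/2) * \<bar>v\<bar>)" .
 qed (use c in auto)
qed

lemma gauss_term_one_integrable:
 assumes Z: "Z > 0" and n: "norm n \<le> 2" shows "integrable lborel (\<lambda>v. gauss_term Z j v 1 n)"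
proof -
 obtain C d where C: "C \<ge> 0" "d > 0" "\<And>v n. norm n \<le> 2 ==> norm (gauss_term Z j v 1 n) \<le> C * exp (- d * \<bar>v\<bar>)"
  using gauss_term_one_bound[OF Z, of j] by blast
 show ?thesis
 proof (rule Bochner_Integration.integrable_bound)
  show "integrable lborel (\<lambda>v. C * exp (- d * \<bar>v\<bar>))" by (intro integrable_mult_right integrable_exp_minus_abs C)
  show "AE v in lborel. norm (gauss_term Z j v 1 n) \<le> norm (C * exp (- d * \<bar>v\<bar>))"
   by (intro AE_I2 order_trans[OF C(3)[OF n]]) (simp only: real_norm_def abs_ge_self)
 qed (use gauss_term_measurable[of 1 n Z j] n in simp)
qed

lemma expansion_coeff_analytic: assumes Z: "Z > 0" shows "expansion_coeff Z k analytic_on of_real ` {0..1::real}"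
proof -
 define T where "T = ball (1::complex) 2"
 obtain C d where C: "C \<ge> 0" "d > 0" "\<And>v n. norm n \<le> 2 ==> norm (gauss_term Z (2 * k) v 1 n) \<le> C * exp (- d * \<bar>v\<bar>)"
  using gauss_term_one_bound[OF Z, of "2 * k"] by blast
 have n: "norm (1 - m) \<le> 2" if "m \<in> T" for m using that by (simp add: T_def dist_norm)
 have "(\<lambda>m. \<integral>v. gauss_term Z (2 * k) v 1 (1 - m) \<partial>lborel) holomorphic_on T"
 proof (rule integral_holomorphic_param)
  show "(\<lambda>m. gauss_term Z (2 * k) v 1 (1 - m)) holomorphic_on T" for v
   unfolding gauss_term_def by (intro holomorphic_on_mult holomorphic_on_const tay_holomorphic holomorphic_intros n) (simp_all add: T_def)
  show "(\<lambda>v. gauss_term Z (2 * k) v 1 (1 - m)) \<in> borel_measurable lborel" if "m \<in> T" for m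
   using gauss_term_measurable[of 1 "1 - m" Z "2 * k"] n[OF that] by simp
  show "\<exists>r>0. \<exists>B. integrable lborel B \<and> (\<forall>v. \<forall>w\<in>ball m r \<inter> T. norm (gauss_term Z (2 * k) v 1 (1 - w)) \<le> B v)" for m
   by (intro exI[of _ 1] conjI exI[of _ "\<lambda>v. C * exp (- d * \<bar>v\<bar>)"] integrable_mult_right integrable_exp_minus_abs C allI ballI)
    (use C(3) n in auto)
 qed (simp add: T_def)
 hence "expansion_coeff Z k holomorphic_on T" unfolding expansion_coeff_def[abs_def] by (intro holomorphic_on_mult holomorphic_on_const)
 moreover have "open T" by (simp add: T_def)
 moreover have "complex_of_real ` {0..1} \<subseteq> T"
 proof
  fix z assume "z \<in> complex_of_real ` {0..1}"
  then obtain m where m: "m \<in> {0..1}" "z = of_real m" by auto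
  have "1 - z = of_real (1 - m)" by (simp add: m)
  hence "norm (1 - z) = \<bar>1 - m\<bar>" by (simp only: norm_of_real)
  thus "z \<in> T" using m by (simp add: T_def dist_norm)
 qed
 ultimately show ?thesis unfolding analytic_on_holomorphic by blast
qed

lemma gauss_term_scale:
 assumes l: "l > 0"
 shows "gauss_term Z j (sqrt l * v) (of_real l) n = of_real (sqrt l) ^ j * gauss_term Z j v 1 n"
proof -
 have "of_real (Z * (sqrt l * v)\<^sup>2) / complex_of_real l = of_real (Z * v\<^sup>2)"
  using l by (simp add: power_mult_distrib flip: of_real_power)
 thus ?thesis unfolding gauss_term_def by (simp add: power_mult_distrib mult_ac)
qed

lemma gauss_term_integral:
 assumes Z: "Z > 0" and l: "l > 0" and n: "norm n \<le> 2"
 shows "integrable lborel (\<lambda>s. gauss_term Z j s (of_real l) n)"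
  and "(\<integral>s. gauss_term Z j s (of_real l) n \<partial>lborel) = of_real (sqrt l) ^ (j + 1) * (\<integral>v. gauss_term Z j v 1 n \<partial>lborel)"
proof -
 have sl: "sqrt l \<noteq> 0" "\<bar>sqrt l\<bar> = sqrt l" using l by auto
 have i: "integrable lborel (\<lambda>v. gauss_term Z j (0 + sqrt l * v) (of_real l) n)"
  unfolding add_0 gauss_term_scale[OF l] by (intro integrable_mult_right gauss_term_one_integrable Z n)
 show "integrable lborel (\<lambda>s. gauss_term Z j s (of_real l) n)"
  using lborel_integrable_real_affine_iff[OF sl(1), of "\<lambda>s. gauss_term Z j s (of_real l) n" 0] i by simp
 have "(\<integral>s. gauss_term Z j s (of_real l) n \<partial>lborel) = sqrt l *\<^sub>R (\<integral>v. gauss_term Z j (0 + sqrt l * v) (of_real l) n \<partial>lborel)"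
  by (subst lborel_integral_real_affine[OF sl(1), of _ 0]) (simp add: sl)
 also have "\<dots> = of_real (sqrt l) ^ (j + 1) * (\<integral>v. gauss_term Z j v 1 n \<partial>lborel)"
  unfolding add_0 gauss_term_scale[OF l] by (simp add: scaleR_conv_of_real)
 finally show "(\<integral>s. gauss_term Z j s (of_real l) n \<partial>lborel) = of_real (sqrt l) ^ (j + 1) * (\<integral>v. gauss_term Z j v 1 n \<partial>lborel)" .
qed

lemma gauss_term_odd: assumes "odd j" shows "(\<integral>v. gauss_term Z j v 1 n \<partial>lborel) = 0"
proof -
 have "gauss_term Z j (0 + (-1) * v) 1 n = - gauss_term Z j v 1 n" for v
 proof -
  have "\<omega> * of_real (0 + (-1) * v) = - (\<omega> * of_real v)" by simp
  hence "(\<omega> * of_real (0 + (-1) * v)) ^ j = - ((\<omega> * of_real v) ^ j)" using power_minus_odd[OF assms] by simp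
  moreover have "(0 + (-1) * v)\<^sup>2 = v\<^sup>2" by simp
  ultimately show ?thesis unfolding gauss_term_def by simp
 qed
 hence "(\<integral>v. gauss_term Z j v 1 n \<partial>lborel) = (\<integral>v. - gauss_term Z j v 1 n \<partial>lborel)"
  by (subst lborel_integral_real_affine[of "-1" _ 0]) simp_all
 thus ?thesis by simp
qed

lemma sum_even_odd:
 fixes f :: "nat => complex"
 assumes "\<And>j. odd j ==> f j = 0" shows "(\<Sum>j<2 * N + 2. f j) = (\<Sum>k\<le>N. f (2 * k))"
proof (induction N)
 case 0
 have "{..<2 * 0 + 2} = {0, 1::nat}" by auto
 thus ?case using assms[of 1] by simp
next
 case (Suc N)
 have "{..<2 * Suc N + 2} = insert (2 * N + 3) (insert (2 * N + 2) {..<2 * N + 2})" by auto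
 hence "(\<Sum>j<2 * Suc N + 2. f j) = f (2 * N + 3) + (f (2 * N + 2) + (\<Sum>j<2 * N + 2. f j))" by simp
 also have "f (2 * N + 3) = 0" by (rule assms) simp
 finally show ?case using Suc by simp
qed

text \<open>
Odd moments vanish; the moment of order \<open>2 k\<close> scales like \<open>l\<^sup>k\<^sup>+\<^sup>1\<^sup>/\<^sup>2\<close>, and the factor \<open>l\<^sup>-\<^sup>1\<^sup>/\<^sup>2\<close> in front leaves \<open>l\<^sup>k\<close>.
\<close>
lemma gaussian_sum:
 assumes Z: "Z > 0" and l: "l > 0" and m: "m \<in> {0..1}"
 shows "2 * \<omega> * (inverse (csqrt (of_real l)) * (\<Sum>j<2 * N + 2. \<integral>s. gauss_term Z j s (of_real l) (1 - of_real m) \<partial>lborel)) = (\<Sum>k\<le>N. expansion_coeff Z k (of_real m) * of_real l ^ k)"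
proof -
 have n: "norm (1 - complex_of_real m) \<le> 2"
 proof -
  have "(1::complex) - of_real m = of_real (1 - m)" by simp
  hence "norm ((1::complex) - of_real m) = \<bar>1 - m\<bar>" by (simp only: norm_of_real)
  thus ?thesis using m by simp
 qed
 have sl: "of_real (sqrt l) \<noteq> (0::complex)" "csqrt (of_real l) = of_real (sqrt l)" using l by auto
 have "(\<Sum>j<2 * N + 2. \<integral>s. gauss_term Z j s (of_real l) (1 - of_real m) \<partial>lborel) =
   (\<Sum>k\<le>N. of_real (sqrt l) ^ (2 * k + 1) * (\<integral>v. gauss_term Z (2 * k) v 1 (1 - of_real m) \<partial>lborel))"
  unfolding gauss_term_integral(2)[OF Z l n] by (rule sum_even_odd) (simp add: gauss_term_odd)
 also have "2 * \<omega> * (inverse (csqrt (of_real l)) * \<dots>) = (\<Sum>k\<le>N. expansion_coeff Z k (of_real m) * of_real l ^ k)"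
  unfolding sum_distrib_left
 proof (rule sum.cong)
  fix k
  have "complex_of_real (sqrt l) ^ (2 * k) = of_real l ^ k" using l unfolding power_mult by (simp flip: of_real_power)
  thus "2 * \<omega> * (inverse (csqrt (of_real l)) * (of_real (sqrt l) ^ (2 * k + 1) * (\<integral>v. gauss_term Z (2 * k) v 1 (1 - of_real m) \<partial>lborel))) = expansion_coeff Z k (of_real m) * of_real l ^ k"
   unfolding sl(2) expansion_coeff_def using sl(1) by simp
 qed simp
 finally show ?thesis .
qed

section \<open>The right tail\<close>

text \<open>
The entire functions \<open>cosh (w\<^sup>1\<^sup>/\<^sup>2)\<close> and \<open>sinh (w\<^sup>1\<^sup>/\<^sup>2) / w\<^sup>1\<^sup>/\<^sup>2\<close>. The contour depends on \<open>m\<close> only through even functions of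
\<open>m\<^sup>1\<^sup>/\<^sup>2\<close>, which are holomorphic in \<open>m\<close> near 0.
\<close>
definition chs :: "complex => complex" where "chs w = (\<Sum>n. (1 / fact (2 * n)) * w ^ n)"
definition shs :: "complex => complex" where "shs w = (\<Sum>n. (1 / fact (2 * n + 1)) * w ^ n)"

lemma chs_sums: "(\<lambda>n. (1 / fact (2 * n)) * (z\<^sup>2) ^ n) sums cosh (z::complex)"
proof -
 have "(\<lambda>n. if even (2 * n) then z ^ (2 * n) /\<^sub>R fact (2 * n) else 0) sums cosh z"
  by (subst sums_mono_reindex[where g = "\<lambda>n. 2 * n"]) (auto intro: cosh_converges simp: strict_mono_def elim!: evenE)
 moreover have "(if even (2 * n) then z ^ (2 * n) /\<^sub>R fact (2 * n) else 0) = (1 / fact (2 * n)) * (z\<^sup>2) ^ n" for n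
  unfolding power_mult by (simp add: scaleR_conv_of_real divide_inverse)
 ultimately show ?thesis by simp
qed

lemma shs_sums: "(\<lambda>n. z * ((1 / fact (2 * n + 1)) * (z\<^sup>2) ^ n)) sums sinh (z::complex)"
proof -
 have "(\<lambda>n. if even (2 * n + 1) then 0 else z ^ (2 * n + 1) /\<^sub>R fact (2 * n + 1)) sums sinh z"
  by (subst sums_mono_reindex[where g = "\<lambda>n. 2 * n + 1"]) (auto intro: sinh_converges simp: strict_mono_def elim!: oddE)
 moreover have "(if even (2 * n + 1) then 0 else z ^ (2 * n + 1) /\<^sub>R fact (2 * n + 1)) = z * ((1 / fact (2 * n + 1)) * (z\<^sup>2) ^ n)" for n
 proof -
  have "z ^ (2 * n + 1) = z * (z\<^sup>2) ^ n" by (simp add: power_mult)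
  thus ?thesis by (simp add: scaleR_conv_of_real divide_inverse mult.left_commute del: fact_Suc)
 qed
 ultimately show ?thesis by (simp only:)
qed

lemma chs: "chs (z\<^sup>2) = cosh z"
 unfolding chs_def using sums_unique[OF chs_sums] by simp

lemma shs_summable: "summable (\<lambda>n. (1 / fact (2 * n + 1)) * (w::complex) ^ n)"
proof (cases "w = 0")
 case False
 define z where "z = csqrt w"
 have z: "z \<noteq> 0" "w = z\<^sup>2" using False by (auto simp: z_def)
 have "summable (\<lambda>n. inverse z * (z * ((1 / fact (2 * n + 1)) * (z\<^sup>2) ^ n)))"
  by (intro summable_mult sums_summable[OF shs_sums])
 moreover have "inverse z * (z * c) = c" for c using z by simp
 ultimately show ?thesis unfolding z(2) by (simp only:)
next
 case True
 thus ?thesis by (intro summable_finite[of "{0}"]) auto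
qed

lemma chs_summable: "summable (\<lambda>n. (1 / fact (2 * n)) * (w::complex) ^ n)"
 using sums_summable[OF chs_sums, of "csqrt w"] by simp

lemma shs: "z * shs (z\<^sup>2) = sinh z"
 unfolding shs_def using sums_unique[OF shs_sums] suminf_mult[OF shs_summable] by metis

lemma chs_holomorphic: "chs holomorphic_on A"
 unfolding holomorphic_on_def field_differentiable_def chs_def[abs_def]
 using termdiffs_strong_converges_everywhere[OF chs_summable] has_field_derivative_at_within by blast

lemma shs_holomorphic: "shs holomorphic_on A"
 unfolding holomorphic_on_def field_differentiable_def shs_def[abs_def]
 using termdiffs_strong_converges_everywhere[OF shs_summable] has_field_derivative_at_within by blast

lemma shs_0: "shs 0 = 1" and chs_0: "chs 0 = 1"
 unfolding shs_def chs_def by (subst suminf_finite[of "{0}"]; simp)+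

lemma shs_nonzero: assumes "Re w > -9" shows "shs w \<noteq> 0"
proof
 assume s: "shs w = 0"
 define z where "z = csqrt w"
 have w: "w = z\<^sup>2" by (simp add: z_def)
 have "w \<noteq> 0" using s shs_0 by auto
 hence z0: "z \<noteq> 0" by (simp add: z_def)
 have "sinh z = 0" using shs[of z] s w by simp
 hence e: "exp z = exp (- z)" by (simp add: sinh_def)
 have "exp (2 * z) = exp z * exp z" unfolding mult_2 by (rule exp_add)
 also have "\<dots> = exp z * exp (- z)" by (rule arg_cong[OF e])
 also have "\<dots> = 1" by (rule exp_minus_inverse)
 finally obtain n :: int where n: "Re (2 * z) = 0" "Im (2 * z) = of_int (2 * n) * pi" unfolding exp_eq_1 by blast
 have z: "Re z = 0" "Im z = real_of_int n * pi" using n by simp_all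
 have "n \<noteq> 0" using z z0 by (auto simp: complex_eq_iff)
 hence "1 \<le> \<bar>n\<bar>" by linarith
 hence n1: "1 \<le> \<bar>real_of_int n\<bar>" by linarith
 have "1 * 3 \<le> \<bar>real_of_int n\<bar> * pi" using n1 pi_gt3 by (intro mult_mono) auto
 hence "3 \<le> \<bar>Im z\<bar>" using z by (simp add: abs_mult)
 hence "9 \<le> (Im z)\<^sup>2" using power_mono[of 3 "\<bar>Im z\<bar>" 2] by simp
 moreover have "Re w = - (Im z)\<^sup>2" using z by (simp add: w power2_eq_square)
 ultimately show False using assms by simp
qed

text \<open>
\<open>w\<^sup>1\<^sup>/\<^sup>2 coth (w\<^sup>1\<^sup>/\<^sup>2)\<close>.
\<close>
definition Gq :: "complex => complex" where "Gq w = chs w / shs w"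

lemma Gq_holomorphic: "Gq holomorphic_on {w. Re w > -9}"
 unfolding Gq_def[abs_def] by (intro holomorphic_on_divide chs_holomorphic shs_holomorphic) (auto dest: shs_nonzero)

lemma Gq_0: "Gq 0 = 1" by (simp add: Gq_def chs_0 shs_0)

text \<open>
For large \<open>w = z\<^sup>2\<close> with \<open>Re w \<ge> - 1\<close> and \<open>Re z \<ge> 0\<close> the real part of \<open>z\<close> exceeds 1, so that \<open>coth z\<close> is bounded.
\<close>
lemma Gq_bound:
 obtains C where "C > 0" "\<And>w. Re w \<ge> -1 ==> norm (Gq w) \<le> C * (1 + sqrt (norm w))"
proof -
 have sub: "cball 0 3 \<subseteq> {w. Re w > -9}"
 proof
  fix w :: complex assume "w \<in> cball 0 3"
  hence "\<bar>Re w\<bar> \<le> 3" using abs_Re_le_cmod[of w] by simp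
  thus "w \<in> {w. Re w > -9}" by simp
 qed
 have "bounded (Gq ` cball 0 3)"
  by (intro compact_imp_bounded compact_continuous_image holomorphic_on_imp_continuous_on holomorphic_on_subset[OF Gq_holomorphic sub] compact_cball)
 then obtain K where K: "\<And>w. w \<in> cball 0 3 ==> norm (Gq w) \<le> K" unfolding bounded_iff by blast
 show thesis
 proof (rule that[of "max K 2"])
  fix w :: complex assume w: "Re w \<ge> -1"
  show "norm (Gq w) \<le> max K 2 * (1 + sqrt (norm w))"
  proof (cases "norm w \<le> 3")
   case True
   hence "norm (Gq w) \<le> max K 2 * 1" using K[of w] by simp
   also have "\<dots> \<le> max K 2 * (1 + sqrt (norm w))" by (intro mult_left_mono) auto
   finally show ?thesis .
  next
   case False
   define z where "z = csqrt w"
   have wz: "w = z\<^sup>2" and nz: "norm z = sqrt (norm w)" by (auto simp: z_def)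
   have z0: "z \<noteq> 0" using False by (auto simp: wz)
   have "norm w = (norm z)\<^sup>2" by (simp add: wz norm_power)
   hence n3: "(Re z)\<^sup>2 + (Im z)\<^sup>2 > 3" using False by (simp add: cmod_power2)
   have "(Re z)\<^sup>2 - (Im z)\<^sup>2 \<ge> -1" using w by (simp add: wz power2_eq_square)
   hence "(Re z)\<^sup>2 > 1\<^sup>2" using n3 by simp
   moreover have "Re z \<ge> 0" unfolding z_def by (rule Re_csqrt)
   ultimately have a: "Re z > 1" by (rule power2_less_imp_less)
   define E where "E = exp (2 * z)"
   have nE: "norm E \<ge> 3"
   proof -
    have "norm E = exp (2 * Re z)" by (simp add: E_def norm_exp_eq_Re)
    moreover have "1 + 2 * Re z \<le> exp (2 * Re z)" by (rule exp_ge_add_one_self)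
    ultimately show ?thesis using a by linarith
   qed
   have EE: "E = exp z * exp z" unfolding E_def by (simp only: mult_2 exp_add)
   have c: "cosh z = exp (-z) * (E + 1) / 2" "sinh z = exp (-z) * (E - 1) / 2"
    by (simp_all add: cosh_def sinh_def EE scaleR_conv_of_real field_simps exp_minus)
   have E1: "norm (E - 1) \<ge> norm E - 1" using norm_triangle_ineq2[of E 1] by simp
   hence E0: "E - 1 \<noteq> 0" using nE by auto
   have "Gq w = z * (cosh z / sinh z)"
   proof -
    have "sinh z \<noteq> 0" using E0 by (simp add: c)
    have "shs (z\<^sup>2) = sinh z / z" using shs[of z] z0 by (simp add: field_simps)
    thus ?thesis unfolding Gq_def wz chs by simp
   qed
   also have "cosh z / sinh z = (E + 1) / (E - 1)" unfolding c using E0 by simp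
   finally have "norm (Gq w) = norm z * (norm (E + 1) / norm (E - 1))" by (simp add: norm_mult norm_divide)
   also have "norm (E + 1) / norm (E - 1) \<le> (norm E + 1) / (norm E - 1)"
    using nE E1 norm_triangle_ineq[of E 1] by (intro frac_le) auto
   also have "(norm E + 1) / (norm E - 1) \<le> 2" using nE by (simp add: divide_le_eq)
   finally have "norm (Gq w) \<le> norm z * 2" by (simp add: mult_left_mono)
   hence "norm (Gq w) \<le> 2 * sqrt (norm w)" by (simp add: nz mult.commute)
   also have "\<dots> \<le> max K 2 * (1 + sqrt (norm w))" by (intro mult_mono) auto
   finally show ?thesis .
  qed
 qed auto
qed

text \<open>
Cauchy's estimate on discs of radius 1.
\<close>
lemma Gq_Lipschitz:
 obtains C where "C > 0" "\<And>w w'. Re w \<ge> 0 ==> norm (w' - w) \<le> 1/2 ==> norm (Gq w' - Gq w) \<le> C * (1 + sqrt (norm w)) * norm (w' - w)"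
proof -
 obtain C where C: "C > 0" "\<And>w. Re w \<ge> -1 ==> norm (Gq w) \<le> C * (1 + sqrt (norm w))" using Gq_bound by blast
 show thesis
 proof (rule that[of "8 * C"])
  fix w w' :: complex assume w: "Re w \<ge> 0" and w': "norm (w' - w) \<le> 1/2"
  have Re: "Re u \<ge> -1" if "u \<in> ball w 1" for u
   using that w abs_Re_le_cmod[of "w - u"] by (simp add: dist_norm)
  have hol: "Gq holomorphic_on ball w 1"
   by (rule holomorphic_on_subset[OF Gq_holomorphic]) (use Re in force)
  have B: "norm (Gq u) \<le> C * (2 * (1 + sqrt (norm w)))" if u: "u \<in> ball w 1" for u
  proof -
   have "norm u \<le> norm w + 1" using u norm_triangle_sub[of u w] by (simp add: dist_norm norm_minus_commute)
   hence "sqrt (norm u) \<le> sqrt (norm w + 1)" by simp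
   also have "\<dots> \<le> sqrt (norm w) + 1" using sqrt_add_le_add_sqrt[of "norm w" 1] by simp
   finally have "sqrt (norm u) \<le> sqrt (norm w) + 1" .
   moreover have "0 \<le> sqrt (norm w)" by simp
   moreover have "1 + a \<le> 2 * (1 + b)" if "a \<le> b + 1" "0 \<le> b" for a b :: real using that by simp
   ultimately have "1 + sqrt (norm u) \<le> 2 * (1 + sqrt (norm w))" by blast
   hence "C * (1 + sqrt (norm u)) \<le> C * (2 * (1 + sqrt (norm w)))" using C by simp
   thus ?thesis using C(2)[OF Re[OF u]] by linarith
  qed
  have "norm (Gq w' - Gq w) \<le> (4 * (C * (2 * (1 + sqrt (norm w)))) / 1) * norm (w' - w)"
  proof (rule field_differentiable_bound[where S = "cball w (1/2)" and f' = "deriv Gq"])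
   fix u assume u: "u \<in> cball w (1/2)"
   show "(Gq has_field_derivative deriv Gq u) (at u within cball w (1/2))"
    by (rule has_field_derivative_at_within[OF holomorphic_derivI[OF hol]]) (use u in auto)
   show "norm (deriv Gq u) \<le> 4 * (C * (2 * (1 + sqrt (norm w)))) / 1"
    by (rule deriv_bound_ball[OF hol _ B]) (use u in \<open>auto simp: dist_norm norm_minus_commute\<close>)
  qed (use w' in \<open>auto simp: dist_norm norm_minus_commute\<close>)
  thus "norm (Gq w' - Gq w) \<le> 8 * C * (1 + sqrt (norm w)) * norm (w' - w)" by (simp add: mult_ac)
 qed (use C in auto)
qed

text \<open>
The solution of \<open>P' = 1 - 2 P + (1 - m) P\<^sup>2\<close>, \<open>P 0 = 0\<close>. Following \<open>Q = - P\<close> the new variable \<open>t\<close> is the logarithmic part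
of the phase, \<open>F Q = t - P\<close>; the singular point of \<open>Q\<close> is reached as \<open>t \<rightarrow> \<infinity>\<close>.
\<close>
definition Pf :: "complex => complex => complex" where
 "Pf m t = t * shs (m * t\<^sup>2) / (chs (m * t\<^sup>2) + t * shs (m * t\<^sup>2))"

lemma Pf_eq:
 assumes "t \<noteq> 0" "shs (m * t\<^sup>2) \<noteq> 0"
 shows "Pf m t = 1 / (1 + Gq (m * t\<^sup>2) / t)"
  and "chs (m * t\<^sup>2) + t * shs (m * t\<^sup>2) = t * shs (m * t\<^sup>2) * (1 + Gq (m * t\<^sup>2) / t)"
proof -
 show *: "chs (m * t\<^sup>2) + t * shs (m * t\<^sup>2) = t * shs (m * t\<^sup>2) * (1 + Gq (m * t\<^sup>2) / t)"
  using assms by (simp add: Gq_def field_simps)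
 show "Pf m t = 1 / (1 + Gq (m * t\<^sup>2) / t)" unfolding Pf_def * using assms by simp
qed

text \<open>
Gives \<open>|sinh z|\<^sup>2 \<le> |z|\<^sup>2 |cosh z|\<^sup>2\<close> on the diagonal \<open>z = a (1 - \<i>)\<close>.
\<close>
lemma cosh_cos_ineq:
 assumes x: "(x::real) \<ge> 0"
 shows "cosh x - cos x \<le> x\<^sup>2 / 2 * (cosh x + cos x)"
proof -
 have ss: "sinh y - sin y \<ge> 0" "cosh y - cos y \<ge> 0" if "y \<ge> 0" for y :: real
 proof -
  show c: "cosh y - cos y \<ge> 0" using cosh_real_ge_1[of y] cos_le_one[of y] by linarith
  have "sinh 0 - sin 0 \<le> sinh y - sin (y::real)"
  proof (rule DERIV_nonneg_imp_nondecreasing[OF that])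
   fix u :: real
   have "cosh u - cos u \<ge> 0" using cosh_real_ge_1[of u] cos_le_one[of u] by linarith
   thus "\<exists>d. ((\<lambda>y. sinh y - sin y) has_real_derivative d) (at u) \<and> 0 \<le> d"
    by (intro exI[of _ "cosh u - cos u"]) (auto intro!: derivative_eq_intros)
  qed
  thus "sinh y - sin y \<ge> 0" by simp
 qed
 define D where "D y = y\<^sup>2 / 2 * (cosh y + cos y) - (cosh y - cos y)" for y :: real
 define D1 where "D1 y = y * (cosh y + cos y) + y\<^sup>2 / 2 * (sinh y - sin y) - (sinh y + sin y)" for y :: real
 have D: "(D has_real_derivative D1 y) (at y)" for y
  unfolding D_def[abs_def] D1_def by (auto intro!: derivative_eq_intros simp: field_simps power2_eq_square)
 have D1: "(D1 has_real_derivative (2 * y * (sinh y - sin y) + y\<^sup>2 / 2 * (cosh y - cos y))) (at y)" for y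
  unfolding D1_def[abs_def] by (auto intro!: derivative_eq_intros simp: field_simps power2_eq_square)
 have D1pos: "D1 y \<ge> 0" if y: "y \<ge> 0" for y
 proof -
  have "D1 0 \<le> D1 y"
  proof (rule DERIV_nonneg_imp_nondecreasing[OF y])
   fix u assume "0 \<le> u" "u \<le> y"
   thus "\<exists>d. (D1 has_real_derivative d) (at u) \<and> 0 \<le> d"
    using D1[of u] ss[of u] by (intro exI[of _ "2 * u * (sinh u - sin u) + u\<^sup>2 / 2 * (cosh u - cos u)"] conjI add_nonneg_nonneg mult_nonneg_nonneg) auto
  qed
  thus ?thesis by (simp add: D1_def)
 qed
 have "D 0 \<le> D x"
 proof (rule DERIV_nonneg_imp_nondecreasing[OF x])
  fix u assume "0 \<le> u" "u \<le> x"
  thus "\<exists>d. (D has_real_derivative d) (at u) \<and> 0 \<le> d" using D[of u] D1pos[of u] by blast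
 qed
 thus ?thesis by (simp add: D_def)
qed

text \<open>
On the ray, \<open>k\<close> is a multiple of \<open>cosh / sinh\<close>, which stays in the quarter plane around the positive real axis
since \<open>|sin a cos a| \<le> sinh a cosh a\<close>.
\<close>
lemma ray_quotient:
 assumes s: "s > 0" and m: "m \<in> {0..1}"
 defines "t \<equiv> \<omega> * of_real s"
 defines "k \<equiv> Gq (of_real m * t\<^sup>2) / t"
 shows "\<bar>Im k\<bar> \<le> Re k" "norm k \<ge> 1 / s" "shs (of_real m * t\<^sup>2) \<noteq> 0" "Re (of_real m * t\<^sup>2) = 0" "norm (of_real m * t\<^sup>2) = m * s\<^sup>2"
proof -
 have t2: "t\<^sup>2 = - \<i> * of_real (s\<^sup>2)" unfolding t_def by (rule i_\<omega>_sq(2))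
 have w: "of_real m * t\<^sup>2 = Complex 0 (- (m * s\<^sup>2))" unfolding t2 by (simp add: complex_eq_iff flip: of_real_power)
 show Re0: "Re (of_real m * t\<^sup>2) = 0" unfolding w by simp
 show "norm (of_real m * t\<^sup>2) = m * s\<^sup>2" unfolding w using m by (simp add: cmod_def)
 show sh: "shs (of_real m * t\<^sup>2) \<noteq> 0" by (rule shs_nonzero) (use Re0 in linarith)
 have t0: "t \<noteq> 0" using s by (simp add: t_def \<omega>)
 have tnorm: "norm t = s" using s by (simp add: t_def norm_mult \<omega>)
 have "\<bar>Im k\<bar> \<le> Re k \<and> norm k \<ge> 1 / s"
 proof (cases "m = 0")
  case True
  have k: "k = 1 / t" by (simp add: k_def True Gq_0)
  have "Re t = sqrt 2 / 2 * s" "Im t = - (sqrt 2 / 2 * s)" by (simp_all add: t_def \<omega>)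
  hence "\<bar>Im t\<bar> = Re t" using s by simp
  moreover have "Re k = Re t / (norm t)\<^sup>2" "Im k = - Im t / (norm t)\<^sup>2" by (simp_all add: k Re_divide Im_divide cmod_power2)
  ultimately have "\<bar>Im k\<bar> \<le> Re k" by simp
  moreover have "norm k \<ge> 1 / s" by (simp add: k norm_divide tnorm)
  ultimately show ?thesis by blast
 next
  case False
  hence m0: "m > 0" using m by simp
  define a where "a = sqrt m * s * (sqrt 2 / 2)"
  define z where "z = of_real (sqrt m) * t"
  have a: "a > 0" using m0 s by (simp add: a_def)
  have z: "Re z = a" "Im z = - a" by (simp_all add: z_def t_def a_def \<omega>)
  have z2: "of_real m * t\<^sup>2 = z\<^sup>2" using m0 by (simp add: z_def power_mult_distrib flip: of_real_power)
  have z0: "z \<noteq> 0" using a z by auto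
  have sz: "sinh z \<noteq> 0" using shs[of z] sh z0 unfolding z2 by auto
  have kq: "k = of_real (sqrt m) * (cosh z / sinh z)"
  proof -
   have "shs (z\<^sup>2) = sinh z / z" using shs[of z] z0 by (simp add: field_simps)
   hence "Gq (z\<^sup>2) = z * (cosh z / sinh z)" unfolding Gq_def chs by simp
   thus ?thesis unfolding k_def z2 using t0 by (simp add: z_def)
  qed
  have ez: "exp z = of_real (exp a) * cis (- a)" "exp (-z) = of_real (exp (-a)) * cis a"
   by (simp_all add: exp_eq_polar[of z] exp_eq_polar[of "-z"] z)
  have cz: "Re (cosh z) = cosh a * cos a" "Im (cosh z) = - (sinh a * sin a)" "Re (sinh z) = sinh a * cos a" "Im (sinh z) = - (cosh a * sin a)"
   unfolding cosh_def sinh_def ez by (simp_all add: field_simps)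
  have cs: "(cosh a)\<^sup>2 = (cosh (2*a) + 1) / 2" "(sinh a)\<^sup>2 = (cosh (2*a) - 1) / 2" "(cos a)\<^sup>2 = (1 + cos (2*a)) / 2" "(sin a)\<^sup>2 = (1 - cos (2*a)) / 2"
   by (simp_all add: cosh_double_cosh cos_double_cos cosh_square_eq sin_squared_eq)
  have n1: "(norm (sinh z))\<^sup>2 = (cosh (2*a) - cos (2*a)) / 2"
  proof -
   have "(norm (sinh z))\<^sup>2 = (sinh a)\<^sup>2 * (cos a)\<^sup>2 + (cosh a)\<^sup>2 * (sin a)\<^sup>2" by (simp add: cmod_power2 cz power_mult_distrib)
   also have "\<dots> = (cosh (2*a) - cos (2*a)) / 2" unfolding cs by (simp add: field_simps)
   finally show ?thesis .
  qed
  have n2: "(norm (cosh z))\<^sup>2 = (cosh (2*a) + cos (2*a)) / 2"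
  proof -
   have "(norm (cosh z))\<^sup>2 = (cosh a)\<^sup>2 * (cos a)\<^sup>2 + (sinh a)\<^sup>2 * (sin a)\<^sup>2" by (simp add: cmod_power2 cz power_mult_distrib)
   also have "\<dots> = (cosh (2*a) + cos (2*a)) / 2" unfolding cs by (simp add: field_simps)
   finally show ?thesis .
  qed
  define q where "q = cosh z / sinh z"
  define N where "N = (norm (sinh z))\<^sup>2"
  have N: "N > 0" using sz by (simp add: N_def)
  have qR: "Re q = sinh a * cosh a / N"
  proof -
   have "Re q = (cosh a * cos a * (sinh a * cos a) + sinh a * sin a * (cosh a * sin a)) / N"
    by (simp add: q_def Re_divide cz N_def cmod_power2)
   also have "cosh a * cos a * (sinh a * cos a) + sinh a * sin a * (cosh a * sin a) = sinh a * cosh a * ((sin a)\<^sup>2 + (cos a)\<^sup>2)"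
    by (simp only: power2_eq_square algebra_simps)
   finally show ?thesis by simp
  qed
  have qI: "Im q = sin a * cos a / N"
  proof -
   have "Im q = (- (sinh a * sin a) * (sinh a * cos a) - cosh a * cos a * (- (cosh a * sin a))) / N"
    by (simp add: q_def Im_divide cz N_def cmod_power2)
   also have "- (sinh a * sin a) * (sinh a * cos a) - cosh a * cos a * (- (cosh a * sin a)) = sin a * cos a * ((cosh a)\<^sup>2 - (sinh a)\<^sup>2)"
    by algebra
   finally show ?thesis by (simp add: cosh_square_eq)
  qed
  have "\<bar>sin (2 * a)\<bar> \<le> 2 * a" using abs_sin_x_le_abs_x[of "2 * a"] a by simp
  also have "2 * a \<le> sinh (2 * a)"
  proof -
   have "sinh 0 - 0 \<le> sinh (2*a) - (2 * a :: real)"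
   proof (rule DERIV_nonneg_imp_nondecreasing[of 0 "2 * a"])
    show "\<exists>d. ((\<lambda>y. sinh y - y) has_real_derivative d) (at u) \<and> 0 \<le> d" for u :: real
     using cosh_real_ge_1[of u] by (intro exI[of _ "cosh u - 1"]) (auto intro!: derivative_eq_intros)
   qed (use a in auto)
   thus ?thesis by simp
  qed
  finally have "\<bar>sin a * cos a\<bar> \<le> sinh a * cosh a" by (simp add: sin_double sinh_double abs_mult)
  hence "\<bar>Im q\<bar> \<le> Re q" unfolding qR qI using N by (simp add: divide_right_mono)
  hence cone: "\<bar>Im k\<bar> \<le> Re k" unfolding kq q_def[symmetric] using m0 by (simp add: abs_mult)
  have "norm (sinh z) \<le> sqrt m * s * norm (cosh z)"
  proof (rule power2_le_imp_le)
   have a2: "(2 * a)\<^sup>2 / 2 = (sqrt m * s)\<^sup>2" by (simp add: a_def power_mult_distrib power_divide)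
   have "(norm (sinh z))\<^sup>2 \<le> (2 * a)\<^sup>2 / 2 * (norm (cosh z))\<^sup>2"
    using cosh_cos_ineq[of "2 * a"] a unfolding n1 n2 by simp
   thus "(norm (sinh z))\<^sup>2 \<le> (sqrt m * s * norm (cosh z))\<^sup>2" unfolding a2 by (simp only: power_mult_distrib)
  qed (use m0 s in auto)
  hence "1 / s \<le> sqrt m * norm (cosh z) / norm (sinh z)"
   using s sz by (simp add: divide_le_eq le_divide_eq mult_ac)
  hence "norm k \<ge> 1 / s" unfolding kq using m0 by (simp add: norm_mult norm_divide)
  thus ?thesis using cone by blast
 qed
 thus "\<bar>Im k\<bar> \<le> Re k" "norm k \<ge> 1 / s" by auto
qed

lemma Pf_holomorphic:
 assumes "g holomorphic_on U" "\<And>z. z \<in> U ==> chs (g z * t\<^sup>2) + t * shs (g z * t\<^sup>2) \<noteq> 0"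
 shows "(\<lambda>z. Pf (g z) t) holomorphic_on U"
proof -
 have gt: "(\<lambda>z. g z * t\<^sup>2) holomorphic_on U" by (intro holomorphic_intros assms)
 have "(chs \<circ> (\<lambda>z. g z * t\<^sup>2)) holomorphic_on U" "(shs \<circ> (\<lambda>z. g z * t\<^sup>2)) holomorphic_on U"
  by (rule holomorphic_on_compose_gen[OF gt]; use chs_holomorphic shs_holomorphic in auto)+
 thus ?thesis unfolding Pf_def o_def using assms(2)
  by (intro holomorphic_on_divide holomorphic_on_mult holomorphic_on_add holomorphic_on_const)
qed

lemma Pf_measurable:
 assumes [measurable]: "t \<in> borel_measurable borel" shows "(\<lambda>y::real. Pf m (t y)) \<in> borel_measurable borel"
proof -
 have [measurable]: "chs \<in> borel_measurable borel" "shs \<in> borel_measurable borel"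
  by (intro borel_measurable_continuous_onI holomorphic_on_imp_continuous_on chs_holomorphic shs_holomorphic)+
 show ?thesis unfolding Pf_def by measurable
qed

text \<open>
As \<open>Pf = 1 / (1 + k)\<close>, the quotient bounds turn into a lower bound that is quadratic for small \<open>s\<close> and linear for large \<open>s\<close>.
\<close>
lemma right_real_bound:
 assumes s: "s > 0" and m: "m \<in> {0..1}"
 defines "t \<equiv> \<omega> * of_real s"
 shows "Re (\<i> * (t - Pf (of_real m) t)) \<ge> s\<^sup>2 / (1 + sqrt 2 * s)"
proof -
 define k where "k = Gq (of_real m * t\<^sup>2) / t"
 note R = ray_quotient[OF s m, folded t_def, folded k_def]
 have t0: "t \<noteq> 0" using s by (simp add: t_def \<omega>)
 have P: "Pf (of_real m) t = 1 / (1 + k)" unfolding k_def by (rule Pf_eq(1)[OF t0 R(3)])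
 define r where "r = norm k"
 have r: "r \<ge> 1 / s" "r > 0" using R(2) s by (auto simp: r_def intro: less_le_trans[of 0 "1 / s"])
 have rr: "r\<^sup>2 = (Re k)\<^sup>2 + (Im k)\<^sup>2" by (simp add: r_def cmod_power2)
 have Rk: "Re k \<ge> 0" using R(1) by simp
 have I2: "(Im k)\<^sup>2 \<le> (Re k)\<^sup>2" using R(1) Rk by (simp add: abs_le_square_iff[symmetric])
 have s2: "(sqrt 2 / 2)\<^sup>2 = (1/2 :: real)" by (simp add: power_divide)
 have Ik: "Im k \<le> sqrt 2 / 2 * r"
 proof (rule power2_le_imp_le)
  show "(Im k)\<^sup>2 \<le> (sqrt 2 / 2 * r)\<^sup>2" unfolding power_mult_distrib s2 rr using I2 by simp
 qed (use r in simp)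
 have Rk2: "Re k \<ge> sqrt 2 / 2 * r"
 proof (rule power2_le_imp_le)
  show "(sqrt 2 / 2 * r)\<^sup>2 \<le> (Re k)\<^sup>2" unfolding power_mult_distrib s2 rr using I2 by simp
 qed (use Rk in simp)
 define D where "D = (norm (1 + k))\<^sup>2"
 have D: "D = 1 + 2 * Re k + r\<^sup>2" unfolding D_def rr cmod_power2 by (simp add: power2_eq_square algebra_simps)
 have Dp: "D > 0" unfolding D using Rk by (intro add_pos_nonneg) auto
 have D2: "D \<ge> r * (r + sqrt 2)" unfolding D using Rk2 by (simp add: power2_eq_square algebra_simps)
 have ImP: "Im (Pf (of_real m) t) = - Im k / D" unfolding P D_def by (simp add: Im_divide cmod_power2)
 have rp: "r * (r + sqrt 2) > 0" using r by (intro mult_pos_pos add_pos_pos) auto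
 have "Im k / D \<le> (sqrt 2 / 2 * r) / (r * (r + sqrt 2))"
 proof (cases "Im k \<ge> 0")
  case True thus ?thesis using Ik D2 r rp by (intro frac_le) auto
 next
  case False
  hence "Im k / D \<le> 0" using Dp by (simp add: divide_le_0_iff)
  also have "0 \<le> (sqrt 2 / 2 * r) / (r * (r + sqrt 2))" using r by simp
  finally show ?thesis .
 qed
 also have "\<dots> = (sqrt 2 / 2) / (r + sqrt 2)" using r by simp
 also have "\<dots> \<le> (sqrt 2 / 2) / (1 / s + sqrt 2)" using r s by (intro divide_left_mono mult_pos_pos add_pos_pos) auto
 finally have IkD: "Im k / D \<le> (sqrt 2 / 2) / (1 / s + sqrt 2)" .
 have "Re (\<i> * (t - Pf (of_real m) t)) = sqrt 2 / 2 * s - Im k / D"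
  using ImP by (simp add: t_def \<omega>)
 also have "\<dots> \<ge> sqrt 2 / 2 * s - (sqrt 2 / 2) / (1 / s + sqrt 2)" using IkD by simp
 also have "sqrt 2 / 2 * s - (sqrt 2 / 2) / (1 / s + sqrt 2) = s\<^sup>2 / (1 + sqrt 2 * s)"
 proof -
  have p: "1 + sqrt 2 * s > 0" using s by (simp add: add_pos_pos)
  have "(sqrt 2 / 2) / (1 / s + sqrt 2) = (sqrt 2 / 2) * s / (1 + sqrt 2 * s)"
   using s p by (simp add: field_simps)
  moreover have "sqrt 2 / 2 * s - (sqrt 2 / 2) * s / (1 + sqrt 2 * s) = (sqrt 2 / 2 * s * (1 + sqrt 2 * s) - sqrt 2 / 2 * s) / (1 + sqrt 2 * s)"
   unfolding diff_divide_distrib nonzero_mult_div_cancel_right[OF less_imp_neq[OF p, symmetric]] ..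
  moreover have "sqrt 2 / 2 * s * (1 + sqrt 2 * s) - sqrt 2 / 2 * s = s\<^sup>2" by (simp add: algebra_simps power2_eq_square)
  ultimately show ?thesis by simp
 qed
 finally show ?thesis .
qed

text \<open>
Complex \<open>m\<close> is a perturbation of \<open>m0 \<in> [0, 1]\<close>: the argument of \<open>Gq\<close> moves by at most \<open>c\<close>, while its Lipschitz constant
grows linearly in \<open>s\<close>; the width \<open>c / (1 + s)\<^sup>2\<close> of the neighbourhood makes up for both.
\<close>
lemma right_bounds:
 assumes e: "0 < \<epsilon>" "\<epsilon> \<le> 1"
 obtains c where "c > 0" "\<And>s m. s > \<epsilon> ==> m \<in> nbh c s ==>
   chs (m * (\<omega> * of_real s)\<^sup>2) + \<omega> * of_real s * shs (m * (\<omega> * of_real s)\<^sup>2) \<noteq> 0 \<and>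
   norm (Pf m (\<omega> * of_real s)) \<le> 2 \<and> norm m \<le> 2 \<and>
   \<epsilon>\<^sup>2/16 * (1 + \<bar>s\<bar>) \<le> Re (\<i> * (\<omega> * of_real s - Pf m (\<omega> * of_real s))) \<and>
   \<bar>Im (\<i> * (\<omega> * of_real s - Pf m (\<omega> * of_real s)))\<bar> \<le> (32/\<epsilon>\<^sup>2) * Re (\<i> * (\<omega> * of_real s - Pf m (\<omega> * of_real s)))"
proof -
 obtain C where C: "C > 0" "\<And>w w'. Re w \<ge> 0 ==> norm (w' - w) \<le> 1/2 ==> norm (Gq w' - Gq w) \<le> C * (1 + sqrt (norm w)) * norm (w' - w)"
  using Gq_Lipschitz by blast
 define c where "c = min (1/4) (\<epsilon>\<^sup>2 / (32 * C))"
 have c: "c > 0" "c \<le> 1/4" using C e by (auto simp: c_def)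
 have "c \<le> \<epsilon>\<^sup>2 / (32 * C)" by (simp add: c_def)
 hence Cc: "C * c \<le> \<epsilon>\<^sup>2 / 32" using C by (simp add: field_simps)
 have e2: "\<epsilon>\<^sup>2 \<le> 1" using e by (simp add: power_le_one)
 show thesis
 proof (rule that[OF c(1)])
  fix s m assume se: "s > \<epsilon>" and m: "m \<in> nbh c s"
  have s: "s > 0" using se e by simp
  obtain m0 where m0: "m0 \<in> {0..1}" "norm (m - of_real m0) \<le> c" "norm (m - of_real m0) * \<bar>s\<bar> \<le> c"
   "norm (m - of_real m0) * (1 + \<bar>s\<bar>)\<^sup>2 \<le> c"
   using nbh_elim[OF m c] by auto
  define t where "t = \<omega> * of_real s"
  define w0 w where "w0 = of_real m0 * t\<^sup>2" and "w = m * t\<^sup>2"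
  define k0 k where "k0 = Gq w0 / t" and "k = Gq w / t"
  define \<eta> where "\<eta> = C * c"
  have eta: "\<eta> \<ge> 0" "\<eta> \<le> 1/2" "2 * \<eta> \<le> \<epsilon>\<^sup>2/16" using Cc C c e2 by (auto simp: \<eta>_def)
  have t: "t \<noteq> 0" "norm t = s" using s by (auto simp: t_def \<omega> norm_mult)
  note R = ray_quotient[OF s m0(1), folded t_def, folded w0_def, folded k0_def]
  have ww: "norm (w - w0) = norm (m - of_real m0) * s\<^sup>2"
   by (simp add: w_def w0_def norm_mult norm_power t flip: left_diff_distrib)
  have sq: "s\<^sup>2 \<le> (1 + \<bar>s\<bar>)\<^sup>2" using s by (intro power_mono) auto
  have "norm (m - of_real m0) * s\<^sup>2 \<le> norm (m - of_real m0) * (1 + \<bar>s\<bar>)\<^sup>2" by (intro mult_left_mono sq) auto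
  hence w1: "norm (w - w0) \<le> 1/2" using m0(4) c ww by linarith
  have "Re w \<ge> - 1/2" using w1 R(4) abs_Re_le_cmod[of "w - w0"] by simp
  hence sh: "shs w \<noteq> 0" by (intro shs_nonzero) simp
  have "norm (k - k0) = norm (Gq w - Gq w0) / s"
   by (simp add: k_def k0_def norm_divide t flip: diff_divide_distrib)
  also have "\<dots> \<le> (C * (1 + sqrt (norm w0)) * norm (w - w0)) / s"
   using C(2)[of w0 w] w1 R(4) s by (intro divide_right_mono) auto
  also have "\<dots> \<le> (C * (1 + s) * (norm (m - of_real m0) * s\<^sup>2)) / s"
  proof (intro divide_right_mono mult_mono mult_left_mono add_left_mono)
   have "norm w0 \<le> s\<^sup>2" unfolding R(5) using m0(1) by (simp add: mult_left_le_one_le)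
   thus "sqrt (norm w0) \<le> s" using s real_le_lsqrt by auto
  qed (use C s ww in auto)
  also have "\<dots> = C * (norm (m - of_real m0) * ((1 + s) * s))" using s by (simp add: power2_eq_square field_simps)
  also have "\<dots> \<le> C * (norm (m - of_real m0) * (1 + \<bar>s\<bar>)\<^sup>2)"
   using C s by (intro mult_left_mono) (auto simp: power2_eq_square)
  also have "\<dots> \<le> \<eta>" unfolding \<eta>_def using C m0(4) by (intro mult_left_mono) auto
  finally have kk: "norm (k - k0) \<le> \<eta>" .
  have "Re k0 \<ge> 0" using R(1) by simp
  hence n0: "norm (1 + k0) \<ge> 1" using complex_Re_le_cmod[of "1 + k0"] by simp
  have "norm (1 + k0) \<le> norm (1 + k) + norm (k - k0)" using norm_triangle_ineq4[of "1 + k" "k - k0"] by simp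
  hence n1: "norm (1 + k) \<ge> 1/2" using n0 kk eta by linarith
  hence k1: "1 + k \<noteq> 0" "1 + k0 \<noteq> 0" using n0 by auto
  have P0: "Pf (of_real m0) t = 1 / (1 + k0)" unfolding k0_def w0_def by (rule Pf_eq(1)[OF t(1)]) (use R(3) w0_def in simp)
  have P: "Pf m t = 1 / (1 + k)" unfolding k_def w_def by (rule Pf_eq(1)[OF t(1)]) (use sh w_def in simp)
  have nP: "norm (Pf m t) \<le> 2" unfolding P norm_divide using n1 k1 by (simp add: divide_le_eq)
  have "Pf m t - Pf (of_real m0) t = (k0 - k) / ((1 + k) * (1 + k0))" unfolding P P0 using k1 by (simp add: diff_frac_eq)
  hence "norm (Pf m t - Pf (of_real m0) t) = norm (k - k0) / (norm (1 + k) * norm (1 + k0))"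
   by (simp add: norm_divide norm_mult norm_minus_commute)
  also have "\<dots> \<le> \<eta> / (1/2 * 1)" using kk n1 n0 eta by (intro frac_le mult_mono) auto
  finally have PP: "norm (Pf m t - Pf (of_real m0) t) \<le> 2 * \<eta>" by simp
  have "\<epsilon> * (1 + s) \<le> 2 * s" using se mult_left_le_one_le[of s \<epsilon>] s e unfolding distrib_left by linarith
  hence "(\<epsilon> * (1 + s))\<^sup>2 \<le> (2 * s)\<^sup>2" using e s by (intro power_mono) auto
  hence es: "\<epsilon>\<^sup>2 * (1 + s)\<^sup>2 \<le> 4 * s\<^sup>2" by (simp add: power_mult_distrib)
  have p: "1 + sqrt 2 * s > 0" using s by (simp add: add_pos_pos)
  have "sqrt 2 \<le> (2::real)" by (rule real_le_lsqrt) auto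
  hence "1 + sqrt 2 * s \<le> 2 * (1 + s)" using mult_right_mono[of "sqrt 2" 2 s, OF _ less_imp_le[OF s]] unfolding distrib_left by linarith
  hence "\<epsilon>\<^sup>2/8 * (1 + s) * (1 + sqrt 2 * s) \<le> \<epsilon>\<^sup>2/8 * (1 + s) * (2 * (1 + s))" using s by (intro mult_left_mono) auto
  also have "\<dots> = \<epsilon>\<^sup>2 * (1 + s)\<^sup>2 / 4" by (simp add: power2_eq_square)
  also have "\<dots> \<le> s\<^sup>2" using es by simp
  finally have "\<epsilon>\<^sup>2/8 * (1 + s) \<le> s\<^sup>2 / (1 + sqrt 2 * s)" using p by (simp add: pos_le_divide_eq)
  also have "\<dots> \<le> Re (\<i> * (t - Pf (of_real m0) t))" unfolding t_def by (rule right_real_bound[OF s m0(1)])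
  finally have X0: "\<epsilon>\<^sup>2/8 * (1 + s) \<le> Re (\<i> * (t - Pf (of_real m0) t))" .
  define X where "X = \<i> * (t - Pf m t)"
  have "\<i> * (t - Pf (of_real m0) t) = X + \<i> * (Pf m t - Pf (of_real m0) t)" by (simp add: X_def algebra_simps)
  hence "Re (\<i> * (t - Pf (of_real m0) t)) \<le> Re X + norm (Pf m t - Pf (of_real m0) t)"
   using abs_Im_le_cmod[of "Pf m t - Pf (of_real m0) t"] by simp
  moreover have "\<epsilon>\<^sup>2/16 * (1 + s) \<ge> \<epsilon>\<^sup>2/16" using s mult_left_mono[of 1 "1 + s" "\<epsilon>\<^sup>2/16"] by simp
  moreover have "\<epsilon>\<^sup>2/8 * (1 + s) = \<epsilon>\<^sup>2/16 * (1 + s) + \<epsilon>\<^sup>2/16 * (1 + s)" by simp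
  ultimately have X1: "\<epsilon>\<^sup>2/16 * (1 + s) \<le> Re X" using X0 PP eta by linarith
  have "\<bar>Im X\<bar> \<le> norm X" by (rule abs_Im_le_cmod)
  also have "norm X \<le> s + 2" unfolding X_def norm_mult using norm_triangle_ineq4[of t "Pf m t"] t nP by simp
  also have "\<dots> \<le> 32/\<epsilon>\<^sup>2 * (\<epsilon>\<^sup>2/16 * (1 + s))" using e s by simp
  also have "\<dots> \<le> 32/\<epsilon>\<^sup>2 * Re X" using X1 by (intro mult_left_mono) auto
  finally have X2: "\<bar>Im X\<bar> \<le> 32/\<epsilon>\<^sup>2 * Re X" .
  have D: "chs w + t * shs w \<noteq> 0"
   unfolding w_def Pf_eq(2)[OF t(1) sh[unfolded w_def]] using sh t k1 by (simp add: w_def k_def)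
  have "norm m \<le> norm (of_real m0 :: complex) + norm (m - of_real m0)" by (rule norm_triangle_sub)
  hence nm: "norm m \<le> 2" using m0 c by simp
  show "chs (m * (\<omega> * of_real s)\<^sup>2) + \<omega> * of_real s * shs (m * (\<omega> * of_real s)\<^sup>2) \<noteq> 0 \<and>
   norm (Pf m (\<omega> * of_real s)) \<le> 2 \<and> norm m \<le> 2 \<and>
   \<epsilon>\<^sup>2/16 * (1 + \<bar>s\<bar>) \<le> Re (\<i> * (\<omega> * of_real s - Pf m (\<omega> * of_real s))) \<and>
   \<bar>Im (\<i> * (\<omega> * of_real s - Pf m (\<omega> * of_real s)))\<bar> \<le> (32/\<epsilon>\<^sup>2) * Re (\<i> * (\<omega> * of_real s - Pf m (\<omega> * of_real s)))"
   unfolding t_def[symmetric] X_def[symmetric] w_def[symmetric] using D nP nm X1 X2 s by simp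
 qed
qed

text \<open>
The derivative of \<open>Pf m\<close>, from its differential equation.
\<close>
definition dP :: "complex => complex => complex" where
 "dP m t = 1 - 2 * Pf m t + (1 - m) * (Pf m t)\<^sup>2"

lemma right_kernel:
 assumes Z: "Z > 0" and e: "0 < \<epsilon>" "\<epsilon> \<le> 1"
 shows "kernel N (\<lambda>y l m. indicator {\<epsilon><..} y *\<^sub>R (inverse (csqrt l) * exp (- (of_real Z / l) * (\<i> * (\<omega> * of_real y - Pf m (\<omega> * of_real y)))) * (2 * \<omega> * dP m (\<omega> * of_real y))))"
proof -
 obtain c where c: "c > 0" and b: "\<And>s m. s > \<epsilon> ==> m \<in> nbh c s ==>
   chs (m * (\<omega> * of_real s)\<^sup>2) + \<omega> * of_real s * shs (m * (\<omega> * of_real s)\<^sup>2) \<noteq> 0 \<and>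
   norm (Pf m (\<omega> * of_real s)) \<le> 2 \<and> norm m \<le> 2 \<and>
   \<epsilon>\<^sup>2/16 * (1 + \<bar>s\<bar>) \<le> Re (\<i> * (\<omega> * of_real s - Pf m (\<omega> * of_real s))) \<and>
   \<bar>Im (\<i> * (\<omega> * of_real s - Pf m (\<omega> * of_real s)))\<bar> \<le> (32/\<epsilon>\<^sup>2) * Re (\<i> * (\<omega> * of_real s - Pf m (\<omega> * of_real s)))"
  using right_bounds[OF e] by blast
 have hP: "(\<lambda>z. Pf (g z) (\<omega> * of_real y)) holomorphic_on U" if "y \<in> {\<epsilon><..}" "g holomorphic_on U" "g ` U \<subseteq> nbh c y" for y U g
  by (rule Pf_holomorphic[OF that(2)]) (use that b in blast)
 have [measurable]: "(\<lambda>y. Pf m (\<omega> * of_real y)) \<in> borel_measurable borel" for m by (rule Pf_measurable) measurable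
 show ?thesis
 proof (rule tail_kernel[OF Z c, where a = "\<epsilon>\<^sup>2/16" and M = "32/\<epsilon>\<^sup>2" and K = 34])
  fix y U g assume y: "y \<in> {\<epsilon><..}" and U: "open U" "g holomorphic_on U" "g ` U \<subseteq> nbh c y"
  show "(\<lambda>z. \<i> * (\<omega> * of_real y - Pf (g z) (\<omega> * of_real y))) holomorphic_on U"
   by (intro holomorphic_on_mult holomorphic_on_diff holomorphic_on_const hP y U)
  show "(\<lambda>z. 2 * \<omega> * dP (g z) (\<omega> * of_real y)) holomorphic_on U" unfolding dP_def
   by (intro holomorphic_on_mult holomorphic_on_diff holomorphic_on_add holomorphic_on_power holomorphic_on_const hP y U)
 next
  fix y m assume y: "y \<in> {\<epsilon><..}" and m: "m \<in> nbh c y"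
  show "\<epsilon>\<^sup>2/16 * (1 + \<bar>y\<bar>) \<le> Re (\<i> * (\<omega> * of_real y - Pf m (\<omega> * of_real y))) \<and>
   \<bar>Im (\<i> * (\<omega> * of_real y - Pf m (\<omega> * of_real y)))\<bar> \<le> (32/\<epsilon>\<^sup>2) * Re (\<i> * (\<omega> * of_real y - Pf m (\<omega> * of_real y)))"
   using b[of y m] y m by blast
  define P where "P = Pf m (\<omega> * of_real y)"
  have P: "norm P \<le> 2" "norm m \<le> 2" using b[of y m] y m by (auto simp: P_def)
  have "norm ((1 - m) * P\<^sup>2) \<le> 3 * 2\<^sup>2" unfolding norm_mult norm_power
   using P norm_triangle_ineq4[of 1 m] by (intro mult_mono power_mono) auto
  moreover have "norm (1 - 2 * P) \<le> 1 + 2 * 2" using P norm_triangle_ineq4[of 1 "2 * P"] by (simp add: norm_mult)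
  ultimately have "norm (dP m (\<omega> * of_real y)) \<le> 17"
   unfolding dP_def P_def[symmetric] using norm_triangle_ineq[of "1 - 2 * P" "(1 - m) * P\<^sup>2"] by simp
  thus "norm (2 * \<omega> * dP m (\<omega> * of_real y)) \<le> 34" by (simp add: norm_mult \<omega>)
 next
  fix m :: real
  show "(\<lambda>y. indicator {\<epsilon><..} y *\<^sub>R (\<i> * (\<omega> * of_real y - Pf (of_real m) (\<omega> * of_real y)))) \<in> borel_measurable borel" by measurable
  show "(\<lambda>y. indicator {\<epsilon><..} y *\<^sub>R (2 * \<omega> * dP (of_real m) (\<omega> * of_real y))) \<in> borel_measurable borel"
   unfolding dP_def by measurable
 qed (use e in auto)
qed

section \<open>The connecting segment\<close>

text \<open>
For such \<open>\<epsilon>\<close> the points \<open>\<omega> \<epsilon>\<close> and \<open>Pf m (\<omega> \<epsilon>)\<close>, at which the line and the curve are cut off, differ by at most \<open>\<epsilon> / 8\<close>, so that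
the phase on the segment between their negatives is dominated by its quadratic term.
\<close>
definition small :: "real => bool" where
 "small \<epsilon> \<longleftrightarrow> 0 < \<epsilon> \<and> \<epsilon> \<le> 1/64 \<and> (\<forall>w. norm w \<le> 2 * \<epsilon>\<^sup>2 --> norm (Gq w - 1) \<le> 1/16)"

lemma small_exists: "\<exists>\<epsilon>. small \<epsilon>"
proof -
 have "open {w::complex. Re w > -9}" by (simp add: open_halfspace_Re_gt)
 hence "isCont Gq 0"
  using holomorphic_on_imp_continuous_on[OF Gq_holomorphic] by (simp add: continuous_on_eq_continuous_at)
 then obtain d where d: "d > 0" "\<And>w. dist w 0 < d ==> dist (Gq w) (Gq 0) < 1/16"
  unfolding continuous_at_eps_delta by (metis zero_less_divide_1_iff zero_less_numeral)
 define \<epsilon> where "\<epsilon> = min (1/64) (d/4)"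
 have e: "0 < \<epsilon>" "\<epsilon> \<le> 1/64" "\<epsilon> \<le> d/4" using d by (auto simp: \<epsilon>_def)
 have "2 * \<epsilon>\<^sup>2 < d"
 proof -
  have "\<epsilon> * \<epsilon> \<le> \<epsilon>" using e by (intro mult_left_le_one_le) auto
  thus ?thesis unfolding power2_eq_square using e d by linarith
 qed
 hence "norm (Gq w - 1) \<le> 1/16" if "norm w \<le> 2 * \<epsilon>\<^sup>2" for w
  using d(2)[of w] that by (simp add: Gq_0 dist_norm)
 hence "small \<epsilon>" unfolding small_def using e by blast
 thus ?thesis ..
qed

lemma connect_bounds:
 assumes e: "small \<epsilon>" and m: "norm m \<le> 2"
 defines "t \<equiv> \<omega> * of_real \<epsilon>"
 shows "chs (m * t\<^sup>2) + t * shs (m * t\<^sup>2) \<noteq> 0" "norm (Pf m t - t) \<le> \<epsilon> / 8"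
proof -
 have e': "0 < \<epsilon>" "\<epsilon> \<le> 1/64" using e by (auto simp: small_def)
 have t: "t \<noteq> 0" "norm t = \<epsilon>" using e' by (auto simp: t_def \<omega> norm_mult)
 define w where "w = m * t\<^sup>2"
 have nw: "norm w \<le> 2 * \<epsilon>\<^sup>2" unfolding w_def norm_mult norm_power t using m by (intro mult_right_mono) auto
 hence G: "norm (Gq w - 1) \<le> 1/16" using e by (simp add: small_def)
 have "\<epsilon>\<^sup>2 \<le> 1" using e' by (simp add: power_le_one)
 hence "norm w \<le> 2" using nw by linarith
 hence sh: "shs w \<noteq> 0" using abs_Re_le_cmod[of w] by (intro shs_nonzero) linarith
 have "norm (1::complex) \<le> norm (t + Gq w) + norm (t + (Gq w - 1))" using norm_triangle_ineq4[of "t + Gq w" "t + (Gq w - 1)"] by simp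
 moreover have "norm (t + (Gq w - 1)) \<le> \<epsilon> + 1/16" using norm_triangle_ineq[of t "Gq w - 1"] G t by simp
 ultimately have n: "norm (t + Gq w) \<ge> 59/64" using e' by simp
 hence nz: "t + Gq w \<noteq> 0" by auto
 have k: "1 + Gq w / t = (t + Gq w) / t" using t by (simp add: field_simps)
 show "chs (m * t\<^sup>2) + t * shs (m * t\<^sup>2) \<noteq> 0"
  unfolding Pf_eq(2)[OF t(1) sh[unfolded w_def]] using sh t nz k by (simp add: w_def)
 have "Pf m t = t / (t + Gq w)" unfolding Pf_eq(1)[OF t(1) sh[unfolded w_def]] using k t nz by (simp add: w_def)
 hence "Pf m t - t = - (t * (t + (Gq w - 1)) / (t + Gq w))" using nz by (simp add: field_simps)
 hence "norm (Pf m t - t) = \<epsilon> * (norm (t + (Gq w - 1)) / norm (t + Gq w))" by (simp add: norm_mult norm_divide t)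
 also have "\<dots> \<le> \<epsilon> * ((1/64 + 1/16) / (59/64))"
  using \<open>norm (t + (Gq w - 1)) \<le> \<epsilon> + 1/16\<close> n e' by (intro mult_left_mono frac_le) auto
 also have "\<dots> \<le> \<epsilon> / 8" using e' by simp
 finally show "norm (Pf m t - t) \<le> \<epsilon> / 8" .
qed

definition Qc :: "real => real => complex => complex" where
 "Qc \<epsilon> y m = - Pf m (\<omega> * of_real \<epsilon>) + of_real y * (Pf m (\<omega> * of_real \<epsilon>) - \<omega> * of_real \<epsilon>)"

lemma Qc_bounds:
 assumes e: "small \<epsilon>" and m: "norm m \<le> 2" and y: "y \<in> {0..1}"
 shows "norm (Qc \<epsilon> y m) \<le> 1/32"
  "norm (1 - m) \<le> 2 ==> norm (\<i> * ((Qc \<epsilon> y m)\<^sup>2 * ht (Qc \<epsilon> y m) (1 - m)) - of_real (\<epsilon>\<^sup>2)) \<le> 3/5 * \<epsilon>\<^sup>2"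
proof -
 have e': "0 < \<epsilon>" "\<epsilon> \<le> 1/64" using e by (auto simp: small_def)
 define t where "t = \<omega> * of_real \<epsilon>"
 have t: "t \<noteq> 0" "norm t = \<epsilon>" using e' by (auto simp: t_def \<omega> norm_mult)
 define d where "d = of_real (1 - y) * (Pf m t - t) / t"
 have "norm d = \<bar>1 - y\<bar> * norm (Pf m t - t) / \<epsilon>" unfolding d_def norm_mult norm_divide norm_of_real t ..
 also have "\<dots> \<le> 1 * (\<epsilon> / 8) / \<epsilon>" using connect_bounds(2)[OF e m, folded t_def] y e'
  by (intro divide_right_mono mult_mono) auto
 finally have d: "norm d \<le> 1/8" using e' by simp
 have Q: "Qc \<epsilon> y m = - (t * (1 + d))" unfolding Qc_def t_def[symmetric] d_def using t by (simp add: field_simps)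
 have "norm (1 + d) \<le> 9/8" using norm_triangle_ineq[of 1 d] d by simp
 hence "norm (Qc \<epsilon> y m) \<le> 1/64 * (9/8)" unfolding Q norm_minus_cancel norm_mult t using e' by (intro mult_mono) auto
 thus nQ: "norm (Qc \<epsilon> y m) \<le> 1/32" by simp
 assume n: "norm (1 - m) \<le> 2"
 define h where "h = ht (Qc \<epsilon> y m) (1 - m) - 1"
 have h: "norm h \<le> 1/4" unfolding h_def by (rule ht_small) (use nQ n in auto)
 have it: "\<i> * t\<^sup>2 = of_real (\<epsilon>\<^sup>2)" unfolding t_def by (rule i_\<omega>_sq(1))
 have "\<i> * ((Qc \<epsilon> y m)\<^sup>2 * ht (Qc \<epsilon> y m) (1 - m)) = (\<i> * t\<^sup>2) * ((1 + d)\<^sup>2 * (1 + h))"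
  unfolding h_def unfolding Q by (simp add: power_mult_distrib)
 hence "\<i> * ((Qc \<epsilon> y m)\<^sup>2 * ht (Qc \<epsilon> y m) (1 - m)) - of_real (\<epsilon>\<^sup>2) = of_real (\<epsilon>\<^sup>2) * ((2 * d + d\<^sup>2) * (1 + h) + h)"
  unfolding it by (simp add: algebra_simps power2_eq_square)
 also have "norm \<dots> = \<epsilon>\<^sup>2 * norm ((2 * d + d\<^sup>2) * (1 + h) + h)" unfolding norm_mult norm_of_real by simp
 also have "\<dots> \<le> \<epsilon>\<^sup>2 * ((2 * (1/8) + (1/8)\<^sup>2) * (1 + 1/4) + 1/4)"
 proof (intro mult_left_mono order_trans[OF norm_triangle_ineq] add_mono h)
  have "norm (2 * d + d\<^sup>2) \<le> 2 * (1/8) + (1/8)\<^sup>2"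
   by (intro order_trans[OF norm_triangle_ineq] add_mono) (use d in \<open>auto simp: norm_mult norm_power intro: power_mono\<close>)
  moreover have "norm (1 + h) \<le> 1 + 1/4" using norm_triangle_ineq[of 1 h] h by simp
  ultimately show "norm ((2 * d + d\<^sup>2) * (1 + h)) \<le> (2 * (1/8) + (1/8)\<^sup>2) * (1 + 1/4)"
   unfolding norm_mult[of "2 * d + d\<^sup>2"] by (intro mult_mono) auto
 qed auto
 also have "\<dots> \<le> 3/5 * \<epsilon>\<^sup>2" by (simp add: power2_eq_square)
 finally show "norm (\<i> * ((Qc \<epsilon> y m)\<^sup>2 * ht (Qc \<epsilon> y m) (1 - m)) - of_real (\<epsilon>\<^sup>2)) \<le> 3/5 * \<epsilon>\<^sup>2" .
qed

lemma connect_kernel: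
 assumes Z: "Z > 0" and e: "small \<epsilon>"
 shows "kernel N (\<lambda>y l m. indicator {0..1} y *\<^sub>R (inverse (csqrt l) * exp (- (of_real Z / l) * (\<i> * ((Qc \<epsilon> y m)\<^sup>2 * ht (Qc \<epsilon> y m) (1 - m)))) * (2 * (Pf m (\<omega> * of_real \<epsilon>) - \<omega> * of_real \<epsilon>))))"
proof -
 have e': "0 < \<epsilon>" "\<epsilon> \<le> 1/64" using e by (auto simp: small_def)
 have nm: "norm m \<le> 2" "norm (1 - m) \<le> 2" if m: "m \<in> nbh (1/4) y" for m y
 proof -
  show "norm (1 - m) \<le> 2" by (rule nbh_norm[OF m])
  obtain m0 where m0: "m0 \<in> {0..1}" "norm (m - of_real m0) \<le> 1/4" "norm (m - of_real m0) * \<bar>y\<bar> \<le> 1/4"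
   "norm (m - of_real m0) * (1 + \<bar>y\<bar>)\<^sup>2 \<le> 1/4"
   using nbh_elim[OF m] by auto
  have "norm m \<le> norm (of_real m0 :: complex) + norm (m - of_real m0)" by (rule norm_triangle_sub)
  thus "norm m \<le> 2" using m0 by simp
 qed
 have hP: "(\<lambda>z. Pf (g z) (\<omega> * of_real \<epsilon>)) holomorphic_on U" if "g holomorphic_on U" "g ` U \<subseteq> nbh (1/4) y" for y U g
  by (rule Pf_holomorphic[OF that(1)]) (use that nm connect_bounds(1)[OF e] in blast)
 have hQ: "(\<lambda>z. Qc \<epsilon> y' (g z)) holomorphic_on U" if "g holomorphic_on U" "g ` U \<subseteq> nbh (1/4) y" for y y' U g
  unfolding Qc_def by (intro holomorphic_on_add holomorphic_on_minus holomorphic_on_mult holomorphic_on_diff holomorphic_on_const hP[OF that])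
 show ?thesis
 proof (rule tail_kernel[OF Z, where c = "1/4" and a = "\<epsilon>\<^sup>2/5" and M = 2 and K = 1])
  fix y U g assume y: "y \<in> {0..1}" and U: "open U" "g holomorphic_on U" "g ` U \<subseteq> nbh (1/4) y"
  have "(\<lambda>z. ht (Qc \<epsilon> y (g z)) (1 - g z)) holomorphic_on U"
  proof (rule ht_holomorphic[OF U(1), where B = 3])
   fix z assume "z \<in> U"
   hence "g z \<in> nbh (1/4) y" using U by auto
   thus "good 3 (Qc \<epsilon> y (g z)) (1 - g z)" using nm[of "g z" y] Qc_bounds(1)[OF e _ y, of "g z"] by (intro good_small) auto
  qed (intro hQ[OF U(2,3)] holomorphic_intros U)+
  thus "(\<lambda>z. \<i> * ((Qc \<epsilon> y (g z))\<^sup>2 * ht (Qc \<epsilon> y (g z)) (1 - g z))) holomorphic_on U"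
   by (intro holomorphic_on_mult holomorphic_on_power holomorphic_on_const hQ[OF U(2,3)])
  show "(\<lambda>z. 2 * (Pf (g z) (\<omega> * of_real \<epsilon>) - \<omega> * of_real \<epsilon>)) holomorphic_on U"
   by (intro holomorphic_on_mult holomorphic_on_diff holomorphic_on_const hP[OF U(2,3)])
 next
  fix y m assume y: "y \<in> {0..1}" and m: "m \<in> nbh (1/4) y"
  define X where "X = \<i> * ((Qc \<epsilon> y m)\<^sup>2 * ht (Qc \<epsilon> y m) (1 - m))"
  have X: "norm (X - of_real (\<epsilon>\<^sup>2)) \<le> 3/5 * \<epsilon>\<^sup>2" unfolding X_def by (rule Qc_bounds(2)[OF e nm(1)[OF m] y nm(2)[OF m]])
  have "\<bar>Re X - \<epsilon>\<^sup>2\<bar> \<le> 3/5 * \<epsilon>\<^sup>2" using X abs_Re_le_cmod[of "X - of_real (\<epsilon>\<^sup>2)"] by (simp del: of_real_power)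
  hence R: "Re X \<ge> 2/5 * \<epsilon>\<^sup>2" by linarith
  have I: "\<bar>Im X\<bar> \<le> 3/5 * \<epsilon>\<^sup>2" using X abs_Im_le_cmod[of "X - of_real (\<epsilon>\<^sup>2)"] by (simp del: of_real_power)
  have "\<epsilon>\<^sup>2/5 * (1 + \<bar>y\<bar>) \<le> \<epsilon>\<^sup>2/5 * 2" using y by (intro mult_left_mono) auto
  moreover have "\<epsilon>\<^sup>2 \<ge> 0" by simp
  ultimately show "\<epsilon>\<^sup>2/5 * (1 + \<bar>y\<bar>) \<le> Re (\<i> * ((Qc \<epsilon> y m)\<^sup>2 * ht (Qc \<epsilon> y m) (1 - m))) \<and>
    \<bar>Im (\<i> * ((Qc \<epsilon> y m)\<^sup>2 * ht (Qc \<epsilon> y m) (1 - m)))\<bar> \<le> 2 * Re (\<i> * ((Qc \<epsilon> y m)\<^sup>2 * ht (Qc \<epsilon> y m) (1 - m)))"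
   unfolding X_def[symmetric] using R I by linarith
  show "norm (2 * (Pf m (\<omega> * of_real \<epsilon>) - \<omega> * of_real \<epsilon>)) \<le> 1"
   unfolding norm_mult using connect_bounds(2)[OF e nm(1)[OF m]] e' by simp
 next
  fix m :: real assume m: "m \<in> {0..1}"
  have [measurable]: "(\<lambda>y. ht (Qc \<epsilon> y (of_real m)) (1 - of_real m)) \<in> borel_measurable borel"
   by (rule ht_measurable) (unfold Qc_def, measurable)
  have [measurable]: "(\<lambda>y. Qc \<epsilon> y (of_real m)) \<in> borel_measurable borel" unfolding Qc_def by measurable
  show "(\<lambda>y. indicator {0..1} y *\<^sub>R (\<i> * ((Qc \<epsilon> y (of_real m))\<^sup>2 * ht (Qc \<epsilon> y (of_real m)) (1 - of_real m)))) \<in> borel_measurable borel" by measurable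
  show "(\<lambda>y::real. indicator {0..1} y *\<^sub>R (2 * (Pf (of_real m) (\<omega> * of_real \<epsilon>) - \<omega> * of_real \<epsilon>))) \<in> borel_measurable borel" by measurable
 qed (use e' in auto)
qed

section \<open>The amplitude\<close>

text \<open>
The integrands on the line near the critical point, on its continuation, on the curve and on the segment.
\<close>
definition cen :: "real => real => real => real => real => complex" where
 "cen Z \<epsilon> l m y = indicator {-\<epsilon>..\<epsilon>} y *\<^sub>R exp (- (of_real Z / of_real l) * (of_real (y\<^sup>2) * ht (\<omega> * of_real y) (1 - of_real m)))"

definition lef :: "real => real => real => real => real => complex" where
 "lef Z \<epsilon> l m y = indicator {\<epsilon><..} y *\<^sub>R (inverse (csqrt (of_real l)) * exp (- (of_real Z / of_real l) * (of_real (y\<^sup>2) * ht (\<omega> * of_real y) (1 - of_real m))) * (2 * \<omega>))"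

definition rig :: "real => real => real => real => real => complex" where
 "rig Z \<epsilon> l m y = indicator {\<epsilon><..} y *\<^sub>R (inverse (csqrt (of_real l)) * exp (- (of_real Z / of_real l) * (\<i> * (\<omega> * of_real y - Pf (of_real m) (\<omega> * of_real y)))) * (2 * \<omega> * dP (of_real m) (\<omega> * of_real y)))"

definition con :: "real => real => real => real => real => complex" where
 "con Z \<epsilon> l m y = indicator {0..1} y *\<^sub>R (inverse (csqrt (of_real l)) * exp (- (of_real Z / of_real l) * (\<i> * ((Qc \<epsilon> y (of_real m))\<^sup>2 * ht (Qc \<epsilon> y (of_real m)) (1 - of_real m)))) * (2 * (Pf (of_real m) (\<omega> * of_real \<epsilon>) - \<omega> * of_real \<epsilon>)))"

definition amplitude :: "real => real => real => real => complex" where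
 "amplitude Z \<epsilon> l m = 2 * \<omega> * (inverse (csqrt (of_real l)) * (\<integral>y. cen Z \<epsilon> l m y \<partial>lborel)) +
   (\<integral>y. lef Z \<epsilon> l m y \<partial>lborel) + (\<integral>y. rig Z \<epsilon> l m y \<partial>lborel) + (\<integral>y. con Z \<epsilon> l m y \<partial>lborel)"

text \<open>
Only the central part contributes to the expansion: it differs from its Gaussian terms by a kernel of order \<open>N\<close>, and
the other three parts are kernels of every order.
\<close>
lemma amplitude_expansion:
 assumes Z: "Z > 0" and e: "small \<epsilon>"
 shows "\<exists>\<Psi>. kernel N \<Psi> \<and> (\<forall>l>0. \<forall>m\<in>{0..1}.
   amplitude Z \<epsilon> l m - (\<Sum>k\<le>N. expansion_coeff Z k (of_real m) * of_real l ^ k) = (\<integral>y. \<Psi> y (of_real l) (of_real m) \<partial>lborel))"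
proof -
 have e': "0 < \<epsilon>" "\<epsilon> \<le> 1/64" "\<epsilon> \<le> 1" using e by (auto simp: small_def)
 define K1 where "K1 = (\<lambda>y l m. 2 * \<omega> * (inverse (csqrt l) * gauss_rem Z \<epsilon> (2 * N + 2) y l (1 - m)))"
 define K2 where "K2 = (\<lambda>y l m. indicator {\<epsilon><..} y *\<^sub>R (inverse (csqrt l) * exp (- (of_real Z / l) * (of_real (y\<^sup>2) * ht (\<omega> * of_real y) (1 - m))) * (2 * \<omega>)))"
 define K3 where "K3 = (\<lambda>y l m. indicator {\<epsilon><..} y *\<^sub>R (inverse (csqrt l) * exp (- (of_real Z / l) * (\<i> * (\<omega> * of_real y - Pf m (\<omega> * of_real y)))) * (2 * \<omega> * dP m (\<omega> * of_real y))))"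
 define K4 where "K4 = (\<lambda>y l m. indicator {0..1} y *\<^sub>R (inverse (csqrt l) * exp (- (of_real Z / l) * (\<i> * ((Qc \<epsilon> y m)\<^sup>2 * ht (Qc \<epsilon> y m) (1 - m)))) * (2 * (Pf m (\<omega> * of_real \<epsilon>) - \<omega> * of_real \<epsilon>))))"
 have k: "kernel N K1" "kernel N K2" "kernel N K3" "kernel N K4"
  unfolding K1_def K2_def K3_def K4_def
  by (rule gauss_rem_kernel[OF Z e'(1,2)], rule left_kernel[OF Z e'(1,3)], rule right_kernel[OF Z e'(1,3)], rule connect_kernel[OF Z e])
 define \<Psi> where "\<Psi> = (\<lambda>y l m. K1 y l m + K2 y l m + K3 y l m + K4 y l m)"
 have "kernel N \<Psi>" unfolding \<Psi>_def by (intro kernel_add k)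
 moreover have "amplitude Z \<epsilon> l m - (\<Sum>k\<le>N. expansion_coeff Z k (of_real m) * of_real l ^ k) = (\<integral>y. \<Psi> y (of_real l) (of_real m) \<partial>lborel)"
  if l: "l > 0" and m: "m \<in> {0..1}" for l m
 proof -
  have n: "norm (1 - complex_of_real m) \<le> 2"
  proof -
   have "(1::complex) - of_real m = of_real (1 - m)" by simp
   hence "norm ((1::complex) - of_real m) = \<bar>1 - m\<bar>" by (simp only: norm_of_real)
   thus ?thesis using m by simp
  qed
  define c where "c = 2 * \<omega> * inverse (csqrt (of_real l))"
  have c0: "c \<noteq> 0" using l by (simp add: c_def \<omega>)
  define S where "S y = (\<Sum>j<2 * N + 2. gauss_term Z j y (of_real l) (1 - of_real m))" for y
  have iS: "integrable lborel S" unfolding S_def by (intro Bochner_Integration.integrable_sum gauss_term_integral(1)[OF Z l n])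
  have K1: "K1 y (of_real l) (of_real m) = c * (cen Z \<epsilon> l m y - S y)" for y
   by (simp add: K1_def c_def cen_def S_def gauss_rem_def)
  have i: "integrable lborel (\<lambda>y. K1 y (of_real l) (of_real m))" "integrable lborel (\<lambda>y. K2 y (of_real l) (of_real m))"
   "integrable lborel (\<lambda>y. K3 y (of_real l) (of_real m))" "integrable lborel (\<lambda>y. K4 y (of_real l) (of_real m))"
   by (rule kernel_integrable[OF k(1) l m], rule kernel_integrable[OF k(2) l m], rule kernel_integrable[OF k(3) l m], rule kernel_integrable[OF k(4) l m])
  have "integrable lborel (\<lambda>y. inverse c * K1 y (of_real l) (of_real m) + S y)" by (intro Bochner_Integration.integrable_add integrable_mult_right i iS)
  moreover have "(\<lambda>y. inverse c * K1 y (of_real l) (of_real m) + S y) = cen Z \<epsilon> l m"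
   using c0 by (simp add: K1 fun_eq_iff flip: mult.assoc)
  ultimately have ic: "integrable lborel (cen Z \<epsilon> l m)" by simp
  have "(\<integral>y. K1 y (of_real l) (of_real m) \<partial>lborel) = c * (\<integral>y. cen Z \<epsilon> l m y - S y \<partial>lborel)"
   unfolding K1 by (rule integral_mult_right_zero)
  also have "(\<integral>y. cen Z \<epsilon> l m y - S y \<partial>lborel) = (\<integral>y. cen Z \<epsilon> l m y \<partial>lborel) - (\<integral>y. S y \<partial>lborel)"
   by (rule Bochner_Integration.integral_diff[OF ic iS])
  also have "(\<integral>y. S y \<partial>lborel) = (\<Sum>j<2 * N + 2. \<integral>s. gauss_term Z j s (of_real l) (1 - of_real m) \<partial>lborel)"
   unfolding S_def by (rule Bochner_Integration.integral_sum[OF gauss_term_integral(1)[OF Z l n]])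
  also have "c * ((\<integral>y. cen Z \<epsilon> l m y \<partial>lborel) - \<dots>) = 2 * \<omega> * (inverse (csqrt (of_real l)) * (\<integral>y. cen Z \<epsilon> l m y \<partial>lborel)) - (\<Sum>k\<le>N. expansion_coeff Z k (of_real m) * of_real l ^ k)"
   unfolding gaussian_sum[OF Z l m, symmetric] c_def by (simp only: right_diff_distrib mult.assoc)
  finally have 1: "(\<integral>y. K1 y (of_real l) (of_real m) \<partial>lborel) = \<dots>" .
  have "(\<integral>y. \<Psi> y (of_real l) (of_real m) \<partial>lborel) = (\<integral>y. K1 y (of_real l) (of_real m) \<partial>lborel) + (\<integral>y. K2 y (of_real l) (of_real m) \<partial>lborel)
    + (\<integral>y. K3 y (of_real l) (of_real m) \<partial>lborel) + (\<integral>y. K4 y (of_real l) (of_real m) \<partial>lborel)"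
   unfolding \<Psi>_def using i by simp
  also have "(\<integral>y. K2 y (of_real l) (of_real m) \<partial>lborel) = (\<integral>y. lef Z \<epsilon> l m y \<partial>lborel)" by (simp only: K2_def lef_def)
  also have "(\<integral>y. K3 y (of_real l) (of_real m) \<partial>lborel) = (\<integral>y. rig Z \<epsilon> l m y \<partial>lborel)" by (simp only: K3_def rig_def)
  also have "(\<integral>y. K4 y (of_real l) (of_real m) \<partial>lborel) = (\<integral>y. con Z \<epsilon> l m y \<partial>lborel)" by (simp only: K4_def con_def)
  finally show ?thesis unfolding 1 amplitude_def by simp
 qed
 ultimately show ?thesis by blast
qed

lemma amplitude_A_loc:
 assumes "Z > 0" "small \<epsilon>"
 shows "(\<lambda>E x. amplitude Z \<epsilon> (sqrt (E + Z * x)) (E / (E + Z * x))) \<in> A_loc index_E"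
 by (rule A_loc_of_expansion[OF assms(1) expansion_coeff_analytic[OF assms(1)] amplitude_expansion[OF assms]])

section \<open>Whittaker's function as a Laplace integral\<close>

abbreviation cut :: "complex set" where "cut \<equiv> - \<real>\<^sub>\<le>\<^sub>0"

lemma cut: "open cut" "connected cut"
proof -
 show "open cut" by (simp add: open_Compl)
 have "complex_of_real ` {..0} = \<real>\<^sub>\<le>\<^sub>0" by (auto simp: nonpos_Reals_def)
 thus "connected cut" using starlike_imp_connected[OF starlike_slotted_complex_plane_left[of 0]] by simp
qed

lemma cut_add: assumes "z \<in> cut" "s \<ge> 0" shows "z + of_real s \<in> cut"
 using assms by (auto simp: complex_nonpos_Reals_iff)

lemma cut_of_real: "x > 0 ==> of_real x \<in> cut" by simp

lemma cut_divide: assumes "z \<in> cut" "s > 0" shows "1 + z / of_real s \<in> cut"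
using assms by (auto simp: complex_nonpos_Reals_iff field_simps)

lemma norm_exp_Ln:
 assumes "Re \<kappa> = 0" "w \<noteq> 0" shows "norm (exp (\<kappa> * Ln w)) \<le> exp (pi * norm \<kappa>)"
proof -
 have "\<bar>Im (Ln w)\<bar> \<le> pi" using mpi_less_Im_Ln[OF assms(2)] Im_Ln_le_pi[OF assms(2)] by linarith
 hence "\<bar>Im \<kappa> * Im (Ln w)\<bar> \<le> norm \<kappa> * pi" unfolding abs_mult by (intro mult_mono abs_Im_le_cmod) auto
 thus ?thesis using assms by (simp add: norm_exp_eq_Re mult.commute)
qed

text \<open>
The integrand for \<open>n = 0\<close>; larger \<open>n\<close> occur in its derivatives with respect to \<open>z\<close>.
\<close>
definition lap :: "complex => nat => real => complex => complex" where
 "lap \<kappa> n s z = indicator {0<..} s *\<^sub>R (exp (- of_real s) * exp (\<kappa> * Ln (1 + z / of_real s)) / (of_real s + z) ^ n)"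

definition Lap :: "complex => nat => complex => complex" where
 "Lap \<kappa> n z = (\<integral>s. lap \<kappa> n s z \<partial>lborel)"

lemma lap_measurable [measurable]: "(\<lambda>s. lap \<kappa> n s z) \<in> borel_measurable borel"
 unfolding lap_def by measurable

lemma exp_integrable: "integrable lborel (\<lambda>s::real. indicator {0<..} s *\<^sub>R exp (- s))"
proof (rule Bochner_Integration.integrable_bound[OF integrable_exp_minus_abs[of 1]])
 show "AE s::real in lborel. norm (indicator {0<..} s *\<^sub>R exp (- s)) \<le> norm (exp (- 1 * \<bar>s\<bar>))"
  by (intro AE_I2) (auto simp: indicator_def)
qed auto

lemma lap_bound:
 assumes "Re \<kappa> = 0" "z \<in> cut" "d > 0" "s > 0 ==> norm (of_real s + z) \<ge> d"
 shows "norm (lap \<kappa> n s z) \<le> exp (pi * norm \<kappa>) / d ^ n * (indicator {0<..} s *\<^sub>R exp (- s))"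
proof (cases "s > 0")
 case True
 have "1 + z / of_real s \<noteq> 0" using cut_divide[OF assms(2) True] by auto
 hence 1: "norm (exp (\<kappa> * Ln (1 + z / of_real s))) \<le> exp (pi * norm \<kappa>)" by (rule norm_exp_Ln[OF assms(1)])
 have "norm (lap \<kappa> n s z) = exp (- s) * norm (exp (\<kappa> * Ln (1 + z / of_real s))) / norm (of_real s + z) ^ n"
  using True by (simp add: lap_def norm_mult norm_divide norm_power norm_exp_eq_Re)
 also have "\<dots> \<le> exp (- s) * exp (pi * norm \<kappa>) / d ^ n"
  using 1 assms(3,4) True by (intro frac_le mult_left_mono power_mono mult_nonneg_nonneg zero_less_power) auto
 finally show ?thesis using True by (simp add: mult.commute)
qed (simp add: lap_def)

lemma cut_dist:
 assumes z: "z \<in> cut"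
 obtains r where "r > 0" "ball z r \<subseteq> cut" "\<And>w s. w \<in> ball z r ==> s > 0 ==> norm (of_real s + w) \<ge> r"
proof -
 obtain r where r: "r > 0" "ball z (2 * r) \<subseteq> cut"
 proof -
  obtain e where "e > 0" "ball z e \<subseteq> cut" using cut(1) z openE by blast
  thus ?thesis using that[of "e / 2"] by simp
 qed
 show thesis
 proof (rule that[OF r(1)])
  show "ball z r \<subseteq> cut" using r subset_ball[of r "2 * r" z] by auto
  fix w s assume w: "w \<in> ball z r" and s: "s > (0::real)"
  have "- of_real s \<notin> cut" using s by (simp add: complex_nonpos_Reals_iff)
  hence "- of_real s \<notin> ball z (2 * r)" using r(2) by blast
  hence "2 * r \<le> dist z (- of_real s)" by simp
  also have "\<dots> \<le> dist z w + dist w (- of_real s)" by (rule dist_triangle)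
  finally show "norm (of_real s + w) \<ge> r" using w by (simp add: dist_norm add.commute)
 qed
qed

lemma lap_integrable:
 assumes k: "Re \<kappa> = 0" and z: "z \<in> cut" shows "integrable lborel (\<lambda>s. lap \<kappa> n s z)"
proof -
 obtain r where r: "r > 0" "ball z r \<subseteq> cut" "\<And>w s. w \<in> ball z r ==> s > 0 ==> norm (of_real s + w) \<ge> r"
  using cut_dist[OF z] by blast
 show ?thesis
 proof (rule Bochner_Integration.integrable_bound)
  show "integrable lborel (\<lambda>s. exp (pi * norm \<kappa>) / r ^ n * (indicator {0<..} s *\<^sub>R exp (- s)))"
   by (intro integrable_mult_right exp_integrable)
  have "norm (lap \<kappa> n s z) \<le> exp (pi * norm \<kappa>) / r ^ n * (indicator {0<..} s *\<^sub>R exp (- s))" for s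
   using r by (intro lap_bound[OF k z]) auto
  thus "AE s in lborel. norm (lap \<kappa> n s z) \<le> norm (exp (pi * norm \<kappa>) / r ^ n * (indicator {0<..} s *\<^sub>R exp (- s)))"
   unfolding real_norm_def by (intro AE_I2 order_trans[OF _ abs_ge_self])
 qed simp
qed

lemma lap_deriv:
 assumes z: "z \<in> cut"
 shows "((\<lambda>z. lap \<kappa> n s z) has_field_derivative (\<kappa> - of_nat n) * lap \<kappa> (Suc n) s z) (at z)"
proof (cases "s > 0")
 case True
 have c: "1 + z / of_real s \<in> cut" by (rule cut_divide[OF z True])
 have sz: "of_real s + z \<noteq> 0" using cut_add[OF z less_imp_le[OF True]] by (auto simp: add.commute)
 have s0: "of_real s \<noteq> (0::complex)" using True by simp
 have e: "1 / of_real s / (1 + z / of_real s) = 1 / (of_real s + z)" using s0 sz by (simp add: field_simps)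
 have L: "((\<lambda>z. exp (\<kappa> * Ln (1 + z / of_real s))) has_field_derivative exp (\<kappa> * Ln (1 + z / of_real s)) * (\<kappa> * (1 / (of_real s + z)))) (at z)"
  unfolding e[symmetric] using c s0 by (auto intro!: derivative_eq_intros simp: divide_inverse mult_ac)
 have P: "((\<lambda>z. inverse (of_real s + z) ^ n) has_field_derivative - (of_nat n * inverse (of_real s + z) ^ Suc n)) (at z)"
 proof -
  have "((\<lambda>z. inverse (of_real s + z)) has_field_derivative - (inverse (of_real s + z) * inverse (of_real s + z))) (at z)"
   using sz by (auto intro!: derivative_eq_intros)
  from DERIV_power[OF this, of n] show ?thesis by (cases n) (simp_all add: mult_ac)
 qed
 have lapE: "lap \<kappa> k s w = exp (- of_real s) * (exp (\<kappa> * Ln (1 + w / of_real s)) * inverse (of_real s + w) ^ k)" for k w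
  using True by (simp add: lap_def divide_inverse power_inverse)
 have A: "a * (b * (\<kappa> * i) * i ^ n + - (N * i ^ Suc n) * b) = (\<kappa> - N) * (a * (b * i ^ Suc n))" for a b i N :: complex
  by (simp add: algebra_simps)
 show ?thesis unfolding lapE
  using DERIV_cmult[OF DERIV_mult[OF L P]] unfolding inverse_eq_divide[symmetric] A .
qed (simp add: lap_def)

lemma Lap_deriv:
 assumes k: "Re \<kappa> = 0" and z: "z \<in> cut"
 shows "(Lap \<kappa> n has_field_derivative (\<kappa> - of_nat n) * Lap \<kappa> (Suc n) z) (at z)"
proof -
 obtain r where r: "r > 0" "ball z r \<subseteq> cut" "\<And>w s. w \<in> ball z r ==> s > 0 ==> norm (of_real s + w) \<ge> r"
  using cut_dist[OF z] by blast
 define B where "B s = norm (\<kappa> - of_nat n) * (exp (pi * norm \<kappa>) / r ^ Suc n * (indicator {0<..} s *\<^sub>R exp (- s)))" for s :: real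
 have zb: "z \<in> ball z r" using r by simp
 have "((\<lambda>y. \<integral>s. lap \<kappa> n s y \<partial>lborel) has_derivative (\<lambda>h. h * (\<integral>s. (\<kappa> - of_nat n) * lap \<kappa> (Suc n) s z \<partial>lborel))) (at z within ball z r)"
 proof (rule has_derivative_integral_param[OF bounded_bilinear_mult convex_ball zb])
  fix s y assume y: "y \<in> ball z r"
  hence yc: "y \<in> cut" using r by blast
  show "(lap \<kappa> n s has_derivative (\<lambda>h. h * ((\<kappa> - of_nat n) * lap \<kappa> (Suc n) s y))) (at y within ball z r)"
   using has_field_derivative_at_within[OF lap_deriv[OF yc]] by (simp add: has_field_derivative_flip)
  show "norm ((\<kappa> - of_nat n) * lap \<kappa> (Suc n) s y) \<le> B s" unfolding norm_mult B_def
   using r y by (intro mult_left_mono lap_bound[OF k yc]) auto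
 next
  show "integrable lborel B" unfolding B_def by (intro integrable_mult_right exp_integrable)
 qed (auto intro: lap_integrable[OF k z])
 hence "((\<lambda>y. \<integral>s. lap \<kappa> n s y \<partial>lborel) has_derivative (\<lambda>h. h * (\<integral>s. (\<kappa> - of_nat n) * lap \<kappa> (Suc n) s z \<partial>lborel))) (at z)"
  by (simp only: at_within_open[OF zb open_ball])
 thus ?thesis unfolding Lap_def by (simp add: has_field_derivative_flip)
qed

text \<open>
The combination is minus the integral of the total derivative of \<open>e\<^sup>-\<^sup>s (1 + z / s)\<^sup>\<kappa> s / (z (s + z))\<close>, which vanishes at both ends.
\<close>
lemma Lap_ode:
 assumes k: "Re \<kappa> = 0" and z: "z \<in> cut"
 shows "(\<kappa> - 1) * Lap \<kappa> 2 z - Lap \<kappa> 1 z + Lap \<kappa> 0 z / z = 0"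
proof -
 have z0: "z \<noteq> 0" using z by auto
 define G where "G s = exp (- of_real s) * exp (\<kappa> * Ln (1 + z / of_real s)) * (of_real s / (z * (of_real s + z)))" for s :: real
 define g where "g s = - ((\<kappa> - 1) * lap \<kappa> 2 s z - lap \<kappa> 1 s z + lap \<kappa> 0 s z / z)" for s :: real
 obtain r where r: "r > 0" "ball z r \<subseteq> cut" "\<And>w s. w \<in> ball z r ==> s > 0 ==> norm (of_real s + w) \<ge> r"
  using cut_dist[OF z] by blast
 have ig: "integrable lborel g" unfolding g_def by (intro Bochner_Integration.integrable_minus Bochner_Integration.integrable_add Bochner_Integration.integrable_diff
   integrable_mult_right integrable_divide lap_integrable[OF k z])
 have sz: "of_real s + z \<noteq> 0" if "s > 0" for s using cut_add[OF z less_imp_le[OF that]] by (auto simp: add.commute)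
 have dG: "(G has_vector_derivative g s) (at s)" if s: "s > 0" for s
 proof -
  have c: "1 + z / of_real s \<in> cut" by (rule cut_divide[OF z s])
  define E where "E = exp (- of_real s) * exp (\<kappa> * Ln (1 + z / of_real s))"
  define S where "S = complex_of_real s"
  have S: "S \<noteq> 0" "S + z \<noteq> 0" "1 + z / S \<noteq> 0" using s sz c by (auto simp: S_def)
  have der: "((\<lambda>u. exp (- u) * exp (\<kappa> * Ln (1 + z / u)) * (u / (z * (u + z)))) has_field_derivative
    (- E + E * (\<kappa> * (- (z / S\<^sup>2) / (1 + z / S)))) * (S / (z * (S + z))) + E * (1 / (S + z)\<^sup>2)) (at S)"
  proof -
   have d1: "((\<lambda>u. 1 + z / u) has_field_derivative - (z / S\<^sup>2)) (at S)"
    using S by (auto intro!: derivative_eq_intros simp: power2_eq_square)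
   have "((\<lambda>u. \<kappa> * Ln (1 + z / u)) has_field_derivative \<kappa> * (- (z / S\<^sup>2) / (1 + z / S))) (at S)"
   proof (rule DERIV_cmult)
    have "1 + z / S \<notin> \<real>\<^sub>\<le>\<^sub>0" using c by (simp add: S_def)
    from DERIV_chain2[OF has_field_derivative_Ln[OF this] d1]
    show "((\<lambda>u. Ln (1 + z / u)) has_field_derivative - (z / S\<^sup>2) / (1 + z / S)) (at S)" by (simp add: divide_inverse mult_ac)
   qed
   from DERIV_chain2[OF DERIV_exp this]
   have d2: "((\<lambda>u. exp (\<kappa> * Ln (1 + z / u))) has_field_derivative exp (\<kappa> * Ln (1 + z / S)) * (\<kappa> * (- (z / S\<^sup>2) / (1 + z / S)))) (at S)" .
   have d3: "((\<lambda>u. exp (- u)) has_field_derivative - exp (- S)) (at S)" by (auto intro!: derivative_eq_intros)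
   have d4: "((\<lambda>u. u / (z * (u + z))) has_field_derivative 1 / (S + z)\<^sup>2) (at S)"
   proof -
    have "(1 * (z * (S + z)) - S * z) / (z * (S + z) * (z * (S + z))) = 1 / (S + z)\<^sup>2"
    proof -
     have "1 * (z * (S + z)) - S * z = z * z" by (simp add: algebra_simps)
     thus ?thesis using z0 by (simp add: power2_eq_square)
    qed
    thus ?thesis using S z0 by (auto intro!: derivative_eq_intros)
   qed
   show ?thesis using DERIV_mult[OF DERIV_mult[OF d3 d2] d4] by (simp add: E_def S_def algebra_simps)
  qed
  have e1: "- (z / S\<^sup>2) / (1 + z / S) = - (z / (S * (S + z)))" using S by (simp add: divide_simps power2_eq_square)
  have e2: "(- E + E * (\<kappa> * - (z / (S * (S + z))))) * (S / (z * (S + z))) + E * (1 / (S + z)\<^sup>2)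
    = - ((\<kappa> - 1) * (E / (S + z)\<^sup>2) - E / (S + z) + E / z)"
   using S z0 by (simp add: divide_simps power2_eq_square) (simp add: algebra_simps)
  have e3: "g s = - ((\<kappa> - 1) * (E / (S + z)\<^sup>2) - E / (S + z) + E / z)" using s by (simp add: g_def lap_def E_def S_def)
  have "((\<lambda>u. exp (- u) * exp (\<kappa> * Ln (1 + z / u)) * (u / (z * (u + z)))) has_field_derivative g s) (at (of_real s))"
   using der unfolding e1 e2 e3[symmetric] unfolding S_def .
  from has_vector_derivative_real_field[OF this] show ?thesis unfolding G_def .
 qed
 have bG: "norm (G s) \<le> exp (pi * norm \<kappa>) / (norm z * r) * (exp (- s) * s)" if s: "s > 0" for s
 proof -
  have "1 + z / of_real s \<noteq> 0" using cut_divide[OF z s] by auto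
  hence 1: "norm (exp (\<kappa> * Ln (1 + z / of_real s))) \<le> exp (pi * norm \<kappa>)" by (rule norm_exp_Ln[OF k])
  have "norm (G s) = exp (- s) * norm (exp (\<kappa> * Ln (1 + z / of_real s))) * (s / (norm z * norm (of_real s + z)))"
   using s by (simp add: G_def norm_mult norm_divide norm_exp_eq_Re)
  also have "\<dots> \<le> exp (- s) * exp (pi * norm \<kappa>) * (s / (norm z * r))"
   using 1 r s z0 by (intro mult_mono frac_le mult_left_mono mult_pos_pos) auto
  finally show ?thesis by (simp add: field_simps)
 qed
 have tG: "(G \<longlongrightarrow> 0) F" if "((\<lambda>s. exp (- s) * s) \<longlongrightarrow> 0) F" "eventually (\<lambda>s. s > 0) F" for F
 proof (rule Lim_null_comparison)
  show "eventually (\<lambda>s. norm (G s) \<le> exp (pi * norm \<kappa>) / (norm z * r) * (exp (- s) * s)) F"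
   using that(2) by eventually_elim (rule bG)
  show "((\<lambda>s. exp (pi * norm \<kappa>) / (norm z * r) * (exp (- s) * s)) \<longlongrightarrow> 0) F"
   using tendsto_mult_right_zero[OF that(1)] .
 qed
 have "(LBINT s=0..\<infinity>. g s) = 0 - 0"
 proof (rule interval_integral_FTC_integrable)
  show "(G has_vector_derivative g s) (at s)" if "0 < ereal s" for s using that by (intro dG) simp
  show "isCont g s" if "0 < ereal s" for s
  proof -
   have s: "s > 0" using that by simp
   have L: "isCont (\<lambda>s. lap \<kappa> n s z) s" for n
   proof -
    have "isCont (\<lambda>s. exp (- complex_of_real s) * exp (\<kappa> * Ln (1 + z / of_real s)) / (of_real s + z) ^ n) s"
     using s cut_divide[OF z s] sz[OF s] by (intro continuous_intros) auto
    moreover have "eventually (\<lambda>s. exp (- complex_of_real s) * exp (\<kappa> * Ln (1 + z / of_real s)) / (of_real s + z) ^ n = lap \<kappa> n s z) (nhds s)"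
     using eventually_nhds_in_open[of "{0<..}" s, OF open_greaterThan] s by (auto elim!: eventually_mono simp: lap_def)
    ultimately show ?thesis using isCont_cong by fast
   qed
   show ?thesis unfolding g_def by (intro continuous_intros L z0)
  qed
  show "set_integrable lborel (einterval 0 \<infinity>) g" unfolding set_integrable_def by (intro integrable_mult_indicator ig) auto
  show "((G \<circ> real_of_ereal) \<longlongrightarrow> 0) (at_right 0)" unfolding zero_ereal_def ereal_tendsto_simps
  proof (rule tG)
   show "((\<lambda>s::real. exp (- s) * s) \<longlongrightarrow> 0) (at_right 0)" by real_asymp
   show "eventually (\<lambda>s::real. s > 0) (at_right 0)" by (rule eventually_at_right_less)
  qed
  show "((G \<circ> real_of_ereal) \<longlongrightarrow> 0) (at_left \<infinity>)" unfolding ereal_tendsto_simps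
  proof (rule tG)
   show "((\<lambda>s::real. exp (- s) * s) \<longlongrightarrow> 0) at_top" by real_asymp
   show "eventually (\<lambda>s::real. s > 0) at_top" by (rule eventually_gt_at_top)
  qed
 qed simp
 hence "(LBINT s:{0<..}. g s) = 0" by (simp add: interval_lebesgue_integral_0_infty)
 moreover have "(LBINT s:{0<..}. g s) = (\<integral>s. g s \<partial>lborel)"
  unfolding set_lebesgue_integral_def by (intro Bochner_Integration.integral_cong) (auto simp: g_def lap_def indicator_def)
 moreover have "(\<integral>s. g s \<partial>lborel) = - ((\<kappa> - 1) * Lap \<kappa> 2 z - Lap \<kappa> 1 z + Lap \<kappa> 0 z / z)"
  unfolding g_def Lap_def using lap_integrable[OF k z] by simp
 ultimately show ?thesis by (metis neg_equal_0_iff_equal)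
qed

text \<open>
Pulling out \<open>z\<^sup>\<kappa>\<close> leaves \<open>e\<^sup>-\<^sup>s s\<^sup>-\<^sup>\<kappa> (1 + s / z)\<^sup>\<kappa>\<close>. Replacing the last factor by 1 costs \<open>O(s / |z|)\<close> on the whole cut plane: for
\<open>|z| \<ge> 2 s\<close> by the mean value theorem, and otherwise trivially, \<open>\<kappa>\<close> being imaginary.
\<close>
lemma Lap_asymp:
 assumes k: "Re \<kappa> = 0"
 obtains C where "\<And>z. z \<in> cut ==> norm (Lap \<kappa> 0 z / z powr \<kappa> - Gamma (1 - \<kappa>)) \<le> C / norm z"
proof -
 define K where "K = 2 * norm \<kappa> * exp (norm \<kappa>) + 2 * (exp (2 * pi * norm \<kappa>) + 1)"
 define h where "h s = indicator {0<..} s *\<^sub>R (exp (- of_real s) * exp (- \<kappa> * Ln (of_real s)))" for s :: real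
 have hm: "h \<in> borel_measurable borel" unfolding h_def by measurable
 have nh: "norm (h s) \<le> norm (indicator {0<..} s *\<^sub>R exp (- s))" for s
  by (simp add: h_def norm_mult norm_exp_eq_Re k indicator_def)
 have ih: "integrable lborel h"
  by (rule Bochner_Integration.integrable_bound[OF exp_integrable]) (use hm nh in auto)
 have hG: "(\<integral>s. h s \<partial>lborel) = Gamma (1 - \<kappa>)"
 proof -
  have "Re (1 - \<kappa>) > 0" using k by simp
  note G = absolutely_integrable_Gamma_integral'[OF this] Gamma_integral_complex'[OF this]
  have e: "indicator {0<..} t *\<^sub>R (complex_of_real t powr (1 - \<kappa> - 1) / of_real (exp t)) = h t" for t
   by (auto simp: h_def indicator_def powr_def exp_minus divide_inverse exp_of_real)
  have "integral {0<..} (\<lambda>t. complex_of_real t powr (1 - \<kappa> - 1) / of_real (exp t)) = Gamma (1 - \<kappa>)" using G(2) by blast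
  moreover have "(LINT t:{0<..}|lebesgue. complex_of_real t powr (1 - \<kappa> - 1) / of_real (exp t)) = integral {0<..} (\<lambda>t. complex_of_real t powr (1 - \<kappa> - 1) / of_real (exp t))"
   by (rule set_lebesgue_integral_eq_integral(2)[OF G(1)])
  moreover have "(LINT t:{0<..}|lebesgue. complex_of_real t powr (1 - \<kappa> - 1) / of_real (exp t)) = (\<integral>s. h s \<partial>lebesgue)"
   unfolding set_lebesgue_integral_def e ..
  moreover have "(\<integral>s. h s \<partial>lebesgue) = (\<integral>s. h s \<partial>lborel)" by (rule integral_completion) (use hm in simp)
  ultimately show ?thesis by simp
 qed
 define B where "B s = indicator {0<..} s *\<^sub>R (\<bar>s\<bar> * exp (- s))" for s :: real
 have iB: "integrable lborel B"
 proof (rule Bochner_Integration.integrable_bound)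
  show "integrable lborel (\<lambda>s::real. 2 * exp (- (1/2) * \<bar>s\<bar>))" by (intro integrable_mult_right integrable_exp_minus_abs) simp
  show "AE s in lborel. norm (B s) \<le> norm (2 * exp (- (1/2) * \<bar>s\<bar>))"
  proof (intro AE_I2)
   fix s :: real
   show "norm (B s) \<le> norm (2 * exp (- (1/2) * \<bar>s\<bar>))"
   proof (cases "s > 0")
    case True
    have "s / 2 \<le> exp (s / 2)" using exp_ge_add_one_self[of "s / 2"] by linarith
    hence "s * exp (- s) \<le> 2 * exp (s/2) * exp (- s)" by (intro mult_right_mono) auto
    also have "\<dots> = 2 * exp (- (1/2) * s)" by (simp flip: exp_add)
    finally show ?thesis using True by (simp add: B_def)
   qed (simp add: B_def)
  qed
 qed (unfold B_def, measurable)
 show thesis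
 proof (rule that[of "K * (\<integral>s. B s \<partial>lborel)"])
  fix z assume z: "z \<in> cut"
  have z0: "z \<noteq> 0" using z by auto
  have pz: "z powr \<kappa> \<noteq> 0" "z powr \<kappa> = exp (\<kappa> * Ln z)" using z0 by (auto simp: powr_def)
  have bound: "norm (lap \<kappa> 0 s z / z powr \<kappa> - h s) \<le> K / norm z * B s" for s
  proof (cases "s > 0")
   case True
   have sz: "z + of_real s \<in> cut" using cut_add[OF z less_imp_le[OF True]] .
   hence sz0: "z + of_real s \<noteq> 0" by auto
   define d where "d = Ln (z + of_real s) - Ln z"
   have L: "Ln (1 + z / of_real s) = Ln (z + of_real s) - ln s"
   proof -
    have "1 + z / of_real s = (z + of_real s) / of_real s" using True by (simp add: field_simps)
    also have "Ln \<dots> = Ln (z + of_real s) - ln s" using Ln_divide_of_real[OF True sz0] by (simp add: Ln_of_real True)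
    finally show ?thesis .
   qed
   have "exp (\<kappa> * Ln (1 + z / of_real s)) = exp (- \<kappa> * Ln (of_real s)) * (exp (\<kappa> * d) * exp (\<kappa> * Ln z))"
    unfolding L d_def exp_add[symmetric] by (rule arg_cong[of _ _ exp]) (simp add: algebra_simps Ln_of_real True)
   hence "lap \<kappa> 0 s z / z powr \<kappa> - h s = (exp (- of_real s) * exp (- \<kappa> * Ln (of_real s))) * (exp (\<kappa> * d) - 1)"
    unfolding pz(2) using True by (simp add: lap_def h_def algebra_simps)
   hence n: "norm (lap \<kappa> 0 s z / z powr \<kappa> - h s) = exp (- s) * norm (exp (\<kappa> * d) - 1)"
    by (simp add: norm_mult norm_exp_eq_Re k Ln_of_real True)
   have "norm (exp (\<kappa> * d) - 1) \<le> K * (s / norm z)"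
   proof (cases "norm z \<ge> 2 * s")
    case True
    have "norm (Ln (z + of_real s) - Ln z) \<le> 2 / norm z * norm (z + of_real s - z)"
    proof (rule field_differentiable_bound[where S = "closed_segment z (z + of_real s)" and f' = "\<lambda>w. 1 / w"])
     fix w assume w: "w \<in> closed_segment z (z + of_real s)"
     then obtain u where u: "0 \<le> u" "u \<le> 1" "w = z + of_real (u * s)"
      by (auto simp: in_segment algebra_simps scaleR_conv_of_real)
     have us: "0 \<le> u * s" "u * s \<le> s" using u \<open>s > 0\<close> by (auto simp: mult_left_le_one_le)
     have wc: "w \<in> cut" unfolding u by (rule cut_add[OF z us(1)])
     show "(Ln has_field_derivative 1 / w) (at w within closed_segment z (z + of_real s))"
      using has_field_derivative_at_within[OF has_field_derivative_Ln] wc by (simp add: divide_inverse)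
     have "norm z \<le> norm w + u * s"
     proof -
      have "w - of_real (u * s) = z" by (simp add: u(3))
      moreover have "norm (complex_of_real (u * s)) = u * s" using us by (simp only: norm_of_real abs_of_nonneg)
      ultimately show ?thesis using norm_triangle_ineq4[of w "of_real (u * s)"] by simp
     qed
     hence "norm w \<ge> norm z / 2" using us True by linarith
     moreover have "w \<noteq> 0" using wc by auto
     ultimately show "norm (1 / w) \<le> 2 / norm z" using z0 by (simp add: norm_divide field_simps)
    qed auto
    hence d: "norm d \<le> 2 * s / norm z" using \<open>s > 0\<close> by (simp add: d_def)
    have "2 * s / norm z \<le> 1" using True z0 by simp
    hence d1: "norm d \<le> 1" using d by linarith
    have "norm (exp (\<kappa> * d) - 1) \<le> exp (norm \<kappa>) * norm (\<kappa> * d - 0)"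
    proof -
     have "norm (exp (\<kappa> * d) - exp 0) \<le> exp (norm \<kappa>) * norm (\<kappa> * d - 0)"
     proof (rule field_differentiable_bound[where S = "cball 0 (norm \<kappa>)" and f' = exp])
      fix w :: complex assume "w \<in> cball 0 (norm \<kappa>)"
      hence "Re w \<le> norm \<kappa>" using complex_Re_le_cmod[of w] by simp
      thus "norm (exp w) \<le> exp (norm \<kappa>)" by (simp add: norm_exp_eq_Re)
     next
      show "\<kappa> * d \<in> cball 0 (norm \<kappa>)" using d1 by (simp add: norm_mult mult_left_le)
     qed (auto intro!: derivative_eq_intros)
     thus ?thesis by simp
    qed
    also have "\<dots> \<le> exp (norm \<kappa>) * (norm \<kappa> * (2 * s / norm z))" unfolding norm_mult diff_zero using d by (intro mult_left_mono) auto
    also have "\<dots> = (2 * norm \<kappa> * exp (norm \<kappa>)) * (s / norm z)" by simp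
    also have "\<dots> \<le> K * (s / norm z)" unfolding K_def using \<open>s > 0\<close> by (intro mult_right_mono) auto
    finally show ?thesis .
   next
    case False
    have "norm (exp (\<kappa> * d)) = norm (exp (\<kappa> * Ln (z + of_real s))) * norm (exp (- \<kappa> * Ln z))"
     unfolding norm_mult[symmetric] exp_add[symmetric] by (simp add: d_def algebra_simps)
    also have "\<dots> \<le> exp (pi * norm \<kappa>) * exp (pi * norm (-\<kappa>))"
     by (intro mult_mono norm_exp_Ln) (use k z0 sz0 in auto)
    also have "\<dots> = exp (2 * pi * norm \<kappa>)" by (simp flip: exp_add)
    finally have "norm (exp (\<kappa> * d) - 1) \<le> exp (2 * pi * norm \<kappa>) + 1" using norm_triangle_ineq4[of "exp (\<kappa> * d)" 1] unfolding norm_one by linarith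
    also have "\<dots> \<le> (exp (2 * pi * norm \<kappa>) + 1) * (2 * (s / norm z))"
    proof -
     have "1 \<le> 2 * (s / norm z)" using False z0 by (simp add: field_simps)
     thus ?thesis using mult_left_mono[of 1 "2 * (s / norm z)" "exp (2 * pi * norm \<kappa>) + 1"] by (simp add: add_nonneg_nonneg)
    qed
    also have "\<dots> = 2 * (exp (2 * pi * norm \<kappa>) + 1) * (s / norm z)" by simp
    also have "\<dots> \<le> K * (s / norm z)" unfolding K_def using \<open>s > 0\<close> by (intro mult_right_mono) auto
    finally show ?thesis .
   qed
   hence "exp (- s) * norm (exp (\<kappa> * d) - 1) \<le> exp (- s) * (K * (s / norm z))" by (intro mult_left_mono) auto
   thus ?thesis unfolding n using True by (simp add: B_def field_simps)
  qed (simp add: lap_def h_def B_def)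
  have il: "integrable lborel (\<lambda>s. lap \<kappa> 0 s z / z powr \<kappa>)" by (intro integrable_divide lap_integrable[OF k z])
  have "Lap \<kappa> 0 z / z powr \<kappa> - Gamma (1 - \<kappa>) = (\<integral>s. lap \<kappa> 0 s z / z powr \<kappa> - h s \<partial>lborel)"
   unfolding hG[symmetric] Lap_def using il ih by simp
  also have "norm \<dots> \<le> (\<integral>s. K / norm z * B s \<partial>lborel)"
   by (rule Bochner_Integration.integral_norm_bound_integral) (use il ih iB bound in auto)
  also have "\<dots> = K * (\<integral>s. B s \<partial>lborel) / norm z" by simp
  finally show "norm (Lap \<kappa> 0 z / z powr \<kappa> - Gamma (1 - \<kappa>)) \<le> K * (\<integral>s. B s \<partial>lborel) / norm z" .
 qed
qed

definition whi :: "complex => complex => complex" where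
 "whi \<kappa> z = exp (- z / 2) / Gamma (1 - \<kappa>) * Lap \<kappa> 0 z"

text \<open>
For \<open>\<mu> = 1/2\<close> the term \<open>1/4 - \<mu>\<^sup>2\<close> vanishes and \<open>Lap_ode\<close> is the differential equation.
\<close>
lemma whi_is_WhittW:
 assumes k: "Re \<kappa> = 0"
 shows "is_WhittW \<kappa> (1/2) (whi \<kappa>)"
proof -
 define G where "G = Gamma (1 - \<kappa>)"
 have G: "G \<noteq> 0"
 proof -
  have "1 - \<kappa> \<notin> \<int>\<^sub>\<le>\<^sub>0"
  proof
   assume "1 - \<kappa> \<in> \<int>\<^sub>\<le>\<^sub>0"
   then obtain n where "1 - \<kappa> = of_int n" "n \<le> 0" by (rule nonpos_Ints_cases)
   hence "Re (1 - \<kappa>) \<le> 0" by (metis Re_complex_of_real of_int_le_0_iff of_real_of_int_eq)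
   thus False using k by simp
  qed
  thus ?thesis by (simp add: G_def Gamma_eq_zero_iff)
 qed
 have d1: "(whi \<kappa> has_field_derivative exp (- z / 2) / G * (\<kappa> * Lap \<kappa> 1 z - Lap \<kappa> 0 z / 2)) (at z)" if z: "z \<in> cut" for z
  unfolding whi_def[abs_def] G_def[symmetric] using Lap_deriv[OF k z, of 0] G
  by (auto intro!: derivative_eq_intros simp: field_simps)
 have hol: "whi \<kappa> holomorphic_on cut" using d1 cut(1) by (auto simp: holomorphic_on_open)
 have ode: "deriv (deriv (whi \<kappa>)) z + (- 1/4 + \<kappa> / z + (1/4 - (1/2)\<^sup>2) / z\<^sup>2) * whi \<kappa> z = 0" if z: "z \<in> cut" for z
 proof -
  have z0: "z \<noteq> 0" using z by auto
  define D where "D = (\<lambda>z. exp (- z / 2) / G * (\<kappa> * Lap \<kappa> 1 z - Lap \<kappa> 0 z / 2))"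
  have "eventually (\<lambda>w. deriv (whi \<kappa>) w = D w) (nhds z)"
   using eventually_nhds_in_open[OF cut(1) z] by eventually_elim (use d1 DERIV_imp_deriv in \<open>auto simp: D_def\<close>)
  hence "deriv (deriv (whi \<kappa>)) z = deriv D z" by (rule deriv_cong_ev) simp
  also have "(D has_field_derivative exp (- z / 2) / G * (\<kappa> * (\<kappa> - 1) * Lap \<kappa> 2 z - \<kappa> * Lap \<kappa> 1 z + Lap \<kappa> 0 z / 4)) (at z)"
   unfolding D_def using Lap_deriv[OF k z, of 0] Lap_deriv[OF k z, of 1] G
   by (auto intro!: derivative_eq_intros simp: field_simps numeral_2_eq_2)
  hence "deriv D z = exp (- z / 2) / G * (\<kappa> * (\<kappa> - 1) * Lap \<kappa> 2 z - \<kappa> * Lap \<kappa> 1 z + Lap \<kappa> 0 z / 4)" by (rule DERIV_imp_deriv)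
  finally have dd: "deriv (deriv (whi \<kappa>)) z = exp (- z / 2) / G * (\<kappa> * (\<kappa> - 1) * Lap \<kappa> 2 z - \<kappa> * Lap \<kappa> 1 z + Lap \<kappa> 0 z / 4)" .
  have h: "(1/4 - (1/2)\<^sup>2) / z\<^sup>2 = 0" by (simp add: power2_eq_square)
  have "deriv (deriv (whi \<kappa>)) z + (- 1/4 + \<kappa> / z + (1/4 - (1/2)\<^sup>2) / z\<^sup>2) * whi \<kappa> z
    = exp (- z / 2) / G * \<kappa> * ((\<kappa> - 1) * Lap \<kappa> 2 z - Lap \<kappa> 1 z + Lap \<kappa> 0 z / z)"
  proof -
   have "e * (\<kappa> * (\<kappa> - 1) * L2 - \<kappa> * L1 + L0 / 4) + (- 1/4 + \<kappa> / z + 0) * (e * L0) = e * \<kappa> * ((\<kappa> - 1) * L2 - L1 + L0 / z)"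
    for e L0 L1 L2 by (simp add: algebra_simps)
   thus ?thesis unfolding dd h whi_def G_def[symmetric] .
  qed
  thus ?thesis unfolding Lap_ode[OF k z] by simp
 qed
 have asy: "whi \<kappa> \<sim>[inf at_infinity (principal cut)] (\<lambda>z. exp (- z / 2) * z powr \<kappa>)"
 proof (rule asymp_equivI')
  obtain C where C: "\<And>z. z \<in> cut ==> norm (Lap \<kappa> 0 z / z powr \<kappa> - Gamma (1 - \<kappa>)) \<le> C / norm z" using Lap_asymp[OF k] by blast
  have "((\<lambda>z. whi \<kappa> z / (exp (- z / 2) * z powr \<kappa>) - 1) \<longlongrightarrow> 0) (inf at_infinity (principal cut))"
  proof (rule Lim_null_comparison)
   have "norm (whi \<kappa> z / (exp (- z / 2) * z powr \<kappa>) - 1) \<le> (C / norm G) * inverse (norm z)" if z: "z \<in> cut" for z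
   proof -
    have "whi \<kappa> z / (exp (- z / 2) * z powr \<kappa>) - 1 = (Lap \<kappa> 0 z / z powr \<kappa> - G) / G"
     using G by (simp add: whi_def G_def[symmetric] diff_divide_distrib)
    hence "norm (whi \<kappa> z / (exp (- z / 2) * z powr \<kappa>) - 1) \<le> (C / norm z) / norm G"
     using divide_right_mono[OF C[OF z], of "norm G"] by (simp add: norm_divide G_def)
    thus ?thesis by (simp add: field_simps)
   qed
   thus "eventually (\<lambda>z. norm (whi \<kappa> z / (exp (- z / 2) * z powr \<kappa>) - 1) \<le> (C / norm G) * inverse (norm z)) (inf at_infinity (principal cut))"
    by (simp add: eventually_inf_principal)
   have "((\<lambda>z::complex. (C / norm G) * inverse (norm z)) \<longlongrightarrow> (C / norm G) * 0) at_infinity"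
    by (intro tendsto_mult tendsto_const filterlim_compose[OF tendsto_inverse_0] filterlim_norm_at_top_imp_at_infinity)
      (simp add: filterlim_norm_at_top)
   hence "((\<lambda>z::complex. (C / norm G) * inverse (norm z)) \<longlongrightarrow> 0) at_infinity" by simp
   thus "((\<lambda>z::complex. (C / norm G) * inverse (norm z)) \<longlongrightarrow> 0) (inf at_infinity (principal cut))"
    by (rule tendsto_mono[rotated]) simp
  qed
  thus "((\<lambda>z. whi \<kappa> z / (exp (- z / 2) * z powr \<kappa>)) \<longlongrightarrow> 1) (inf at_infinity (principal cut))" by (subst LIM_zero_iff[symmetric])
 qed
 show ?thesis unfolding is_WhittW_def using hol ode asy by auto
qed

lemma is_WhittW_bounds:
 assumes W: "is_WhittW \<kappa> \<mu> W" and k: "Re \<kappa> = 0"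
 obtains R where "R > 0" "\<And>z. z \<in> cut ==> norm z \<ge> R ==> W z \<noteq> 0"
  "\<And>z. z \<in> cut ==> norm z \<ge> R ==> norm (W z) \<le> 2 * exp (pi * norm \<kappa>) * exp (- Re z / 2)"
proof -
 have "((\<lambda>z. if W z = 0 \<and> exp (- z / 2) * z powr \<kappa> = 0 then 1 else W z / (exp (- z / 2) * z powr \<kappa>)) \<longlongrightarrow> 1) (inf at_infinity (principal cut))"
  using W unfolding is_WhittW_def asymp_equiv_def by blast
 hence "eventually (\<lambda>z. dist (if W z = 0 \<and> exp (- z / 2) * z powr \<kappa> = 0 then 1 else W z / (exp (- z / 2) * z powr \<kappa>)) 1 < 1) (inf at_infinity (principal cut))"
  by (rule tendstoD) simp
 then obtain R where R: "\<And>z. z \<in> cut ==> norm z \<ge> R ==> dist (if W z = 0 \<and> exp (- z / 2) * z powr \<kappa> = 0 then 1 else W z / (exp (- z / 2) * z powr \<kappa>)) 1 < 1"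
  unfolding eventually_inf_principal eventually_at_infinity by blast
 have main: "W z \<noteq> 0 \<and> norm (W z) \<le> 2 * exp (pi * norm \<kappa>) * exp (- Re z / 2)" if z: "z \<in> cut" "norm z \<ge> max R 1" for z
 proof -
  have z0: "z \<noteq> 0" using z by auto
  have e: "z powr \<kappa> = exp (\<kappa> * Ln z)" using z0 by (simp add: powr_def)
  define q where "q = W z / (exp (- z / 2) * z powr \<kappa>)"
  have "norm (q - 1) < 1" using R[of z] z z0 by (simp add: q_def dist_norm)
  hence q: "q \<noteq> 0" "norm q \<le> 2" using norm_triangle_ineq[of "q - 1" 1] by auto
  have Wq: "W z = q * (exp (- z / 2) * exp (\<kappa> * Ln z))" using z0 by (simp add: q_def e)
  have "norm (W z) \<le> 2 * (exp (- Re z / 2) * exp (pi * norm \<kappa>))"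
   unfolding Wq norm_mult by (intro mult_mono q norm_exp_Ln[OF k z0]) (auto simp: norm_exp_eq_Re)
  thus ?thesis using q Wq by (simp add: mult_ac)
 qed
 show thesis by (rule that[of "max R 1"]) (use main in auto)
qed

text \<open>
Both solutions decay along the positive real axis, and so do their derivatives by Cauchy's estimate. Hence the Wronskian,
a constant, is zero and the quotient is constant on a half plane; the asymptotics fix it to be 1.
\<close>
lemma is_WhittW_unique:
 assumes W: "is_WhittW \<kappa> \<mu> W1" "is_WhittW \<kappa> \<mu> W2" and k: "Re \<kappa> = 0" and z: "z \<in> cut"
 shows "W1 z = W2 z"
proof -
 note hol = W[unfolded is_WhittW_def, THEN conjunct1]
 note hd = holomorphic_deriv[OF hol(1) cut(1)] holomorphic_deriv[OF hol(2) cut(1)]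
 have D: "(W1 has_field_derivative deriv W1 z) (at z)" "(W2 has_field_derivative deriv W2 z) (at z)"
  "(deriv W1 has_field_derivative deriv (deriv W1) z) (at z)" "(deriv W2 has_field_derivative deriv (deriv W2) z) (at z)" if "z \<in> cut" for z
  using holomorphic_derivI[OF _ cut(1) that] hol hd by auto
 define w where "w z = W1 z * deriv W2 z - deriv W1 z * W2 z" for z
 have dw: "(w has_field_derivative 0) (at z)" if z: "z \<in> cut" for z
 proof -
  define q where "q = - 1/4 + \<kappa> / z + (1/4 - \<mu>\<^sup>2) / z\<^sup>2"
  have o: "deriv (deriv W1) z = - q * W1 z" "deriv (deriv W2) z = - q * W2 z"
  proof -
   have "deriv (deriv W1) z + q * W1 z = 0" "deriv (deriv W2) z + q * W2 z = 0"
    using W z unfolding is_WhittW_def q_def by blast+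
   thus "deriv (deriv W1) z = - q * W1 z" "deriv (deriv W2) z = - q * W2 z"
    by (simp_all only: eq_neg_iff_add_eq_0 mult_minus_left)
  qed
  have "(w has_field_derivative (deriv W1 z * deriv W2 z + deriv (deriv W2) z * W1 z - (deriv (deriv W1) z * W2 z + deriv W2 z * deriv W1 z))) (at z)"
   unfolding w_def[abs_def] by (intro DERIV_diff DERIV_mult D[OF z])
  moreover have "deriv W1 z * deriv W2 z + deriv (deriv W2) z * W1 z - (deriv (deriv W1) z * W2 z + deriv W2 z * deriv W1 z) = 0"
   unfolding o by (simp add: algebra_simps)
  ultimately show ?thesis by simp
 qed
 obtain c where c: "\<And>z. z \<in> cut ==> w z = c"
 proof -
  have "continuous_on cut w" by (intro continuous_at_imp_continuous_on ballI DERIV_isCont[OF dw])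
  thus ?thesis using that DERIV_zero_connected_constant[OF cut(2,1) finite.emptyI, of w] dw by auto
 qed
 obtain R1 where R1: "R1 > 0" "\<And>z. z \<in> cut ==> norm z \<ge> R1 ==> W1 z \<noteq> 0"
  "\<And>z. z \<in> cut ==> norm z \<ge> R1 ==> norm (W1 z) \<le> 2 * exp (pi * norm \<kappa>) * exp (- Re z / 2)" using is_WhittW_bounds[OF W(1) k] by blast
 obtain R2 where R2: "R2 > 0" "\<And>z. z \<in> cut ==> norm z \<ge> R2 ==> W2 z \<noteq> 0"
  "\<And>z. z \<in> cut ==> norm z \<ge> R2 ==> norm (W2 z) \<le> 2 * exp (pi * norm \<kappa>) * exp (- Re z / 2)" using is_WhittW_bounds[OF W(2) k] by blast
 define R where "R = max R1 R2"
 define M where "M = 2 * exp (pi * norm \<kappa>)"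
 have M: "M > 0" by (simp add: M_def)
 have halfplane: "z \<in> cut" "norm z \<ge> R" if "Re z > R" for z
  using that R1(1) complex_Re_le_cmod[of z] by (auto simp: R_def complex_nonpos_Reals_iff)
 have bnd: "norm (V (of_real x)) \<le> M * exp (- (x - 1) / 2) \<and> norm (deriv V (of_real x)) \<le> 4 * (M * exp (- (x - 1) / 2))"
  if x: "x > R + 1" and V: "V holomorphic_on cut" "\<And>z. z \<in> cut ==> norm z \<ge> R ==> norm (V z) \<le> M * exp (- Re z / 2)" for x V
 proof -
  have b: "Re u > R \<and> Re u > x - 1" if "u \<in> ball (of_real x) 1" for u
   using that x abs_Re_le_cmod[of "of_real x - u"] by (auto simp: dist_norm)
  have Vb: "norm (V u) \<le> M * exp (- (x - 1) / 2)" if "u \<in> ball (of_real x) 1" for u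
  proof -
   have "norm (V u) \<le> M * exp (- Re u / 2)" using V(2) halfplane b[OF that] by blast
   also have "\<dots> \<le> M * exp (- (x - 1) / 2)" using b[OF that] M by (intro mult_left_mono) auto
   finally show ?thesis .
  qed
  have "norm (deriv V (of_real x)) \<le> 4 * (M * exp (- (x - 1) / 2)) / 1"
   by (rule deriv_bound_ball[OF holomorphic_on_subset[OF V(1)]]) (use b halfplane Vb in auto)
  thus ?thesis using Vb[of "of_real x"] by simp
 qed
 have "c = 0"
 proof (rule ccontr)
  assume c0: "c \<noteq> 0"
  have "norm c \<le> 8 * M\<^sup>2 * exp (- (x - 1))" if x: "x > R + 1" for x
  proof -
   define e where "e = M * exp (- (x - 1) / 2)"
   have "e \<ge> 0" using M by (simp add: e_def)
   have 1: "norm (W1 (of_real x)) \<le> e \<and> norm (deriv W1 (of_real x)) \<le> 4 * e" unfolding e_def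
    by (rule bnd[OF x hol(1)]) (use R1 in \<open>auto simp: M_def R_def\<close>)
   have 2: "norm (W2 (of_real x)) \<le> e \<and> norm (deriv W2 (of_real x)) \<le> 4 * e" unfolding e_def
    by (rule bnd[OF x hol(2)]) (use R2 in \<open>auto simp: M_def R_def\<close>)
   have "x > 0" using x R1(1) by (simp add: R_def)
   hence "norm c = norm (w (of_real x))" using c[OF cut_of_real] by simp
   also have "\<dots> \<le> e * (4 * e) + 4 * e * e"
   proof -
    have "norm (W1 (of_real x) * deriv W2 (of_real x)) \<le> e * (4 * e)"
     unfolding norm_mult using 1 2 \<open>e \<ge> 0\<close> by (intro mult_mono) auto
    moreover have "norm (deriv W1 (of_real x) * W2 (of_real x)) \<le> 4 * e * e"
     unfolding norm_mult using 1 2 \<open>e \<ge> 0\<close> by (intro mult_mono) auto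
    ultimately show ?thesis unfolding w_def by (intro order_trans[OF norm_triangle_ineq4] add_mono)
   qed
   also have "\<dots> = 8 * (e * e)" by simp
   also have "e * e = M\<^sup>2 * exp (- (x - 1))" unfolding e_def by (simp add: power2_eq_square flip: exp_add)
   finally show ?thesis by (simp add: mult_ac)
  qed
  hence ev: "eventually (\<lambda>x. norm c \<le> 8 * M\<^sup>2 * exp (- (x - 1))) at_top"
   by (rule eventually_mono[OF eventually_gt_at_top[of "R + 1"]])
  have lim: "((\<lambda>x::real. 8 * M\<^sup>2 * exp (- (x - 1))) \<longlongrightarrow> 0) at_top"
   by (rule tendsto_mult_right_zero) real_asymp
  have "norm c \<le> 0" by (rule tendsto_lowerbound[OF lim ev trivial_limit_at_top_linorder])
  thus False using c0 by simp
 qed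
 \<comment> \<open>\<open>W2\<close> has no zeros in the half plane, so the vanishing Wronskian is the derivative of a quotient\<close>
 define q where "q z = W1 z / W2 z" for z
 have dq: "(q has_field_derivative 0) (at z within {z. Re z > R})" if zR: "z \<in> {z. Re z > R}" for z
 proof -
  have z: "z \<in> cut" "W2 z \<noteq> 0" using zR halfplane[of z] R2(2)[of z] by (auto simp: R_def)
  have "(q has_field_derivative (deriv W1 z * W2 z - W1 z * deriv W2 z) / (W2 z * W2 z)) (at z)"
   unfolding q_def[abs_def] by (rule DERIV_divide[OF D(1)[OF z(1)] D(2)[OF z(1)] z(2)])
  moreover have "deriv W1 z * W2 z - W1 z * deriv W2 z = 0" using c[OF z(1)] \<open>c = 0\<close> by (simp add: w_def)
  ultimately show ?thesis by (simp add: has_field_derivative_at_within)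
 qed
 obtain d where d: "\<And>z. Re z > R ==> q z = d"
  using has_field_derivative_zero_constant[OF convex_halfspace_Re_gt dq] by auto
 have "d = 1"
 proof -
  have f: "filterlim (\<lambda>x. complex_of_real x) (inf at_infinity (principal cut)) at_top"
   unfolding filterlim_inf filterlim_principal
  proof
   show "filterlim complex_of_real at_infinity at_top" by (rule filterlim_of_real_at_infinity)
   show "eventually (\<lambda>x. complex_of_real x \<in> cut) at_top"
    by (rule eventually_mono[OF eventually_gt_at_top[of 0]]) (rule cut_of_real)
  qed
  have "(\<lambda>x. W1 (of_real x)) \<sim>[at_top] (\<lambda>x. exp (- of_real x / 2) * of_real x powr \<kappa>)"
   "(\<lambda>x. W2 (of_real x)) \<sim>[at_top] (\<lambda>x. exp (- of_real x / 2) * of_real x powr \<kappa>)"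
   using asymp_equiv_compose'[OF _ f] W unfolding is_WhittW_def by blast+
  hence "(\<lambda>x::real. W1 (of_real x)) \<sim>[at_top] (\<lambda>x. W2 (of_real x))" using asymp_equiv_trans asymp_equiv_symI by blast
  hence "((\<lambda>x. if W1 (of_real x) = 0 \<and> W2 (of_real x) = 0 then 1 else W1 (of_real x) / W2 (of_real x)) \<longlongrightarrow> 1) (at_top :: real filter)"
   unfolding asymp_equiv_def .
  moreover have "eventually (\<lambda>x::real. (if W1 (of_real x) = 0 \<and> W2 (of_real x) = 0 then 1 else W1 (of_real x) / W2 (of_real x)) = d) at_top"
   using eventually_gt_at_top[of R]
  proof eventually_elim
   case (elim x)
   have "W2 (of_real x) \<noteq> 0" using halfplane[of "of_real x"] R2(2)[of "of_real x"] elim by (auto simp: R_def)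
   thus ?case using d[of "of_real x"] elim by (simp add: q_def)
  qed
  ultimately have "((\<lambda>x::real. d) \<longlongrightarrow> 1) at_top" using tendsto_cong by fast
  thus ?thesis using tendsto_const_iff trivial_limit_at_top_linorder by blast
 qed
 have eq: "W1 z = W2 z" if zR: "Re z > R" for z
  using d[OF zR] halfplane[OF zR] R2(2)[of z] \<open>d = 1\<close> by (simp add: q_def R_def)
 show ?thesis
 proof (rule analytic_continuation_open[OF open_halfspace_Re_gt cut(1) _ cut(2) _ hol _ z, of R])
  show "{z. Re z > R} \<noteq> {}" by (auto intro!: exI[of _ "of_real (R + 1)"])
  show "{z. Re z > R} \<subseteq> cut" using halfplane by blast
 qed (use eq in auto)
qed

lemma WhittW_eq:
 assumes k: "Re \<kappa> = 0" and z: "z \<in> cut"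
 shows "WhittW \<kappa> (1/2) z = exp (- z / 2) / Gamma (1 - \<kappa>) * Lap \<kappa> 0 z"
proof -
 have "is_WhittW \<kappa> (1/2) (WhittW \<kappa> (1/2))" unfolding WhittW_def by (rule someI[of _ "whi \<kappa>"]) (rule whi_is_WhittW[OF k])
 from is_WhittW_unique[OF this whi_is_WhittW[OF k] k z] show ?thesis by (simp add: whi_def)
qed

section \<open>Deformation of the Laplace contour\<close>

lemma FTC_path:
 fixes \<gamma> :: "real => complex"
 assumes ab: "a \<le> b" and d: "\<And>y. y \<in> {a..b} ==> (\<gamma> has_vector_derivative \<gamma>' y) (at y)"
  and F: "\<And>y. y \<in> {a..b} ==> (F has_field_derivative f y) (at (\<gamma> y))"
  and h: "\<And>y. y \<in> {a..b} ==> \<gamma>' y * f y = h y" and c: "continuous_on {a..b} h"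
 shows "(\<integral>y. indicator {a..b} y *\<^sub>R h y \<partial>lborel) = F (\<gamma> b) - F (\<gamma> a)"
proof -
 have "(\<integral>y. indicator {a..b} y *\<^sub>R h y \<partial>lborel) = (F \<circ> \<gamma>) b - (F \<circ> \<gamma>) a"
 proof (rule integral_FTC_atLeastAtMost[OF ab _ c])
  fix y assume "a \<le> y" "y \<le> b"
  hence y: "y \<in> {a..b}" by simp
  show "((F \<circ> \<gamma>) has_vector_derivative h y) (at y within {a..b})"
   using field_vector_diff_chain_at[OF d[OF y] F[OF y]] unfolding h[OF y] by (rule has_vector_derivative_at_within)
 qed
 thus ?thesis by simp
qed

text \<open>
Dominated convergence; improper integrals become limits along a sequence of sets.
\<close>
lemma integral_exhaust:
 fixes f :: "real => complex"
 assumes f: "integrable lborel f" and A: "\<And>n. A n \<in> sets borel"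
  and e: "\<And>y. f y \<noteq> 0 ==> eventually (\<lambda>n. y \<in> A n) sequentially"
 shows "(\<lambda>n. \<integral>y. indicator (A n) y *\<^sub>R f y \<partial>lborel) \<longlonglongrightarrow> (\<integral>y. f y \<partial>lborel)"
proof (rule integral_dominated_convergence[where w = "\<lambda>y. norm (f y)"])
 show "f \<in> borel_measurable lborel" using f by simp
 show "(\<lambda>y. indicator (A n) y *\<^sub>R f y) \<in> borel_measurable lborel" for n
  using f A by (intro borel_measurable_scaleR borel_measurable_indicator) auto
 show "AE y in lborel. (\<lambda>n. indicator (A n) y *\<^sub>R f y) \<longlonglongrightarrow> f y"
 proof (intro AE_I2)
  fix y show "(\<lambda>n. indicator (A n) y *\<^sub>R f y) \<longlonglongrightarrow> f y"
  proof (cases "f y = 0")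
   case False
   have "eventually (\<lambda>n. indicator (A n) y *\<^sub>R f y = f y) sequentially"
    using e[OF False] by eventually_elim simp
   thus ?thesis by (rule tendsto_eventually)
  qed simp
 qed
 show "AE y in lborel. norm (indicator (A n) y *\<^sub>R f y) \<le> norm (f y)" for n
  by (intro AE_I2) (auto simp: indicator_def)
qed (use f in simp)

text \<open>
Here \<open>m\<close> is the square root of the parameter \<open>m\<close> above, and \<open>b = Z / l\<close>. Then \<open>z\<close>, \<open>\<kappa>\<close> are the arguments of the W-function, \<open>s0\<close> is the
critical point, \<open>v0\<close> its image under \<open>v = ln (1 + z / s) / 2\<close>, and \<open>s = S v\<close> is the inverse of this substitution. \<open>c0\<close> is the value of the
integrand \<open>e\<^sup>-\<^sup>s (1 + z / s)\<^sup>\<kappa>\<close> at \<open>s0\<close>, and \<open>g v dv\<close> is the integrand in the variable \<open>v\<close>, with primitive \<open>\<G>\<close> on \<open>Re v > 0\<close>.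
\<close>
locale contour =
 fixes m b :: real
 assumes m: "0 < m" "m < 1" and b: "0 < b"
begin

definition k :: complex where "k = \<i> * of_real b"
definition \<nu> :: complex where "\<nu> = 1 - of_real (m\<^sup>2)"
definition \<kappa> :: complex where "\<kappa> = - k / (2 * of_real m)"
definition z :: complex where "z = 2 * of_real m * k / \<nu>"
definition v0 :: real where "v0 = ln ((1 + m) / (1 - m)) / 2"
definition s0 :: complex where "s0 = k / (1 + of_real m)"
definition c0 :: complex where "c0 = exp (2 * \<kappa> * of_real v0 - s0)"
definition S :: "complex => complex" where "S v = z / (exp (2 * v) - 1)"
definition g :: "complex => complex" where
 "g v = exp (- S v) * exp (2 * \<kappa> * v) * (- 2 * z * exp (2 * v) / (exp (2 * v) - 1)\<^sup>2)"
definition \<G> :: "complex => complex" where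
 "\<G> = (SOME G. \<forall>v. Re v > 0 --> (G has_field_derivative g v) (at v))"
definition vl :: "complex => complex" where "vl s = Ln (1 + z / s) / 2"

lemma nz: "k \<noteq> 0" "\<nu> \<noteq> 0" "of_real m \<noteq> (0::complex)" "1 + of_real m \<noteq> (0::complex)" "1 - of_real m \<noteq> (0::complex)" "z \<noteq> 0"
proof -
 have m2: "m\<^sup>2 < 1" using m by (simp add: abs_square_less_1)
 have "\<nu> = of_real (1 - m\<^sup>2)" by (simp add: \<nu>_def)
 thus n: "\<nu> \<noteq> 0" using m2 by (metis of_real_eq_0_iff diff_gt_0_iff_gt less_irrefl)
 show k: "k \<noteq> 0" using b by (simp add: k_def)
 show m0: "of_real m \<noteq> (0::complex)" using m by simp
 have "complex_of_real (1 + m) \<noteq> 0" "complex_of_real (1 - m) \<noteq> 0" using m by (simp_all only: of_real_eq_0_iff)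
 thus "1 + of_real m \<noteq> (0::complex)" "1 - of_real m \<noteq> (0::complex)" by simp_all
 show "z \<noteq> 0" using n k m0 by (simp add: z_def)
qed

lemma \<nu>: "\<nu> = (1 - of_real m) * (1 + of_real m)"
 by (simp add: \<nu>_def algebra_simps power2_eq_square)

lemma s0_alt: "s0 = k * (1 - of_real m) / \<nu>"
 unfolding s0_def \<nu> using nz by simp

lemma z_im: "Re z = 0" "Im z > 0"
proof -
 have z: "z = \<i> * of_real (2 * m * b / (1 - m\<^sup>2))" by (simp add: z_def k_def \<nu>_def)
 have "m\<^sup>2 < 1" using m by (simp add: abs_square_less_1)
 thus "Re z = 0" "Im z > 0" unfolding z using m b by simp_all
qed

lemma Re_\<kappa>: "Re \<kappa> = 0" "Im \<kappa> = - b / (2 * m)"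
proof -
 have "\<kappa> = \<i> * of_real (- b / (2 * m))" by (simp add: \<kappa>_def k_def)
 thus "Re \<kappa> = 0" "Im \<kappa> = - b / (2 * m)" by simp_all
qed

lemma e2v_neq_1: assumes "Re v > 0" shows "exp (2 * v) \<noteq> 1"
proof
 assume "exp (2 * v) = 1"
 hence "norm (exp (2 * v)) = 1" by simp
 thus False using assms by (simp add: norm_exp_eq_Re)
qed

lemma \<G>: assumes v: "Re v > 0" shows "(\<G> has_field_derivative g v) (at v)"
proof -
 have o: "open {v::complex. Re v > 0}" by (rule open_halfspace_Re_gt)
 have "g holomorphic_on {v. Re v > 0}" unfolding g_def S_def
  by (intro holomorphic_intros) (use e2v_neq_1 in auto)
 then obtain G where G: "\<And>v. v \<in> {v. Re v > 0} ==> (G has_field_derivative g v) (at v within {v. Re v > 0})"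
  using holomorphic_convex_primitive'[OF convex_halfspace_Re_gt o] by blast
 have "\<forall>v. Re v > 0 --> (G has_field_derivative g v) (at v)"
 proof (intro allI impI)
  fix v :: complex assume "Re v > 0"
  hence v: "v \<in> {v. Re v > 0}" by simp
  show "(G has_field_derivative g v) (at v)" using G[OF v] unfolding at_within_open[OF v o] .
 qed
 from someI[of "\<lambda>G. \<forall>v. Re v > 0 --> (G has_field_derivative g v) (at v)", OF this]
 show ?thesis unfolding \<G>_def using v by blast
qed

text \<open>
\<open>z\<close> lies on the positive imaginary axis, so \<open>s\<close> in the closed upper half plane is closer to 0 than to \<open>- z\<close>, and the
segment from \<open>- z\<close> to 0, where the logarithm is singular, is avoided.
\<close>
lemma dom:
 assumes "Im s \<ge> 0" "Re s > 0 \<or> Im s > 0"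
 shows "s \<noteq> 0" "s + z \<noteq> 0" "1 + z / s \<in> cut" "Re (vl s) > 0"
proof -
 show s: "s \<noteq> 0" using assms by auto
 have Iz: "Im (s + z) > 0" using assms z_im by simp
 show sz: "s + z \<noteq> 0"
 proof
  assume "s + z = 0"
  thus False using Iz by (simp only: complex.sel zero_complex.sel less_irrefl)
 qed
 have w: "1 + z / s = (s + z) / s" using s by (simp add: field_simps)
 have Imw: "Im (1 + z / s) = Im z * Re s / (norm s)\<^sup>2" by (simp add: Im_divide z_im cmod_power2)
 have Rew: "Re (1 + z / s) = 1 + Im z * Im s / (norm s)\<^sup>2" by (simp add: Re_divide z_im cmod_power2)
 have "Re (1 + z / s) > 0" unfolding Rew using assms z_im by (intro add_pos_nonneg) auto
 thus c: "1 + z / s \<in> cut" by (auto simp: complex_nonpos_Reals_iff simp del: plus_complex.sel)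
 have "(norm s)\<^sup>2 < (norm (s + z))\<^sup>2" unfolding cmod_power2 using assms z_im by (simp add: power2_eq_square algebra_simps add_pos_nonneg)
 hence "norm s < norm (s + z)" by (rule power2_less_imp_less) simp
 hence n: "norm (1 + z / s) > 1" unfolding w norm_divide using s by simp
 hence "1 + z / s \<noteq> 0" by (metis norm_zero not_one_less_zero)
 from Re_Ln[OF this] show "Re (vl s) > 0" unfolding vl_def using ln_gt_zero[OF n] by simp
qed

lemma exp_vl: assumes "Im s \<ge> 0" "Re s > 0 \<or> Im s > 0" shows "exp (2 * vl s) = 1 + z / s" "S (vl s) = s"
proof -
 have "1 + z / s \<noteq> 0" using dom(3)[OF assms] by (metis ComplD nonpos_Reals_zero_I)
 thus e: "exp (2 * vl s) = 1 + z / s" by (simp add: vl_def)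
 show "S (vl s) = s" unfolding S_def e using dom(1)[OF assms] nz by simp
qed

lemma vl_deriv: assumes s: "Im s \<ge> 0" "Re s > 0 \<or> Im s > 0"
 shows "(vl has_field_derivative - z / (2 * s * (s + z))) (at s)"
proof -
 note d = dom[OF s]
 have d1: "((\<lambda>s. 1 + z / s) has_field_derivative - (z / (s * s))) (at s)"
  using d by (auto intro!: derivative_eq_intros)
 have "1 + z / s \<notin> \<real>\<^sub>\<le>\<^sub>0" using d by simp
 from DERIV_cdivide[OF DERIV_chain2[OF has_field_derivative_Ln[OF this] d1], of 2]
 have "(vl has_field_derivative inverse (1 + z / s) * - (z / (s * s)) / 2) (at s)" unfolding vl_def[abs_def] .
 moreover have "inverse (1 + z / s) * - (z / (s * s)) / 2 = - z / (2 * s * (s + z))"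
 proof -
  have "1 + z / s = (s + z) / s" using d by (simp add: field_simps)
  thus ?thesis using d by simp
 qed
 ultimately show ?thesis by simp
qed

lemma g_vl: assumes s: "Im s \<ge> 0" "Re s > 0 \<or> Im s > 0"
 shows "g (vl s) = exp (- s) * exp (2 * \<kappa> * vl s) * (- (2 * s * (s + z) / z))"
proof -
 note d = dom[OF s] and e = exp_vl[OF s]
 have "- 2 * z * (1 + z / s) / (z / s)\<^sup>2 = - (2 * s * (s + z) / z)"
  using d nz by (simp add: power2_eq_square divide_simps)
 thus ?thesis unfolding g_def e by simp
qed

lemma \<G>_vl: assumes s: "Im s \<ge> 0" "Re s > 0 \<or> Im s > 0"
 shows "((\<lambda>s. \<G> (vl s)) has_field_derivative exp (- s) * exp (\<kappa> * Ln (1 + z / s))) (at s)"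
proof -
 have "((\<lambda>s. \<G> (vl s)) has_field_derivative g (vl s) * (- z / (2 * s * (s + z)))) (at s)"
  by (rule DERIV_chain2[OF \<G>[OF dom(4)[OF s]] vl_deriv[OF s]])
 moreover have "g (vl s) * (- z / (2 * s * (s + z))) = exp (- s) * exp (2 * \<kappa> * vl s)"
  unfolding g_vl[OF s] using dom[OF s] nz by simp
 moreover have "2 * \<kappa> * vl s = \<kappa> * Ln (1 + z / s)" by (simp add: vl_def)
 ultimately show ?thesis by simp
qed

lemma Q_dom: assumes "Re Q > - 1/2" shows "Im (s0 + k * Q) > 0"
proof -
 have "s0 = \<i> * of_real (b / (1 + m))" by (simp add: s0_def k_def)
 hence I: "Im (s0 + k * Q) = b * (1 / (1 + m) + Re Q)" by (simp add: k_def distrib_left)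
 have "1 / (1 + m) > 1 / 2" using m by (simp add: field_simps)
 thus ?thesis unfolding I using assms b by (intro mult_pos_pos) auto
qed

lemma sQ: "(s0 + k * Q) * (s0 + k * Q + z) = k\<^sup>2 / \<nu> * (1 + 2 * Q + \<nu> * Q\<^sup>2)"
proof -
 have a: "s0 + k * Q = k / \<nu> * (1 - of_real m + \<nu> * Q)" unfolding s0_alt using nz by (simp add: field_simps)
 have c: "s0 + k * Q + z = k / \<nu> * (1 + of_real m + \<nu> * Q)" unfolding a z_def using nz by (simp add: field_simps)
 have "(1 - of_real m + \<nu> * Q) * (1 + of_real m + \<nu> * Q) = \<nu> * (1 + 2 * Q + \<nu> * Q\<^sup>2)"
  unfolding \<nu> by (simp add: algebra_simps power2_eq_square)
 hence "(s0 + k * Q) * (s0 + k * Q + z) = k / \<nu> * (k / \<nu>) * (\<nu> * (1 + 2 * Q + \<nu> * Q\<^sup>2))"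
  unfolding c unfolding a by (metis mult.assoc mult.left_commute)
 thus ?thesis using nz by (simp add: power2_eq_square)
qed

text \<open>
The phase in closed form.
\<close>
definition Ft :: "complex => complex" where "Ft Q = Q + (vl (s0 + k * Q) - of_real v0) / of_real m"

lemma Ft_deriv: assumes Q: "Re Q > - 1/2"
 shows "1 + 2 * Q + \<nu> * Q\<^sup>2 \<noteq> 0" "(Ft has_field_derivative Q * kap Q \<nu>) (at Q)"
proof -
 have s: "Im (s0 + k * Q) \<ge> 0" "Re (s0 + k * Q) > 0 \<or> Im (s0 + k * Q) > 0" using Q_dom[OF Q] by auto
 show n: "1 + 2 * Q + \<nu> * Q\<^sup>2 \<noteq> 0"
 proof
  assume "1 + 2 * Q + \<nu> * Q\<^sup>2 = 0"
  hence "(s0 + k * Q) * (s0 + k * Q + z) = 0" unfolding sQ by simp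
  thus False using dom(1,2)[OF s] by simp
 qed
 have "((\<lambda>Q. s0 + k * Q) has_field_derivative k) (at Q)" by (auto intro!: derivative_eq_intros)
 from DERIV_chain2[OF vl_deriv[OF s] this]
 have "((\<lambda>Q. vl (s0 + k * Q)) has_field_derivative - z / (2 * (s0 + k * Q) * (s0 + k * Q + z)) * k) (at Q)" .
 hence d: "(Ft has_field_derivative 1 + (- z / (2 * (s0 + k * Q) * (s0 + k * Q + z)) * k - 0) / of_real m) (at Q)"
  unfolding Ft_def[abs_def] by (intro DERIV_add DERIV_ident DERIV_cdivide DERIV_diff DERIV_const)
 have "1 + (- z / (2 * (s0 + k * Q) * (s0 + k * Q + z)) * k - 0) / of_real m = 1 - 1 / (1 + 2 * Q + \<nu> * Q\<^sup>2)"
  unfolding mult.assoc sQ unfolding z_def using nz n by (simp add: power2_eq_square)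
 also have "\<dots> = Q * kap Q \<nu>" unfolding kap_def using n by (simp add: field_simps power2_eq_square)
 finally show "(Ft has_field_derivative Q * kap Q \<nu>) (at Q)" using d by simp
qed

lemma v0_eq: "vl s0 = of_real v0" "exp (2 * of_real v0) = (1 + of_real m) / (1 - complex_of_real m)"
proof -
 have p: "(1 + m) / (1 - m) > 0" using m by simp
 have "1 + z / s0 = of_real ((1 + m) / (1 - m))"
  unfolding z_def s0_alt using nz by (simp add: field_simps)
 thus "vl s0 = of_real v0" unfolding vl_def v0_def using p by (simp only: Ln_of_real) simp
 have "exp (2 * of_real v0) = complex_of_real (exp (2 * v0))" by (simp flip: exp_of_real)
 also have "exp (2 * v0) = (1 + m) / (1 - m)" unfolding v0_def using p by simp
 finally show "exp (2 * of_real v0) = (1 + of_real m) / (1 - complex_of_real m)" by simp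
qed

text \<open>
Both sides are the integral of the derivative of \<open>Ft\<close> along the segment from 0 to \<open>Q\<close>.
\<close>
lemma ht_Ft: assumes Q: "Re Q > - 1/2" shows "Q\<^sup>2 * ht Q \<nu> = Ft Q"
proof -
 have Qx: "Re (Q * of_real x) > - 1/2" if "x \<in> {0..1}" for x
 proof (cases "Re Q \<ge> 0")
  case True
  hence "0 \<le> Re Q * x" using that by simp
  thus ?thesis by simp
 next
  case False
  hence "Re Q * 1 \<le> Re Q * x" using that by (intro mult_left_mono_neg) auto
  thus ?thesis using Q by simp
 qed
 define h where "h x = Q\<^sup>2 * (of_real x * kap (Q * of_real x) \<nu>)" for x :: real
 have "(\<integral>x. indicator {0..1} x *\<^sub>R h x \<partial>lborel) = Ft (Q * of_real 1) - Ft (Q * of_real 0)"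
 proof (rule FTC_path[where \<gamma> = "\<lambda>x. Q * of_real x" and F = Ft and f = "\<lambda>x. Q * of_real x * kap (Q * of_real x) \<nu>" and \<gamma>' = "\<lambda>_. Q"])
  show "((\<lambda>x. Q * of_real x) has_vector_derivative Q) (at y)" for y :: real
   by (auto intro!: derivative_eq_intros)
  show "(Ft has_field_derivative Q * of_real y * kap (Q * of_real y) \<nu>) (at (Q * of_real y))" if "y \<in> {0..1}" for y
   by (rule Ft_deriv(2)[OF Qx[OF that]])
  show "continuous_on {0..1} h" unfolding h_def kap_def
   by (intro continuous_intros) (use Ft_deriv(1)[OF Qx] in auto)
 qed (simp_all add: h_def power2_eq_square mult_ac)
 moreover have e: "indicator {0..1} x *\<^sub>R h x = Q\<^sup>2 * (indicator {0..1} x *\<^sub>R (of_real x * kap (Q * of_real x) \<nu>))" for x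
  by (simp add: h_def)
 moreover have "Ft 0 = 0" by (simp add: Ft_def v0_eq)
 ultimately show ?thesis unfolding ht_def e by (simp only: integral_mult_right_zero of_real_0 of_real_1 mult_zero_right mult_1_right diff_zero)
qed

lemma exponent: assumes Q: "Re Q > - 1/2"
 shows "exp (- (s0 + k * Q)) * exp (\<kappa> * Ln (1 + z / (s0 + k * Q))) = c0 * exp (- k * (Q\<^sup>2 * ht Q \<nu>))"
proof -
 define v where "v = vl (s0 + k * Q)"
 have L: "\<kappa> * Ln (1 + z / (s0 + k * Q)) = 2 * \<kappa> * v" by (simp add: vl_def v_def)
 have F: "Ft Q = Q + (v - of_real v0) / of_real m" by (simp add: Ft_def v_def)
 have km: "2 * \<kappa> * (v - of_real v0) = - k * ((v - of_real v0) / of_real m)" unfolding \<kappa>_def using nz by simp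
 have "- (s0 + k * Q) + 2 * \<kappa> * v = (2 * \<kappa> * of_real v0 - s0) + (- k * Ft Q)"
 proof -
  have "2 * \<kappa> * v = 2 * \<kappa> * of_real v0 + 2 * \<kappa> * (v - of_real v0)" by (simp add: algebra_simps)
  thus ?thesis unfolding km F by (simp add: algebra_simps)
 qed
 thus ?thesis unfolding L ht_Ft[OF Q] c0_def by (simp only: exp_add[symmetric])
qed

lemma Q_integral:
 assumes ab: "a1 \<le> a2" and Q: "\<And>y. y \<in> {a1..a2} ==> Re (p + of_real y * q) > - 1/2"
 defines "\<gamma> \<equiv> \<lambda>y. p + of_real y * q"
 shows "c0 * k * (\<integral>y. indicator {a1..a2} y *\<^sub>R (exp (- k * ((\<gamma> y)\<^sup>2 * ht (\<gamma> y) \<nu>)) * q) \<partial>lborel)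
   = \<G> (vl (s0 + k * \<gamma> a2)) - \<G> (vl (s0 + k * \<gamma> a1))"
proof -
 have s: "Im (s0 + k * \<gamma> y) \<ge> 0" "Re (s0 + k * \<gamma> y) > 0 \<or> Im (s0 + k * \<gamma> y) > 0" if "y \<in> {a1..a2}" for y
  using Q_dom[OF Q[OF that]] by (auto simp: \<gamma>_def)
 define h where "h y = c0 * exp (- k * Ft (\<gamma> y)) * (k * q)" for y
 have cF: "continuous_on {a1..a2} (\<lambda>y. Ft (\<gamma> y))"
 proof (rule continuous_on_compose2[of "{Q. Re Q > - 1/2}" Ft])
  show "continuous_on {Q. Re Q > - 1/2} Ft"
   using DERIV_isCont[OF Ft_deriv(2)] by (intro continuous_at_imp_continuous_on) auto
  show "continuous_on {a1..a2} \<gamma>" unfolding \<gamma>_def by (intro continuous_intros)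
  show "\<gamma> ` {a1..a2} \<subseteq> {Q. Re Q > - 1/2}" using Q by (auto simp: \<gamma>_def)
 qed
 have "(\<integral>y. indicator {a1..a2} y *\<^sub>R h y \<partial>lborel) = \<G> (vl (s0 + k * \<gamma> a2)) - \<G> (vl (s0 + k * \<gamma> a1))"
 proof (rule FTC_path[OF ab, where \<gamma> = "\<lambda>y. s0 + k * \<gamma> y" and F = "\<lambda>s. \<G> (vl s)" and \<gamma>' = "\<lambda>_. k * q"])
  show "((\<lambda>y. s0 + k * \<gamma> y) has_vector_derivative k * q) (at y)" for y
   unfolding \<gamma>_def by (auto intro!: derivative_eq_intros)
  fix y assume y: "y \<in> {a1..a2}"
  show "((\<lambda>s. \<G> (vl s)) has_field_derivative c0 * exp (- k * Ft (\<gamma> y))) (at (s0 + k * \<gamma> y))"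
   using \<G>_vl[OF s[OF y]] exponent[OF Q[OF y]] ht_Ft[OF Q[OF y]] by (simp add: \<gamma>_def)
 next
  show "continuous_on {a1..a2} h" unfolding h_def by (intro continuous_intros cF)
 qed (simp add: h_def)
 moreover have e: "indicator {a1..a2} y *\<^sub>R h y = c0 * k * (indicator {a1..a2} y *\<^sub>R (exp (- k * ((\<gamma> y)\<^sup>2 * ht (\<gamma> y) \<nu>)) * q))" for y
 proof (cases "y \<in> {a1..a2}")
  case True
  show ?thesis unfolding h_def \<gamma>_def ht_Ft[OF Q[OF True]] by simp
 qed simp
 ultimately show ?thesis unfolding e by (simp only: integral_mult_right_zero)
qed

text \<open>
\<open>S\<close> solves a Riccati equation in \<open>v\<close>, and \<open>Pf\<close> is its solution after the affine substitution; here this is verified on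
the explicit exponentials. Note that \<open>v\<close> moves along a ray, while \<open>ln (1 + z / s)\<close> would jump.
\<close>
lemma right_S:
 assumes s: "y > 0" defines "t \<equiv> \<omega> * of_real y"
 defines "P \<equiv> Pf (of_real (m\<^sup>2)) t" and "v \<equiv> of_real v0 + of_real m * t"
 shows "Re v > 0" "S v = s0 - k * P" "g v * of_real m = - (c0 * k * (exp (- k * (t - P)) * dP (of_real (m\<^sup>2)) t))"
proof -
 have "v0 > 0" unfolding v0_def using m by (simp add: ln_gt_zero_iff)
 thus Rv: "Re v > 0" using s m by (simp add: v_def t_def \<omega> add_pos_pos)
 have t0: "t \<noteq> 0" using s by (simp add: t_def \<omega>)
 define e where "e = exp (2 * (of_real m * t))"
 have ev: "exp (2 * v) = (1 + of_real m) / (1 - of_real m) * e"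
  by (simp only: v_def e_def distrib_left exp_add v0_eq)
 define D where "D = (1 + of_real m) * e - (1 - complex_of_real m)"
 have E1: "exp (2 * v) - 1 = D / (1 - of_real m)" unfolding ev D_def using nz by (simp add: field_simps)
 have D: "D \<noteq> 0" using e2v_neq_1[OF Rv] E1 by auto
 have P: "P = (e - 1) / D"
 proof -
  define u where "u = complex_of_real m * t"
  have u0: "u \<noteq> 0" using t0 nz by (simp add: u_def)
  have u2: "of_real (m\<^sup>2) * t\<^sup>2 = u\<^sup>2" by (simp add: u_def power_mult_distrib)
  have eu: "e = exp u * exp u" unfolding e_def u_def by (simp only: mult_2 exp_add)
  have shu: "shs (u\<^sup>2) = sinh u / u" using shs[of u] u0 by (simp add: field_simps)
  have tu: "t * (sinh u / u) = sinh u / of_real m" using t0 nz by (simp add: u_def)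
  have "P = (sinh u / of_real m) / (cosh u + sinh u / of_real m)" unfolding P_def Pf_def u2 shu chs tu ..
  also have "\<dots> = sinh u / (of_real m * cosh u + sinh u)" using nz by (simp add: field_simps)
  also have "\<dots> = (2 * exp u * sinh u) / (2 * exp u * (of_real m * cosh u + sinh u))" by simp
  also have "2 * exp u * sinh u = e - 1" unfolding eu sinh_def by (simp add: scaleR_conv_of_real algebra_simps exp_minus)
  also have "2 * exp u * (of_real m * cosh u + sinh u) = D"
   unfolding D_def eu sinh_def cosh_def by (simp add: scaleR_conv_of_real algebra_simps exp_minus)
  finally show ?thesis .
 qed
 have S1: "S v = z * (1 - of_real m) / D" unfolding S_def E1 using D nz by simp
 have "(1 - of_real m - \<nu> * P) = 2 * of_real m * (1 - of_real m) / D"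
  unfolding P using D by (simp add: field_simps) (simp add: D_def \<nu> algebra_simps)
 hence "k * (1 - of_real m - \<nu> * P) / \<nu> = k * (2 * of_real m * (1 - of_real m) / D) / \<nu>" by simp
 also have "\<dots> = S v" unfolding S1 z_def by (simp add: mult_ac)
 finally have "S v = k * (1 - of_real m - \<nu> * P) / \<nu>" ..
 also have "\<dots> = s0 - k * P" unfolding s0_alt using nz by (simp add: field_simps)
 finally show S2: "S v = s0 - k * P" .
 have S0: "S v \<noteq> 0" unfolding S1 using nz D by simp
 have ew: "exp (2 * v) = 1 + z / S v" unfolding S_def using nz by simp
 have "- 2 * z * exp (2 * v) / (exp (2 * v) - 1)\<^sup>2 = - (2 * (S v * (S v + z)) / z)"
  unfolding ew using S0 nz by (simp add: power2_eq_square divide_simps)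
 also have "S v * (S v + z) = k\<^sup>2 / \<nu> * dP (of_real (m\<^sup>2)) t"
 proof -
  have dp: "dP (of_real (m\<^sup>2)) t = 1 + 2 * (- P) + \<nu> * (- P)\<^sup>2" unfolding dP_def P_def[symmetric] \<nu>_def[symmetric] by simp
  have S3: "S v = s0 + k * (- P)" unfolding S2 by simp
  show ?thesis unfolding dp S3 by (rule sQ)
 qed
 finally have A: "- 2 * z * exp (2 * v) / (exp (2 * v) - 1)\<^sup>2 * of_real m = - (k * dP (of_real (m\<^sup>2)) t)"
  unfolding z_def using nz by (simp add: power2_eq_square)
 have B: "exp (- S v) * exp (2 * \<kappa> * v) = c0 * exp (- k * (t - P))"
 proof -
  have 1: "2 * \<kappa> * (of_real m * t) = - k * t" unfolding \<kappa>_def using nz by simp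
  have 2: "2 * \<kappa> * v = 2 * \<kappa> * of_real v0 + 2 * \<kappa> * (of_real m * t)" unfolding v_def by (rule distrib_left)
  have "- S v + 2 * \<kappa> * v = (2 * \<kappa> * of_real v0 - s0) + (- k * (t - P))" unfolding S2 2 1 by (simp add: algebra_simps)
  thus ?thesis unfolding c0_def by (simp only: exp_add[symmetric])
 qed
 have "g v * of_real m = (exp (- S v) * exp (2 * \<kappa> * v)) * (- 2 * z * exp (2 * v) / (exp (2 * v) - 1)\<^sup>2 * of_real m)"
  unfolding g_def by (rule mult.assoc)
 thus "g v * of_real m = - (c0 * k * (exp (- k * (t - P)) * dP (of_real (m\<^sup>2)) t))"
  unfolding A B by (simp only: mult_minus_right mult_ac)
qed

lemma right_integral:
 assumes ab: "0 < a1" "a1 \<le> a2"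
 shows "c0 * k * (\<integral>y. indicator {a1..a2} y *\<^sub>R (exp (- k * (\<omega> * of_real y - Pf (of_real (m\<^sup>2)) (\<omega> * of_real y))) * dP (of_real (m\<^sup>2)) (\<omega> * of_real y) * \<omega>) \<partial>lborel)
   = \<G> (of_real v0 + of_real m * (\<omega> * of_real a1)) - \<G> (of_real v0 + of_real m * (\<omega> * of_real a2))"
proof -
 define v where "v y = of_real v0 + of_real m * (\<omega> * complex_of_real y)" for y
 define h where "h y = g (v y) * (of_real m * \<omega>)" for y
 note R = right_S[folded v_def]
 have "(\<integral>y. indicator {a1..a2} y *\<^sub>R h y \<partial>lborel) = \<G> (v a2) - \<G> (v a1)"
 proof (rule FTC_path[OF ab(2), where \<gamma> = v and F = \<G> and f = "\<lambda>y. g (v y)" and \<gamma>' = "\<lambda>_. of_real m * \<omega>"])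
  show "(v has_vector_derivative of_real m * \<omega>) (at y)" for y unfolding v_def[abs_def] by (auto intro!: derivative_eq_intros)
  fix y assume y: "y \<in> {a1..a2}"
  show "(\<G> has_field_derivative g (v y)) (at (v y))" by (rule \<G>) (use R(1)[of y] y ab in auto)
 next
  have "exp (2 * v y) - 1 \<noteq> 0" if "y \<in> {a1..a2}" for y using e2v_neq_1[OF R(1)[of y]] that ab by auto
  moreover have "continuous_on {a1..a2} v" unfolding v_def by (intro continuous_intros)
  ultimately show "continuous_on {a1..a2} h" unfolding h_def g_def S_def by (intro continuous_intros) auto
 qed (simp add: h_def mult.commute)
 moreover have e: "indicator {a1..a2} y *\<^sub>R h y = - (c0 * k * (indicator {a1..a2} y *\<^sub>R (exp (- k * (\<omega> * of_real y - Pf (of_real (m\<^sup>2)) (\<omega> * of_real y))) * dP (of_real (m\<^sup>2)) (\<omega> * of_real y) * \<omega>)))" for y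
 proof (cases "y \<in> {a1..a2}")
  case True
  hence "h y = - (c0 * k * (exp (- k * (\<omega> * of_real y - Pf (of_real (m\<^sup>2)) (\<omega> * of_real y))) * dP (of_real (m\<^sup>2)) (\<omega> * of_real y))) * \<omega>"
   unfolding h_def mult.assoc[symmetric] using R(3)[of y] ab by simp
  thus ?thesis using True by simp
 qed simp
 ultimately have "- (c0 * k * (\<integral>y. indicator {a1..a2} y *\<^sub>R (exp (- k * (\<omega> * of_real y - Pf (of_real (m\<^sup>2)) (\<omega> * of_real y))) * dP (of_real (m\<^sup>2)) (\<omega> * of_real y) * \<omega>) \<partial>lborel)) = \<G> (v a2) - \<G> (v a1)"
  unfolding e by (simp only: Bochner_Integration.integral_minus integral_mult_right_zero)
 moreover have "X = B - A" if "- X = A - B" for X A B :: complex using that by (metis minus_diff_eq minus_minus)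
 ultimately show ?thesis unfolding v_def by blast
qed

lemma vl_unique:
 assumes "\<bar>Im v\<bar> < pi / 2" "exp (2 * v) = 1 + z / s" shows "vl s = v"
proof -
 have "Ln (exp (2 * v)) = 2 * v" using assms(1) by (intro Ln_exp) auto
 thus ?thesis unfolding vl_def assms(2)[symmetric] by simp
qed

text \<open>
The end of the segment is the beginning of the curve; for small \<open>\<epsilon>\<close> both lie on the principal sheet.
\<close>
lemma junction:
 assumes e: "0 < \<epsilon>" "\<epsilon> \<le> 1"
 shows "vl (s0 + k * (- Pf (of_real (m\<^sup>2)) (\<omega> * of_real \<epsilon>))) = of_real v0 + of_real m * (\<omega> * of_real \<epsilon>)"
proof -
 define v where "v = of_real v0 + of_real m * (\<omega> * complex_of_real \<epsilon>)"
 note R = right_S[OF e(1), folded v_def]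
 have "m * \<epsilon> \<le> 1 * 1" using m e by (intro mult_mono) auto
 moreover have "sqrt 2 / 2 \<le> (1::real)" using real_le_lsqrt[of 2 2] by simp
 ultimately have "m * \<epsilon> * (sqrt 2 / 2) \<le> 1 * 1" using m e by (intro mult_mono) auto
 moreover have "\<bar>Im v\<bar> = m * \<epsilon> * (sqrt 2 / 2)" using m e by (simp add: v_def \<omega>)
 ultimately have "\<bar>Im v\<bar> < pi / 2" using pi_gt3 by linarith
 moreover have "exp (2 * v) = 1 + z / S v" unfolding S_def using nz by simp
 ultimately show ?thesis using vl_unique R(2) by (simp add: v_def)
qed

end

context contour begin

section \<open>The ends of the contour\<close>

text \<open>
For large \<open>Re v\<close> the integrand is \<open>O(exp (- 2 Re v))\<close>, uniformly where \<open>Im v\<close> is bounded above, as \<open>\<kappa>\<close> is in \<open>- \<i> (0, \<infinity>)\<close>.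
\<close>
lemma end_zero:
 assumes L: "L \<ge> 1" and v: "Re v1 = L" "Re v2 = L" "Im v1 \<le> pi / 2" "Im v2 \<le> pi / 2"
 shows "norm (\<G> v1 - \<G> v2) \<le> exp (norm z) * exp (b / m * (pi / 2)) * (8 * norm z * exp (- 2 * L)) * norm (v1 - v2)"
proof (rule field_differentiable_bound[where S = "{v. Re v \<ge> L} \<inter> {v. Im v \<le> pi / 2}" and f' = g])
 show "convex ({v. Re v \<ge> L} \<inter> {v. Im v \<le> pi / 2})"
  by (intro convex_Int convex_halfspace_Re_ge convex_halfspace_Im_le)
 fix v assume v: "v \<in> {v. Re v \<ge> L} \<inter> {v. Im v \<le> pi / 2}"
 hence R: "Re v \<ge> L" "Im v \<le> pi / 2" "Re v > 0" using L by auto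
 show "(\<G> has_field_derivative g v) (at v within {v. Re v \<ge> L} \<inter> {v. Im v \<le> pi / 2})"
  by (rule has_field_derivative_at_within[OF \<G>[OF R(3)]])
 define E where "E = exp (2 * v)"
 have nE: "norm E = exp (2 * Re v)" by (simp add: E_def norm_exp_eq_Re)
 have E3: "norm E \<ge> 2" using exp_ge_add_one_self[of "2 * Re v"] R L unfolding nE by linarith
 have E1: "norm (E - 1) \<ge> norm E / 2" "norm (E - 1) \<ge> 1" using E3 norm_triangle_ineq2[of E 1] by auto
 have "norm (S v) \<le> norm z / 1" unfolding S_def norm_divide E_def[symmetric] using E1(2) by (intro divide_left_mono) auto
 hence 1: "norm (exp (- S v)) \<le> exp (norm z)" using abs_Re_le_cmod[of "S v"] by (simp add: norm_exp_eq_Re)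
 have "Re (2 * \<kappa> * v) = b / m * Im v" by (simp add: Re_\<kappa>)
 also have "\<dots> \<le> b / m * (pi / 2)" using R m b by (intro mult_left_mono) auto
 finally have 2: "norm (exp (2 * \<kappa> * v)) \<le> exp (b / m * (pi / 2))" by (simp add: norm_exp_eq_Re)
 have "norm (- 2 * z * E / (E - 1)\<^sup>2) = 2 * norm z * norm E / (norm (E - 1))\<^sup>2" by (simp add: norm_mult norm_divide norm_power)
 also have "\<dots> \<le> 2 * norm z * norm E / (norm E / 2)\<^sup>2"
  using E1 E3 by (intro divide_left_mono power_mono mult_pos_pos zero_less_power mult_nonneg_nonneg) auto
 also have "\<dots> = 8 * norm z * inverse (norm E)" using E3 by (simp add: power2_eq_square field_simps)
 also have "inverse (norm E) = exp (- 2 * Re v)" unfolding nE by (simp add: exp_minus)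
 also have "8 * norm z * exp (- 2 * Re v) \<le> 8 * norm z * exp (- 2 * L)" using R by (intro mult_left_mono) auto
 finally have 3: "norm (- 2 * z * E / (E - 1)\<^sup>2) \<le> 8 * norm z * exp (- 2 * L)" .
 show "norm (g v) \<le> exp (norm z) * exp (b / m * (pi / 2)) * (8 * norm z * exp (- 2 * L))"
  unfolding g_def norm_mult[of "_ * _" "_ / _"] norm_mult[of "exp _" "exp _"] E_def[symmetric]
  by (intro mult_mono 1 2 3) auto
qed (use v in auto)

lemma end_infinity:
 assumes "\<beta> > 0" and s: "Re s1 = \<beta>" "Re s2 = \<beta>" "Im s1 \<ge> 0" "Im s2 \<ge> 0"
 shows "norm (\<G> (vl s1) - \<G> (vl s2)) \<le> exp (- \<beta>) * exp (pi * norm \<kappa>) * norm (s1 - s2)"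
proof (rule field_differentiable_bound[where S = "{s. Re s \<ge> \<beta>} \<inter> {s. Im s \<ge> 0}" and f = "\<lambda>s. \<G> (vl s)" and f' = "\<lambda>s. exp (- s) * exp (\<kappa> * Ln (1 + z / s))"])
 show "convex ({s. Re s \<ge> \<beta>} \<inter> {s. Im s \<ge> 0})"
  by (intro convex_Int convex_halfspace_Re_ge convex_halfspace_Im_ge)
 fix s assume "s \<in> {s. Re s \<ge> \<beta>} \<inter> {s. Im s \<ge> 0}"
 hence s: "Re s \<ge> \<beta>" "Im s \<ge> 0" "Re s > 0 \<or> Im s > 0" using assms(1) by auto
 show "((\<lambda>s. \<G> (vl s)) has_field_derivative exp (- s) * exp (\<kappa> * Ln (1 + z / s))) (at s within {s. Re s \<ge> \<beta>} \<inter> {s. Im s \<ge> 0})"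
  by (rule has_field_derivative_at_within[OF \<G>_vl[OF s(2,3)]])
 have "1 + z / s \<noteq> 0" using dom(3)[OF s(2,3)] by (metis ComplD nonpos_Reals_zero_I)
 thus "norm (exp (- s) * exp (\<kappa> * Ln (1 + z / s))) \<le> exp (- \<beta>) * exp (pi * norm \<kappa>)"
  unfolding norm_mult using s by (intro mult_mono norm_exp_Ln Re_\<kappa>) (auto simp: norm_exp_eq_Re)
qed (use s in auto)

lemma real_integral:
 assumes "0 < a1" "a1 \<le> a2"
 shows "(\<integral>s. indicator {a1..a2} s *\<^sub>R lap \<kappa> 0 s z \<partial>lborel) = \<G> (vl (of_real a2)) - \<G> (vl (of_real a1))"
proof -
 define h where "h s = exp (- complex_of_real s) * exp (\<kappa> * Ln (1 + z / of_real s))" for s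
 have d: "Im (complex_of_real s) \<ge> 0" "Re (complex_of_real s) > 0 \<or> Im (complex_of_real s) > 0" if "s \<in> {a1..a2}" for s using that assms by auto
 have "(\<integral>s. indicator {a1..a2} s *\<^sub>R h s \<partial>lborel) = \<G> (vl (of_real a2)) - \<G> (vl (of_real a1))"
 proof (rule FTC_path[OF assms(2), where \<gamma> = of_real and F = "\<lambda>s. \<G> (vl s)" and f = h and \<gamma>' = "\<lambda>_. 1"])
  show "(complex_of_real has_vector_derivative 1) (at y)" for y by (auto intro!: derivative_eq_intros)
  show "((\<lambda>s. \<G> (vl s)) has_field_derivative h y) (at (of_real y))" if "y \<in> {a1..a2}" for y
   unfolding h_def by (rule \<G>_vl[OF d[OF that]])
  have "1 + z / of_real s \<notin> \<real>\<^sub>\<le>\<^sub>0" "s \<noteq> 0" if "s \<in> {a1..a2}" for s using dom(3)[OF d[OF that]] that assms by auto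
  thus "continuous_on {a1..a2} h" unfolding h_def by (intro continuous_intros) auto
 qed simp
 moreover have "indicator {a1..a2} s *\<^sub>R h s = indicator {a1..a2} s *\<^sub>R lap \<kappa> 0 s z" for s
  using assms by (auto simp: h_def lap_def indicator_def)
 ultimately show ?thesis by simp
qed

text \<open>
All five pieces are differences of values of \<open>\<G>\<close>. The sum telescopes up to two differences: at \<open>s = 0\<close> between the curve
and the real axis, joined by a vertical segment in \<open>v\<close>, and at infinity between the line and the real axis, joined by a
vertical segment in \<open>s\<close>. The cut-offs are chosen such that these segments are vertical; both differences tend to zero.
\<close>
lemma contour_shift:
 assumes e: "0 < \<epsilon>" "\<epsilon> \<le> 1/4"
  and con: "\<And>y. y \<in> {0..1} ==> Re (Qc \<epsilon> y (of_real (m\<^sup>2))) > - 1/2"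
 defines "P \<equiv> Pf (of_real (m\<^sup>2))"
 defines "el \<equiv> \<lambda>Q. exp (- k * (Q\<^sup>2 * ht Q \<nu>))"
  and "er \<equiv> \<lambda>t. exp (- k * (t - P t)) * dP (of_real (m\<^sup>2)) t"
 assumes il: "integrable lborel (\<lambda>y. indicator {\<epsilon><..} y *\<^sub>R (el (\<omega> * of_real y) * \<omega>))"
  and ir: "integrable lborel (\<lambda>y. indicator {\<epsilon><..} y *\<^sub>R (er (\<omega> * of_real y) * \<omega>))"
 shows "c0 * k * ((\<integral>y. indicator {-\<epsilon>..\<epsilon>} y *\<^sub>R (el (\<omega> * of_real y) * \<omega>) \<partial>lborel)
   + (\<integral>y. indicator {\<epsilon><..} y *\<^sub>R (el (\<omega> * of_real y) * \<omega>) \<partial>lborel)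
   + (\<integral>y. indicator {\<epsilon><..} y *\<^sub>R (er (\<omega> * of_real y) * \<omega>) \<partial>lborel)
   + (\<integral>y. indicator {0..1} y *\<^sub>R (el (Qc \<epsilon> y (of_real (m\<^sup>2))) * (P (\<omega> * of_real \<epsilon>) - \<omega> * of_real \<epsilon>)) \<partial>lborel)) = Lap \<kappa> 0 z"
proof -
 define Vq where "Vq y = \<G> (vl (s0 + k * (\<omega> * of_real y)))" for y :: real
 define Vr where "Vr y = \<G> (of_real v0 + of_real m * (\<omega> * of_real y))" for y :: real
 define Va where "Va y = \<G> (vl (of_real y))" for y :: real
 define VP where "VP = \<G> (vl (s0 + k * (- P (\<omega> * of_real \<epsilon>))))"
 define c where "c = sqrt 2 / 2"
 have c: "c > 0" by (simp add: c_def)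
 have c1: "c \<le> 1" using real_le_lsqrt[of 2 2] by (simp add: c_def)
 have rayQ: "Re (0 + of_real y * \<omega>) > - 1/2" if "y \<ge> - \<epsilon>" for y
 proof -
  have "- (1/4) * 1 \<le> y * c"
  proof (cases "y \<ge> 0")
   case True
   hence "0 \<le> y * c" using c by simp
   thus ?thesis by simp
  next
   case False
   have "- (1/4) * 1 \<le> y * 1" using that e by simp
   also have "y * 1 \<le> y * c" using False c1 by (intro mult_left_mono_neg) auto
   finally show ?thesis .
  qed
  thus ?thesis by (simp add: \<omega> c_def)
 qed
 have Qint: "c0 * k * (\<integral>y. indicator {a1..a2} y *\<^sub>R (el (\<omega> * of_real y) * \<omega>) \<partial>lborel) = Vq a2 - Vq a1" if "- \<epsilon> \<le> a1" "a1 \<le> a2" for a1 a2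
 proof -
  have ray: "0 + of_real y * \<omega> = \<omega> * of_real y" for y by (simp only: add_0_left mult.commute)
  have "Re (0 + of_real y * \<omega>) > - 1/2" if "y \<in> {a1..a2}" for y
   by (rule rayQ) (use that \<open>- \<epsilon> \<le> a1\<close> in auto)
  from Q_integral[OF that(2) this] show ?thesis unfolding el_def Vq_def ray .
 qed
 have cen: "c0 * k * (\<integral>y. indicator {-\<epsilon>..\<epsilon>} y *\<^sub>R (el (\<omega> * of_real y) * \<omega>) \<partial>lborel) = Vq \<epsilon> - Vq (- \<epsilon>)"
  using Qint[of "- \<epsilon>" \<epsilon>] e by simp
 have conn: "c0 * k * (\<integral>y. indicator {0..1} y *\<^sub>R (el (Qc \<epsilon> y (of_real (m\<^sup>2))) * (P (\<omega> * of_real \<epsilon>) - \<omega> * of_real \<epsilon>)) \<partial>lborel) = Vq (- \<epsilon>) - VP"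
 proof -
  have Qc: "Qc \<epsilon> y (of_real (m\<^sup>2)) = - P (\<omega> * of_real \<epsilon>) + of_real y * (P (\<omega> * of_real \<epsilon>) - \<omega> * of_real \<epsilon>)" for y
   by (simp only: Qc_def P_def)
  have 1: "- P (\<omega> * of_real \<epsilon>) + of_real 1 * (P (\<omega> * of_real \<epsilon>) - \<omega> * of_real \<epsilon>) = \<omega> * of_real (- \<epsilon>)"
   "- P (\<omega> * of_real \<epsilon>) + of_real 0 * (P (\<omega> * of_real \<epsilon>) - \<omega> * of_real \<epsilon>) = - P (\<omega> * of_real \<epsilon>)" by simp_all
  show ?thesis using Q_integral[OF zero_le_one con[unfolded Qc]] unfolding el_def Qc Vq_def VP_def 1 .
 qed
 have junc: "VP = Vr \<epsilon>" unfolding VP_def Vr_def P_def by (subst junction) (use e in auto)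
 \<comment> \<open>\<open>[a, \<beta>]\<close> is the part of the real axis; \<open>Y\<close> is chosen to make the real parts of \<open>v\<close> at the two ends near \<open>s = 0\<close> equal\<close>
 define a where "a n = 1 / (real n + 1)" for n
 define \<beta> where "\<beta> n = b * c * real n" for n
 define L where "L n = Re (vl (of_real (a n)))" for n
 define Y where "Y n = (L n - v0) / (m * c)" for n
 have a0: "a n > 0" for n by (simp add: a_def)
 have La: "ln (Im z * (real n + 1)) / 2 \<le> L n" for n
 proof -
  have "Im z * (real n + 1) = Im (1 + z / of_real (a n))" by (simp add: a_def)
  also have "\<dots> \<le> norm (1 + z / of_real (a n))" using abs_Im_le_cmod[of "1 + z / of_real (a n)"] by linarith
  finally have 1: "Im z * (real n + 1) \<le> norm (1 + z / of_real (a n))" .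
  have 2: "Im z * (real n + 1) > 0" using z_im by simp
  hence "1 + z / of_real (a n) \<noteq> 0" using 1 by auto
  hence "L n = ln (norm (1 + z / of_real (a n))) / 2" by (simp add: L_def vl_def)
  thus ?thesis using 1 2 by (simp add: ln_mono)
 qed
 have Linf: "filterlim L at_top sequentially"
 proof (rule filterlim_at_top_mono[OF _ always_eventually])
  have "Im z > 0" by (rule z_im)
  thus "filterlim (\<lambda>n. ln (Im z * (real n + 1)) / 2) at_top sequentially" by real_asymp
 qed (use La in auto)
 have Yinf: "filterlim Y at_top sequentially"
 proof -
  have "filterlim (\<lambda>x. (x - v0) / (m * c)) at_top at_top" using m c by real_asymp
  from filterlim_compose[OF this Linf] show ?thesis by (simp add: Y_def[abs_def])
 qed
 have binf: "filterlim \<beta> at_top sequentially" unfolding \<beta>_def using b c by real_asymp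
 have lim_a: "(\<lambda>n. \<integral>s. indicator {a n..\<beta> n} s *\<^sub>R lap \<kappa> 0 s z \<partial>lborel) \<longlonglongrightarrow> Lap \<kappa> 0 z"
  unfolding Lap_def
 proof (rule integral_exhaust)
  show "integrable lborel (\<lambda>s. lap \<kappa> 0 s z)" using z_im by (intro lap_integrable Re_\<kappa>) (auto simp: complex_nonpos_Reals_iff)
  fix y assume "lap \<kappa> 0 y z \<noteq> 0"
  hence y: "y > 0" by (auto simp: lap_def indicator_def split: if_splits)
  have "a \<longlonglongrightarrow> 0" unfolding a_def by real_asymp
  hence "eventually (\<lambda>n. a n < y) sequentially" using y by (rule order_tendstoD)
  moreover have "eventually (\<lambda>n. y \<le> \<beta> n) sequentially" using binf by (simp add: filterlim_at_top)
  ultimately show "eventually (\<lambda>n. y \<in> {a n..\<beta> n}) sequentially" by eventually_elim simp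
 qed simp
 have tail: "(\<lambda>n. \<integral>y. indicator {\<epsilon>..T n} y *\<^sub>R f y \<partial>lborel) \<longlonglongrightarrow> (\<integral>y. indicator {\<epsilon><..} y *\<^sub>R f y \<partial>lborel)"
  if f: "integrable lborel (\<lambda>y. indicator {\<epsilon><..} y *\<^sub>R f y)" and T: "filterlim T at_top sequentially" for f :: "real => complex" and T
 proof -
  have "(\<lambda>n. \<integral>y. indicator {\<epsilon>..T n} y *\<^sub>R (indicator {\<epsilon><..} y *\<^sub>R f y) \<partial>lborel) \<longlonglongrightarrow> (\<integral>y. indicator {\<epsilon><..} y *\<^sub>R f y \<partial>lborel)"
  proof (rule integral_exhaust[OF f])
   fix y assume "indicator {\<epsilon><..} y *\<^sub>R f y \<noteq> 0"
   hence "y > \<epsilon>" by (auto simp: indicator_def split: if_splits)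
   moreover have "eventually (\<lambda>n. y \<le> T n) sequentially" using T by (simp add: filterlim_at_top)
   ultimately show "eventually (\<lambda>n. y \<in> {\<epsilon>..T n}) sequentially" by (auto elim!: eventually_mono)
  qed simp
  moreover have "(\<integral>y. indicator {\<epsilon>..T n} y *\<^sub>R (indicator {\<epsilon><..} y *\<^sub>R f y) \<partial>lborel) = (\<integral>y. indicator {\<epsilon>..T n} y *\<^sub>R f y \<partial>lborel)" for n
  proof (rule integral_discrete_difference[of "{\<epsilon>}"])
   show "indicator {\<epsilon>..T n} y *\<^sub>R (indicator {\<epsilon><..} y *\<^sub>R f y) = indicator {\<epsilon>..T n} y *\<^sub>R f y" if "y \<notin> {\<epsilon>}" for y
    using that by (auto simp: indicator_def)
  qed auto
  ultimately show ?thesis by simp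
 qed
 have lim_l: "(\<lambda>n. c0 * k * (\<integral>y. indicator {\<epsilon>..real n} y *\<^sub>R (el (\<omega> * of_real y) * \<omega>) \<partial>lborel))
   \<longlonglongrightarrow> c0 * k * (\<integral>y. indicator {\<epsilon><..} y *\<^sub>R (el (\<omega> * of_real y) * \<omega>) \<partial>lborel)"
  by (intro tendsto_mult tendsto_const tail il filterlim_real_sequentially)
 have lim_r: "(\<lambda>n. c0 * k * (\<integral>y. indicator {\<epsilon>..Y n} y *\<^sub>R (er (\<omega> * of_real y) * \<omega>) \<partial>lborel))
   \<longlonglongrightarrow> c0 * k * (\<integral>y. indicator {\<epsilon><..} y *\<^sub>R (er (\<omega> * of_real y) * \<omega>) \<partial>lborel)"
  by (intro tendsto_mult tendsto_const tail ir Yinf)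
 define D where "D n = (Vq (real n) - Va (\<beta> n)) - (Vr (Y n) - Va (a n))" for n
 have D0: "D \<longlonglongrightarrow> 0 - 0" unfolding D_def
 proof (rule tendsto_diff)
  show "(\<lambda>n. Vq (real n) - Va (\<beta> n)) \<longlonglongrightarrow> 0"
  proof (rule Lim_null_comparison)
   define C where "C = b / (1 + m)"
   have C: "C > 0" using m b by (simp add: C_def)
   have "norm (Vq (real n) - Va (\<beta> n)) \<le> exp (pi * norm \<kappa>) * (exp (- \<beta> n) * (C + \<beta> n))" if n: "n > 0" for n
   proof -
    have "s0 = \<i> * of_real C" by (simp add: s0_def k_def C_def)
    hence s: "Re (s0 + k * (\<omega> * of_real (real n))) = \<beta> n" "Im (s0 + k * (\<omega> * of_real (real n))) = C + \<beta> n"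
     by (simp_all add: k_def \<omega> \<beta>_def c_def)
    have bn: "\<beta> n > 0" using n b c by (simp add: \<beta>_def)
    have "norm (Vq (real n) - Va (\<beta> n)) \<le> exp (- \<beta> n) * exp (pi * norm \<kappa>) * norm (s0 + k * (\<omega> * of_real (real n)) - of_real (\<beta> n))"
     unfolding Vq_def Va_def by (rule end_infinity[OF bn]) (use s C bn in auto)
    also have "s0 + k * (\<omega> * of_real (real n)) - of_real (\<beta> n) = \<i> * of_real (C + \<beta> n)"
     by (rule complex_eqI) (use s in auto)
    also have "norm (\<i> * complex_of_real (C + \<beta> n)) = C + \<beta> n" unfolding norm_mult norm_of_real using C bn by simp
    finally show ?thesis by (simp add: mult_ac)
   qed
   thus "eventually (\<lambda>n. norm (Vq (real n) - Va (\<beta> n)) \<le> exp (pi * norm \<kappa>) * (exp (- \<beta> n) * (C + \<beta> n))) sequentially"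
    by (intro eventually_mono[OF eventually_gt_at_top[of 0]])
   have "((\<lambda>x. exp (- x) * (C + x)) \<longlongrightarrow> 0) at_top" by real_asymp
   from tendsto_mult_right_zero[OF filterlim_compose[OF this binf]]
   show "(\<lambda>n. exp (pi * norm \<kappa>) * (exp (- \<beta> n) * (C + \<beta> n))) \<longlonglongrightarrow> 0" .
  qed
 next
  define K where "K = exp (norm z) * exp (b / m * (pi / 2)) * (8 * norm z)"
  have K: "K \<ge> 0" by (simp add: K_def)
  show "(\<lambda>n. Vr (Y n) - Va (a n)) \<longlonglongrightarrow> 0"
  proof (rule Lim_null_comparison)
   have "norm (Vr (Y n) - Va (a n)) \<le> K * (exp (- 2 * L n) * (L n + pi / 2 - v0))" if n: "L n \<ge> max 1 v0" for n
   proof -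
    define v where "v = of_real v0 + of_real m * (\<omega> * complex_of_real (Y n))"
    define w where "w = vl (of_real (a n))"
    have mcY: "m * c * Y n = L n - v0" unfolding Y_def using m c by simp
    have v: "Re v = L n" "Im v = v0 - L n" using mcY by (simp_all add: v_def \<omega> c_def)
    have "1 + z / of_real (a n) \<in> cut" using dom(3)[of "of_real (a n)"] a0 by simp
    hence "1 + z / of_real (a n) \<noteq> 0" by (metis ComplD nonpos_Reals_zero_I)
    hence w: "Re w = L n" "Im w \<le> pi / 2" "- (pi / 2) \<le> Im w"
     using mpi_less_Im_Ln[of "1 + z / of_real (a n)"] Im_Ln_le_pi[of "1 + z / of_real (a n)"] by (auto simp: w_def L_def vl_def)
    have "norm (\<G> v - \<G> w) \<le> exp (norm z) * exp (b / m * (pi / 2)) * (8 * norm z * exp (- 2 * L n)) * norm (v - w)"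
     by (rule end_zero) (use v w n in auto)
    also have "\<dots> = K * (exp (- 2 * L n) * norm (v - w))" by (simp add: K_def)
    also have "norm (v - w) \<le> \<bar>Re (v - w)\<bar> + \<bar>Im (v - w)\<bar>" by (rule cmod_le)
    also have "\<bar>Re (v - w)\<bar> + \<bar>Im (v - w)\<bar> \<le> L n + pi / 2 - v0" using v w n by auto
    finally show ?thesis using K by (simp add: Vr_def Va_def v_def w_def mult_left_mono)
   qed
   moreover have "eventually (\<lambda>n. L n \<ge> max 1 v0) sequentially" using Linf unfolding filterlim_at_top by blast
   ultimately show "eventually (\<lambda>n. norm (Vr (Y n) - Va (a n)) \<le> K * (exp (- 2 * L n) * (L n + pi / 2 - v0))) sequentially"
    by (auto elim!: eventually_mono)
   have "((\<lambda>x. exp (- 2 * x) * (x + pi / 2 - v0)) \<longlongrightarrow> 0) at_top" by real_asymp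
   from tendsto_mult_right_zero[OF filterlim_compose[OF this Linf]]
   show "(\<lambda>n. K * (exp (- 2 * L n) * (L n + pi / 2 - v0))) \<longlonglongrightarrow> 0" .
  qed
 qed
 define tot where "tot n = (Vq \<epsilon> - Vq (- \<epsilon>)) + c0 * k * (\<integral>y. indicator {\<epsilon>..real n} y *\<^sub>R (el (\<omega> * of_real y) * \<omega>) \<partial>lborel)
   + c0 * k * (\<integral>y. indicator {\<epsilon>..Y n} y *\<^sub>R (er (\<omega> * of_real y) * \<omega>) \<partial>lborel) + (Vq (- \<epsilon>) - VP)" for n
 have "eventually (\<lambda>n. (\<integral>s. indicator {a n..\<beta> n} s *\<^sub>R lap \<kappa> 0 s z \<partial>lborel) + D n = tot n) sequentially"
 proof -
  have "eventually (\<lambda>n. real n \<ge> \<epsilon>) sequentially" using filterlim_real_sequentially unfolding filterlim_at_top by blast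
  moreover have "eventually (\<lambda>n. Y n \<ge> \<epsilon>) sequentially" using Yinf unfolding filterlim_at_top by blast
  moreover have "eventually (\<lambda>n. \<beta> n \<ge> 1) sequentially" using binf unfolding filterlim_at_top by blast
  ultimately show ?thesis
  proof eventually_elim
   case (elim n)
   have "a n \<le> 1" by (simp add: a_def)
   hence 1: "(\<integral>s. indicator {a n..\<beta> n} s *\<^sub>R lap \<kappa> 0 s z \<partial>lborel) = Va (\<beta> n) - Va (a n)"
    unfolding Va_def using elim by (intro real_integral a0) simp
   have 2: "c0 * k * (\<integral>y. indicator {\<epsilon>..real n} y *\<^sub>R (el (\<omega> * of_real y) * \<omega>) \<partial>lborel) = Vq (real n) - Vq \<epsilon>"
    by (rule Qint) (use elim e in auto)
   have 3: "c0 * k * (\<integral>y. indicator {\<epsilon>..Y n} y *\<^sub>R (er (\<omega> * of_real y) * \<omega>) \<partial>lborel) = Vr \<epsilon> - Vr (Y n)"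
    unfolding er_def P_def Vr_def by (rule right_integral[OF e(1) elim(2)])
   show ?case unfolding tot_def 1 2 3 D_def junc by simp
  qed
 qed
 moreover have "(\<lambda>n. (\<integral>s. indicator {a n..\<beta> n} s *\<^sub>R lap \<kappa> 0 s z \<partial>lborel) + D n) \<longlonglongrightarrow> Lap \<kappa> 0 z + (0 - 0)"
  by (intro tendsto_add lim_a D0)
 ultimately have "tot \<longlonglongrightarrow> Lap \<kappa> 0 z" using Lim_transform_eventually by fastforce
 moreover have "tot \<longlonglongrightarrow> (Vq \<epsilon> - Vq (- \<epsilon>)) + c0 * k * (\<integral>y. indicator {\<epsilon><..} y *\<^sub>R (el (\<omega> * of_real y) * \<omega>) \<partial>lborel)
   + c0 * k * (\<integral>y. indicator {\<epsilon><..} y *\<^sub>R (er (\<omega> * of_real y) * \<omega>) \<partial>lborel) + (Vq (- \<epsilon>) - VP)"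
  unfolding tot_def by (intro tendsto_add tendsto_const lim_l lim_r)
 ultimately have "Lap \<kappa> 0 z = (Vq \<epsilon> - Vq (- \<epsilon>)) + c0 * k * (\<integral>y. indicator {\<epsilon><..} y *\<^sub>R (el (\<omega> * of_real y) * \<omega>) \<partial>lborel)
   + c0 * k * (\<integral>y. indicator {\<epsilon><..} y *\<^sub>R (er (\<omega> * of_real y) * \<omega>) \<partial>lborel) + (Vq (- \<epsilon>) - VP)"
  by (rule LIMSEQ_unique)
 thus ?thesis unfolding distrib_left cen conn by simp
qed

end

section \<open>Whittaker's function and the amplitude\<close>

lemma (in contour) Lap_amplitude:
 assumes Z: "Z > 0" and e: "small \<epsilon>" and l: "l > 0" and bl: "b = Z / l"
 shows "c0 * k * amplitude Z \<epsilon> l (m\<^sup>2) = 2 * inverse (csqrt (of_real l)) * Lap \<kappa> 0 z"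
proof -
 have e': "0 < \<epsilon>" "\<epsilon> \<le> 1/64" "\<epsilon> \<le> 1" "\<epsilon> \<le> 1/4" using e by (auto simp: small_def)
 define c where "c = 2 * inverse (csqrt (of_real l))"
 have c0: "c \<noteq> 0" using l by (simp add: c_def)
 have mm: "m\<^sup>2 \<in> {0..1}" using m by (simp add: power_le_one)
 have kb: "k = \<i> * (of_real Z / of_real l)" unfolding k_def by (simp add: bl)
 have nm: "norm (complex_of_real (m\<^sup>2)) \<le> 2"
 proof -
  have "norm (complex_of_real (m\<^sup>2)) = m\<^sup>2" by (simp only: norm_of_real abs_power2)
  thus ?thesis using mm by simp
 qed
 have con: "Re (Qc \<epsilon> y (of_real (m\<^sup>2))) > - 1/2" if "y \<in> {0..1}" for y
  using Qc_bounds(1)[OF e nm that] abs_Re_le_cmod[of "Qc \<epsilon> y (of_real (m\<^sup>2))"] by linarith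
 define el where "el Q = exp (- k * (Q\<^sup>2 * ht Q \<nu>))" for Q
 define er where "er t = exp (- k * (t - Pf (of_real (m\<^sup>2)) t)) * dP (of_real (m\<^sup>2)) t" for t
 have el: "el (\<omega> * of_real y) = exp (- (of_real Z / of_real l) * (of_real (y\<^sup>2) * ht (\<omega> * of_real y) (1 - of_real (m\<^sup>2))))" for y
 proof -
  have "- k * ((\<omega> * of_real y)\<^sup>2 * h) = - (of_real Z / of_real l) * ((\<i> * (\<omega> * of_real y)\<^sup>2) * h)" for h
   unfolding kb by (simp add: mult_ac)
  thus ?thesis unfolding el_def i_\<omega>_sq(1) \<nu>_def by simp
 qed
 have cen: "cen Z \<epsilon> l (m\<^sup>2) y * \<omega> = indicator {-\<epsilon>..\<epsilon>} y *\<^sub>R (el (\<omega> * of_real y) * \<omega>)" for y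
  unfolding cen_def el by simp
 have lef: "lef Z \<epsilon> l (m\<^sup>2) y = c * (indicator {\<epsilon><..} y *\<^sub>R (el (\<omega> * of_real y) * \<omega>))" for y
  unfolding lef_def el c_def by simp
 have rig: "rig Z \<epsilon> l (m\<^sup>2) y = c * (indicator {\<epsilon><..} y *\<^sub>R (er (\<omega> * of_real y) * \<omega>))" for y
  unfolding rig_def er_def c_def kb by (simp add: mult_ac)
 have conq: "con Z \<epsilon> l (m\<^sup>2) y = c * (indicator {0..1} y *\<^sub>R (el (Qc \<epsilon> y (of_real (m\<^sup>2))) * (Pf (of_real (m\<^sup>2)) (\<omega> * of_real \<epsilon>) - \<omega> * of_real \<epsilon>)))" for y
  unfolding con_def el_def c_def kb \<nu>_def by (simp add: mult_ac)
 have unscale: "integrable lborel f" if "integrable lborel (\<lambda>y. c * f y)" for f :: "real => complex"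
  using integrable_mult_right[OF that, of "inverse c"] c0 by (simp flip: mult.assoc)
 have il: "integrable lborel (\<lambda>y. indicator {\<epsilon><..} y *\<^sub>R (el (\<omega> * of_real y) * \<omega>))"
  using kernel_integrable[OF left_kernel[OF Z e'(1,3), of 0] l mm] unfolding lef_def[symmetric] lef by (rule unscale)
 have ir: "integrable lborel (\<lambda>y. indicator {\<epsilon><..} y *\<^sub>R (er (\<omega> * of_real y) * \<omega>))"
  using kernel_integrable[OF right_kernel[OF Z e'(1,3), of 0] l mm] unfolding rig_def[symmetric] rig by (rule unscale)
 have A0: "amplitude Z \<epsilon> l (m\<^sup>2) = c * ((\<integral>y. cen Z \<epsilon> l (m\<^sup>2) y * \<omega> \<partial>lborel)
   + (\<integral>y. indicator {\<epsilon><..} y *\<^sub>R (el (\<omega> * of_real y) * \<omega>) \<partial>lborel)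
   + (\<integral>y. indicator {\<epsilon><..} y *\<^sub>R (er (\<omega> * of_real y) * \<omega>) \<partial>lborel)
   + (\<integral>y. indicator {0..1} y *\<^sub>R (el (Qc \<epsilon> y (of_real (m\<^sup>2))) * (Pf (of_real (m\<^sup>2)) (\<omega> * of_real \<epsilon>) - \<omega> * of_real \<epsilon>)) \<partial>lborel))"
  unfolding amplitude_def lef rig conq integral_mult_right_zero integral_mult_left_zero distrib_left
  by (simp add: c_def mult_ac)
 have A: "c0 * k * amplitude Z \<epsilon> l (m\<^sup>2) = c * (c0 * k * ((\<integral>y. indicator {-\<epsilon>..\<epsilon>} y *\<^sub>R (el (\<omega> * of_real y) * \<omega>) \<partial>lborel)
   + (\<integral>y. indicator {\<epsilon><..} y *\<^sub>R (el (\<omega> * of_real y) * \<omega>) \<partial>lborel)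
   + (\<integral>y. indicator {\<epsilon><..} y *\<^sub>R (er (\<omega> * of_real y) * \<omega>) \<partial>lborel)
   + (\<integral>y. indicator {0..1} y *\<^sub>R (el (Qc \<epsilon> y (of_real (m\<^sup>2))) * (Pf (of_real (m\<^sup>2)) (\<omega> * of_real \<epsilon>) - \<omega> * of_real \<epsilon>)) \<partial>lborel)))"
  unfolding A0 cen by (simp only: mult_ac)
 show ?thesis unfolding A
  using contour_shift[OF e'(1,4) con il[unfolded el_def] ir[unfolded er_def]] unfolding el_def er_def c_def by simp
qed

theorem propositionA4:
 fixes Z :: real
 assumes "Z > 0"
 shows "\<exists>a \<in> A_loc index_E. \<forall>E x \<sigma> r :: real.
  E > 0 \<longrightarrow> x > 0 \<longrightarrow> \<sigma> = sqrt E \<longrightarrow> r = 1 / x \<longrightarrow>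
  WhittW (- \<i> * of_real Z / (2 * of_real \<sigma>)) (1/2) (2 * \<i> * of_real \<sigma> * of_real r) =
   of_real \<sigma> * inverse (Gamma (\<i> * of_real Z / (2 * of_real \<sigma>)))
   * of_real ((\<sigma>\<^sup>2 + Z / r) powr (-1/4))
   * exp (- \<i> * of_real (r * sqrt (\<sigma>\<^sup>2 + Z / r))
       - \<i> * of_real (Z / \<sigma>)
        * of_real (ln (\<sigma> * sqrt r / sqrt Z + sqrt (1 + \<sigma>\<^sup>2 * r / Z))))
   * a E x"
proof -
 obtain \<epsilon> where e: "small \<epsilon>" using small_exists by blast
 define a where "a E x = amplitude Z \<epsilon> (sqrt (E + Z * x)) (E / (E + Z * x))" for E x
 have "a \<in> A_loc index_E" unfolding a_def[abs_def] by (rule amplitude_A_loc[OF assms e])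
 moreover have "WhittW (- \<i> * of_real Z / (2 * of_real \<sigma>)) (1/2) (2 * \<i> * of_real \<sigma> * of_real r) =
   of_real \<sigma> * inverse (Gamma (\<i> * of_real Z / (2 * of_real \<sigma>)))
   * of_real ((\<sigma>\<^sup>2 + Z / r) powr (-1/4))
   * exp (- \<i> * of_real (r * sqrt (\<sigma>\<^sup>2 + Z / r))
       - \<i> * of_real (Z / \<sigma>)
        * of_real (ln (\<sigma> * sqrt r / sqrt Z + sqrt (1 + \<sigma>\<^sup>2 * r / Z))))
   * a E x"
  if E: "E > 0" and x: "x > 0" and \<sigma>: "\<sigma> = sqrt E" and r: "r = 1 / x" for E x \<sigma> r
 proof -
  define l where "l = sqrt (E + Z * x)"
  define m where "m = \<sigma> / l"
  define b where "b = Z / l"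
  have Zx: "Z * x > 0" using assms x by simp
  have s: "\<sigma> > 0" "\<sigma>\<^sup>2 = E" using E \<sigma> by auto
  have l: "l > 0" "l\<^sup>2 = E + Z * x" using E Zx by (auto simp: l_def add_pos_pos)
  have sl: "\<sigma> < l" unfolding \<sigma> l_def using Zx by simp
  have dif: "(l - \<sigma>) * (l + \<sigma>) = Z * x" using l(2) s(2) by (simp add: algebra_simps power2_eq_square)
  interpret contour m b
   by unfold_locales (use s l sl assms in \<open>auto simp: m_def b_def\<close>)
  have m2: "m\<^sup>2 = E / (E + Z * x)" by (simp add: m_def power_divide s l)
  have l0: "complex_of_real l \<noteq> 0" "complex_of_real \<sigma> \<noteq> 0" "complex_of_real x \<noteq> 0" "complex_of_real Z \<noteq> 0" using l s x assms by auto
  have kap': "- \<i> * of_real Z / (2 * of_real \<sigma>) = \<kappa>" unfolding \<kappa>_def k_def unfolding m_def b_def using l0 by simp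
  have zz: "2 * \<i> * of_real \<sigma> * of_real r = z"
  proof -
   have nu: "\<nu> = of_real (Z * x / l\<^sup>2)"
   proof -
    have "1 - m\<^sup>2 = Z * x / l\<^sup>2" unfolding m2 l(2) using E Zx by (simp add: field_simps)
    thus ?thesis unfolding \<nu>_def by (metis of_real_1 of_real_diff)
   qed
   show ?thesis unfolding z_def nu k_def unfolding m_def b_def r using l0 by (simp add: power2_eq_square)
  qed
  have G: "Gamma (1 - \<kappa>) = - \<kappa> * Gamma (- \<kappa>)" "\<kappa> \<noteq> 0"
  proof -
   show k0: "\<kappa> \<noteq> 0" unfolding \<kappa>_def using nz by simp
   have "- \<kappa> \<notin> \<int>\<^sub>\<le>\<^sub>0"
   proof
    assume "- \<kappa> \<in> \<int>\<^sub>\<le>\<^sub>0"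
    then obtain n where n: "- \<kappa> = of_int n" by (rule nonpos_Ints_cases)
    hence "Im (- \<kappa>) = 0" by simp
    thus False using k0 Re_\<kappa>(1) by (simp add: complex_eq_iff)
   qed
   from Gamma_plus1[OF this] show "Gamma (1 - \<kappa>) = - \<kappa> * Gamma (- \<kappa>)" by (simp add: add.commute)
  qed
  have pw: "(\<sigma>\<^sup>2 + Z / r) powr (-1/4) = inverse (sqrt l)"
  proof -
   have "\<sigma>\<^sup>2 + Z / r = l powr 2" unfolding s l(2)[symmetric] r using l by (simp add: powr_numeral)
   hence "(\<sigma>\<^sup>2 + Z / r) powr (-1/4) = l powr (- (1/2))" by (simp add: powr_powr)
   thus ?thesis using l by (simp add: powr_minus powr_half_sqrt)
  qed
  have v0: "ln (\<sigma> * sqrt r / sqrt Z + sqrt (1 + \<sigma>\<^sup>2 * r / Z)) = v0"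
  proof -
   \<comment> \<open>\<open>v0\<close> is artanh of \<open>m\<close>; it agrees with the logarithm since \<open>(l - \<sigma>) (l + \<sigma>) = Z x\<close>\<close>
   define u where "u = \<sigma> * sqrt r / sqrt Z + sqrt (1 + \<sigma>\<^sup>2 * r / Z)"
   have r0: "r > 0" using x r by simp
   have "1 + \<sigma>\<^sup>2 * r / Z = l\<^sup>2 * r / Z" unfolding l(2) s r using x assms by (simp add: field_simps)
   hence "sqrt (1 + \<sigma>\<^sup>2 * r / Z) = l * sqrt r / sqrt Z" using l(1) by (simp add: real_sqrt_divide real_sqrt_mult)
   hence u: "u = (\<sigma> + l) * sqrt r / sqrt Z" unfolding u_def by (simp add: add_divide_distrib distrib_right)
   have u0: "u > 0" unfolding u using s l r0 assms by simp
   have "u\<^sup>2 = (\<sigma> + l)\<^sup>2 * r / Z" unfolding u using r0 assms by (simp add: power_divide power_mult_distrib)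
   also have "\<dots> = (\<sigma> + l)\<^sup>2 / (Z * x)" unfolding r by simp
   also have "\<dots> = (l + \<sigma>) / (l - \<sigma>)" unfolding dif[symmetric] using s l sl by (simp add: power2_eq_square add.commute)
   also have "\<dots> = (1 + m) / (1 - m)"
   proof -
    have "1 + m = (l + \<sigma>) / l" "1 - m = (l - \<sigma>) / l" unfolding m_def using l by (simp_all add: field_simps)
    thus ?thesis using l by simp
   qed
   finally have "2 * ln u = ln ((1 + m) / (1 - m))" using u0 by (metis ln_realpow of_nat_numeral)
   thus ?thesis unfolding v0_def u_def by simp
  qed
  have ex: "exp (- \<i> * of_real (r * sqrt (\<sigma>\<^sup>2 + Z / r)) - \<i> * of_real (Z / \<sigma>) * of_real v0) = exp (- z / 2) * c0"
  proof -
   have q: "sqrt (\<sigma>\<^sup>2 + Z / r) = l" unfolding s r l_def by simp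
   have s0': "s0 = \<i> * of_real ((l - \<sigma>) / x)"
   proof -
    have "b / (1 + m) = Z / (l + \<sigma>)" unfolding b_def m_def using l s by (simp add: field_simps)
    also have "\<dots> = (l - \<sigma>) / x" using dif l s x by (simp add: field_simps)
    finally have "(l - \<sigma>) / x = b / (1 + m)" ..
    thus ?thesis unfolding s0_def k_def by simp
   qed
   have "- \<i> * of_real (r * l) - \<i> * of_real (Z / \<sigma>) * of_real v0 = - z / 2 + (2 * \<kappa> * of_real v0 - s0)"
    unfolding s0' zz[symmetric] kap'[symmetric] r using l0 by (simp add: field_simps)
   thus ?thesis unfolding q c0_def exp_add[symmetric] by simp
  qed
  have "Re \<kappa> = 0" by (rule Re_\<kappa>)
  moreover have "z \<in> cut" using z_im by (auto simp: complex_nonpos_Reals_iff)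
  ultimately have W: "WhittW \<kappa> (1/2) z = exp (- z / 2) / Gamma (1 - \<kappa>) * Lap \<kappa> 0 z" by (rule WhittW_eq)
  have LA: "c0 * k * a E x = 2 * inverse (of_real (sqrt l)) * Lap \<kappa> 0 z"
   using Lap_amplitude[OF assms e l(1) b_def] l unfolding a_def m2 l_def[symmetric] by (simp add: csqrt_of_real_nonneg)
  have sl0: "of_real (sqrt l) \<noteq> (0::complex)" using l by simp
  have LE: "Lap \<kappa> 0 z = of_real (sqrt l) / 2 * (c0 * k * a E x)" unfolding LA using sl0 by simp
  have "WhittW \<kappa> (1/2) z = exp (- z / 2) / (- \<kappa> * Gamma (- \<kappa>)) * (of_real (sqrt l) / 2 * (c0 * k * a E x))" unfolding W G(1) LE ..
  also have "\<dots> = (k / (- 2 * \<kappa>)) * of_real (sqrt l) * inverse (Gamma (- \<kappa>)) * (exp (- z / 2) * c0) * a E x"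
  proof -
   have "u / (- q * w) * (t / 2 * (c * k' * d)) = (k' / (- 2 * q)) * t * inverse w * (u * c) * d" for u q w t c k' d :: complex
    by (simp add: field_simps)
   thus ?thesis .
  qed
  also have "k / (- 2 * \<kappa>) = of_real m" unfolding \<kappa>_def using nz by simp
  also have "of_real m * of_real (sqrt l) = of_real \<sigma> * complex_of_real (inverse (sqrt l))"
  proof -
   have "sqrt l * sqrt l = l" using l by simp
   hence "m * sqrt l = \<sigma> * inverse (sqrt l)" unfolding m_def using l by (simp add: field_simps)
   thus ?thesis by (metis of_real_mult)
  qed
  finally have "WhittW \<kappa> (1/2) z = of_real \<sigma> * inverse (Gamma (- \<kappa>)) * of_real (inverse (sqrt l)) * (exp (- z / 2) * c0) * a E x"
   by (simp only: mult_ac)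
  moreover have "\<i> * of_real Z / (2 * of_real \<sigma>) = - \<kappa>" unfolding kap'[symmetric] by simp
  ultimately show ?thesis unfolding kap' zz pw v0 ex by (simp only:)
 qed
 ultimately show ?thesis by blast
qed

end
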